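(* Let $k_1,k_2,l\in\mathbb{N}$ be fixed and let $m,n\to\infty$ with $\alpha=\lim_{n\to\infty}\frac{m}{n}$ a constant (not necessarily $1$). Let $A_1,\dots,A_l\in\mathbb{R}^{k_1\times k_2}$ be deterministic and let $A_D=A_D^T\in\mathbb{R}^{k_2\times k_2}$ be deterministic. Let $G_1,\dots,G_l\in\mathbb{R}^{m\times n}$ be independent matrices with independent standard normal entries, and let $$H=\frac{1}{\sqrt n}\sum_{i=1}^{l}A_i\otimes G_i .$$ For $c_D\in\mathbb{R}$ set $$\zeta(c_D)=\inf_{\substack{Z_Y=Z_Y^T\succ0,\ Z_X=Z_X^T\succ0\\ \gamma_D\in\mathbb{R}}}\left(\lambda_n\Big(\gamma_DA_D+\frac12\Big(Z_X+\alpha\sum_{i=1}^{l}A_i^TZ_Y^{-1}A_i\Big)\Big)+\frac12\lambda_n\Big(Z_Y+\sum_{i=1}^{l}A_iZ_X^{-1}A_i^T\Big)-\gamma_Dc_D\right),$$ where $Z_X\in\mathbb{R}^{k_2\times k_2}$ and $Z_Y\in\mathbb{R}^{k_1\times k_1}$. Then, provided the quantities under the square roots are nonnegative, $$\lim_{n\to\infty}\mathbb{E}\sqrt{\lambda_n(A_D\otimes I_n+H^TH)}\;\ge\;\sqrt{\max_{c_D}\big(c_D+\zeta(c_D)^2\big)},$$ where the maximum is over the values $c_D$ attainable as $c_D=\mathrm{tr}(A_DR_X^TR_X)$ for some $R_X\in\mathbb{R}^{k_2\times k_2}$ with $\mathrm{tr}(R_X^TR_X)=1$ (i.e. over $c_D$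 between the smallest and the largest eigenvalue of $A_D$).
   Context: For a symmetric matrix $M$ of any size, $\lambda_n(M)$ denotes its largest eigenvalue (the subscript is only notation for "largest"). *)

theory Defs
  imports
    "HOL-Probability.Probability"
    "Jordan_Normal_Form.Gauss_Jordan_Elimination"
    "Jordan_Normal_Form.Spectral_Radius"
begin

(* Only meant for symmetric real matrices of positive size, whose spectrum is a nonempty
   finite set of reals; on other matrices Max may be taken of the empty set. *)
definition lambda_max :: "real mat \<Rightarrow> real" where
  "lambda_max A = Max (spectrum A)"

(* mat_inverse returns an option; it is used below only on invertible matrices. *)
definition mat_inv :: "real mat \<Rightarrow> real mat" where
  "mat_inv A = the (mat_inverse A)"

definition mat_trace :: "real mat \<Rightarrow> real" where
  "mat_trace A = (\<Sum>i<dim_row A. A $$ (i, i))"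

definition pos_def_mats :: "nat \<Rightarrow> real mat set" where
  "pos_def_mats k = {Z \<in> carrier_mat k k. transpose_mat Z = Z \<and>
     (\<forall>v \<in> carrier_vec k. v \<noteq> 0\<^sub>v k \<longrightarrow> scalar_prod v (Z *\<^sub>v v) > 0)}"

(* The dimensions are explicit so that the empty sum is the zero matrix of the right size. *)
definition mat_sum :: "nat \<Rightarrow> nat \<Rightarrow> (nat \<Rightarrow> real mat) \<Rightarrow> nat \<Rightarrow> real mat" where
  "mat_sum r c F l = mat r c (\<lambda>(i, j). \<Sum>t<l. F t $$ (i, j))"

(* The block matrix whose (i, j) block is A $$ (i, j) times B. *)
definition kronecker :: "real mat \<Rightarrow> real mat \<Rightarrow> real mat" where
  "kronecker A B = mat (dim_row A * dim_row B) (dim_col A * dim_col B)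
     (\<lambda>(i, j). A $$ (i div dim_row B, j div dim_col B) * B $$ (i mod dim_row B, j mod dim_col B))"

(* G t w is the t-th of l random m x n matrices at the sample point w. Independence is joint
   over t and over the entries. *)
definition indep_gaussian_matrices ::
  "'w measure \<Rightarrow> nat \<Rightarrow> nat \<Rightarrow> nat \<Rightarrow> (nat \<Rightarrow> 'w \<Rightarrow> real mat) \<Rightarrow> bool" where
  "indep_gaussian_matrices M l m n G \<longleftrightarrow>
     (\<forall>t<l. \<forall>w \<in> space M. G t w \<in> carrier_mat m n) \<and>
     prob_space.indep_vars M (\<lambda>_. borel) (\<lambda>(t, i, j) w. G t w $$ (i, j))
       ({..<l} \<times> {..<m} \<times> {..<n}) \<and>
     (\<forall>t<l. \<forall>i<m. \<forall>j<n. distributed M lborel (\<lambda>w. G t w $$ (i, j)) std_normal_density)"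

definition kron_model ::
  "nat \<Rightarrow> nat \<Rightarrow> nat \<Rightarrow> nat \<Rightarrow> nat \<Rightarrow> (nat \<Rightarrow> real mat) \<Rightarrow> (nat \<Rightarrow> real mat) \<Rightarrow> real mat" where
  "kron_model k1 k2 m n l A G =
     (1 / sqrt (real n)) \<cdot>\<^sub>m mat_sum (k1 * m) (k2 * n) (\<lambda>t. kronecker (A t) (G t)) l"

definition zeta_objective ::
  "nat \<Rightarrow> nat \<Rightarrow> nat \<Rightarrow> real \<Rightarrow> (nat \<Rightarrow> real mat) \<Rightarrow> real mat \<Rightarrow> real
     \<Rightarrow> real mat \<Rightarrow> real mat \<Rightarrow> real \<Rightarrow> real" where
  "zeta_objective k1 k2 l \<alpha> A AD c ZY ZX \<gamma> =
     lambda_max (\<gamma> \<cdot>\<^sub>m AD + (1/2) \<cdot>\<^sub>m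
       (ZX + \<alpha> \<cdot>\<^sub>m mat_sum k2 k2 (\<lambda>t. transpose_mat (A t) * mat_inv ZY * A t) l))
     + (1/2) * lambda_max (ZY + mat_sum k1 k1 (\<lambda>t. A t * mat_inv ZX * transpose_mat (A t)) l)
     - \<gamma> * c"

(* A real infimum: for attainable c (see below) and \<alpha> \<ge> 0 the objective is nonnegative,
   since lambda_max (\<gamma> AD + P) \<ge> trace ((\<gamma> AD + P) R\<^sup>T R) \<ge> \<gamma> c when P is positive
   semidefinite, trace (R\<^sup>T R) = 1 and trace (AD R\<^sup>T R) = c.
   For non-attainable c the infimum is -\<infinity> and the value here is meaningless. *)
definition zeta ::
  "nat \<Rightarrow> nat \<Rightarrow> nat \<Rightarrow> real \<Rightarrow> (nat \<Rightarrow> real mat) \<Rightarrow> real mat \<Rightarrow> real \<Rightarrow> real" where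
  "zeta k1 k2 l \<alpha> A AD c =
     (INF (ZY, ZX, \<gamma>) \<in> pos_def_mats k1 \<times> pos_def_mats k2 \<times> UNIV.
        zeta_objective k1 k2 l \<alpha> A AD c ZY ZX \<gamma>)"

definition attainable :: "nat \<Rightarrow> real mat \<Rightarrow> real set" where
  "attainable k AD = {mat_trace (AD * transpose_mat R * R) | R.
     R \<in> carrier_mat k k \<and> mat_trace (transpose_mat R * R) = 1}"

end

theory Submission
  imports Defs
begin

text \<open>
Write \<open>\<Lambda>\<close> for the largest eigenvalue of $A_D \otimes I + H^T H$. The proof computes its limit. Let $S$ be the
infimum of the levels $s$ at which the finite-dimensional system

  $Y^{-1} + \sum A_i X A_i^T < 1$, $X^{-1} + \alpha \sum A_i^T Y A_i + A_D < s$

has a solution $X, Y > 0$ (predicate \<open>feasible\<close>). It is the inequality form of the Dyson equation for the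
resolvent $(s - A_D \otimes I - H^T H)^{-1}$, where $X$ stands for the partial trace of the resolvent. The theorem follows
from three facts.

(1) Weak duality (\<open>feasible_bounds_zeta\<close>): $c + \zeta(c)^2 \le s$ for every feasible $s$ and attainable $c$. With
$b = 1/\sqrt{s-c}$, the point $Z_Y = Y^{-1}/b$, $Z_X = b X^{-1}$, $\gamma_D = b/2$ makes the objective of $\zeta(c)$ at most
$\sqrt{s-c}$. So $S$ is at least the maximum in the theorem.

(2) \<open>\<Lambda>\<close> tends to $S$ in probability. If $s$ is feasible, \<open>\<Lambda>\<close> exceeds $s$ with vanishing probability
(\<open>feasible_failure_tendsto_0\<close>): the rows of noise are added one at a time to a deterministic positive form, and a
supermartingale that controls a dominating resolvent keeps the form positive, in the manner of the barrier method of Batson,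
Spielman and Srivastava. Conversely (\<open>infeasible_success_tendsto_0\<close>), if $s$ lies above the spectrum with room to spare,
then the resolvent itself, compared with the resolvents in which one row is left out, is an approximate solution of the
Dyson equation; so levels below $S$ lie above the spectrum only with vanishing probability.

(3) The square root of \<open>\<Lambda>\<close> is at most a constant plus a random variable whose expectation tends to 0 (\<open>operator_norm_le\<close>,
\<open>net_excess_tendsto_0\<close>): a lattice net reduces the operator norm of $H$ to exponentially many Gaussian variables of variance
of order $1/n$. Hence the expectations converge too, and their limit is $\sqrt S$.

That the maximum over $c$ is attained is a matter of semicontinuity (\<open>zeta_argmax\<close>): $\zeta$ is an infimum of affine functions
and the attainable values form a compact interval.

Vectors and matrices are functions restricted to a finite index set. Positive forms are compared without inverses:
\<open>fenchel_on I N Q\<close> says $2 \langle x, y\rangle \le \langle x, N x\rangle + \langle y, Q y\rangle$ for all $x, y$,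
which for positive definite $Q$ means $N \ge Q^{-1}$.
\<close>

section \<open>Matrices over a finite index set\<close>

definition dot_on :: "'a set => ('a => real) => ('a => real) => real" where
 "dot_on I x y = (\<Sum>a\<in>I. x a * y a)"

definition app_on :: "'b set => ('a => 'b => real) => ('b => real) => 'a => real" where
 "app_on J X y = (%a. \<Sum>b\<in>J. X a b * y b)"

definition mul_on :: "'b set => ('a => 'b => real) => ('b => 'c => real) => 'a => 'c => real" where
 "mul_on J X Y = (%a c. \<Sum>b\<in>J. X a b * Y b c)"

definition quad_on :: "'a set => ('a => 'a => real) => ('a => real) => real" where
 "quad_on I X x = dot_on I x (app_on I X x)"

definition tr_on :: "'a set => ('a => 'a => real) => real" where
 "tr_on I X = (\<Sum>a\<in>I. X a a)"

definition sym_on :: "'a set => ('a => 'a => real) => bool" where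
 "sym_on I X \<longleftrightarrow> (\<forall>a\<in>I. \<forall>b\<in>I. X a b = X b a)"

definition psd_on :: "'a set => ('a => 'a => real) => bool" where
 "psd_on I X \<longleftrightarrow> (\<forall>x. 0 <= quad_on I X x)"

text \<open>For positive definite $Q$ the least admissible $N$ is $Q^{-1}$; the condition stays meaningful, and stable under
limits, when $Q$ is singular, and either matrix can be enlarged freely.\<close>

definition fenchel_on :: "'a set => ('a => 'a => real) => ('a => 'a => real) => bool" where
 "fenchel_on I N Q \<longleftrightarrow> (\<forall>x y. 2 * dot_on I x y <= quad_on I N x + quad_on I Q y)"

lemma sym_onD: "sym_on I X ==> a \<in> I ==> b \<in> I ==> X a b = X b a"
 by (auto simp: sym_on_def)

lemma dot_on_cong:
 "(!!a. a \<in> I ==> x a = x' a) ==> (!!a. a \<in> I ==> y a = y' a) ==> dot_on I x y = dot_on I x' y'"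
 by (auto simp: dot_on_def intro!: sum.cong)

lemma quad_on_alt: "quad_on I X x = (\<Sum>a\<in>I. \<Sum>b\<in>I. X a b * x a * x b)"
 by (simp add: quad_on_def dot_on_def app_on_def sum_distrib_left ac_simps)

lemma quad_on_cong:
 "(!!a b. a \<in> I ==> b \<in> I ==> X a b = X' a b) ==> (!!a. a \<in> I ==> x a = x' a)
  ==> quad_on I X x = quad_on I X' x'"
 by (simp add: quad_on_alt)

lemma dot_on_commute: "dot_on I x y = dot_on I y x"
 by (simp add: dot_on_def mult.commute)

lemma dot_on_linear:
 "dot_on I (%a. x a + x' a) y = dot_on I x y + dot_on I x' y"
 "dot_on I (%a. x a - x' a) y = dot_on I x y - dot_on I x' y"
 "dot_on I x (%a. y a + y' a) = dot_on I x y + dot_on I x y'"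
 "dot_on I x (%a. y a - y' a) = dot_on I x y - dot_on I x y'"
 "dot_on I (%a. c * x a) y = c * dot_on I x y"
 "dot_on I x (%a. c * y a) = c * dot_on I x y"
 by (simp_all add: dot_on_def sum.distrib sum_subtractf sum_distrib_left algebra_simps)

lemma app_on_linear:
 "app_on I X (%a. x a + y a) = (%a. app_on I X x a + app_on I X y a)"
 "app_on I X (%a. x a - y a) = (%a. app_on I X x a - app_on I X y a)"
 "app_on I X (%a. c * x a) = (%a. c * app_on I X x a)"
 "app_on I (%a b. X a b + Y a b) x = (%a. app_on I X x a + app_on I Y x a)"
 "app_on I (%a b. X a b - Y a b) x = (%a. app_on I X x a - app_on I Y x a)"
 "app_on I (%a b. c * X a b) x = (%a. c * app_on I X x a)"
 by (simp_all add: app_on_def sum.distrib sum_subtractf sum_distrib_left algebra_simps)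

lemma quad_on_linear:
 "quad_on I (%a b. X a b + Y a b) x = quad_on I X x + quad_on I Y x"
 "quad_on I (%a b. X a b - Y a b) x = quad_on I X x - quad_on I Y x"
 "quad_on I (%a b. c * X a b) x = c * quad_on I X x"
 by (simp_all add: quad_on_def app_on_linear dot_on_linear)

lemma app_on_mul: "app_on J (mul_on K X Y) y = app_on K X (app_on J Y y)"
 unfolding app_on_def mul_on_def sum_distrib_left sum_distrib_right
 by (subst sum.swap) (simp add: mult.assoc)

lemma mul_on_assoc: "mul_on J (mul_on K X Y) Z = mul_on K X (mul_on J Y Z)"
 unfolding mul_on_def sum_distrib_left sum_distrib_right
 by (subst sum.swap) (simp add: mult.assoc)

lemma mul_on_linear:
 "mul_on J X (%a b. Y a b + Z a b) = (%a b. mul_on J X Y a b + mul_on J X Z a b)"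
 "mul_on J (%a b. Y a b + Z a b) X = (%a b. mul_on J Y X a b + mul_on J Z X a b)"
 "mul_on J X (%a b. Y a b - Z a b) = (%a b. mul_on J X Y a b - mul_on J X Z a b)"
 "mul_on J (%a b. Y a b - Z a b) X = (%a b. mul_on J Y X a b - mul_on J Z X a b)"
 by (simp_all add: mul_on_def sum.distrib sum_subtractf algebra_simps)

lemma dot_on_app_transpose:
 "dot_on I x (app_on J X y) = dot_on J (app_on I (%b a. X a b) x) y"
 unfolding dot_on_def app_on_def sum_distrib_left sum_distrib_right
 by (subst sum.swap) (simp add: ac_simps)

lemma dot_on_app_sym: "sym_on I X ==> dot_on I x (app_on I X y) = dot_on I (app_on I X x) y"
 unfolding dot_on_app_transpose
 by (rule dot_on_cong) (auto simp: app_on_def sym_onD intro!: sum.cong)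

lemma quad_on_sandwich:
 assumes "sym_on I R"
 shows "quad_on I (mul_on I R (mul_on I E R)) x = quad_on I E (app_on I R x)"
 unfolding quad_on_def app_on_mul using dot_on_app_sym[OF assms] .

lemma sym_on_sandwich:
 assumes "sym_on I R" "sym_on I E"
 shows "sym_on I (mul_on I R (mul_on I E R))"
 unfolding sym_on_def
proof (intro ballI)
 fix a b assume ab: "a \<in> I" "b \<in> I"
 have "mul_on I R (mul_on I E R) a b = (\<Sum>c\<in>I. \<Sum>d\<in>I. R a c * E c d * R d b)"
  by (simp add: mul_on_def sum_distrib_left ac_simps)
 also have "... = (\<Sum>d\<in>I. \<Sum>c\<in>I. R a c * E c d * R d b)" by (rule sum.swap)
 also have "... = (\<Sum>d\<in>I. \<Sum>c\<in>I. R b d * E d c * R c a)"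
 proof (intro sum.cong refl)
  fix d c assume "d \<in> I" "c \<in> I"
  then have "R a c = R c a" "E c d = E d c" "R d b = R b d"
   using ab sym_onD[OF assms(1)] sym_onD[OF assms(2)] by blast+
  then show "R a c * E c d * R d b = R b d * E d c * R c a" by simp
 qed
 also have "... = mul_on I R (mul_on I E R) b a"
  by (simp add: mul_on_def sum_distrib_left ac_simps)
 finally show "mul_on I R (mul_on I E R) a b = mul_on I R (mul_on I E R) b a" .
qed

lemma quad_on_unit:
 assumes "finite I" "a \<in> I"
 shows "quad_on I X (%c. of_bool (c = a)) = X a a"
proof -
 have "quad_on I X (%c. of_bool (c = a)) = (\<Sum>b\<in>I. if b = a then (\<Sum>c\<in>I. if c = a then X b c else 0) else 0)"
  unfolding quad_on_alt by (rule sum.cong) (auto intro!: sum.cong)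
 then show ?thesis using assms by (simp add: sum.delta)
qed

lemma psd_on_diag_nonneg: "finite I ==> psd_on I X ==> a \<in> I ==> 0 <= X a a"
 using quad_on_unit[of I a X] by (metis psd_on_def)

lemma psd_on_tr_nonneg: "finite I ==> psd_on I X ==> 0 <= tr_on I X"
 unfolding tr_on_def by (rule sum_nonneg) (auto intro: psd_on_diag_nonneg)

lemma quad_on_insert:
 assumes "finite I" "a \<notin> I" "!!b. b \<in> I ==> W b a = W a b"
 shows "quad_on (insert a I) W x = W a a * (x a)^2 + 2 * x a * (\<Sum>b\<in>I. W a b * x b) + quad_on I W x"
proof -
 define S where "S = (\<Sum>b\<in>I. W a b * x b)"
 have 1: "(\<Sum>b\<in>I. W b a * x b * x a) = x a * (\<Sum>b\<in>I. W a b * x b)"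
  unfolding sum_distrib_left by (rule sum.cong) (auto simp: assms(3))
 have 2: "(\<Sum>b\<in>I. W a b * x a * x b) = x a * (\<Sum>b\<in>I. W a b * x b)"
  unfolding sum_distrib_left by (rule sum.cong) auto
 have "quad_on (insert a I) W x = W a a * x a * x a + (\<Sum>b\<in>I. W a b * x a * x b)
   + ((\<Sum>b\<in>I. W b a * x b * x a) + quad_on I W x)"
  unfolding quad_on_alt using assms(1,2) by (simp add: sum.distrib)
 also have "... = W a a * x a * x a + x a * S + (x a * S + quad_on I W x)"
  unfolding 1 2 S_def ..
 finally show ?thesis unfolding S_def[symmetric] by (simp add: power2_eq_square)
qed

text \<open>Cholesky factorisation, by induction on the index set: subtract the square completed in the first variable.\<close>

lemma psd_on_gram:
 assumes "finite I" "sym_on I W" "psd_on I W"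
 shows "\<exists>L :: 'a => 'a => real. \<forall>a\<in>I. \<forall>b\<in>I. W a b = (\<Sum>c\<in>I. L c a * L c b)"
 using assms
proof (induction I arbitrary: W rule: finite_induct)
 case (insert a I)
 have q: "quad_on (insert a I) W x = W a a * (x a)^2 + 2 * x a * (\<Sum>b\<in>I. W a b * x b) + quad_on I W x" for x
  by (intro quad_on_insert insert.hyps sym_onD[OF insert.prems(1)]) auto
 have waa: "0 <= W a a" using insert by (intro psd_on_diag_nonneg[of "insert a I"]) auto
 have z: "W a b = 0" if "W a a = 0" "b \<in> I" for b
 proof (rule ccontr)
  assume "W a b \<noteq> 0"
  define t where "t = - (W b b + 1) / (2 * W a b)"
  have s: "(\<Sum>c\<in>I. W a c * of_bool (c = b)) = W a b"
   using insert.hyps that by (simp add: of_bool_def if_distrib[of "(*) _"] sum.delta cong: if_cong)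
  have qb: "quad_on I W (%c. of_bool (c = b)) = W b b"
   using insert.hyps that by (intro quad_on_unit) auto
  define y where "y = (%c. if c = a then t else of_bool (c = b))"
  have "quad_on I W y = W b b" unfolding qb[symmetric]
   using insert.hyps by (intro quad_on_cong) (auto simp: y_def)
  moreover have "(\<Sum>c\<in>I. W a c * y c) = W a b" unfolding s[symmetric]
   using insert.hyps by (intro sum.cong) (auto simp: y_def)
  moreover have "y a = t" by (simp add: y_def)
  ultimately have "quad_on (insert a I) W y = 2 * t * W a b + W b b"
   unfolding q using that by simp
  also have "... = -1" using \<open>W a b \<noteq> 0\<close> by (simp add: t_def field_simps)
  finally have "quad_on (insert a I) W y = -1" .
  then show False using insert.prems(2) unfolding psd_on_def by (metis neg_0_le_iff_le not_one_le_zero)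
 qed
 define W' where "W' = (%b c. W b c - W a b * W a c / W a a)"
 have q': "quad_on I W' x = quad_on I W x - (\<Sum>b\<in>I. W a b * x b)^2 / W a a" for x
  unfolding quad_on_alt W'_def
  by (simp add: left_diff_distrib right_diff_distrib sum_subtractf power2_eq_square sum_product sum_divide_distrib ac_simps)
 have "sym_on I W'" unfolding sym_on_def W'_def
  by (intro ballI) (subst sym_onD[OF insert.prems(1)], auto)
 moreover have "psd_on I W'"
  unfolding psd_on_def
 proof
  fix x
  define s where "s = (\<Sum>b\<in>I. W a b * x b)"
  define y where "y = (%c. if c = a then - s / W a a else x c)"
  have "quad_on I W y = quad_on I W x" "(\<Sum>b\<in>I. W a b * y b) = s" "y a = - s / W a a"
   using insert.hyps by (auto intro!: quad_on_cong sum.cong simp: y_def s_def)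
  then have "quad_on (insert a I) W y = quad_on I W' x"
   unfolding q q' s_def[symmetric]
   by (cases "W a a = 0") (auto simp: power2_eq_square field_simps)
  then show "0 <= quad_on I W' x" using insert.prems(2) by (metis psd_on_def)
 qed
 ultimately obtain L where L: "!!b c. b \<in> I ==> c \<in> I ==> W' b c = (\<Sum>d\<in>I. L d b * L d c)"
  using insert.IH by blast
 define L' where "L' = (%d b. if d = a then W a b / sqrt (W a a) else if b = a then 0 else L d b)"
 have "W b c = (\<Sum>d\<in>insert a I. L' d b * L' d c)" if "b \<in> insert a I" "c \<in> insert a I" for b c
 proof -
  have L'I: "(\<Sum>d\<in>I. L' d b * L' d c) = (if b = a \<or> c = a then 0 else \<Sum>d\<in>I. L d b * L d c)"
   using insert.hyps by (auto intro!: sum.cong sum.neutral simp: L'_def)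
  have "L' a b * L' a c = W a b * W a c / W a a"
   using waa by (simp add: L'_def)
  moreover have "W b c = W a b * W a c / W a a" if "b = a \<or> c = a"
  proof -
   have "W b c = (if b = a then W a c else W a b)"
    using that sym_onD[OF insert.prems(1) \<open>b \<in> _\<close> \<open>c \<in> _\<close>] by auto
   then show ?thesis using that z \<open>b \<in> _\<close> \<open>c \<in> _\<close>
    by (cases "W a a = 0") auto
  qed
  ultimately show ?thesis
   using L[of b c] that insert.hyps L'I by (auto simp: W'_def)
 qed
 then show ?case by blast
qed auto

lemma tr_on_psd_mul_nonneg:
 assumes "finite I" "psd_on I R" "sym_on I W" "psd_on I W"
 shows "0 <= tr_on I (mul_on I R W)"
proof -
 obtain L where L: "!!a b. a \<in> I ==> b \<in> I ==> W a b = (\<Sum>c\<in>I. L c a * L c b)"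
  using psd_on_gram[OF assms(1,3,4)] by blast
 have "tr_on I (mul_on I R W) = (\<Sum>a\<in>I. \<Sum>b\<in>I. \<Sum>c\<in>I. R a b * L c a * L c b)"
  unfolding tr_on_def mul_on_def
  by (intro sum.cong refl) (simp add: L sum_distrib_left ac_simps)
 also have "... = (\<Sum>a\<in>I. \<Sum>c\<in>I. \<Sum>b\<in>I. R a b * L c a * L c b)"
  by (intro sum.cong refl sum.swap)
 also have "... = (\<Sum>c\<in>I. quad_on I R (L c))"
  unfolding quad_on_alt by (rule sum.swap)
 also have "... \<ge> 0" using assms(2) by (auto intro!: sum_nonneg simp: psd_on_def)
 finally show ?thesis .
qed

lemma dot_on_nonneg: "0 <= dot_on I x x"
 unfolding dot_on_def by (intro sum_nonneg) auto

lemma abs_quad_on_le: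
 assumes "finite I"
 shows "\<bar>quad_on I S v\<bar> <= (\<Sum>a\<in>I. \<Sum>b\<in>I. \<bar>S a b\<bar>) * dot_on I v v"
proof -
 have "\<bar>v a * v b\<bar> <= dot_on I v v" if "a \<in> I" "b \<in> I" for a b
 proof -
  have sq: "(v c)^2 <= dot_on I v v" if "c \<in> I" for c
   unfolding dot_on_def power2_eq_square using assms that by (intro member_le_sum) auto
  have "\<bar>v a * v b\<bar> <= ((v a)^2 + (v b)^2) / 2"
   using sum_squares_bound[of "\<bar>v a\<bar>" "\<bar>v b\<bar>"] by (simp add: abs_mult)
  then show ?thesis using sq[OF that(1)] sq[OF that(2)] by simp
 qed
 then have "(\<Sum>a\<in>I. \<Sum>b\<in>I. \<bar>S a b * v a * v b\<bar>) <= (\<Sum>a\<in>I. \<Sum>b\<in>I. \<bar>S a b\<bar> * dot_on I v v)"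
  unfolding abs_mult[of "_ * _"] mult.assoc abs_mult by (intro sum_mono mult_left_mono) (auto simp: abs_mult)
 then show ?thesis
  unfolding quad_on_alt
  by (rule_tac order.trans[OF sum_abs], rule_tac order.trans[OF sum_mono[OF sum_abs]]) (simp add: sum_distrib_right)
qed

lemma quad_of_bool: "finite I ==> quad_on I (%a b. of_bool (a = b)) x = dot_on I x x"
 unfolding quad_on_alt dot_on_def
 by (intro sum.cong refl) (simp add: of_bool_def if_distrib if_distribR cong: if_cong)

section \<open>Inverses\<close>

text \<open>Determinants belong to matrices indexed by an initial segment of the naturals; an enumeration of the index set
carries the inverse over, together with its measurability in the entries.\<close>

definition enum_on :: "'a set => nat => 'a" where
 "enum_on I = (SOME f. bij_betw f {..<card I} I)"

definition mat_on :: "'a set => ('a => 'a => real) => real mat" where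
 "mat_on I X = mat (card I) (card I) (%(i, j). X (enum_on I i) (enum_on I j))"

definition inv_on :: "'a set => ('a => 'a => real) => 'a => 'a => real" where
 "inv_on I X = (%a b. adj_mat (mat_on I X) $$
   (inv_into {..<card I} (enum_on I) a, inv_into {..<card I} (enum_on I) b) / det (mat_on I X))"

lemma bij_enum_on: "finite I ==> bij_betw (enum_on I) {..<card I} I"
 unfolding enum_on_def using ex_bij_betw_nat_finite[of I]
 by (metis atLeast0LessThan someI_ex)

lemma mul_on_inv_on:
 assumes I: "finite I" and ker: "!!x. (!!a. a \<in> I ==> app_on I X x a = 0) ==> \<forall>a\<in>I. x a = 0"
  and ab: "a \<in> I" "b \<in> I"
 shows "mul_on I X (inv_on I X) a b = of_bool (a = b)" "mul_on I (inv_on I X) X a b = of_bool (a = b)"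
proof -
 define d where "d = card I"
 define e where "e = enum_on I"
 define e' where "e' = inv_into {..<d} e"
 define Z where "Z = mat_on I X"
 have e: "bij_betw e {..<d} I" using bij_enum_on[OF I] by (simp add: e_def d_def)
 have e': "bij_betw e' I {..<d}" unfolding e'_def by (rule bij_betw_inv_into[OF e])
 have Z: "Z \<in> carrier_mat d d" by (simp add: Z_def mat_on_def d_def)
 have Zij: "Z $$ (i, j) = X (e i) (e j)" if "i < d" "j < d" for i j
  using that by (simp add: Z_def mat_on_def d_def e_def)
 have ee': "e (e' a) = a" if "a \<in> I" for a
  using that e by (simp add: e'_def bij_betw_inv_into_right)
 have e'e: "e' (e i) = i" if "i < d" for i
  using that e by (simp add: e'_def bij_betw_inv_into_left)
 have e'd: "e' a < d" if "a \<in> I" for a using e' that by (auto simp: bij_betw_def)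
 have eI: "e i \<in> I" if "i < d" for i using e that by (auto simp: bij_betw_def)
 have det: "det Z \<noteq> 0"
 proof
  assume "det Z = 0"
  then obtain v where v: "v \<in> carrier_vec d" "v \<noteq> 0\<^sub>v d" "Z *\<^sub>v v = 0\<^sub>v d"
   using det_0_iff_vec_prod_zero[OF Z] by blast
  define x where "x = (%a. v $ e' a)"
  have "app_on I X x a = 0" if "a \<in> I" for a
  proof -
   have "app_on I X x a = (\<Sum>j<d. X a (e j) * x (e j))"
    unfolding app_on_def by (rule sum.reindex_bij_betw[OF e, symmetric])
   also have "... = (\<Sum>j<d. Z $$ (e' a, j) * v $ j)"
    using that by (intro sum.cong) (auto simp: Zij e'd ee' x_def e'e)
   also have "... = (Z *\<^sub>v v) $ e' a"
    using that e'd Z v(1) by (auto simp: scalar_prod_def atLeast0LessThan)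
   also have "... = 0" using v(3) that e'd by simp
   finally show ?thesis .
  qed
  then have "\<forall>a\<in>I. x a = 0" by (rule ker)
  then have "v $ i = 0" if "i < d" for i using that eI e'e by (force simp: x_def)
  then have "v = 0\<^sub>v d" using v(1) by (intro eq_vecI) auto
  then show False using v by blast
 qed
 have inv: "inv_on I X (e i) (e j) = adj_mat Z $$ (i, j) / det Z" if "i < d" "j < d" for i j
  using that by (simp add: inv_on_def e'_def[symmetric] e'e flip: e_def d_def Z_def)
 have inj: "e' a = e' b \<longleftrightarrow> a = b" using ee' ab by metis
 have adj: "adj_mat Z \<in> carrier_mat d d" "Z * adj_mat Z = det Z \<cdot>\<^sub>m 1\<^sub>m d" "adj_mat Z * Z = det Z \<cdot>\<^sub>m 1\<^sub>m d"
  using adj_mat[OF Z] by auto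
 have "mul_on I X (inv_on I X) a b = (\<Sum>j<d. X a (e j) * inv_on I X (e j) b)"
  unfolding mul_on_def by (rule sum.reindex_bij_betw[OF e, symmetric])
 also have "... = (\<Sum>j<d. Z $$ (e' a, j) * (adj_mat Z $$ (j, e' b) / det Z))"
  using ab inv[OF _ e'd[OF ab(2)]] by (intro sum.cong) (auto simp: Zij e'd ee')
 also have "... = (Z * adj_mat Z) $$ (e' a, e' b) / det Z"
  using ab e'd Z adj(1) by (auto simp: scalar_prod_def atLeast0LessThan sum_divide_distrib)
 also have "... = of_bool (a = b)"
  unfolding adj using ab e'd det inj by simp
 finally show "mul_on I X (inv_on I X) a b = of_bool (a = b)" .
 have "mul_on I (inv_on I X) X a b = (\<Sum>j<d. inv_on I X a (e j) * X (e j) b)"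
  unfolding mul_on_def by (rule sum.reindex_bij_betw[OF e, symmetric])
 also have "... = (\<Sum>j<d. (adj_mat Z $$ (e' a, j) / det Z) * Z $$ (j, e' b))"
  using ab inv[OF e'd[OF ab(1)]] by (intro sum.cong) (auto simp: Zij e'd ee')
 also have "... = (adj_mat Z * Z) $$ (e' a, e' b) / det Z"
  using ab e'd Z adj(1) by (auto simp: scalar_prod_def atLeast0LessThan sum_divide_distrib)
 also have "... = of_bool (a = b)"
  unfolding adj using ab e'd det inj by simp
 finally show "mul_on I (inv_on I X) X a b = of_bool (a = b)" .
qed

lemma app_on_inv_on:
 assumes I: "finite I" and ker: "!!x. (!!a. a \<in> I ==> app_on I X x a = 0) ==> \<forall>a\<in>I. x a = 0"
  and a: "a \<in> I"
 shows "app_on I X (app_on I (inv_on I X) y) a = y a" "app_on I (inv_on I X) (app_on I X y) a = y a"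
proof -
 have "(\<Sum>b\<in>I. of_bool (a = b) * y b) = y a"
  using I a by (simp add: of_bool_def if_distrib[of "%x. x * _"] sum.delta cong: if_cong)
 then show "app_on I X (app_on I (inv_on I X) y) a = y a" "app_on I (inv_on I X) (app_on I X y) a = y a"
  unfolding app_on_mul[symmetric] using mul_on_inv_on[OF I ker a]
  by (simp_all add: app_on_def)
qed

lemma det_borel_measurable:
 assumes "!!i j. i < d ==> j < d ==> (%w. Z w i j) \<in> borel_measurable M"
 shows "(%w. det (mat d d (%(i, j). Z w i j :: real))) \<in> borel_measurable M"
proof -
 have perm: "p i < d" if "p permutes {0..<d}" "i < d" for p i
  using permutes_in_image[OF that(1), of i] that(2) by simp
 have "det (mat d d (%(i, j). Z w i j)) =
  (\<Sum>p | p permutes {0..<d}. signof p * (\<Prod>i = 0..<d. Z w i (p i)))" for w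
  unfolding det_def by (auto intro!: sum.cong prod.cong simp: perm)
 then show ?thesis
  by (simp, intro borel_measurable_sum borel_measurable_times borel_measurable_const borel_measurable_prod)
    (auto simp: perm assms)
qed

lemma inv_on_borel_measurable:
 assumes I: "finite I" and X: "!!a b. a \<in> I ==> b \<in> I ==> (%w. X w a b) \<in> borel_measurable M"
  and ab: "a \<in> I" "b \<in> I"
 shows "(%w. inv_on I (X w) a b) \<in> borel_measurable M"
proof -
 define d where "d = card I"
 define e where "e = enum_on I"
 define e' where "e' = inv_into {..<d} e"
 have e: "bij_betw e {..<d} I" using bij_enum_on[OF I] by (simp add: e_def d_def)
 have e'd: "e' a < d" if "a \<in> I" for a using bij_betw_inv_into[OF e] that by (auto simp: bij_betw_def e'_def)
 have eI: "e i \<in> I" if "i < d" for i using e that by (auto simp: bij_betw_def)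
 have 1: "(%w. det (mat_on I (X w))) \<in> borel_measurable M"
  unfolding mat_on_def d_def[symmetric] e_def[symmetric]
  by (rule det_borel_measurable) (auto intro: X eI)
 define s where "s = (%k i. if i < k then i else Suc i)"
 have co: "adj_mat (mat_on I (X w)) $$ (i, j) =
   (-1) ^ (j + i) * det (mat (d - 1) (d - 1) (%(i', j'). X w (e (s j i')) (e (s i j'))))"
  if "i < d" "j < d" for i j w
 proof -
  have "mat_delete (mat_on I (X w)) j i = mat (d - 1) (d - 1) (%(i', j'). X w (e (s j i')) (e (s i j')))"
   using that by (auto simp: mat_delete_def mat_on_def s_def d_def e_def intro!: eq_matI)
  then show ?thesis using that by (simp add: adj_mat_def mat_on_def d_def[symmetric] cofactor_def)
 qed
 have "(%w. adj_mat (mat_on I (X w)) $$ (e' a, e' b)) \<in> borel_measurable M"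
  unfolding co[OF e'd[OF ab(1)] e'd[OF ab(2)]]
  by (intro borel_measurable_times borel_measurable_const det_borel_measurable X eI)
    (auto simp: s_def)
 then show ?thesis unfolding inv_on_def d_def[symmetric] e_def[symmetric] e'_def[symmetric]
  using 1 by (intro borel_measurable_divide) auto
qed

section \<open>Moments of Gaussian linear and quadratic forms\<close>

text \<open>All quantities whose expectations are taken are polynomials in Gaussian variables. Having moments of every order
is closed under sums and products, so integrability is settled by the shape of the expression.\<close>

definition all_moments :: "'w measure => ('w => real) => bool" where
 "all_moments M f \<longleftrightarrow> f \<in> borel_measurable M \<and> (\<forall>k. integrable M (%x. f x ^ k))"

lemma all_moments_measurable: "all_moments M f ==> f \<in> borel_measurable M"
 by (simp add: all_moments_def)

lemma all_moments_integrable: "all_moments M f ==> integrable M f"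
 unfolding all_moments_def by (drule conjunct2, drule spec[of _ 1]) simp

lemma all_moments_const: "finite_measure M ==> all_moments M (%x. c)"
 by (simp add: all_moments_def finite_measure.integrable_const)

lemma all_moments_mult:
 assumes f: "all_moments M f" and g: "all_moments M g"
 shows "all_moments M (%x. f x * g x)"
 unfolding all_moments_def
proof (intro conjI allI)
 have [measurable]: "f \<in> borel_measurable M" "g \<in> borel_measurable M"
  using f g by (auto simp: all_moments_def)
 show "(%x. f x * g x) \<in> borel_measurable M" by measurable
 fix k
 have bound_int: "integrable M (%x. f x ^ (2 * k) + g x ^ (2 * k))"
  using f g by (intro Bochner_Integration.integrable_add) (auto simp: all_moments_def)
 have bound: "norm ((f x * g x) ^ k) <= norm (f x ^ (2 * k) + g x ^ (2 * k))" for x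
 proof -
  have "2 * (\<bar>f x ^ k\<bar> * \<bar>g x ^ k\<bar>) <= (f x ^ k)^2 + (g x ^ k)^2"
   using sum_squares_bound[of "\<bar>f x ^ k\<bar>" "\<bar>g x ^ k\<bar>"] by simp
  moreover have "0 <= \<bar>f x ^ k\<bar> * \<bar>g x ^ k\<bar>" by simp
  ultimately have "\<bar>f x ^ k\<bar> * \<bar>g x ^ k\<bar> <= (f x ^ k)^2 + (g x ^ k)^2" by linarith
  then show ?thesis
   unfolding power_even_eq power_mult_distrib real_norm_def abs_mult by linarith
 qed
 show "integrable M (%x. (f x * g x) ^ k)"
  by (rule Bochner_Integration.integrable_bound[OF bound_int _ AE_I2[OF bound]]) measurable
qed

lemma all_moments_add:
 assumes f: "all_moments M f" and g: "all_moments M g"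
 shows "all_moments M (%x. f x + g x)"
 unfolding all_moments_def
proof (intro conjI allI)
 have [measurable]: "f \<in> borel_measurable M" "g \<in> borel_measurable M"
  using f g by (auto simp: all_moments_def)
 show "(%x. f x + g x) \<in> borel_measurable M" by measurable
 fix k
 have bound_int: "integrable M (%x. 2 ^ k * (\<bar>f x ^ k\<bar> + \<bar>g x ^ k\<bar>))"
  using f g by (intro integrable_mult_right Bochner_Integration.integrable_add integrable_abs)
   (auto simp: all_moments_def)
 have bound: "norm ((f x + g x) ^ k) <= norm (2 ^ k * (\<bar>f x ^ k\<bar> + \<bar>g x ^ k\<bar>))" for x
 proof -
  have "\<bar>f x + g x\<bar> ^ k <= (2 * max \<bar>f x\<bar> \<bar>g x\<bar>) ^ k" by (intro power_mono) auto
  also have "... <= 2 ^ k * (\<bar>f x\<bar> ^ k + \<bar>g x\<bar> ^ k)"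
   by (auto simp: power_mult_distrib max_def)
  finally show ?thesis by (simp add: power_abs)
 qed
 show "integrable M (%x. (f x + g x) ^ k)"
  by (rule Bochner_Integration.integrable_bound[OF bound_int _ AE_I2[OF bound]]) measurable
qed

lemma all_moments_diff:
 assumes "finite_measure M" "all_moments M f" "all_moments M g"
 shows "all_moments M (%x. f x - g x)"
 using all_moments_add[OF assms(2) all_moments_mult[OF all_moments_const[OF assms(1), of "-1"] assms(3)]]
 by simp

lemma all_moments_sum:
 "finite_measure M ==> (!!i. i \<in> I ==> all_moments M (f i)) ==> all_moments M (%x. \<Sum>i\<in>I. f i x)"
 by (induction I rule: infinite_finite_induct) (auto intro: all_moments_const all_moments_add)

lemma all_moments_power:
 "finite_measure M ==> all_moments M f ==> all_moments M (%x. f x ^ n)"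
 by (induction n) (auto intro: all_moments_const all_moments_mult)

lemma weighted_am_gm:
 fixes u v x y :: real
 assumes "0 < u" "0 < v"
 shows "x * y <= (v / u * x^2 + u / v * y^2) / 2"
proof -
 have "0 <= (v * x - u * y)^2 / (u * v)" using assms by simp
 also have "... = v / u * x^2 + u / v * y^2 - 2 * (x * y)"
  using assms by (simp add: field_simps power2_eq_square)
 finally show ?thesis by simp
qed

text \<open>Optimising the weight in the weighted arithmetic-geometric mean inequality would divide by a second moment that
may vanish; the bounds are enlarged by $e$ and $e$ then tends to 0.\<close>

lemma (in prob_space) cauchy_schwarz_moments:
 assumes X: "all_moments M X" and Y: "all_moments M Y"
  and a: "expectation (%w. X w ^ 2) <= a^2" and b: "expectation (%w. Y w ^ 2) <= b^2" and "0 <= a" "0 <= b"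
 shows "expectation (%w. X w * Y w) <= a * b"
proof -
 have fm: "finite_measure M" by (rule finite_measure_axioms)
 have i: "integrable M (%w. X w ^ 2)" "integrable M (%w. Y w ^ 2)" "integrable M (%w. X w * Y w)"
  using X Y by (auto intro!: all_moments_integrable all_moments_power all_moments_mult fm)
 have "expectation (%w. X w * Y w) <= (a + e) * (b + e)" if "e > 0" for e
 proof -
  have e: "a + e > 0" "b + e > 0" using that assms by auto
  have "expectation (%w. X w * Y w) <=
    expectation (%w. ((b + e) / (a + e) * X w ^ 2 + (a + e) / (b + e) * Y w ^ 2) / 2)"
  proof (rule integral_mono)
   fix w
   show "X w * Y w <= ((b + e) / (a + e) * X w ^ 2 + (a + e) / (b + e) * Y w ^ 2) / 2"
    by (rule weighted_am_gm[OF e])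
  qed (use i in auto)
  also have "... = ((b + e) / (a + e) * expectation (%w. X w ^ 2) + (a + e) / (b + e) * expectation (%w. Y w ^ 2)) / 2"
   using i by simp
  also have "... <= ((b + e) / (a + e) * (a + e)^2 + (a + e) / (b + e) * (b + e)^2) / 2"
  proof -
   have "a^2 <= (a + e)^2" "b^2 <= (b + e)^2" using that assms by (auto intro!: power_mono)
   then show ?thesis using a b e
    by (intro divide_right_mono add_mono mult_left_mono) auto
  qed
  also have "... = (a + e) * (b + e)"
  proof -
   have "(v / u * u^2 + u / v * v^2) / 2 = u * v" if "0 < u" "0 < v" for u v :: real
    using that by (simp add: field_simps power2_eq_square)
   then show ?thesis using e by blast
  qed
  finally show ?thesis .
 qed
 moreover have "((%e. (a + e) * (b + e)) \<longlongrightarrow> (a + 0) * (b + 0)) (at_right 0)"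
  by (intro tendsto_intros)
 ultimately show ?thesis
  by (intro tendsto_lowerbound[of _ _ "at_right 0"]) (auto simp: eventually_at_filter)
qed

lemma (in prob_space) second_moment_le:
 assumes X: "all_moments M X" and a: "expectation (%w. X w ^ 4) <= a^2" "0 <= a"
 shows "expectation (%w. X w ^ 2) <= a"
proof -
 have fm: "finite_measure M" by (rule finite_measure_axioms)
 have "(%w. (X w ^ 2) ^ 2) = (%w. X w ^ 4)" by (simp flip: power_mult)
 then show ?thesis
  using cauchy_schwarz_moments[of "%w. X w ^ 2" "%w. 1" a 1] a X
  by (auto simp: prob_space intro: all_moments_power all_moments_const fm)
qed

definition gauss :: "real measure" where
 "gauss = density lborel (%x. ennreal (std_normal_density x))"

abbreviation gauss_on :: "'i set => ('i => real) measure" where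
 "gauss_on S \<equiv> Pi\<^sub>M S (%_. gauss)"

lemma prob_space_gauss: "prob_space gauss"
 unfolding gauss_def by (rule prob_space_normal_density) simp

lemma sets_gauss [measurable_cong]: "sets gauss = sets borel"
 by (simp add: gauss_def)

lemma space_gauss [simp]: "space gauss = UNIV"
 by (simp add: gauss_def)

interpretation gauss: prob_space gauss by (rule prob_space_gauss)

interpretation gauss_prod: product_sigma_finite "%_ :: 'i. gauss"
 by unfold_locales

lemma prob_space_gauss_on: "prob_space (gauss_on S)"
 by (intro prob_space_PiM prob_space_gauss)

lemma finite_measure_gauss_on: "finite_measure (gauss_on S)"
 using prob_space_gauss_on by (rule prob_space.axioms)

lemma all_moments_gauss: "all_moments gauss (%x. x)"
 unfolding all_moments_def gauss_def
 using integrable_std_normal_moment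
 by (auto simp: integrable_density)

lemma gauss_moment_even: "gauss.expectation (%x. x ^ (2 * k)) = fact (2 * k) / (2 ^ k * fact k)"
 unfolding gauss_def by (subst integral_density) (auto simp: integral_std_normal_moment_even)

lemma gauss_moment_odd: "gauss.expectation (%x. x ^ (2 * k + 1)) = 0"
 unfolding gauss_def by (subst integral_density) (use integral_std_normal_moment_odd[of k] in auto)

lemma gauss_polynomial:
 "gauss.expectation (%y. a0 + a1 * y + a2 * y ^ 2 + a3 * y ^ 3 + a4 * y ^ 4 + a5 * y ^ 5 + a6 * y ^ 6
   + a7 * y ^ 7 + a8 * y ^ 8) = a0 + a2 + 3 * a4 + 15 * a6 + 105 * a8"
proof -
 have i: "integrable gauss (%y. y ^ k)" for k
  using all_moments_gauss by (simp add: all_moments_def)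
 have i1: "integrable gauss (%y. y)" using i[of 1] by simp
 have "gauss.expectation (%y. y) = 0" using gauss_moment_odd[of 0] by simp
 moreover have "gauss.expectation (%y. y ^ 2) = 1" using gauss_moment_even[of 1] by (simp add: fact_numeral)
 moreover have "gauss.expectation (%y. y ^ 3) = 0" using gauss_moment_odd[of 1] by (simp add: numeral_eq_Suc)
 moreover have "gauss.expectation (%y. y ^ 4) = 3" using gauss_moment_even[of 2] by (simp add: fact_numeral)
 moreover have "gauss.expectation (%y. y ^ 5) = 0" using gauss_moment_odd[of 2] by (simp add: numeral_eq_Suc)
 moreover have "gauss.expectation (%y. y ^ 6) = 15" using gauss_moment_even[of 3] by (simp add: fact_numeral)
 moreover have "gauss.expectation (%y. y ^ 7) = 0" using gauss_moment_odd[of 3] by (simp add: numeral_eq_Suc)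
 moreover have "gauss.expectation (%y. y ^ 8) = 105" using gauss_moment_even[of 4] by (simp add: fact_numeral)
 ultimately show ?thesis using i i1 gauss.prob_space by simp
qed

lemma all_moments_component: "s \<in> S ==> all_moments (gauss_on S) (%\<omega>. \<omega> s)"
proof -
 assume s: "s \<in> S"
 have d: "distr (gauss_on S) gauss (%\<omega>. \<omega> s) = gauss"
  using s by (rule distr_PiM_component[OF prob_space_gauss])
 have "integrable (gauss_on S) (%\<omega>. \<omega> s ^ k)" for k
  using all_moments_gauss s
  by (subst integrable_distr_eq[of "%\<omega>. \<omega> s" _ gauss "%x. x ^ k", symmetric]) (auto simp: d all_moments_def)
 moreover have "(%\<omega>. \<omega> s) \<in> measurable (gauss_on S) gauss"
  using s by measurable
 ultimately show ?thesis by (auto simp: all_moments_def measurable_cong_sets[OF refl sets_gauss])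
qed

lemmas all_moments_intros = all_moments_const[OF finite_measure_gauss_on] all_moments_mult all_moments_add
 all_moments_diff[OF finite_measure_gauss_on] all_moments_sum[OF finite_measure_gauss_on]
 all_moments_power[OF finite_measure_gauss_on] all_moments_component

lemma gauss_on_insert:
 assumes "finite S" "a \<notin> S" "all_moments (gauss_on (insert a S)) f"
 shows "integral\<^sup>L (gauss_on (insert a S)) f = (\<integral>\<omega>. (\<integral>y. f (fun_upd \<omega> a y) \<partial>gauss) \<partial>(gauss_on S))"
 using assms by (intro gauss_prod.product_integral_insert all_moments_integrable)

lemma gauss_linear_moments:
 assumes "finite S"
 shows "(\<integral>\<omega>. (\<Sum>s\<in>S. c s * \<omega> s)^2 \<partial>(gauss_on S)) = (\<Sum>s\<in>S. (c s)^2)"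
  and "(\<integral>\<omega>. (\<Sum>s\<in>S. c s * \<omega> s) ^ 4 \<partial>(gauss_on S)) = 3 * (\<Sum>s\<in>S. (c s)^2)^2"
 using assms
proof (induction S rule: finite_induct)
 case empty
 { case 1 show ?case by simp next case 2 show ?case by simp }
next
 case (insert a S)
 define l where "l = (%\<omega>. \<Sum>s\<in>S. c s * \<omega> s)"
 have l: "all_moments (gauss_on T) l" if "S \<subseteq> T" for T
  unfolding l_def using that by (intro all_moments_intros) auto
 have l': "l (fun_upd \<omega> a y) = l \<omega>" for \<omega> y
  unfolding l_def using insert.hyps by (intro sum.cong) auto
 have s: "(\<Sum>s\<in>insert a S. c s * \<omega> s) = c a * \<omega> a + l \<omega>" for \<omega>
  using insert.hyps by (simp add: l_def)
 interpret S: prob_space "gauss_on S" by (rule prob_space_gauss_on)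
 have l2: "S.expectation (%\<omega>. (l \<omega>)^2) = (\<Sum>s\<in>S. (c s)^2)"
  and l4: "S.expectation (%\<omega>. l \<omega> ^ 4) = 3 * (\<Sum>s\<in>S. (c s)^2)^2"
  unfolding l_def by (fact insert.IH)+
 have li: "integrable (gauss_on S) (%\<omega>. l \<omega> ^ 2)" "integrable (gauss_on S) (%\<omega>. l \<omega> ^ 4)"
  by (auto intro!: all_moments_integrable all_moments_intros l)
 { case 1
  have "(\<integral>\<omega>. (\<Sum>s\<in>insert a S. c s * \<omega> s)^2 \<partial>(gauss_on (insert a S))) =
    (\<integral>\<omega>. \<integral>y. (c a * y + l \<omega>)^2 \<partial>gauss \<partial>(gauss_on S))"
   unfolding s using insert.hyps
   by (subst gauss_on_insert) (auto simp: l' intro!: all_moments_intros l)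
  also have "(%\<omega>. \<integral>y. (c a * y + l \<omega>)^2 \<partial>gauss) = (%\<omega>. (c a)^2 + l \<omega> ^ 2)"
  proof
   fix \<omega>
   show "(\<integral>y. (c a * y + l \<omega>)^2 \<partial>gauss) = (c a)^2 + l \<omega> ^ 2"
    using gauss_polynomial[of "l \<omega> ^ 2" "2 * c a * l \<omega>" "(c a)^2" 0 0 0 0 0 0]
    by (simp add: power2_eq_square algebra_simps)
  qed
  also have "(\<integral>\<omega>. (c a)^2 + l \<omega> ^ 2 \<partial>(gauss_on S)) = (c a)^2 + (\<Sum>s\<in>S. (c s)^2)"
   using li by (simp add: S.prob_space l2)
  finally show ?case using insert.hyps by simp }
 { case 2
  have "(\<integral>\<omega>. (\<Sum>s\<in>insert a S. c s * \<omega> s)^4 \<partial>(gauss_on (insert a S))) =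
    (\<integral>\<omega>. \<integral>y. (c a * y + l \<omega>)^4 \<partial>gauss \<partial>(gauss_on S))"
   unfolding s using insert.hyps
   by (subst gauss_on_insert) (auto simp: l' intro!: all_moments_intros l)
  also have "(%\<omega>. \<integral>y. (c a * y + l \<omega>)^4 \<partial>gauss) = (%\<omega>. 3 * (c a)^4 + 6 * (c a)^2 * l \<omega> ^ 2 + l \<omega> ^ 4)"
  proof
   fix \<omega>
   have "(c a * y + l \<omega>)^4 = l \<omega> ^ 4 + (4 * c a * l \<omega> ^ 3) * y + (6 * (c a)^2 * l \<omega> ^ 2) * y ^ 2
     + (4 * c a ^ 3 * l \<omega>) * y ^ 3 + (c a)^4 * y ^ 4 + 0 * y ^ 5 + 0 * y ^ 6 + 0 * y ^ 7 + 0 * y ^ 8" for y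
    by (simp add: eval_nat_numeral algebra_simps)
   then show "(\<integral>y. (c a * y + l \<omega>)^4 \<partial>gauss) = 3 * (c a)^4 + 6 * (c a)^2 * l \<omega> ^ 2 + l \<omega> ^ 4"
    by (simp only: gauss_polynomial)
  qed
  also have "(\<integral>\<omega>. 3 * (c a)^4 + 6 * (c a)^2 * l \<omega> ^ 2 + l \<omega> ^ 4 \<partial>(gauss_on S)) =
    3 * (c a)^4 + 6 * (c a)^2 * (\<Sum>s\<in>S. (c s)^2) + 3 * (\<Sum>s\<in>S. (c s)^2)^2"
   using li by (simp add: S.prob_space l2 l4)
  also have "... = 3 * (\<Sum>s\<in>insert a S. (c s)^2)^2"
  proof -
   have "3 * (x^2 + z)^2 = 3 * x ^ 4 + 6 * x^2 * z + 3 * z^2" for x z :: real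
    by (simp add: eval_nat_numeral algebra_simps)
   then show ?thesis using insert.hyps by simp
  qed
  finally show ?case . }
qed

lemma gauss_covariance:
 assumes "finite S" "a \<in> S" "b \<in> S"
 shows "(\<integral>\<omega>. \<omega> a * \<omega> b \<partial>(gauss_on S)) = of_bool (a = b)"
proof -
 have s: "(\<Sum>s\<in>S. of_bool (s = c) * \<omega> s) = \<omega> c" if "c \<in> S" for c and \<omega> :: "'a => real"
  using assms(1) that by (simp add: of_bool_def if_distrib[of "%x. x * _"] sum.delta cong: if_cong)
 have s2: "(\<Sum>s\<in>S. (of_bool (s = c))^2) = (1::real)" if "c \<in> S" for c
 proof -
  have "(\<Sum>s\<in>S. (of_bool (s = c))^2) = (\<Sum>s\<in>S. of_bool (s = c) * (1::real))"
   by (intro sum.cong) auto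
  then show ?thesis using s[OF that, of "%_. 1"] by simp
 qed
 have 1: "(\<integral>\<omega>. (\<omega> c)^2 \<partial>(gauss_on S)) = 1" if "c \<in> S" for c
  using gauss_linear_moments(1)[OF assms(1), of "%s. of_bool (s = c)"] that by (simp add: s s2)
 show ?thesis
 proof (cases "a = b")
  case True then show ?thesis using 1 assms by (simp add: power2_eq_square)
 next
  case False
  have "(\<Sum>s\<in>S. ((of_bool (s = a) + of_bool (s = b)) :: real)^2) = (\<Sum>s\<in>S. (of_bool (s = a))^2 + (of_bool (s = b))^2)"
   using False by (intro sum.cong) auto
  also have "... = 2" using assms by (simp only: sum.distrib s2)
  finally have "(\<integral>\<omega>. (\<omega> a + \<omega> b)^2 \<partial>(gauss_on S)) = 2"
   using gauss_linear_moments(1)[OF assms(1), of "%s. of_bool (s = a) + of_bool (s = b)"] assms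
   by (simp only: distrib_right sum.distrib s)
  moreover have "(\<integral>\<omega>. (\<omega> a + \<omega> b)^2 \<partial>(gauss_on S)) =
   (\<integral>\<omega>. (\<omega> a)^2 + (\<omega> b)^2 + 2 * (\<omega> a * \<omega> b) \<partial>(gauss_on S))"
   by (intro Bochner_Integration.integral_cong refl) (simp add: power2_eq_square algebra_simps)
  moreover have "integrable (gauss_on S) (%\<omega>. (\<omega> c)^2)" "integrable (gauss_on S) (%\<omega>. \<omega> a * \<omega> b)" if "c \<in> S" for c
   using assms that by (auto intro!: all_moments_integrable all_moments_intros)
  ultimately show ?thesis using 1 assms False by simp
 qed
qed

text \<open>Hypercontractivity for quadratic forms: the fourth moment of the centred form is at most a constant times the
square of the squared Hilbert-Schmidt norm. Induction on the number of variables, expanding in the last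
variable: the remaining form, a linear form and a centred square are the coefficients, and odd moments vanish.\<close>

lemma gauss_centered_quadratic_fourth_moment:
 assumes "finite S"
 shows "(\<integral>\<omega>. ((\<Sum>a\<in>S. \<Sum>b\<in>S. W a b * \<omega> a * \<omega> b) - (\<Sum>a\<in>S. W a a)) ^ 4 \<partial>(gauss_on S))
  <= 400 * (\<Sum>a\<in>S. \<Sum>b\<in>S. (W a b)^2)^2"
 using assms
proof (induction S rule: finite_induct)
 case (insert a S)
 define q where "q = (%\<omega>. (\<Sum>a\<in>S. \<Sum>b\<in>S. W a b * \<omega> a * \<omega> b) - (\<Sum>a\<in>S. W a a))"
 define l where "l = (%\<omega>. \<Sum>b\<in>S. (W a b + W b a) * \<omega> b)"
 define c where "c = W a a"
 define F where "F = (\<Sum>a\<in>S. \<Sum>b\<in>S. (W a b)^2)"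
 define r where "r = (\<Sum>b\<in>S. (W a b)^2 + (W b a)^2)"
 have F0: "0 <= F" and r0: "0 <= r" unfolding F_def r_def by (intro sum_nonneg; simp)+
 have l: "all_moments (gauss_on T) l" if "S \<subseteq> T" for T
  unfolding l_def using that by (intro all_moments_intros) auto
 have q: "all_moments (gauss_on T) q" if "S \<subseteq> T" for T
  unfolding q_def using that by (intro all_moments_intros) auto
 have l': "l (fun_upd \<omega> a y) = l \<omega>" for \<omega> y
  unfolding l_def using insert.hyps by (intro sum.cong) auto
 have q': "q (fun_upd \<omega> a y) = q \<omega>" for \<omega> y
  unfolding q_def using insert.hyps by (intro arg_cong2[where f = "(-)"] sum.cong) auto
 have split: "(\<Sum>b\<in>insert a S. \<Sum>d\<in>insert a S. W b d * \<omega> b * \<omega> d) - (\<Sum>b\<in>insert a S. W b b)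
   = q \<omega> + c * (\<omega> a ^ 2 - 1) + \<omega> a * l \<omega>" for \<omega>
 proof -
  have cross: "\<omega> a * l \<omega> = (\<Sum>b\<in>S. W a b * \<omega> a * \<omega> b) + (\<Sum>b\<in>S. W b a * \<omega> b * \<omega> a)"
   unfolding l_def sum_distrib_left sum.distrib[symmetric]
   by (intro sum.cong refl) (simp add: algebra_simps)
  have "(\<Sum>b\<in>insert a S. \<Sum>d\<in>insert a S. W b d * \<omega> b * \<omega> d) =
   (W a a * \<omega> a * \<omega> a + (\<Sum>b\<in>S. W a b * \<omega> a * \<omega> b)) +
   ((\<Sum>b\<in>S. W b a * \<omega> b * \<omega> a) + (\<Sum>b\<in>S. \<Sum>d\<in>S. W b d * \<omega> b * \<omega> d))"
   using insert.hyps by (simp only: sum.insert sum.distrib if_False not_False_eq_True)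
  moreover have "(\<Sum>b\<in>insert a S. W b b) = c + (\<Sum>b\<in>S. W b b)"
   using insert.hyps by (simp add: c_def)
  moreover have "W a a * \<omega> a * \<omega> a = c * (\<omega> a)^2"
   by (simp add: c_def power2_eq_square)
  ultimately show ?thesis unfolding q_def right_diff_distrib using cross by linarith
 qed
 have F': "(\<Sum>b\<in>insert a S. \<Sum>d\<in>insert a S. (W b d)^2) = F + c^2 + r"
  using insert.hyps by (simp add: F_def r_def c_def sum.distrib)
 interpret S: prob_space "gauss_on S" by (rule prob_space_gauss_on)
 have i: "integrable (gauss_on S) (%\<omega>. q \<omega> ^ k * l \<omega> ^ j)" for k j
  by (auto intro!: all_moments_integrable all_moments_intros l q)
 have i': "integrable (gauss_on S) (%\<omega>. q \<omega> ^ k)" "integrable (gauss_on S) (%\<omega>. l \<omega> ^ k)" for k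
  by (auto intro!: all_moments_integrable all_moments_intros l q)
 have lam: "(\<Sum>b\<in>S. (W a b + W b a)^2) <= 2 * r"
  unfolding r_def sum_distrib_left
 proof (rule sum_mono)
  fix b show "(W a b + W b a)^2 <= 2 * ((W a b)^2 + (W b a)^2)"
   using sum_squares_bound[of "W a b" "W b a"] by (simp add: power2_sum)
 qed
 have l2: "S.expectation (%\<omega>. l \<omega> ^ 2) <= 2 * r"
  unfolding l_def gauss_linear_moments(1)[OF insert.hyps(1)] by (rule lam)
 have "(\<Sum>b\<in>S. (W a b + W b a)^2)^2 <= (2 * r)^2" by (intro power_mono lam sum_nonneg) auto
 then have l4: "S.expectation (%\<omega>. l \<omega> ^ 4) <= 12 * r^2"
  unfolding l_def gauss_linear_moments(2)[OF insert.hyps(1)] by (simp add: power2_eq_square)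
 have q4: "S.expectation (%\<omega>. q \<omega> ^ 4) <= (20 * F)^2"
  using insert.IH by (simp add: q_def F_def power_mult_distrib)
 have q2: "S.expectation (%\<omega>. q \<omega> ^ 2) <= 20 * F"
  using F0 by (intro S.second_moment_le q q4) auto
 have "S.expectation (%\<omega>. q \<omega> ^ 2 * l \<omega> ^ 2) <= (20 * F) * (4 * r)"
 proof (rule S.cauchy_schwarz_moments)
  have "(%w. (q w ^ 2) ^ 2) = (%w. q w ^ 4)" by (simp flip: power_mult)
  then show "S.expectation (%w. (q w ^ 2) ^ 2) <= (20 * F)^2" using q4 by simp
  have "(%w. (l w ^ 2) ^ 2) = (%w. l w ^ 4)" by (simp flip: power_mult)
  then show "S.expectation (%w. (l w ^ 2) ^ 2) <= (4 * r)^2"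
   using l4 zero_le_power2[of r] unfolding power_mult_distrib
   by (rule_tac order.trans[of _ "12 * r^2"]) simp_all
 qed (use F0 r0 in \<open>auto intro!: all_moments_intros l q\<close>)
 note q2l2 = this
 have "(\<integral>\<omega>. ((\<Sum>b\<in>insert a S. \<Sum>d\<in>insert a S. W b d * \<omega> b * \<omega> d) - (\<Sum>b\<in>insert a S. W b b)) ^ 4 \<partial>(gauss_on (insert a S)))
   = (\<integral>\<omega>. \<integral>y. (q \<omega> + c * (y ^ 2 - 1) + y * l \<omega>)^4 \<partial>gauss \<partial>(gauss_on S))"
  unfolding split using insert.hyps
  by (subst gauss_on_insert) (auto simp: l' q' intro!: all_moments_intros l q)
 also have "(%\<omega>. \<integral>y. (q \<omega> + c * (y ^ 2 - 1) + y * l \<omega>)^4 \<partial>gauss) =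
  (%\<omega>. q \<omega> ^ 4 + 12 * c^2 * q \<omega> ^ 2 + 6 * (q \<omega> ^ 2 * l \<omega> ^ 2) + 32 * c ^ 3 * q \<omega> + 24 * c * (q \<omega> * l \<omega> ^ 2)
    + 60 * c ^ 4 + 60 * c^2 * l \<omega> ^ 2 + 3 * l \<omega> ^ 4)"
 proof
  fix \<omega>
  define u where "u = q \<omega> - c"
  define v where "v = l \<omega>"
  have "(q \<omega> + c * (y ^ 2 - 1) + y * l \<omega>)^4 = u ^ 4 + (4 * u ^ 3 * v) * y + (4 * u ^ 3 * c + 6 * u^2 * v^2) * y ^ 2
   + (12 * u^2 * v * c + 4 * u * v ^ 3) * y ^ 3 + (6 * u^2 * c^2 + 12 * u * v^2 * c + v ^ 4) * y ^ 4
   + (12 * u * v * c^2 + 4 * v ^ 3 * c) * y ^ 5 + (4 * u * c ^ 3 + 6 * v^2 * c^2) * y ^ 6 + (4 * v * c ^ 3) * y ^ 7 + c ^ 4 * y ^ 8" for y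
  proof -
   have e: "q \<omega> + c * (y ^ 2 - 1) + y * l \<omega> = u + v * y + c * y ^ 2"
    by (simp add: u_def v_def algebra_simps)
   show ?thesis unfolding e by (simp add: eval_nat_numeral algebra_simps)
  qed
  then have "(\<integral>y. (q \<omega> + c * (y ^ 2 - 1) + y * l \<omega>)^4 \<partial>gauss) =
   u ^ 4 + (4 * u ^ 3 * c + 6 * u^2 * v^2) + 3 * (6 * u^2 * c^2 + 12 * u * v^2 * c + v ^ 4)
    + 15 * (4 * u * c ^ 3 + 6 * v^2 * c^2) + 105 * c ^ 4"
   by (simp only: gauss_polynomial)
  also have "... = q \<omega> ^ 4 + 12 * c^2 * q \<omega> ^ 2 + 6 * (q \<omega> ^ 2 * l \<omega> ^ 2) + 32 * c ^ 3 * q \<omega> + 24 * c * (q \<omega> * l \<omega> ^ 2)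
    + 60 * c ^ 4 + 60 * c^2 * l \<omega> ^ 2 + 3 * l \<omega> ^ 4"
   unfolding u_def v_def by (simp add: eval_nat_numeral algebra_simps)
  finally show "(\<integral>y. (q \<omega> + c * (y ^ 2 - 1) + y * l \<omega>)^4 \<partial>gauss) = ..." .
 qed
 also have "S.expectation ... <= S.expectation (%\<omega>. q \<omega> ^ 4 + 40 * c^2 * q \<omega> ^ 2 + 6 * (q \<omega> ^ 2 * l \<omega> ^ 2)
    + 76 * c ^ 4 + 60 * c^2 * l \<omega> ^ 2 + 15 * l \<omega> ^ 4)"
 proof (rule integral_mono)
  fix \<omega>
  have "0 <= 16 * (c^2 - c * q \<omega>)^2 + 12 * (c * q \<omega> - l \<omega> ^ 2)^2" by simp
  then show "q \<omega> ^ 4 + 12 * c^2 * q \<omega> ^ 2 + 6 * (q \<omega> ^ 2 * l \<omega> ^ 2) + 32 * c ^ 3 * q \<omega> + 24 * c * (q \<omega> * l \<omega> ^ 2)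
    + 60 * c ^ 4 + 60 * c^2 * l \<omega> ^ 2 + 3 * l \<omega> ^ 4 <= q \<omega> ^ 4 + 40 * c^2 * q \<omega> ^ 2 + 6 * (q \<omega> ^ 2 * l \<omega> ^ 2)
    + 76 * c ^ 4 + 60 * c^2 * l \<omega> ^ 2 + 15 * l \<omega> ^ 4"
   by (simp add: eval_nat_numeral algebra_simps)
 qed (auto intro!: all_moments_integrable all_moments_intros l q)
 also have "... = S.expectation (%\<omega>. q \<omega> ^ 4) + 40 * c^2 * S.expectation (%\<omega>. q \<omega> ^ 2)
   + 6 * S.expectation (%\<omega>. q \<omega> ^ 2 * l \<omega> ^ 2) + 76 * c ^ 4 + 60 * c^2 * S.expectation (%\<omega>. l \<omega> ^ 2)
   + 15 * S.expectation (%\<omega>. l \<omega> ^ 4)"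
  using i i' by (simp add: S.prob_space)
 also have "... <= (20 * F)^2 + 40 * c^2 * (20 * F) + 6 * ((20 * F) * (4 * r)) + 76 * c ^ 4 + 60 * c^2 * (2 * r) + 15 * (12 * r^2)"
  using q4 q2 q2l2 l2 l4 by (intro add_mono mult_left_mono) auto
 also have "... <= 400 * (F + c^2 + r)^2"
 proof -
  have "0 <= F * r" "0 <= c^2 * r" "0 <= c ^ 4" "0 <= r^2" "0 <= F * c^2" using F0 r0 by auto
  then show ?thesis by (simp add: power2_eq_square eval_nat_numeral algebra_simps)
 qed
 finally show ?case unfolding F' .
qed simp

text \<open>The variable is Gaussian with variance $\sum c_s^2$, and the product structure of the measure factors the
exponential.\<close>

lemma gauss_exp_linear:
 assumes "finite S"
 shows "integrable (gauss_on S) (%\<omega>. exp (\<Sum>s\<in>S. c s * \<omega> s))"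
  and "(\<integral>\<omega>. exp (\<Sum>s\<in>S. c s * \<omega> s) \<partial>(gauss_on S)) = exp ((\<Sum>s\<in>S. (c s)^2) / 2)"
proof -
 have sh: "exp (t * x) * std_normal_density x = exp (t^2 / 2) * normal_density t 1 x" for t x :: real
 proof -
  have "t * x + - x\<^sup>2 / 2 = t^2 / 2 + - (x - t)\<^sup>2 / 2" by (simp add: power2_eq_square field_simps)
  then show ?thesis unfolding normal_density_def
   by (simp add: exp_add[symmetric] field_simps del: exp_add)
 qed
 have i1: "integrable gauss (%x. exp (t * x))" for t
  unfolding gauss_def
  by (subst integrable_density) (auto simp: sh mult.commute[of "std_normal_density _"])
 have e1: "(\<integral>x. exp (t * x) \<partial>gauss) = exp (t^2 / 2)" for t
  unfolding gauss_def
  by (subst integral_density) (auto simp: sh mult.commute[of "std_normal_density _"])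
 show "integrable (gauss_on S) (%\<omega>. exp (\<Sum>s\<in>S. c s * \<omega> s))"
  unfolding exp_sum[OF assms] by (rule gauss_prod.product_integrable_prod[OF assms i1])
 show "(\<integral>\<omega>. exp (\<Sum>s\<in>S. c s * \<omega> s) \<partial>(gauss_on S)) = exp ((\<Sum>s\<in>S. (c s)^2) / 2)"
  unfolding exp_sum[OF assms] sum_divide_distrib
  by (subst gauss_prod.product_integral_prod[OF assms i1]) (simp add: e1)
qed

section \<open>The Kronecker rows\<close>

text \<open>A kernel is a matrix over the pairs (column block, position in the block), that is, over the column indices of
$A_i \otimes G_i$; a \<open>cmat\<close> is a coefficient matrix of fixed size, indexed by the rows or the
columns of the $A_i$.\<close>

type_synonym kernel = "nat \<times> nat => nat \<times> nat => real"
type_synonym cmat = "nat => nat => real"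

locale kron_coeffs =
 fixes k1 k2 l :: nat and A :: "nat => nat => nat => real"
begin

abbreviation "K1 \<equiv> lessThan k1"
abbreviation "K2 \<equiv> lessThan k2"

definition idx :: "nat => (nat \<times> nat) set" where
 "idx n = K2 \<times> {..<n}"

definition noise :: "nat => (nat \<times> nat) set" where
 "noise n = {..<l} \<times> {..<n}"

abbreviation "row_law n \<equiv> Pi\<^sub>M (noise n) (%_. gauss)"
abbreviation "mean n f \<equiv> integral\<^sup>L (row_law n) f"

text \<open>Row $(q, i)$ of $H$, as a function of the $i$-th rows of the $G_t$. For fixed $i$ there are \<open>k1\<close>
such rows, which are dependent, and different $i$ give independent families.\<close>

definition row :: "nat => (nat \<times> nat => real) => nat => nat \<times> nat => real" where
 "row n g q a = (\<Sum>t<l. A t q (fst a) * g (t, snd a)) / sqrt (real n)"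

definition cov :: "nat => nat => nat => nat => real" where
 "cov q p q' p' = (\<Sum>t<l. A t q p * A t q' p')"

definition normA :: real where
 "normA = (\<Sum>t<l. \<Sum>q<k1. \<Sum>p<k2. (A t q p)^2)"

text \<open>The normalised partial trace over the second tensor factor.\<close>

definition ptrace :: "nat => kernel => nat => nat => real" where
 "ptrace n R p p' = (\<Sum>j<n. R (p, j) (p', j)) / real n"

text \<open>$e \otimes I_n$.\<close>

definition tens :: "cmat => kernel" where
 "tens e a b = of_bool (snd a = snd b) * e (fst a) (fst b)"

text \<open>The maps $Y \mapsto \sum A_i^T Y A_i$ and $X \mapsto \sum A_i X A_i^T$ of the Dyson equation.\<close>

definition etaX :: "cmat => nat => nat => real" where
 "etaX Y p p' = (\<Sum>q<k1. \<Sum>q'<k1. cov q p q' p' * Y q q')"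

definition etaY :: "cmat => nat => nat => real" where
 "etaY X q q' = (\<Sum>p<k2. \<Sum>p'<k2. cov q p q' p' * X p p')"

definition frob :: "nat => kernel => real" where
 "frob n M = (\<Sum>a\<in>idx n. \<Sum>b\<in>idx n. (M a b)^2)"

text \<open>The entry $h_q M h_{q'}^T$ for two rows of $H$ with the same $i$; its expectation is an entry of $\sum A_i\,
\mathrm{ptrace}(M) A_i^T$.\<close>

definition rform :: "nat => (nat \<times> nat => real) => nat => nat => kernel => real" where
 "rform n g q q' M = (\<Sum>a\<in>idx n. \<Sum>b\<in>idx n. M a b * row n g q a * row n g q' b)"

lemma finite_idx [simp]: "finite (idx n)" and finite_noise [simp]: "finite (noise n)"
 by (simp_all add: idx_def noise_def)

lemma sum_idx: "(\<Sum>a\<in>idx n. f a) = (\<Sum>p<k2. \<Sum>j<n. f (p, j))"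
 by (simp add: idx_def sum.cartesian_product)

lemma sum_noise: "(\<Sum>a\<in>noise n. f a) = (\<Sum>t<l. \<Sum>j<n. f (t, j))"
 by (simp add: noise_def sum.cartesian_product)

lemma normA_nonneg: "0 <= normA"
 unfolding normA_def by (intro sum_nonneg) auto

lemma frob_nonneg: "0 <= frob n M"
 unfolding frob_def by (intro sum_nonneg) auto

lemma normA_row: "q < k1 ==> (\<Sum>t<l. \<Sum>p<k2. (A t q p)^2) <= normA"
 unfolding normA_def
 by (intro sum_mono member_le_sum[of q "K1" "%q. \<Sum>p<k2. (A _ q p)^2"]) (auto intro: sum_nonneg)

lemma abs_cov_le: "q < k1 ==> q' < k1 ==> p < k2 ==> p' < k2 ==> \<bar>cov q p q' p'\<bar> <= normA"
proof -
 assume *: "q < k1" "q' < k1" "p < k2" "p' < k2"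
 have c: "(\<Sum>t<l. (A t q p)^2) <= normA" if "q < k1" "p < k2" for q p
 proof -
  have "(\<Sum>t<l. (A t q p)^2) <= (\<Sum>t<l. \<Sum>p<k2. (A t q p)^2)"
   using that by (intro sum_mono member_le_sum) auto
  also have "... <= normA" by (rule normA_row[OF that(1)])
  finally show ?thesis .
 qed
 have "(cov q p q' p')^2 <= (\<Sum>t<l. (A t q p)^2) * (\<Sum>t<l. (A t q' p')^2)"
  unfolding cov_def by (rule Cauchy_Schwarz_ineq_sum)
 also have "... <= normA * normA"
  using * by (intro mult_mono c normA_nonneg sum_nonneg) auto
 finally have "(cov q p q' p')^2 <= normA^2" by (simp add: power2_eq_square)
 then show ?thesis
  using normA_nonneg by (metis abs_le_square_iff abs_of_nonneg)
qed

definition rowcoef :: "nat => nat => kernel" where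
 "rowcoef n q a s = A (fst s) q (fst a) * of_bool (snd s = snd a) / sqrt (real n)"

lemma row_eq: "a \<in> idx n ==> row n g q a = (\<Sum>s\<in>noise n. rowcoef n q a s * g s)"
proof -
 assume "a \<in> idx n"
 then have "(\<Sum>j<n. A t q (fst a) * of_bool (j = snd a) / sqrt (real n) * g (t, j))
  = A t q (fst a) * g (t, snd a) / sqrt (real n)" for t
  by (auto simp: idx_def of_bool_def if_distrib if_distribR cong: if_cong)
 then show ?thesis by (simp add: sum_noise rowcoef_def row_def sum_divide_distrib)
qed

lemma rowcoef_covariance:
 assumes "a \<in> idx n" "b \<in> idx n"
 shows "(\<Sum>s\<in>noise n. rowcoef n q a s * rowcoef n q' b s) =
  of_bool (snd a = snd b) * cov q (fst a) q' (fst b) / real n"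
proof -
 have "(\<Sum>j<n. rowcoef n q a (t, j) * rowcoef n q' b (t, j)) =
   of_bool (snd a = snd b) * (A t q (fst a) * A t q' (fst b)) / real n" for t
 proof -
  have "(\<Sum>j<n. rowcoef n q a (t, j) * rowcoef n q' b (t, j)) =
   (\<Sum>j<n. if j = snd a then of_bool (snd a = snd b) * (A t q (fst a) * A t q' (fst b)) / real n else 0)"
   by (intro sum.cong) (auto simp: rowcoef_def)
  also have "... = of_bool (snd a = snd b) * (A t q (fst a) * A t q' (fst b)) / real n"
   using assms by (auto simp: idx_def)
  finally show ?thesis .
 qed
 then show ?thesis
  by (simp add: sum_noise cov_def sum_distrib_left sum_divide_distrib)
qed

definition noiseform :: "nat => nat => nat => kernel => kernel" where
 "noiseform n q q' M s s' = (\<Sum>a\<in>idx n. \<Sum>b\<in>idx n. M a b * rowcoef n q a s * rowcoef n q' b s')"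

lemma rform_eq: "rform n g q q' M = (\<Sum>s\<in>noise n. \<Sum>s'\<in>noise n. noiseform n q q' M s s' * g s * g s')"
proof -
 have "rform n g q q' M = (\<Sum>a\<in>idx n. \<Sum>b\<in>idx n. \<Sum>s\<in>noise n. \<Sum>s'\<in>noise n.
   M a b * rowcoef n q a s * rowcoef n q' b s' * g s * g s')"
  unfolding rform_def
  by (intro sum.cong refl) (simp add: row_eq sum_product sum_distrib_left ac_simps)
 also have "... = (\<Sum>a\<in>idx n. \<Sum>s\<in>noise n. \<Sum>b\<in>idx n. \<Sum>s'\<in>noise n.
   M a b * rowcoef n q a s * rowcoef n q' b s' * g s * g s')"
  by (intro sum.cong refl sum.swap)
 also have "... = (\<Sum>s\<in>noise n. \<Sum>a\<in>idx n. \<Sum>b\<in>idx n. \<Sum>s'\<in>noise n.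
   M a b * rowcoef n q a s * rowcoef n q' b s' * g s * g s')"
  by (rule sum.swap)
 also have "... = (\<Sum>s\<in>noise n. \<Sum>a\<in>idx n. \<Sum>s'\<in>noise n. \<Sum>b\<in>idx n.
   M a b * rowcoef n q a s * rowcoef n q' b s' * g s * g s')"
  by (intro sum.cong refl sum.swap)
 also have "... = (\<Sum>s\<in>noise n. \<Sum>s'\<in>noise n. \<Sum>a\<in>idx n. \<Sum>b\<in>idx n.
   M a b * rowcoef n q a s * rowcoef n q' b s' * g s * g s')"
  by (intro sum.cong refl sum.swap)
 also have "... = (\<Sum>s\<in>noise n. \<Sum>s'\<in>noise n. noiseform n q q' M s s' * g s * g s')"
  by (simp add: noiseform_def sum_distrib_right)
 finally show ?thesis .
qed

lemma noiseform_trace: "(\<Sum>s\<in>noise n. noiseform n q q' M s s) = etaY (ptrace n M) q q'"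
proof -
 have "(\<Sum>s\<in>noise n. noiseform n q q' M s s) =
   (\<Sum>a\<in>idx n. \<Sum>b\<in>idx n. \<Sum>s\<in>noise n. M a b * rowcoef n q a s * rowcoef n q' b s)"
 proof -
  have "(\<Sum>s\<in>noise n. noiseform n q q' M s s) =
   (\<Sum>a\<in>idx n. \<Sum>s\<in>noise n. \<Sum>b\<in>idx n. M a b * rowcoef n q a s * rowcoef n q' b s)"
   unfolding noiseform_def by (rule sum.swap)
  also have "... = (\<Sum>a\<in>idx n. \<Sum>b\<in>idx n. \<Sum>s\<in>noise n. M a b * rowcoef n q a s * rowcoef n q' b s)"
   by (intro sum.cong refl sum.swap)
  finally show ?thesis .
 qed
 also have "... = (\<Sum>a\<in>idx n. \<Sum>b\<in>idx n. M a b * (of_bool (snd a = snd b) * cov q (fst a) q' (fst b) / real n))"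
  by (intro sum.cong refl) (simp add: rowcoef_covariance[symmetric] sum_distrib_left mult.assoc)
 also have "... = (\<Sum>p<k2. \<Sum>j<n. \<Sum>p'<k2. M (p, j) (p', j) * cov q p q' p' / real n)"
 proof -
  have "(\<Sum>j'<n. M (p, j) (p', j') * (of_bool (j = j') * cov q p q' p') / real n) = M (p, j) (p', j) * cov q p q' p' / real n"
   if "j < n" for p j p'
  proof -
   have "(\<Sum>j'<n. M (p, j) (p', j') * (of_bool (j = j') * cov q p q' p') / real n) =
    (\<Sum>j'<n. if j' = j then M (p, j) (p', j) * cov q p q' p' / real n else 0)"
    by (intro sum.cong) auto
   then show ?thesis using that by simp
  qed
  then show ?thesis by (simp add: sum_idx)
 qed
 also have "... = (\<Sum>p<k2. \<Sum>p'<k2. \<Sum>j<n. M (p, j) (p', j) * cov q p q' p' / real n)"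
  by (intro sum.cong refl sum.swap)
 also have "... = etaY (ptrace n M) q q'"
  by (simp add: etaY_def ptrace_def sum_distrib_left sum_divide_distrib mult.commute)
 finally show ?thesis .
qed

text \<open>Each entry of the form in the noise variables is a bilinear expression of a block of $M$ in the coefficients, so
Cauchy-Schwarz in the fixed-size indices costs only a constant.\<close>

lemma noiseform_frob:
 assumes q: "q < k1" "q' < k1"
 shows "(\<Sum>s\<in>noise n. \<Sum>s'\<in>noise n. (noiseform n q q' M s s')^2) <= (normA / real n)^2 * frob n M"
proof -
 have col: "noiseform n q q' M (t, j) (t', j') =
   (\<Sum>z\<in>K2 \<times> K2. (A t q (fst z) * A t' q' (snd z)) * M (fst z, j) (snd z, j')) / real n"
  if "j < n" "j' < n" for t j t' j'
 proof -
  have "noiseform n q q' M (t, j) (t', j') = (\<Sum>p<k2. \<Sum>i<n. \<Sum>p'<k2. \<Sum>i'<n.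
    M (p, i) (p', i') * (A t q p * of_bool (j = i) / sqrt (real n)) * (A t' q' p' * of_bool (j' = i') / sqrt (real n)))"
   by (simp add: noiseform_def sum_idx rowcoef_def)
  also have "... = (\<Sum>p<k2. \<Sum>i<n. if i = j then (\<Sum>p'<k2. \<Sum>i'<n. if i' = j' then
    M (p, j) (p', j') * (A t q p / sqrt (real n)) * (A t' q' p' / sqrt (real n)) else 0) else 0)"
   by (intro sum.cong refl) (auto intro!: sum.cong sum.neutral simp del: sum.delta sum.delta')
  also have "... = (\<Sum>p<k2. \<Sum>p'<k2. (A t q p * A t' q' p') * M (p, j) (p', j') / real n)"
   using that by (simp add: mult.commute mult.left_commute)
  finally show ?thesis by (simp add: sum.cartesian_product sum_divide_distrib case_prod_beta)
 qed
 define \<alpha> where "\<alpha> = (%q t. \<Sum>p<k2. (A t q p)^2)"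
 have bound: "(noiseform n q q' M (t, j) (t', j'))^2 <= \<alpha> q t * \<alpha> q' t' * (\<Sum>p<k2. \<Sum>p'<k2. (M (p, j) (p', j'))^2) / (real n)^2"
  if "j < n" "j' < n" for t j t' j'
 proof -
  have "(\<Sum>z\<in>K2 \<times> K2. (A t q (fst z) * A t' q' (snd z)) * M (fst z, j) (snd z, j'))^2
   <= (\<Sum>z\<in>K2 \<times> K2. (A t q (fst z) * A t' q' (snd z))^2) * (\<Sum>z\<in>K2 \<times> K2. (M (fst z, j) (snd z, j'))^2)"
   by (rule Cauchy_Schwarz_ineq_sum)
  also have "(\<Sum>z\<in>K2 \<times> K2. (A t q (fst z) * A t' q' (snd z))^2) = \<alpha> q t * \<alpha> q' t'"
   by (simp add: \<alpha>_def sum_product sum.cartesian_product power_mult_distrib case_prod_beta)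
  also have "(\<Sum>z\<in>K2 \<times> K2. (M (fst z, j) (snd z, j'))^2) = (\<Sum>p<k2. \<Sum>p'<k2. (M (p, j) (p', j'))^2)"
   by (simp add: sum.cartesian_product case_prod_beta)
  finally show ?thesis unfolding col[OF that] power_divide by (rule divide_right_mono) simp
 qed
 have "(\<Sum>s\<in>noise n. \<Sum>s'\<in>noise n. (noiseform n q q' M s s')^2) <=
  (\<Sum>t<l. \<Sum>j<n. \<Sum>t'<l. \<Sum>j'<n. \<alpha> q t * \<alpha> q' t' * (\<Sum>p<k2. \<Sum>p'<k2. (M (p, j) (p', j'))^2) / (real n)^2)"
  unfolding sum_noise by (intro sum_mono bound) auto
 also have "... = (\<Sum>t<l. \<alpha> q t) * (\<Sum>t<l. \<alpha> q' t) * (\<Sum>j<n. \<Sum>j'<n. \<Sum>p<k2. \<Sum>p'<k2. (M (p, j) (p', j'))^2) / (real n)^2"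
 proof -
  define m where "m = (%j j'. \<Sum>p<k2. \<Sum>p'<k2. (M (p, j) (p', j'))^2)"
  have "(\<Sum>t<l. \<Sum>j<n. \<Sum>t'<l. \<Sum>j'<n. \<alpha> q t * \<alpha> q' t' * m j j' / (real n)^2)
   = (\<Sum>t<l. \<Sum>t'<l. \<Sum>j<n. \<Sum>j'<n. \<alpha> q t * \<alpha> q' t' * m j j' / (real n)^2)"
   by (intro sum.cong refl sum.swap)
  also have "... = (\<Sum>t<l. \<Sum>t'<l. \<alpha> q t * \<alpha> q' t' * (\<Sum>j<n. \<Sum>j'<n. m j j') / (real n)^2)"
   by (simp add: sum_distrib_left sum_divide_distrib)
  also have "... = (\<Sum>t<l. \<alpha> q t) * (\<Sum>t<l. \<alpha> q' t) * (\<Sum>j<n. \<Sum>j'<n. m j j') / (real n)^2"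
   by (simp only: sum_divide_distrib[symmetric] sum_distrib_right[symmetric] sum_distrib_left[symmetric])
  finally show ?thesis by (simp add: m_def)
 qed
 also have "(\<Sum>j<n. \<Sum>j'<n. \<Sum>p<k2. \<Sum>p'<k2. (M (p, j) (p', j'))^2) = frob n M"
 proof -
  have "frob n M = (\<Sum>j<n. \<Sum>p<k2. \<Sum>p'<k2. \<Sum>j'<n. (M (p, j) (p', j'))^2)"
   unfolding frob_def sum_idx by (rule sum.swap)
  also have "... = (\<Sum>j<n. \<Sum>p<k2. \<Sum>j'<n. \<Sum>p'<k2. (M (p, j) (p', j'))^2)"
   by (intro sum.cong refl sum.swap)
  also have "... = (\<Sum>j<n. \<Sum>j'<n. \<Sum>p<k2. \<Sum>p'<k2. (M (p, j) (p', j'))^2)"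
   by (intro sum.cong refl sum.swap)
  finally show ?thesis ..
 qed
 also have "(\<Sum>t<l. \<alpha> q t) * (\<Sum>t<l. \<alpha> q' t) * frob n M / (real n)^2 <= normA * normA * frob n M / (real n)^2"
  unfolding \<alpha>_def using q
  by (intro divide_right_mono mult_right_mono mult_mono normA_row normA_nonneg frob_nonneg sum_nonneg) auto
 finally show ?thesis by (simp add: power2_eq_square)
qed

lemma all_moments_row: "q < k1 ==> a \<in> idx n ==> all_moments (row_law n) (%g. row n g q a)"
 by (subst row_eq) (auto intro!: all_moments_intros)

lemma all_moments_rform: "all_moments (row_law n) (%g. rform n g q q' M)"
 unfolding rform_eq by (intro all_moments_intros)

lemma rform_expectation: "(mean n (%g. rform n g q q' M)) = etaY (ptrace n M) q q'"
proof -
 have "(mean n (%g. rform n g q q' M)) =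
  (\<Sum>s\<in>noise n. \<Sum>s'\<in>noise n. noiseform n q q' M s s' * (mean n (%g. g s * g s')))"
  unfolding rform_eq mult.assoc
  by (subst Bochner_Integration.integral_sum Bochner_Integration.integral_mult_right_zero,
    auto intro!: all_moments_integrable all_moments_intros sum.cong)+
 also have "... = (\<Sum>s\<in>noise n. \<Sum>s'\<in>noise n. if s' = s then noiseform n q q' M s s else 0)"
  by (intro sum.cong refl) (auto simp: gauss_covariance)
 also have "... = (\<Sum>s\<in>noise n. noiseform n q q' M s s)" by simp
 finally show ?thesis by (simp only: noiseform_trace)
qed

text \<open>Concentration of $h_q M h_{q'}^T$: the fluctuation is of order $n^{-1/2}$ when $M$ has bounded normalised
Hilbert-Schmidt norm.\<close>

lemma rform_fourth_moment:
 assumes "q < k1" "q' < k1"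
 shows "(mean n (%g. (rform n g q q' M - etaY (ptrace n M) q q') ^ 4))
  <= 400 * ((normA / real n)^2 * frob n M)^2"
proof -
 have "(mean n (%g. (rform n g q q' M - etaY (ptrace n M) q q') ^ 4))
  <= 400 * (\<Sum>s\<in>noise n. \<Sum>s'\<in>noise n. (noiseform n q q' M s s')^2)^2"
  unfolding rform_eq noiseform_trace[symmetric]
  by (rule gauss_centered_quadratic_fourth_moment) simp
 also have "... <= 400 * ((normA / real n)^2 * frob n M)^2"
  using assms by (intro mult_left_mono power_mono noiseform_frob sum_nonneg) auto
 finally show ?thesis .
qed

lemma rform_variance:
 assumes "q < k1" "q' < k1"
 shows "(mean n (%g. (rform n g q q' M - etaY (ptrace n M) q q') ^ 2))
  <= 20 * ((normA / real n)^2 * frob n M)"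
proof -
 interpret G: prob_space "row_law n" by (rule prob_space_gauss_on)
 show ?thesis
  using rform_fourth_moment[OF assms] frob_nonneg
  by (intro G.second_moment_le all_moments_intros all_moments_rform) (auto simp: power_mult_distrib)
qed

lemma rform_second_moment:
 assumes "q < k1" "q' < k1" "\<bar>etaY (ptrace n M) q q'\<bar> <= c" "(normA / real n)^2 * frob n M <= c^2"
 shows "(mean n (%g. (rform n g q q' M) ^ 2)) <= 42 * c^2"
proof -
 interpret G: prob_space "row_law n" by (rule prob_space_gauss_on)
 define u where "u = etaY (ptrace n M) q q'"
 have "G.expectation (%g. (rform n g q q' M) ^ 2) <= G.expectation (%g. 2 * (rform n g q q' M - u)^2 + 2 * u^2)"
 proof (rule integral_mono)
  fix g
  have "(x + u)^2 <= 2 * x^2 + 2 * u^2" for x using sum_squares_bound[of x u] by (simp add: power2_sum)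
  from this[of "rform n g q q' M - u"] show "(rform n g q q' M) ^ 2 <= 2 * (rform n g q q' M - u)^2 + 2 * u^2" by simp
 qed (auto intro!: all_moments_integrable all_moments_intros all_moments_rform)
 also have "... = 2 * G.expectation (%g. (rform n g q q' M - u)^2) + 2 * u^2"
  by (subst Bochner_Integration.integral_add)
   (auto simp: G.prob_space intro!: all_moments_integrable all_moments_intros all_moments_rform)
 also have "... <= 2 * (20 * c^2) + 2 * c^2"
  using rform_variance[OF assms(1,2), of n M] assms(3,4) abs_le_square_iff[of u c]
  by (intro add_mono mult_left_mono) (auto simp: u_def)
 finally show ?thesis by simp
qed

end

section \<open>Rank and barrier updates of a dual pair\<close>

lemma sym_on_of_dot:
 assumes "finite I" "!!x y. dot_on I x (app_on I X y) = dot_on I (app_on I X x) y"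
 shows "sym_on I X"
 unfolding sym_on_def
proof (intro ballI)
 fix a b assume ab: "a \<in> I" "b \<in> I"
 have 1: "app_on I X (%c. of_bool (c = d)) a = X a d" if "d \<in> I" for a d
 proof -
  have "app_on I X (%c. of_bool (c = d)) a = (\<Sum>c\<in>I. if c = d then X a d else 0)"
   unfolding app_on_def by (intro sum.cong) auto
  then show ?thesis using assms(1) that by simp
 qed
 have 2: "dot_on I (%c. of_bool (c = d)) z = z d" if "d \<in> I" for d z
 proof -
  have "dot_on I (%c. of_bool (c = d)) z = (\<Sum>c\<in>I. if c = d then z d else 0)"
   unfolding dot_on_def by (intro sum.cong) auto
  then show ?thesis using assms(1) that by simp
 qed
 have "dot_on I (%c. of_bool (c = a)) (app_on I X (%c. of_bool (c = b))) = X a b"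
  using ab by (simp add: 1 2)
 moreover have "dot_on I (app_on I X (%c. of_bool (c = a))) (%c. of_bool (c = b)) = X b a"
  using ab by (subst dot_on_commute) (simp add: 1 2)
 ultimately show "X a b = X b a" using assms(2) by metis
qed

lemma dot_on_sum_left: "dot_on I (%a. \<Sum>q\<in>K. c q * h q a) x = (\<Sum>q\<in>K. c q * dot_on I (h q) x)"
 unfolding dot_on_def sum_distrib_left sum_distrib_right
 by (subst sum.swap) (simp add: mult.assoc)

lemma dot_on_sum_right: "dot_on I x (%a. \<Sum>q\<in>K. c q * h q a) = (\<Sum>q\<in>K. c q * dot_on I x (h q))"
 unfolding dot_on_commute[of I x] by (rule dot_on_sum_left)

lemma app_on_sum: "app_on I X (%a. \<Sum>q\<in>K. c q * h q a) = (%a. \<Sum>q\<in>K. c q * app_on I X (h q) a)"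
 unfolding app_on_def sum_distrib_left
 by (rule ext, subst sum.swap) (simp add: ac_simps)

lemma quad_on_outer:
 "quad_on I (%a b. \<Sum>q\<in>K. \<Sum>q'\<in>K. B q q' * w q a * w q' b) y = quad_on K B (%q. dot_on I (w q) y)"
proof -
 have "quad_on I (%a b. \<Sum>q\<in>K. \<Sum>q'\<in>K. B q q' * w q a * w q' b) y
   = (\<Sum>a\<in>I. \<Sum>b\<in>I. \<Sum>q\<in>K. \<Sum>q'\<in>K. B q q' * (w q a * y a) * (w q' b * y b))"
  unfolding quad_on_alt by (simp add: sum_distrib_right sum_distrib_left ac_simps)
 also have "... = (\<Sum>a\<in>I. \<Sum>q\<in>K. \<Sum>b\<in>I. \<Sum>q'\<in>K. B q q' * (w q a * y a) * (w q' b * y b))"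
  by (intro sum.cong refl sum.swap)
 also have "... = (\<Sum>q\<in>K. \<Sum>a\<in>I. \<Sum>b\<in>I. \<Sum>q'\<in>K. B q q' * (w q a * y a) * (w q' b * y b))"
  by (rule sum.swap)
 also have "... = (\<Sum>q\<in>K. \<Sum>a\<in>I. \<Sum>q'\<in>K. \<Sum>b\<in>I. B q q' * (w q a * y a) * (w q' b * y b))"
  by (intro sum.cong refl sum.swap)
 also have "... = (\<Sum>q\<in>K. \<Sum>q'\<in>K. \<Sum>a\<in>I. \<Sum>b\<in>I. B q q' * (w q a * y a) * (w q' b * y b))"
  by (intro sum.cong refl sum.swap)
 also have "... = (\<Sum>q\<in>K. \<Sum>q'\<in>K. B q q' * dot_on I (w q) y * dot_on I (w q') y)"
 proof (intro sum.cong refl)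
  fix q q'
  show "(\<Sum>a\<in>I. \<Sum>b\<in>I. B q q' * (w q a * y a) * (w q' b * y b)) = B q q' * dot_on I (w q) y * dot_on I (w q') y"
   unfolding dot_on_def mult.assoc[of "B q q'"] sum_product by (simp only: sum_distrib_left)
 qed
 finally show ?thesis by (simp add: quad_on_alt)
qed

lemma quad_on_gram:
 "quad_on I (%a b. \<Sum>q\<in>K. h q a * h q b) x = (\<Sum>q\<in>K. (dot_on I (h q) x)^2)"
proof -
 have "quad_on I (%a b. \<Sum>q\<in>K. h q a * h q b) x = (\<Sum>a\<in>I. \<Sum>b\<in>I. \<Sum>q\<in>K. (h q a * x a) * (h q b * x b))"
  unfolding quad_on_alt by (simp add: sum_distrib_right sum_distrib_left ac_simps)
 also have "... = (\<Sum>a\<in>I. \<Sum>q\<in>K. \<Sum>b\<in>I. (h q a * x a) * (h q b * x b))"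
  by (intro sum.cong refl sum.swap)
 also have "... = (\<Sum>q\<in>K. \<Sum>a\<in>I. \<Sum>b\<in>I. (h q a * x a) * (h q b * x b))"
  by (rule sum.swap)
 finally show ?thesis by (simp add: dot_on_def power2_eq_square sum_product)
qed

lemma quad_on_add:
 assumes "sym_on I R"
 shows "quad_on I R (%a. x a + y a) = quad_on I R x + 2 * dot_on I y (app_on I R x) + quad_on I R y"
 unfolding quad_on_def app_on_linear dot_on_linear
 using dot_on_app_sym[OF assms, of x y] dot_on_commute[of I y "app_on I R x"] by simp

text \<open>Rank update of a dual pair: subtracting the rows $h_q$ from $N$ is compensated by adding $R h^T B h R$ to the
dual matrix, as soon as $B$ dominates $(1 - h R h^T)^{-1}$. This is the Woodbury formula with inequalities in
place of inverses. The pair is tested at $y$ shifted by the combination of rows selected by $x$.\<close>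

lemma fenchel_on_downdate:
 assumes dual: "fenchel_on I N R" and R: "sym_on I R"
  and D: "!!x c. 2 * dot_on K x c <= quad_on K B x + dot_on K c c
   - quad_on K (%q q'. dot_on I (h q) (app_on I R (h q'))) c"
 shows "fenchel_on I (%a b. N a b - (\<Sum>q\<in>K. h q a * h q b))
  (%a b. R a b + (\<Sum>q\<in>K. \<Sum>q'\<in>K. B q q' * app_on I R (h q) a * app_on I R (h q') b))"
 unfolding fenchel_on_def
proof (intro allI)
 fix x y
 define c where "c = (%q. dot_on I (h q) x)"
 define v where "v = (%a. \<Sum>q\<in>K. c q * h q a)"
 define s where "s = (%q. dot_on I (app_on I R (h q)) y)"
 have cc: "dot_on K c c = (\<Sum>q\<in>K. (dot_on I (h q) x)^2)"
  by (simp add: dot_on_def c_def power2_eq_square)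
 have xv: "dot_on I x v = dot_on K c c"
  unfolding v_def dot_on_sum_right by (simp add: dot_on_def[of K] c_def dot_on_commute[of I x])
 have vy: "dot_on I v (app_on I R y) = dot_on K s c"
  unfolding v_def dot_on_sum_left
  by (simp add: dot_on_def[of K] s_def dot_on_app_sym[OF R] mult.commute)
 have vv: "quad_on I R v = quad_on K (%q q'. dot_on I (h q) (app_on I R (h q'))) c"
  unfolding quad_on_def[of I] v_def app_on_sum dot_on_sum_left dot_on_sum_right
  by (simp add: quad_on_def dot_on_def[of K] app_on_def[of K] mult.commute)
 have "2 * dot_on I x (%a. y a + v a) <= quad_on I N x + quad_on I R (%a. y a + v a)"
  using dual by (simp add: fenchel_on_def)
 then have "2 * (dot_on I x y + dot_on K c c) <= quad_on I N x
   + (quad_on I R y + 2 * dot_on K s c + quad_on I R v)"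
  unfolding quad_on_add[OF R] vy dot_on_linear xv .
 moreover have qN: "quad_on I (%a b. N a b - (\<Sum>q\<in>K. h q a * h q b)) x = quad_on I N x - dot_on K c c"
  by (simp add: quad_on_linear quad_on_gram cc)
 moreover have qR: "quad_on I (%a b. R a b + (\<Sum>q\<in>K. \<Sum>q'\<in>K. B q q' * app_on I R (h q) a * app_on I R (h q') b)) y
   = quad_on I R y + quad_on K B s"
  by (simp add: quad_on_linear quad_on_outer s_def)
 ultimately show "2 * dot_on I x y <= quad_on I (%a b. N a b - (\<Sum>q\<in>K. h q a * h q b)) x
  + quad_on I (%a b. R a b + (\<Sum>q\<in>K. \<Sum>q'\<in>K. B q q' * app_on I R (h q) a * app_on I R (h q') b)) y"
  using D[of s c] unfolding vv qN qR by argo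
qed

text \<open>Adding $E$ to $N$ allows the dual matrix $Q$ to shrink to $R$ with $R = Q - Q E R$, formally $(Q^{-1} +
E)^{-1}$. The gain is at least $R E R$, because $Q - R - R E R = R E Q E R$ is positive semidefinite; the last
claim records this gain in the Hilbert-Schmidt norm. The matrix $1 + Q E$ is invertible since $E$ is definite,
even when $Q$ is not.\<close>

lemma fenchel_on_barrier:
 assumes I: "finite I" and Q: "sym_on I Q" "psd_on I Q" and E: "sym_on I E" "psd_on I E"
  and pd: "!!x. quad_on I E x = 0 ==> \<forall>a\<in>I. x a = 0" and dual: "fenchel_on I N Q"
 obtains R where "sym_on I R" "psd_on I R" "fenchel_on I (%a b. N a b + E a b) R"
  "!!v. quad_on I R v + quad_on I (mul_on I R (mul_on I E R)) v <= quad_on I Q v"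
  "(\<Sum>a\<in>I. \<Sum>b\<in>I. (R a b)^2) + 2 * (\<Sum>a\<in>I. \<Sum>b\<in>I. R a b * mul_on I R (mul_on I E R) a b)
   <= (\<Sum>a\<in>I. \<Sum>b\<in>I. (Q a b)^2)"
proof -
 define X where "X = (%a b. of_bool (a = b) + mul_on I Q E a b)"
 have appI: "app_on I (%a b. of_bool (a = b)) x a = x a" if "a \<in> I" for x :: "'a => real" and a
 proof -
  have "app_on I (%a b. of_bool (a = b)) x a = (\<Sum>b\<in>I. if b = a then x a else 0)"
   unfolding app_on_def by (intro sum.cong) auto
  then show ?thesis using I that by simp
 qed
 have ker: "\<forall>a\<in>I. x a = 0" if "!!a. a \<in> I ==> app_on I X x a = 0" for x
 proof (rule pd)
  define z where "z = app_on I E x"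
  have "x a = - app_on I Q z a" if "a \<in> I" for a
   using \<open>!!a. a \<in> I ==> app_on I X x a = 0\<close>[OF that] appI[OF that, of x]
   by (simp add: X_def app_on_linear app_on_mul z_def)
  then have "dot_on I x z = dot_on I (%a. (-1) * app_on I Q z a) z"
   by (intro dot_on_cong) auto
  also have "... = - quad_on I Q z"
   unfolding dot_on_linear by (simp add: quad_on_def dot_on_commute)
  also have "... <= 0" using Q(2) by (simp add: psd_on_def)
  finally have "quad_on I E x <= 0" by (simp add: quad_on_def z_def)
  then show "quad_on I E x = 0" using E(2) unfolding psd_on_def by (metis antisym)
 qed
 define R where "R = mul_on I (inv_on I X) Q"
 have XR: "mul_on I X R a b = Q a b" if "a \<in> I" for a b
 proof -
  have "mul_on I X R a b = mul_on I (mul_on I X (inv_on I X)) Q a b"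
   by (simp add: R_def mul_on_assoc)
  also have "... = (\<Sum>c\<in>I. if c = a then Q a b else 0)"
   unfolding mul_on_def[of I "mul_on I X (inv_on I X)"]
   by (intro sum.cong refl) (auto simp: mul_on_inv_on(1)[OF I ker that])
  also have "... = Q a b" using I that by simp
  finally show ?thesis .
 qed
 have mulI: "mul_on I (%a b. of_bool (a = b)) R a b = R a b" if "a \<in> I" for a b
 proof -
  have "mul_on I (%a b. of_bool (a = b)) R a b = (\<Sum>c\<in>I. if c = a then R a b else 0)"
   unfolding mul_on_def by (intro sum.cong) auto
  then show ?thesis using I that by simp
 qed
 have QR: "Q a b = R a b + mul_on I Q (mul_on I E R) a b" if "a \<in> I" for a b
  using XR[OF that, of b] mulI[OF that, of b] by (simp add: X_def mul_on_linear mul_on_assoc)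
 have Qapp: "app_on I Q y a = app_on I R y a + app_on I Q (app_on I E (app_on I R y)) a" if "a \<in> I" for y a
  unfolding app_on_mul[symmetric] using QR[OF that] by (simp add: app_on_def sum.distrib distrib_right)
 have Rsym: "sym_on I R"
 proof (rule sym_on_of_dot[OF I])
  fix x y
  define u where "u = app_on I R x"
  define v where "v = app_on I R y"
  have u: "u a = app_on I Q (%a. x a - app_on I E u a) a" if "a \<in> I" for a
   using Qapp[OF that, of x] by (simp add: app_on_linear u_def)
  have v: "v a = app_on I Q (%a. y a - app_on I E v a) a" if "a \<in> I" for a
   using Qapp[OF that, of y] by (simp add: app_on_linear v_def)
  have "dot_on I x v = dot_on I (%a. x a - app_on I E u a) v + dot_on I (app_on I E u) v"
   by (simp add: dot_on_linear)
  also have "dot_on I (%a. x a - app_on I E u a) v =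
    dot_on I (%a. x a - app_on I E u a) (app_on I Q (%a. y a - app_on I E v a))"
   by (rule dot_on_cong) (simp_all only: v[symmetric])
  also have "... = dot_on I (app_on I Q (%a. x a - app_on I E u a)) (%a. y a - app_on I E v a)"
   by (rule dot_on_app_sym[OF Q(1)])
  also have "... = dot_on I u (%a. y a - app_on I E v a)"
   by (rule dot_on_cong) (simp_all only: u[symmetric])
  also have "dot_on I (app_on I E u) v = dot_on I u (app_on I E v)"
   by (rule dot_on_app_sym[OF E(1), symmetric])
  finally show "dot_on I x v = dot_on I (app_on I R x) y"
   by (simp add: dot_on_linear u_def)
 qed
 define P where "P = mul_on I R (mul_on I E R)"
 have quadP: "quad_on I P v = quad_on I E (app_on I R v)" for v
  unfolding P_def by (rule quad_on_sandwich[OF Rsym])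
 have quadQ: "quad_on I Q v = quad_on I R v + quad_on I P v + quad_on I Q (app_on I E (app_on I R v))" for v
 proof -
  define u where "u = app_on I R v"
  have "quad_on I Q v = dot_on I v (%a. u a + app_on I Q (app_on I E u) a)"
   unfolding quad_on_def u_def by (rule dot_on_cong, rule refl, erule Qapp)
  also have "... = quad_on I R v + dot_on I (app_on I Q v) (app_on I E u)"
   by (simp add: dot_on_linear quad_on_def u_def dot_on_app_sym[OF Q(1)])
  also have "dot_on I (app_on I Q v) (app_on I E u) = dot_on I (%a. u a + app_on I Q (app_on I E u) a) (app_on I E u)"
   unfolding u_def by (rule dot_on_cong, erule Qapp, rule refl)
  also have "... = quad_on I E u + quad_on I Q (app_on I E u)"
   by (simp add: dot_on_linear quad_on_def dot_on_commute)
  finally show ?thesis by (simp add: quadP u_def)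
 qed
 have quadR: "quad_on I R y = quad_on I Q (%a. y a - app_on I E (app_on I R y) a) + quad_on I E (app_on I R y)" for y
 proof -
  define u where "u = app_on I R y"
  have u: "u a = app_on I Q (%a. y a - app_on I E u a) a" if "a \<in> I" for a
   using Qapp[OF that, of y] by (simp add: app_on_linear u_def)
  have "quad_on I Q (%a. y a - app_on I E u a) = dot_on I (%a. y a - app_on I E u a) u"
   unfolding quad_on_def by (rule dot_on_cong) (simp_all only: u[symmetric])
  then show ?thesis by (simp add: dot_on_linear quad_on_def u_def dot_on_commute)
 qed
 have Rpsd: "psd_on I R"
  unfolding psd_on_def
 proof
  fix y show "0 <= quad_on I R y" using quadR[of y] Q(2) E(2) by (simp add: psd_on_def)
 qed
 have "fenchel_on I (%a b. N a b + E a b) R"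
  unfolding fenchel_on_def
 proof (intro allI)
  fix x y
  define u where "u = app_on I R y"
  define f where "f = app_on I E u"
  have "2 * dot_on I x (%a. y a - f a) <= quad_on I N x + quad_on I Q (%a. y a - f a)"
   using dual by (simp add: fenchel_on_def)
  moreover have "0 <= quad_on I E (%a. x a - u a)" using E(2) by (simp add: psd_on_def)
  then have "2 * dot_on I x f <= quad_on I E x + quad_on I E u"
   unfolding quad_on_def app_on_linear dot_on_linear f_def
   using dot_on_app_sym[OF E(1), of x u] dot_on_commute[of I u "app_on I E x"] by linarith
  ultimately show "2 * dot_on I x y <= quad_on I (%a b. N a b + E a b) x + quad_on I R y"
   using quadR[of y] by (simp add: quad_on_linear dot_on_linear f_def u_def)
 qed
 moreover have "quad_on I R v + quad_on I P v <= quad_on I Q v" for v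
  using quadQ[of v] Q(2) by (simp add: psd_on_def)
 moreover have "(\<Sum>a\<in>I. \<Sum>b\<in>I. (R a b)^2) + 2 * (\<Sum>a\<in>I. \<Sum>b\<in>I. R a b * P a b) <= (\<Sum>a\<in>I. \<Sum>b\<in>I. (Q a b)^2)"
 proof -
  have Psym: "sym_on I P" unfolding P_def by (rule sym_on_sandwich[OF Rsym E(1)])
  define W where "W = (%a b. Q a b - R a b - P a b)"
  have Wsym: "sym_on I W"
   unfolding sym_on_def W_def
  proof (intro ballI)
   fix a b assume ab: "a \<in> I" "b \<in> I"
   show "Q a b - R a b - P a b = Q b a - R b a - P b a"
    unfolding sym_onD[OF Psym ab] sym_onD[OF Rsym ab] sym_onD[OF Q(1) ab] ..
  qed
  have "psd_on I W"
   unfolding psd_on_def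
  proof
   fix v
   have "quad_on I W v = quad_on I Q (app_on I E (app_on I R v))"
    unfolding W_def quad_on_linear using quadQ[of v] by linarith
   then show "0 <= quad_on I W v" using Q(2) by (simp add: psd_on_def)
  qed
  then have "0 <= tr_on I (mul_on I R W)" by (rule tr_on_psd_mul_nonneg[OF I Rpsd Wsym])
  also have "tr_on I (mul_on I R W) = (\<Sum>a\<in>I. \<Sum>b\<in>I. R a b * W a b)"
   unfolding tr_on_def mul_on_def
   by (intro sum.cong refl) (subst sym_onD[OF Wsym], simp_all)
  finally have RW: "0 <= (\<Sum>a\<in>I. \<Sum>b\<in>I. R a b * W a b)" .
  have "(\<Sum>a\<in>I. \<Sum>b\<in>I. (Q a b)^2) = (\<Sum>a\<in>I. \<Sum>b\<in>I. (R a b)^2 + (2 * (R a b * P a b) + (2 * (R a b * W a b) + (P a b + W a b)^2)))"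
   by (intro sum.cong refl) (simp add: W_def power2_eq_square algebra_simps)
  also have "... = (\<Sum>a\<in>I. \<Sum>b\<in>I. (R a b)^2) + (2 * (\<Sum>a\<in>I. \<Sum>b\<in>I. R a b * P a b)
    + (2 * (\<Sum>a\<in>I. \<Sum>b\<in>I. R a b * W a b) + (\<Sum>a\<in>I. \<Sum>b\<in>I. (P a b + W a b)^2)))"
   by (simp only: sum.distrib sum_distrib_left)
  finally show ?thesis
   using RW sum_nonneg[of I "%a. \<Sum>b\<in>I. (P a b + W a b)^2"] by (simp add: sum_nonneg)
 qed
 ultimately show ?thesis using that[of R] Rsym Rpsd unfolding P_def by blast
qed

section \<open>One row of noise\<close>

context kron_coeffs
begin

definition sandwich_norm :: real where
 "sandwich_norm = normA * ((real k2)^2 + 1)"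

text \<open>The increment $R h^T B h R$ of the dual matrix caused by one group of rows.\<close>

definition bump :: "nat => (nat \<times> nat => real) => kernel => cmat
  => kernel" where
 "bump n g R B a b = (\<Sum>q<k1. \<Sum>q'<k1. B q q' * app_on (idx n) R (row n g q) a * app_on (idx n) R (row n g q') b)"

text \<open>The size of the increment \<open>bump\<close> up to a factor depending on $B$.\<close>

definition sigma :: "nat => (nat \<times> nat => real) => kernel => real" where
 "sigma n g R = (\<Sum>q<k1. \<Sum>a\<in>idx n. (app_on (idx n) R (row n g q) a)^2)"

lemma quad_tens: "quad_on (idx n) (tens e) x = (\<Sum>j<n. quad_on K2 e (%p. x (p, j)))"
proof -
 have "quad_on (idx n) (tens e) x = (\<Sum>p<k2. \<Sum>j<n. \<Sum>p'<k2. \<Sum>j'<n. if j' = j then e p p' * x (p, j) * x (p', j) else 0)"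
  unfolding quad_on_alt sum_idx tens_def by (intro sum.cong refl) auto
 also have "... = (\<Sum>p<k2. \<Sum>j<n. \<Sum>p'<k2. e p p' * x (p, j) * x (p', j))"
  by (intro sum.cong refl) simp
 also have "... = (\<Sum>j<n. \<Sum>p<k2. \<Sum>p'<k2. e p p' * x (p, j) * x (p', j))"
  by (rule sum.swap)
 finally show ?thesis by (simp add: quad_on_alt)
qed

lemma quad_ptrace:
 "quad_on K2 (ptrace n R) v = (\<Sum>j<n. quad_on (idx n) R (%a. of_bool (snd a = j) * v (fst a))) / real n"
proof -
 have "quad_on (idx n) R (%a. of_bool (snd a = j) * v (fst a)) = (\<Sum>p<k2. \<Sum>p'<k2. R (p, j) (p', j) * v p * v p')"
  if "j < n" for j
 proof -
  have "quad_on (idx n) R (%a. of_bool (snd a = j) * v (fst a)) =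
   (\<Sum>p<k2. \<Sum>i<n. if i = j then (\<Sum>p'<k2. \<Sum>i'<n. if i' = j then R (p, j) (p', j) * v p * v p' else 0) else 0)"
   unfolding quad_on_alt sum_idx
   by (intro sum.cong refl) (auto intro!: sum.cong sum.neutral simp del: sum.delta sum.delta')
  then show ?thesis using that by simp
 qed
 then have "(\<Sum>j<n. quad_on (idx n) R (%a. of_bool (snd a = j) * v (fst a))) =
  (\<Sum>j<n. \<Sum>p<k2. \<Sum>p'<k2. R (p, j) (p', j) * v p * v p')" by simp
 also have "... = (\<Sum>p<k2. \<Sum>j<n. \<Sum>p'<k2. R (p, j) (p', j) * v p * v p')" by (rule sum.swap)
 also have "... = (\<Sum>p<k2. \<Sum>p'<k2. \<Sum>j<n. R (p, j) (p', j) * v p * v p')"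
  by (intro sum.cong refl sum.swap)
 finally show ?thesis
  by (simp add: quad_on_alt ptrace_def sum_divide_distrib sum_distrib_right)
qed

lemma quad_etaX: "quad_on K2 (etaX B) v = (\<Sum>t<l. quad_on K1 B (%q. \<Sum>p<k2. A t q p * v p))"
proof -
 have "quad_on K1 B (%q. \<Sum>p<k2. A t q p * v p) =
  (\<Sum>p<k2. \<Sum>p'<k2. \<Sum>q<k1. \<Sum>q'<k1. A t q p * A t q' p' * B q q' * v p * v p')" for t
 proof -
  have "quad_on K1 B (%q. \<Sum>p<k2. A t q p * v p) =
   (\<Sum>q<k1. \<Sum>q'<k1. \<Sum>p<k2. \<Sum>p'<k2. A t q p * A t q' p' * B q q' * v p * v p')"
   unfolding quad_on_alt mult.assoc sum_product by (simp add: sum_distrib_left ac_simps)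
  also have "... = (\<Sum>q<k1. \<Sum>p<k2. \<Sum>q'<k1. \<Sum>p'<k2. A t q p * A t q' p' * B q q' * v p * v p')"
   by (intro sum.cong refl sum.swap)
  also have "... = (\<Sum>p<k2. \<Sum>q<k1. \<Sum>q'<k1. \<Sum>p'<k2. A t q p * A t q' p' * B q q' * v p * v p')"
   by (rule sum.swap)
  also have "... = (\<Sum>p<k2. \<Sum>q<k1. \<Sum>p'<k2. \<Sum>q'<k1. A t q p * A t q' p' * B q q' * v p * v p')"
   by (intro sum.cong refl sum.swap)
  also have "... = (\<Sum>p<k2. \<Sum>p'<k2. \<Sum>q<k1. \<Sum>q'<k1. A t q p * A t q' p' * B q q' * v p * v p')"
   by (intro sum.cong refl sum.swap)
  finally show ?thesis .
 qed
 then have "(\<Sum>t<l. quad_on K1 B (%q. \<Sum>p<k2. A t q p * v p)) =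
  (\<Sum>t<l. \<Sum>p<k2. \<Sum>p'<k2. \<Sum>q<k1. \<Sum>q'<k1. A t q p * A t q' p' * B q q' * v p * v p')" by simp
 also have "... = (\<Sum>p<k2. \<Sum>t<l. \<Sum>p'<k2. \<Sum>q<k1. \<Sum>q'<k1. A t q p * A t q' p' * B q q' * v p * v p')"
  by (rule sum.swap)
 also have "... = (\<Sum>p<k2. \<Sum>p'<k2. \<Sum>t<l. \<Sum>q<k1. \<Sum>q'<k1. A t q p * A t q' p' * B q q' * v p * v p')"
  by (intro sum.cong refl sum.swap)
 also have "... = (\<Sum>p<k2. \<Sum>p'<k2. \<Sum>q<k1. \<Sum>t<l. \<Sum>q'<k1. A t q p * A t q' p' * B q q' * v p * v p')"
  by (intro sum.cong refl sum.swap)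
 also have "... = (\<Sum>p<k2. \<Sum>p'<k2. \<Sum>q<k1. \<Sum>q'<k1. \<Sum>t<l. A t q p * A t q' p' * B q q' * v p * v p')"
  by (intro sum.cong refl sum.swap)
 finally show ?thesis
  by (simp add: quad_on_alt etaX_def cov_def sum_distrib_right)
qed

lemma psd_etaX: "psd_on K1 B ==> psd_on K2 (etaX B)"
 by (simp add: psd_on_def quad_etaX sum_nonneg)

lemma sym_etaX: "sym_on K1 B ==> sym_on K2 (etaX B)"
proof -
 assume B: "sym_on K1 B"
 have "etaX B p p' = etaX B p' p" for p p'
 proof -
  have "etaX B p p' = (\<Sum>q'<k1. \<Sum>q<k1. cov q p q' p' * B q q')"
   unfolding etaX_def by (rule sum.swap)
  also have "... = (\<Sum>q'<k1. \<Sum>q<k1. cov q' p' q p * B q' q)"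
  proof (intro sum.cong refl)
   fix q' q assume "q' \<in> K1" "q \<in> K1"
   then have "B q q' = B q' q" using sym_onD[OF B] by blast
   then show "cov q p q' p' * B q q' = cov q' p' q p * B q' q"
    by (simp add: cov_def mult.commute)
  qed
  finally show ?thesis by (simp add: etaX_def)
 qed
 then show ?thesis unfolding sym_on_def by blast
qed

lemma frob_gram_le:
 assumes M: "!!c d. M c d = (\<Sum>z\<in>Z. u z c * v z d)"
  and u: "(\<Sum>z\<in>Z. \<Sum>c\<in>idx n. (u z c)^2) <= F" and v: "(\<Sum>z\<in>Z. \<Sum>c\<in>idx n. (v z c)^2) <= F"
 shows "frob n M <= F^2"
proof -
 have "0 <= (\<Sum>z\<in>Z. \<Sum>c\<in>idx n. (u z c)^2)" by (intro sum_nonneg) auto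
 then have F: "0 <= F" using u by simp
 have "frob n M <= (\<Sum>c\<in>idx n. \<Sum>d\<in>idx n. (\<Sum>z\<in>Z. (u z c)^2) * (\<Sum>z\<in>Z. (v z d)^2))"
  unfolding frob_def M by (intro sum_mono Cauchy_Schwarz_ineq_sum)
 also have "... = (\<Sum>c\<in>idx n. \<Sum>z\<in>Z. (u z c)^2) * (\<Sum>d\<in>idx n. \<Sum>z\<in>Z. (v z d)^2)"
  by (simp only: sum_product)
 also have "... = (\<Sum>z\<in>Z. \<Sum>c\<in>idx n. (u z c)^2) * (\<Sum>z\<in>Z. \<Sum>c\<in>idx n. (v z c)^2)"
  by (subst (1 2) sum.swap) simp
 also have "... <= F * F" using F u v by (intro mult_mono sum_nonneg) auto
 finally show ?thesis by (simp add: power2_eq_square)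
qed

lemma ptrace_gram_le:
 assumes M: "!!c d. M c d = (\<Sum>z\<in>Z. u z c * v z d)"
  and u: "(\<Sum>z\<in>Z. \<Sum>c\<in>idx n. (u z c)^2) <= F" and v: "(\<Sum>z\<in>Z. \<Sum>c\<in>idx n. (v z c)^2) <= F"
  and p: "p < k2" "p' < k2"
 shows "\<bar>ptrace n M p p'\<bar> <= F / real n"
proof -
 have *: "(\<Sum>j<n. \<Sum>z\<in>Z. (w z (r, j))^2) <= F" if "(\<Sum>z\<in>Z. \<Sum>c\<in>idx n. (w z c)^2) <= F" "r < k2" for w r
 proof -
  have "(\<Sum>j<n. \<Sum>z\<in>Z. (w z (r, j))^2) = (\<Sum>z\<in>Z. \<Sum>j<n. (w z (r, j))^2)" by (rule sum.swap)
  also have "... <= (\<Sum>z\<in>Z. \<Sum>c\<in>idx n. (w z c)^2)"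
   unfolding sum_idx using that(2)
   by (intro sum_mono member_le_sum[of r "K2" "%p. \<Sum>j<n. (w _ (p, j))^2"]) (auto intro: sum_nonneg)
  finally show ?thesis using that(1) by simp
 qed
 have "\<bar>\<Sum>j<n. M (p, j) (p', j)\<bar> <= (\<Sum>j<n. \<Sum>z\<in>Z. \<bar>u z (p, j) * v z (p', j)\<bar>)"
  unfolding M by (rule order.trans[OF sum_abs sum_mono[OF sum_abs]])
 also have "... <= (\<Sum>j<n. \<Sum>z\<in>Z. ((u z (p, j))^2 + (v z (p', j))^2) / 2)"
 proof (intro sum_mono)
  fix j z
  show "\<bar>u z (p, j) * v z (p', j)\<bar> <= ((u z (p, j))^2 + (v z (p', j))^2) / 2"
   using sum_squares_bound[of "\<bar>u z (p, j)\<bar>" "\<bar>v z (p', j)\<bar>"] by (simp add: abs_mult)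
 qed
 also have "... = ((\<Sum>j<n. \<Sum>z\<in>Z. (u z (p, j))^2) + (\<Sum>j<n. \<Sum>z\<in>Z. (v z (p', j))^2)) / 2"
  by (simp add: sum.distrib sum_divide_distrib[symmetric] add_divide_distrib)
 also have "... <= F" using *[OF u p(1)] *[OF v p(2)] by simp
 finally show ?thesis by (simp add: ptrace_def divide_right_mono)
qed

lemma abs_etaY_le:
 assumes "q < k1" "q' < k1" "!!p p'. p < k2 ==> p' < k2 ==> \<bar>X p p'\<bar> <= c"
 shows "\<bar>etaY X q q'\<bar> <= normA * ((real k2)^2 * c)"
proof -
 have "\<bar>etaY X q q'\<bar> <= (\<Sum>p<k2. \<Sum>p'<k2. \<bar>cov q p q' p' * X p p'\<bar>)"
  unfolding etaY_def by (rule order.trans[OF sum_abs sum_mono[OF sum_abs]])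
 also have "... <= (\<Sum>p<k2. \<Sum>p'<k2. normA * c)"
  unfolding abs_mult using assms by (intro sum_mono mult_mono abs_cov_le normA_nonneg) auto
 finally show ?thesis by (simp add: power2_eq_square ac_simps)
qed

text \<open>Matrices of the form $u^T v$ with square-summable factors have trace norm at most $F$; both the mean and the
fluctuation of the row form are then of order $F/n$.\<close>

lemma rform_gram_second_moment:
 assumes n: "0 < n" and q: "q < k1" "q' < k1" and M: "!!c d. M c d = (\<Sum>z\<in>Z. u z c * v z d)"
  and u: "(\<Sum>z\<in>Z. \<Sum>c\<in>idx n. (u z c)^2) <= F" and v: "(\<Sum>z\<in>Z. \<Sum>c\<in>idx n. (v z c)^2) <= F"
 shows "(mean n (%g. (rform n g q q' M) ^ 2)) <= 42 * (sandwich_norm * F / real n)^2"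
proof (rule rform_second_moment[OF q])
 have "0 <= (\<Sum>z\<in>Z. \<Sum>c\<in>idx n. (u z c)^2)" by (intro sum_nonneg) auto
 then have F: "0 <= F" using u by simp
 have "\<bar>etaY (ptrace n M) q q'\<bar> <= normA * ((real k2)^2 * (F / real n))"
  by (intro abs_etaY_le q ptrace_gram_le[OF M u v])
 also have "... <= sandwich_norm * F / real n"
  using F normA_nonneg unfolding sandwich_norm_def
  by (simp add: field_simps divide_right_mono)
 finally show "\<bar>etaY (ptrace n M) q q'\<bar> <= sandwich_norm * F / real n" .
 have "(normA / real n)^2 * frob n M <= (normA / real n)^2 * F^2"
  by (intro mult_left_mono frob_gram_le[OF M u v]) auto
 also have "... = (normA * F / real n)^2" by (simp add: power_mult_distrib power_divide)
 also have "... <= (sandwich_norm * F / real n)^2"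
  using F normA_nonneg
  by (intro power_mono divide_right_mono mult_right_mono) (auto simp: sandwich_norm_def algebra_simps)
 finally show "(normA / real n)^2 * frob n M <= (sandwich_norm * F / real n)^2" .
qed

lemma app_row_product:
 "app_on (idx n) R (row n g q) a * app_on (idx n) R (row n g q') b = rform n g q q' (%c d. R a c * R b d)"
 unfolding app_on_def sum_product rform_def by (intro sum.cong refl) (simp add: ac_simps)

lemma sum_app_row_square:
 "(\<Sum>a\<in>idx n. (app_on (idx n) R (row n g q) a)^2) = rform n g q q (%c d. \<Sum>z\<in>idx n. R z c * R z d)"
proof -
 have "(\<Sum>a\<in>idx n. (app_on (idx n) R (row n g q) a)^2) =
   (\<Sum>z\<in>idx n. \<Sum>a\<in>idx n. \<Sum>b\<in>idx n. R z a * R z b * row n g q a * row n g q b)"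
  unfolding power2_eq_square app_row_product rform_def ..
 also have "... = (\<Sum>a\<in>idx n. \<Sum>z\<in>idx n. \<Sum>b\<in>idx n. R z a * R z b * row n g q a * row n g q b)"
  by (rule sum.swap)
 also have "... = (\<Sum>a\<in>idx n. \<Sum>b\<in>idx n. \<Sum>z\<in>idx n. R z a * R z b * row n g q a * row n g q b)"
  by (intro sum.cong refl sum.swap)
 finally show ?thesis unfolding rform_def by (simp only: sum_distrib_right)
qed

lemma all_moments_app_row:
 "q < k1 ==> all_moments (row_law n) (%g. app_on (idx n) R (row n g q) a)"
 unfolding app_on_def by (intro all_moments_intros all_moments_row) auto

lemma all_moments_sigma: "all_moments (row_law n) (%g. sigma n g R)"
 unfolding sigma_def by (intro all_moments_intros all_moments_app_row) auto

lemma all_moments_bump: "all_moments (row_law n) (%g. bump n g R B a b)"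
 unfolding bump_def by (intro all_moments_intros all_moments_app_row) auto

lemma sigma_second_moment:
 assumes "0 < n"
 shows "(mean n (%g. (sigma n g R)^2)) <= 42 * (real k1)^2 * (sandwich_norm * frob n R / real n)^2"
proof -
 define \<rho> where "\<rho> = (%g q. rform n g q q (%c d. \<Sum>z\<in>idx n. R z c * R z d))"
 have \<rho>: "(mean n (%g. (\<rho> g q)^2)) <= 42 * (sandwich_norm * frob n R / real n)^2" if "q < k1" for q
  unfolding \<rho>_def using assms that
  by (intro rform_gram_second_moment[where Z = "idx n" and u = R and v = R]) (auto simp: frob_def)
 have i: "integrable (row_law n) (%g. (\<rho> g q)^2)" for q
  unfolding \<rho>_def by (intro all_moments_integrable all_moments_intros all_moments_rform)
 have "(mean n (%g. (sigma n g R)^2)) <= (mean n (%g. real k1 * (\<Sum>q<k1. (\<rho> g q)^2)))"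
 proof (rule integral_mono)
  show "integrable (row_law n) (%g. (sigma n g R)^2)"
   by (intro all_moments_integrable all_moments_intros all_moments_sigma)
  show "integrable (row_law n) (%g. real k1 * (\<Sum>q<k1. (\<rho> g q)^2))"
   using i by (intro integrable_mult_right Bochner_Integration.integrable_sum)
  fix g
  show "(sigma n g R)^2 <= real k1 * (\<Sum>q<k1. (\<rho> g q)^2)"
   using Cauchy_Schwarz_ineq_sum[of "%_. 1" "\<rho> g" "K1"]
   by (simp add: sigma_def sum_app_row_square \<rho>_def)
 qed
 also have "... = real k1 * (\<Sum>q<k1. (mean n (%g. (\<rho> g q)^2)))"
  using i by simp
 also have "... <= real k1 * (\<Sum>q<k1. 42 * (sandwich_norm * frob n R / real n)^2)"
  using \<rho> by (intro mult_left_mono sum_mono) auto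
 finally show ?thesis by (simp add: power2_eq_square ac_simps)
qed

lemma frob_bump_le: "frob n (bump n g R B) <= (\<Sum>q<k1. \<Sum>q'<k1. (B q q')^2) * (sigma n g R)^2"
proof -
 define w where "w = (%q. app_on (idx n) R (row n g q))"
 have "frob n (bump n g R B) <= (\<Sum>a\<in>idx n. \<Sum>b\<in>idx n. (\<Sum>q<k1. \<Sum>q'<k1. (B q q')^2) * ((\<Sum>q<k1. (w q a)^2) * (\<Sum>q<k1. (w q b)^2)))"
  unfolding frob_def
 proof (intro sum_mono)
  fix a b
  have "bump n g R B a b = (\<Sum>z\<in>K1 \<times> K1. B (fst z) (snd z) * (w (fst z) a * w (snd z) b))"
   unfolding bump_def w_def by (simp add: sum.cartesian_product case_prod_beta mult.assoc)
  also have "...^2 <= (\<Sum>z\<in>K1 \<times> K1. (B (fst z) (snd z))^2) * (\<Sum>z\<in>K1 \<times> K1. (w (fst z) a * w (snd z) b)^2)"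
   by (rule Cauchy_Schwarz_ineq_sum)
  also have "... = (\<Sum>q<k1. \<Sum>q'<k1. (B q q')^2) * ((\<Sum>q<k1. (w q a)^2) * (\<Sum>q<k1. (w q b)^2))"
   by (simp add: sum_product sum.cartesian_product case_prod_beta power_mult_distrib)
  finally show "(bump n g R B a b)^2 <= (\<Sum>q<k1. \<Sum>q'<k1. (B q q')^2) * ((\<Sum>q<k1. (w q a)^2) * (\<Sum>q<k1. (w q b)^2))" .
 qed
 also have "... = (\<Sum>q<k1. \<Sum>q'<k1. (B q q')^2) * ((\<Sum>a\<in>idx n. \<Sum>q<k1. (w q a)^2) * (\<Sum>a\<in>idx n. \<Sum>q<k1. (w q a)^2))"
 proof -
  have "(\<Sum>a\<in>idx n. \<Sum>b\<in>idx n. c * (x a * x b)) = c * ((\<Sum>a\<in>idx n. x a) * (\<Sum>a\<in>idx n. x a))"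
   for c and x :: "nat \<times> nat => real"
   unfolding sum_product by (simp only: sum_distrib_left)
  then show ?thesis .
 qed
 also have "(\<Sum>a\<in>idx n. \<Sum>q<k1. (w q a)^2) = sigma n g R"
  unfolding sigma_def w_def by (rule sum.swap)
 finally show ?thesis by (simp add: power2_eq_square)
qed

lemma abs_ptrace_bump_le:
 assumes "p < k2" "p' < k2"
 shows "\<bar>ptrace n (bump n g R B) p p'\<bar> <= (\<Sum>q<k1. \<Sum>q'<k1. \<bar>B q q'\<bar>) * sigma n g R / real n"
proof -
 define w where "w = (%q. app_on (idx n) R (row n g q))"
 have wq: "(\<Sum>j<n. (w q (p, j))^2) <= sigma n g R" if "q < k1" "p < k2" for q p
 proof -
  have "(\<Sum>j<n. (w q (p, j))^2) <= (\<Sum>a\<in>idx n. (w q a)^2)"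
   unfolding sum_idx using that
   by (intro member_le_sum[of p "K2" "%p. \<Sum>j<n. (w q (p, j))^2"]) (auto intro: sum_nonneg)
  also have "... <= (\<Sum>q<k1. \<Sum>a\<in>idx n. (w q a)^2)"
   using that
   by (intro member_le_sum[of q "K1" "%q. \<Sum>a\<in>idx n. (w q a)^2"]) (auto intro: sum_nonneg)
  finally show ?thesis by (simp add: sigma_def w_def)
 qed
 have "\<bar>\<Sum>j<n. bump n g R B (p, j) (p', j)\<bar> <=
   (\<Sum>j<n. \<Sum>q<k1. \<Sum>q'<k1. \<bar>B q q' * w q (p, j) * w q' (p', j)\<bar>)"
  unfolding bump_def w_def
  by (intro order.trans[OF sum_abs] sum_mono order.trans[OF sum_abs] order.refl)
 also have "... = (\<Sum>q<k1. \<Sum>j<n. \<Sum>q'<k1. \<bar>B q q' * w q (p, j) * w q' (p', j)\<bar>)" by (rule sum.swap)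
 also have "... = (\<Sum>q<k1. \<Sum>q'<k1. \<Sum>j<n. \<bar>B q q' * w q (p, j) * w q' (p', j)\<bar>)"
  by (intro sum.cong refl sum.swap)
 also have "... <= (\<Sum>q<k1. \<Sum>q'<k1. \<bar>B q q'\<bar> * sigma n g R)"
 proof (intro sum_mono)
  fix q q' assume q: "q \<in> K1" "q' \<in> K1"
  have "(\<Sum>j<n. \<bar>B q q' * w q (p, j) * w q' (p', j)\<bar>) <= (\<Sum>j<n. \<bar>B q q'\<bar> * (((w q (p, j))^2 + (w q' (p', j))^2) / 2))"
   unfolding abs_mult mult.assoc
  proof (intro sum_mono mult_left_mono)
   fix j show "\<bar>w q (p, j)\<bar> * \<bar>w q' (p', j)\<bar> <= ((w q (p, j))^2 + (w q' (p', j))^2) / 2"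
    using sum_squares_bound[of "\<bar>w q (p, j)\<bar>" "\<bar>w q' (p', j)\<bar>"] by simp
  qed simp
  also have "... = \<bar>B q q'\<bar> * (((\<Sum>j<n. (w q (p, j))^2) + (\<Sum>j<n. (w q' (p', j))^2)) / 2)"
   by (simp add: sum_distrib_left[symmetric] sum.distrib sum_divide_distrib[symmetric])
  also have "... <= \<bar>B q q'\<bar> * sigma n g R"
   using wq[of q p] wq[of q' p'] q assms by (intro mult_left_mono) auto
  finally show "(\<Sum>j<n. \<bar>B q q' * w q (p, j) * w q' (p', j)\<bar>) <= \<bar>B q q'\<bar> * sigma n g R" .
 qed
 also have "... = (\<Sum>q<k1. \<Sum>q'<k1. \<bar>B q q'\<bar>) * sigma n g R"
  by (simp only: sum_distrib_right)
 finally show ?thesis by (simp add: ptrace_def divide_right_mono)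
qed

text \<open>The mean increment is $R\,(\sum A_i^T B A_i \otimes I)\,R / n$. A barrier shift by $E = (\sum A_i^T B A_i
\otimes I)/n$ wins $R E R$, so it cancels the increment in the mean; this balance is the reason for the second
inequality in the definition of feasibility.\<close>

lemma bump_expectation:
 assumes R: "sym_on (idx n) R" and ab: "a \<in> idx n" "b \<in> idx n"
 shows "(mean n (%g. bump n g R B a b)) =
  mul_on (idx n) R (mul_on (idx n) (%a b. tens (etaX B) a b / real n) R) a b"
proof -
 have "(mean n (%g. bump n g R B a b)) =
  (\<Sum>q<k1. \<Sum>q'<k1. B q q' * etaY (ptrace n (%c d. R a c * R b d)) q q')"
  unfolding bump_def mult.assoc app_row_product
  using all_moments_integrable[OF all_moments_rform]
  by (simp add: rform_expectation)
 also have "... = (\<Sum>q<k1. \<Sum>q'<k1. \<Sum>p<k2. \<Sum>p'<k2. \<Sum>j<n. R a (p, j) * (cov q p q' p' * B q q') * R b (p', j) / real n)"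
  unfolding etaY_def ptrace_def
  by (simp add: sum_distrib_left sum_distrib_right sum_divide_distrib ac_simps)
 also have "... = (\<Sum>q<k1. \<Sum>p<k2. \<Sum>q'<k1. \<Sum>p'<k2. \<Sum>j<n. R a (p, j) * (cov q p q' p' * B q q') * R b (p', j) / real n)"
  by (intro sum.cong refl sum.swap)
 also have "... = (\<Sum>p<k2. \<Sum>q<k1. \<Sum>q'<k1. \<Sum>p'<k2. \<Sum>j<n. R a (p, j) * (cov q p q' p' * B q q') * R b (p', j) / real n)"
  by (rule sum.swap)
 also have "... = (\<Sum>p<k2. \<Sum>q<k1. \<Sum>p'<k2. \<Sum>q'<k1. \<Sum>j<n. R a (p, j) * (cov q p q' p' * B q q') * R b (p', j) / real n)"
  by (intro sum.cong refl sum.swap)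
 also have "... = (\<Sum>p<k2. \<Sum>p'<k2. \<Sum>q<k1. \<Sum>q'<k1. \<Sum>j<n. R a (p, j) * (cov q p q' p' * B q q') * R b (p', j) / real n)"
  by (intro sum.cong refl sum.swap)
 also have "... = (\<Sum>p<k2. \<Sum>p'<k2. \<Sum>q<k1. \<Sum>j<n. \<Sum>q'<k1. R a (p, j) * (cov q p q' p' * B q q') * R b (p', j) / real n)"
  by (intro sum.cong refl sum.swap)
 also have "... = (\<Sum>p<k2. \<Sum>p'<k2. \<Sum>j<n. \<Sum>q<k1. \<Sum>q'<k1. R a (p, j) * (cov q p q' p' * B q q') * R b (p', j) / real n)"
  by (intro sum.cong refl sum.swap)
 also have "... = (\<Sum>p<k2. \<Sum>p'<k2. \<Sum>j<n. R a (p, j) * (etaX B p p' / real n * R b (p', j)))"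
  unfolding etaX_def by (simp add: sum_distrib_left sum_distrib_right sum_divide_distrib ac_simps)
 also have "... = (\<Sum>p<k2. \<Sum>j<n. \<Sum>p'<k2. R a (p, j) * (etaX B p p' / real n * R b (p', j)))"
  by (intro sum.cong refl sum.swap)
 also have "... = (\<Sum>p<k2. \<Sum>j<n. R a (p, j) * (\<Sum>p'<k2. \<Sum>j'<n. tens (etaX B) (p, j) (p', j') / real n * R (p', j') b))"
 proof (intro sum.cong refl)
  fix p j assume pj: "p \<in> K2" "j \<in> {..<n}"
  have "(\<Sum>j'<n. tens (etaX B) (p, j) (p', j') / real n * R (p', j') b) = etaX B p p' / real n * R b (p', j)"
   if "p' < k2" for p'
  proof -
   have "(\<Sum>j'<n. tens (etaX B) (p, j) (p', j') / real n * R (p', j') b) =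
    (\<Sum>j'<n. if j' = j then etaX B p p' / real n * R (p', j) b else 0)"
    unfolding tens_def by (intro sum.cong refl) auto
   also have "... = etaX B p p' / real n * R (p', j) b" using pj by simp
   also have "R (p', j) b = R b (p', j)"
    by (rule sym_onD[OF R]) (use that pj ab in \<open>auto simp: idx_def\<close>)
   finally show ?thesis .
  qed
  then show "(\<Sum>p'<k2. R a (p, j) * (etaX B p p' / real n * R b (p', j))) =
   R a (p, j) * (\<Sum>p'<k2. \<Sum>j'<n. tens (etaX B) (p, j) (p', j') / real n * R (p', j') b)"
   by (simp add: sum_distrib_left)
 qed
 also have "... = mul_on (idx n) R (mul_on (idx n) (%a b. tens (etaX B) a b / real n) R) a b"
  by (simp add: mul_on_def sum_idx)
 finally show ?thesis .
qed

end

context kron_coeffs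
begin

lemma etaY_transpose: "etaY X = kron_coeffs.etaX k2 l (%t p q. A t q p) X"
 by (intro ext) (simp add: etaY_def kron_coeffs.etaX_def cov_def kron_coeffs.cov_def)

lemma quad_etaY: "quad_on K1 (etaY X) c = (\<Sum>t<l. quad_on K2 X (%p. \<Sum>q<k1. A t q p * c q))"
 unfolding etaY_transpose by (rule kron_coeffs.quad_etaX)

lemma psd_etaY: "psd_on K2 X ==> psd_on K1 (etaY X)"
 unfolding etaY_transpose by (rule kron_coeffs.psd_etaX)

lemma sym_etaY: "sym_on K2 X ==> sym_on K1 (etaY X)"
 unfolding etaY_transpose by (rule kron_coeffs.sym_etaX)

lemma quad_etaY_le:
 assumes dom: "!!v. quad_on K2 T v <= quad_on K2 X v + quad_on K2 S v"
 shows "quad_on K1 (etaY T) c <= quad_on K1 (etaY X) c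
   + normA * (\<Sum>p<k2. \<Sum>p'<k2. \<bar>S p p'\<bar>) * dot_on K1 c c"
proof -
 define v where "v = (%t p. \<Sum>q<k1. A t q p * c q)"
 define s where "s = (\<Sum>p<k2. \<Sum>p'<k2. \<bar>S p p'\<bar>)"
 have s0: "0 <= s" unfolding s_def by (intro sum_nonneg) auto
 have "(\<Sum>t<l. quad_on K2 T (v t)) <= (\<Sum>t<l. quad_on K2 X (v t) + s * dot_on K2 (v t) (v t))"
 proof (rule sum_mono)
  fix t
  show "quad_on K2 T (v t) <= quad_on K2 X (v t) + s * dot_on K2 (v t) (v t)"
   using dom[of "v t"] abs_quad_on_le[of "K2" S "v t"] unfolding s_def by simp
 qed
 also have "... = quad_on K1 (etaY X) c + s * (\<Sum>t<l. dot_on K2 (v t) (v t))"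
  unfolding quad_etaY v_def[symmetric] by (simp add: sum.distrib sum_distrib_left v_def)
 also have "... <= quad_on K1 (etaY X) c + s * (normA * dot_on K1 c c)"
 proof -
  have "(\<Sum>t<l. dot_on K2 (v t) (v t)) <= (\<Sum>t<l. \<Sum>p<k2. (\<Sum>q<k1. (A t q p)^2) * (\<Sum>q<k1. (c q)^2))"
   unfolding dot_on_def v_def power2_eq_square[symmetric]
   by (intro sum_mono Cauchy_Schwarz_ineq_sum)
  also have "... = (\<Sum>t<l. \<Sum>p<k2. \<Sum>q<k1. (A t q p)^2) * dot_on K1 c c"
   by (simp add: dot_on_def power2_eq_square sum_distrib_right)
  also have "(\<Sum>t<l. \<Sum>p<k2. \<Sum>q<k1. (A t q p)^2) = normA"
   unfolding normA_def by (intro sum.cong refl sum.swap)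
  finally show ?thesis using s0 by (simp add: mult_left_mono)
 qed
 finally show ?thesis
  unfolding quad_etaY[of T] v_def s_def by (simp add: ac_simps)
qed

text \<open>One step of the process: raise the form by the barrier shift and subtract one group of rows.\<close>

definition next_form :: "nat => cmat => kernel => (nat \<times> nat => real)
  => kernel" where
 "next_form n e N g a b = N a b + tens e a b / real n - (\<Sum>q<k1. row n g q a * row n g q b)"

text \<open>The normalised trace.\<close>

definition ptr :: "nat => kernel => real" where
 "ptr n Q = (\<Sum>p<k2. ptrace n Q p p)"

lemma ptr_eq: "ptr n Q = tr_on (idx n) Q / real n"
 by (simp add: ptr_def ptrace_def tr_on_def sum_idx sum_divide_distrib)

lemma rform_dot: "rform n g q q' R = dot_on (idx n) (row n g q) (app_on (idx n) R (row n g q'))"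
 by (simp add: rform_def dot_on_def app_on_def sum_distrib_left ac_simps)

text \<open>One step preserves duality provided the row form is close to its mean and the partial trace of $R$ is at most
$X$ up to a small drift $S$: then $h R h^T$ is at most $\sum A_i X A_i^T$ up to small errors, and $B$ controls
this by the first inequality of feasibility.\<close>

lemma fenchel_next_form:
 assumes R: "sym_on (idx n) R" and dual: "fenchel_on (idx n) (%a b. N a b + tens e a b / real n) R"
  and dom: "!!v. quad_on K2 (ptrace n R) v <= quad_on K2 X v + quad_on K2 S v"
  and B: "!!x c. 2 * dot_on K1 x c <= quad_on K1 B x + dot_on K1 c c
    - quad_on K1 (etaY X) c - eps * dot_on K1 c c"
  and good: "!!q q'. q < k1 ==> q' < k1 ==> \<bar>rform n g q q' R - etaY (ptrace n R) q q'\<bar> <= \<theta>"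
  and small: "\<theta> * (real k1)^2 + normA * (\<Sum>p<k2. \<Sum>p'<k2. \<bar>S p p'\<bar>) <= eps"
 shows "fenchel_on (idx n) (next_form n e N g) (%a b. R a b + bump n g R B a b)"
proof -
 have "2 * dot_on K1 x c <= quad_on K1 B x + dot_on K1 c c
   - quad_on K1 (%q q'. dot_on (idx n) (row n g q) (app_on (idx n) R (row n g q'))) c" for x c
 proof -
  define F where "F = (%q q'. rform n g q q' R - etaY (ptrace n R) q q')"
  define d where "d = dot_on K1 c c"
  have d0: "0 <= d" unfolding d_def by (rule dot_on_nonneg)
  have "quad_on K1 (%q q'. rform n g q q' R) c = quad_on K1 (%q q'. etaY (ptrace n R) q q' + F q q') c"
   by (simp add: F_def)
  also have "... = quad_on K1 (etaY (ptrace n R)) c + quad_on K1 F c"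
   by (rule quad_on_linear)
  also have "quad_on K1 F c <= (\<Sum>q<k1. \<Sum>q'<k1. \<bar>F q q'\<bar>) * d"
   using abs_quad_on_le[of "K1" F c] unfolding d_def by simp
  also have "... <= (\<theta> * (real k1)^2) * d"
  proof (rule mult_right_mono[OF _ d0])
   have "(\<Sum>q<k1. \<Sum>q'<k1. \<bar>F q q'\<bar>) <= (\<Sum>q<k1. \<Sum>q'<k1. \<theta>)"
    using good unfolding F_def by (intro sum_mono) auto
   then show "(\<Sum>q<k1. \<Sum>q'<k1. \<bar>F q q'\<bar>) <= \<theta> * (real k1)^2" by (simp add: power2_eq_square ac_simps)
  qed
  also have "quad_on K1 (etaY (ptrace n R)) c <= quad_on K1 (etaY X) c
    + normA * (\<Sum>p<k2. \<Sum>p'<k2. \<bar>S p p'\<bar>) * d"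
   unfolding d_def by (rule quad_etaY_le[OF dom])
  finally have "quad_on K1 (%q q'. rform n g q q' R) c <= quad_on K1 (etaY X) c + eps * d"
   using mult_right_mono[OF small d0] by (simp add: algebra_simps)
  then show ?thesis using B[of x c] unfolding rform_dot d_def by linarith
 qed
 from fenchel_on_downdate[OF dual R this]
 show ?thesis unfolding next_form_def[abs_def] bump_def[abs_def] .
qed

definition cov_form :: "nat => cmat => kernel => kernel" where
 "cov_form n B R = mul_on (idx n) R (mul_on (idx n) (%a b. tens (etaX B) a b / real n) R)"

lemma ptrace_add: "ptrace n (%a b. X a b + Y a b) = (%p p'. ptrace n X p p' + ptrace n Y p p')"
 by (intro ext) (simp add: ptrace_def sum.distrib add_divide_distrib)

lemma ptrace_mono:
 assumes "!!v. quad_on (idx n) X v <= quad_on (idx n) Y v"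
 shows "quad_on K2 (ptrace n X) v <= quad_on K2 (ptrace n Y) v"
 unfolding quad_ptrace using assms by (intro divide_right_mono sum_mono) auto

text \<open>The shift contains an extra $\delta$, which makes it definite and, in the trace, leaves a surplus proportional
to the squared Hilbert-Schmidt norm. That surplus pays for the growth of the Hilbert-Schmidt norm in the
potential below.\<close>

lemma barrier_resolvent:
 assumes n: "0 < n" and Q: "sym_on (idx n) Q" "psd_on (idx n) Q" and dual: "fenchel_on (idx n) N Q"
  and B: "sym_on K1 B" "psd_on K1 B" and \<delta>: "0 < \<delta>"
 obtains R where "sym_on (idx n) R" "psd_on (idx n) R"
  "fenchel_on (idx n) (%a b. N a b + tens (%p p'. etaX B p p' + \<delta> * of_bool (p = p')) a b / real n) R"
  "!!v. quad_on K2 (ptrace n R) v + quad_on K2 (ptrace n (cov_form n B R)) v <= quad_on K2 (ptrace n Q) v"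
  "ptr n R + ptr n (cov_form n B R) + \<delta> / real n * (frob n R / real n) <= ptr n Q"
  "frob n R + 2 * (\<Sum>a\<in>idx n. \<Sum>b\<in>idx n. R a b * cov_form n B R a b) <= frob n Q"
  "frob n R <= frob n Q"
proof -
 define e where "e = (%p p'. etaX B p p' + \<delta> * of_bool (p = p'))"
 define E where "E = (%a b. tens e a b / real n)"
 define EB where "EB = (%a b. tens (etaX B) a b / real n)"
 have E: "E a b = EB a b + \<delta> / real n * of_bool (a = b)" if "a \<in> idx n" "b \<in> idx n" for a b
  using that by (auto simp: E_def EB_def tens_def e_def prod_eq_iff add_divide_distrib)
 have quadEB: "quad_on (idx n) EB x = (\<Sum>j<n. quad_on K2 (etaX B) (%p. x (p, j))) / real n" for x
  using quad_on_linear(3)[of "idx n" "1 / real n" "tens (etaX B)" x] by (simp add: EB_def quad_tens)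
 have EBpsd: "psd_on (idx n) EB"
  using psd_etaX[OF B(2)] unfolding psd_on_def quadEB by (auto intro!: divide_nonneg_nonneg sum_nonneg)
 have EBsym: "sym_on (idx n) EB"
  using sym_onD[OF sym_etaX[OF B(1)]] by (auto simp: sym_on_def EB_def tens_def idx_def)
 have quadE: "quad_on (idx n) E x = quad_on (idx n) EB x + \<delta> / real n * dot_on (idx n) x x" for x
 proof -
  have "quad_on (idx n) E x = quad_on (idx n) (%a b. EB a b + \<delta> / real n * of_bool (a = b)) x"
   by (rule quad_on_cong) (auto simp: E)
  moreover have "quad_on (idx n) (%a b. of_bool (a = b)) x = dot_on (idx n) x x"
   unfolding quad_on_alt dot_on_def
   by (intro sum.cong refl) (simp add: of_bool_def if_distrib if_distribR cong: if_cong)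
  ultimately show ?thesis by (simp only: quad_on_linear)
 qed
 have Epsd: "psd_on (idx n) E"
  using EBpsd \<delta> unfolding psd_on_def quadE by (simp add: dot_on_nonneg)
 have Esym: "sym_on (idx n) E"
  unfolding sym_on_def using E sym_onD[OF EBsym] by auto
 have Epd: "\<forall>a\<in>idx n. x a = 0" if "quad_on (idx n) E x = 0" for x
 proof -
  have "\<delta> / real n * dot_on (idx n) x x = 0"
   using that EBpsd \<delta> dot_on_nonneg[of "idx n" x] unfolding quadE psd_on_def
   by (smt (verit) divide_nonneg_nonneg mult_nonneg_nonneg of_nat_0_le_iff)
  then have "(\<Sum>a\<in>idx n. (x a)^2) = 0" using \<delta> n by (simp add: dot_on_def power2_eq_square)
  then show ?thesis by (simp add: sum_nonneg_eq_0_iff)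
 qed
 obtain R where R: "sym_on (idx n) R" "psd_on (idx n) R" "fenchel_on (idx n) (%a b. N a b + E a b) R"
  and q: "!!v. quad_on (idx n) R v + quad_on (idx n) (mul_on (idx n) R (mul_on (idx n) E R)) v <= quad_on (idx n) Q v"
  and f: "(\<Sum>a\<in>idx n. \<Sum>b\<in>idx n. (R a b)^2) + 2 * (\<Sum>a\<in>idx n. \<Sum>b\<in>idx n. R a b * mul_on (idx n) R (mul_on (idx n) E R) a b)
   <= (\<Sum>a\<in>idx n. \<Sum>b\<in>idx n. (Q a b)^2)"
  using fenchel_on_barrier[OF finite_idx Q Esym Epsd Epd dual] by blast
 define P where "P = cov_form n B R"
 define RR where "RR = mul_on (idx n) R R"
 have ER: "mul_on (idx n) E R c b = mul_on (idx n) EB R c b + \<delta> / real n * R c b" if "c \<in> idx n" for b c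
 proof -
  have "mul_on (idx n) E R c b = (\<Sum>d\<in>idx n. EB c d * R d b + (if d = c then \<delta> / real n * R c b else 0))"
   unfolding mul_on_def by (intro sum.cong refl) (auto simp: E[OF that] algebra_simps)
  then show ?thesis using that by (simp add: sum.distrib mul_on_def)
 qed
 have RER: "mul_on (idx n) R (mul_on (idx n) E R) a b = P a b + \<delta> / real n * RR a b" for a b
 proof -
  have "mul_on (idx n) R (mul_on (idx n) E R) a b = (\<Sum>c\<in>idx n. R a c * mul_on (idx n) E R c b)"
   by (simp only: mul_on_def[of "idx n" R "mul_on (idx n) E R"])
  also have "... = (\<Sum>c\<in>idx n. R a c * mul_on (idx n) EB R c b) + \<delta> / real n * (\<Sum>c\<in>idx n. R a c * R c b)"
   by (simp add: ER distrib_left sum.distrib sum_distrib_left ac_simps)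
  also have "(\<Sum>c\<in>idx n. R a c * mul_on (idx n) EB R c b) = P a b"
   by (simp only: P_def cov_form_def EB_def mul_on_def[of "idx n" R "mul_on (idx n) (%a b. tens (etaX B) a b / real n) R"])
  also have "(\<Sum>c\<in>idx n. R a c * R c b) = RR a b"
   by (simp add: RR_def mul_on_def)
  finally show ?thesis .
 qed
 have quadRR: "quad_on (idx n) RR v = dot_on (idx n) (app_on (idx n) R v) (app_on (idx n) R v)" for v
  unfolding quad_on_def RR_def app_on_mul by (rule dot_on_app_sym[OF R(1)])
 have quadRER: "quad_on (idx n) (mul_on (idx n) R (mul_on (idx n) E R)) v = quad_on (idx n) P v + \<delta> / real n * quad_on (idx n) RR v" for v
  unfolding RER[abs_def] quad_on_linear ..
 have 1: "quad_on K2 (ptrace n R) v + quad_on K2 (ptrace n P) v <= quad_on K2 (ptrace n Q) v" for v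
 proof -
  have "quad_on K2 (ptrace n (%a b. R a b + P a b)) v <= quad_on K2 (ptrace n Q) v"
  proof (rule ptrace_mono)
   fix v
   have "0 <= \<delta> / real n * quad_on (idx n) RR v" unfolding quadRR using \<delta> by (simp add: dot_on_nonneg)
   then show "quad_on (idx n) (%a b. R a b + P a b) v <= quad_on (idx n) Q v"
    using q[of v] unfolding quadRER quad_on_linear by linarith
  qed
  then show ?thesis by (simp add: ptrace_add quad_on_linear)
 qed
 have trRR: "tr_on (idx n) RR = frob n R"
  unfolding tr_on_def RR_def mul_on_def frob_def power2_eq_square
  by (intro sum.cong refl arg_cong2[where f = "(*)"] sym_onD[OF R(1)])
 have 2: "ptr n R + ptr n P + \<delta> / real n * (frob n R / real n) <= ptr n Q"
 proof -
  have "R a a + (P a a + \<delta> / real n * RR a a) <= Q a a" if "a \<in> idx n" for a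
   using q[of "%c. of_bool (c = a)"] unfolding quad_on_unit[OF finite_idx that] RER .
  then have "(\<Sum>a\<in>idx n. R a a + (P a a + \<delta> / real n * RR a a)) <= tr_on (idx n) Q"
   unfolding tr_on_def by (rule sum_mono)
  then have "tr_on (idx n) R + (tr_on (idx n) P + \<delta> / real n * frob n R) <= tr_on (idx n) Q"
   unfolding trRR[symmetric] by (simp add: tr_on_def sum.distrib sum_distrib_left)
  then have "(tr_on (idx n) R + (tr_on (idx n) P + \<delta> / real n * frob n R)) / real n <= tr_on (idx n) Q / real n"
   by (rule divide_right_mono) simp
  then show ?thesis unfolding ptr_eq by (simp add: add_divide_distrib)
 qed
 have RRR: "0 <= (\<Sum>a\<in>idx n. \<Sum>b\<in>idx n. R a b * RR a b)"
 proof -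
  have "(\<Sum>a\<in>idx n. \<Sum>b\<in>idx n. R a b * RR a b) = (\<Sum>a\<in>idx n. \<Sum>b\<in>idx n. \<Sum>c\<in>idx n. R a b * R a c * R b c)"
   unfolding RR_def mul_on_def sum_distrib_left mult.assoc
   by (intro sum.cong refl arg_cong2[where f = "(*)"] sym_onD[OF R(1)])
  also have "... = (\<Sum>a\<in>idx n. \<Sum>c\<in>idx n. \<Sum>b\<in>idx n. R a b * R a c * R b c)"
   by (intro sum.cong refl sum.swap)
  also have "... = (\<Sum>c\<in>idx n. quad_on (idx n) R (%a. R a c))"
   unfolding quad_on_alt by (rule sum.swap)
  also have "... \<ge> 0" using R(2) by (intro sum_nonneg) (auto simp: psd_on_def)
  finally show ?thesis .
 qed
 have fE: "frob n R + 2 * ((\<Sum>a\<in>idx n. \<Sum>b\<in>idx n. R a b * P a b) + \<delta> / real n * (\<Sum>a\<in>idx n. \<Sum>b\<in>idx n. R a b * RR a b)) <= frob n Q"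
 proof -
  have "(\<Sum>a\<in>idx n. \<Sum>b\<in>idx n. R a b * mul_on (idx n) R (mul_on (idx n) E R) a b) =
   (\<Sum>a\<in>idx n. \<Sum>b\<in>idx n. R a b * P a b) + \<delta> / real n * (\<Sum>a\<in>idx n. \<Sum>b\<in>idx n. R a b * RR a b)"
   unfolding RER by (simp add: distrib_left sum.distrib sum_distrib_left ac_simps)
  then show ?thesis using f unfolding frob_def by simp
 qed
 have 3: "frob n R + 2 * (\<Sum>a\<in>idx n. \<Sum>b\<in>idx n. R a b * P a b) <= frob n Q"
 proof -
  have "0 <= \<delta> / real n * (\<Sum>a\<in>idx n. \<Sum>b\<in>idx n. R a b * RR a b)"
   using RRR \<delta> by (intro mult_nonneg_nonneg) auto
  then show ?thesis using fE unfolding distrib_left by linarith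
 qed
 have Psym: "sym_on (idx n) P"
  unfolding P_def cov_form_def EB_def[symmetric] by (rule sym_on_sandwich[OF R(1) EBsym])
 have "psd_on (idx n) P"
  unfolding psd_on_def P_def cov_form_def EB_def[symmetric] quad_on_sandwich[OF R(1)]
  using EBpsd by (simp add: psd_on_def)
 then have "0 <= tr_on (idx n) (mul_on (idx n) R P)"
  by (rule tr_on_psd_mul_nonneg[OF finite_idx R(2) Psym])
 also have "... = (\<Sum>a\<in>idx n. \<Sum>b\<in>idx n. R a b * P a b)"
  unfolding tr_on_def mul_on_def
  by (intro sum.cong refl arg_cong2[where f = "(*)"] sym_onD[OF Psym])
 finally have 4: "frob n R <= frob n Q" using 3 by linarith
 show ?thesis
  by (rule that[of R]) (use R 1 2 3 4 in \<open>simp_all add: P_def E_def e_def\<close>)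
qed

end

section \<open>A potential that controls the barrier\<close>

context kron_coeffs
begin

definition sumsq :: "cmat => real" where
 "sumsq B = (\<Sum>q<k1. \<Sum>q'<k1. (B q q')^2)"

definition sumabs :: "cmat => real" where
 "sumabs B = (\<Sum>q<k1. \<Sum>q'<k1. \<bar>B q q'\<bar>)"

definition sigma_const :: real where
 "sigma_const = 42 * (real k1)^2 * sandwich_norm^2"

lemma sigma_const_nonneg: "0 <= sigma_const"
 by (simp add: sigma_const_def)

lemma sigma_second_moment':
 "0 < n ==> (mean n (%g. (sigma n g R)^2)) <= sigma_const * (frob n R / real n)^2"
 using sigma_second_moment[of n R] by (simp add: sigma_const_def power_mult_distrib power_divide)

lemma bump_expectation':
 "sym_on (idx n) R ==> a \<in> idx n ==> b \<in> idx n ==>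
  (mean n (%g. bump n g R B a b)) = cov_form n B R a b"
 unfolding cov_form_def by (rule bump_expectation)

lemma integrable_bump: "integrable (row_law n) (%g. bump n g R B a b)"
 by (intro all_moments_integrable all_moments_bump)

lemma ptrace_bump_expectation:
 assumes "sym_on (idx n) R" "p < k2" "p' < k2"
 shows "(mean n (%g. ptrace n (bump n g R B) p p')) = ptrace n (cov_form n B R) p p'"
proof -
 have "(mean n (%g. ptrace n (bump n g R B) p p')) =
  (\<Sum>j<n. (mean n (%g. bump n g R B (p, j) (p', j)))) / real n"
  unfolding ptrace_def using integrable_bump by simp
 also have "(\<Sum>j<n. (mean n (%g. bump n g R B (p, j) (p', j)))) = (\<Sum>j<n. cov_form n B R (p, j) (p', j))"
  using assms by (intro sum.cong refl bump_expectation') (auto simp: idx_def)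
 finally show ?thesis by (simp add: ptrace_def)
qed

lemma all_moments_ptrace_bump: "all_moments (row_law n) (%g. ptrace n (bump n g R B) p p')"
 unfolding ptrace_def divide_inverse by (intro all_moments_intros all_moments_bump)

lemma frob_add_bump_expectation:
 assumes n: "0 < n" and R: "sym_on (idx n) R"
 shows "integrable (row_law n) (%g. frob n (%a b. R a b + bump n g R B a b))" (is ?I)
  and "(mean n (%g. frob n (%a b. R a b + bump n g R B a b))) <=
  frob n R + 2 * (\<Sum>a\<in>idx n. \<Sum>b\<in>idx n. R a b * cov_form n B R a b)
   + sumsq B * (sigma_const * (frob n R / real n)^2)" (is ?E)
proof -
 show ?I
  unfolding frob_def by (intro all_moments_integrable all_moments_intros all_moments_bump)
 have split: "frob n (%a b. R a b + bump n g R B a b) =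
   frob n R + 2 * (\<Sum>a\<in>idx n. \<Sum>b\<in>idx n. R a b * bump n g R B a b) + frob n (bump n g R B)" for g
  unfolding frob_def sum_distrib_left sum.distrib[symmetric]
  by (intro sum.cong refl) (simp add: power2_sum)
 have i1: "integrable (row_law n) (%g. \<Sum>a\<in>idx n. \<Sum>b\<in>idx n. R a b * bump n g R B a b)"
  by (intro all_moments_integrable all_moments_intros all_moments_bump)
 have i2: "integrable (row_law n) (%g. (sigma n g R)^2)"
  by (intro all_moments_integrable all_moments_intros all_moments_sigma)
 interpret G: prob_space "row_law n" by (rule prob_space_gauss_on)
 have "(mean n (%g. frob n (%a b. R a b + bump n g R B a b))) <=
  (mean n (%g. frob n R + 2 * (\<Sum>a\<in>idx n. \<Sum>b\<in>idx n. R a b * bump n g R B a b) + sumsq B * (sigma n g R)^2))"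
 proof (rule integral_mono[OF \<open>?I\<close>])
  show "integrable (row_law n) (%g. frob n R + 2 * (\<Sum>a\<in>idx n. \<Sum>b\<in>idx n. R a b * bump n g R B a b) + sumsq B * (sigma n g R)^2)"
   using i1 i2 by (intro Bochner_Integration.integrable_add integrable_mult_right) auto
  fix g
  show "frob n (%a b. R a b + bump n g R B a b) <=
   frob n R + 2 * (\<Sum>a\<in>idx n. \<Sum>b\<in>idx n. R a b * bump n g R B a b) + sumsq B * (sigma n g R)^2"
   unfolding split sumsq_def using frob_bump_le[of n g R B] by simp
 qed
 also have "... = frob n R + 2 * (mean n (%g. (\<Sum>a\<in>idx n. \<Sum>b\<in>idx n. R a b * bump n g R B a b)))
   + sumsq B * (mean n (%g. (sigma n g R)^2))"
  using i1 i2 by (simp add: G.prob_space)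
 also have "(mean n (%g. (\<Sum>a\<in>idx n. \<Sum>b\<in>idx n. R a b * bump n g R B a b))) =
   (\<Sum>a\<in>idx n. \<Sum>b\<in>idx n. R a b * cov_form n B R a b)"
  using integrable_bump by (simp add: bump_expectation'[OF R])
 also have "sumsq B * (mean n (%g. (sigma n g R)^2)) <= sumsq B * (sigma_const * (frob n R / real n)^2)"
  by (intro mult_left_mono sigma_second_moment'[OF n]) (simp add: sumsq_def sum_nonneg)
 finally show ?E by simp
qed

lemma ptr_add_bump_expectation:
 assumes R: "sym_on (idx n) R"
 shows "integrable (row_law n) (%g. ptr n (%a b. R a b + bump n g R B a b))"
  and "(mean n (%g. ptr n (%a b. R a b + bump n g R B a b))) = ptr n R + ptr n (cov_form n B R)"
proof -
 interpret G: prob_space "row_law n" by (rule prob_space_gauss_on)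
 have i: "integrable (row_law n) (%g. ptrace n (bump n g R B) p p)" for p
  by (intro all_moments_integrable all_moments_ptrace_bump)
 show "integrable (row_law n) (%g. ptr n (%a b. R a b + bump n g R B a b))"
  unfolding ptr_def ptrace_add using i by simp
 show "(mean n (%g. ptr n (%a b. R a b + bump n g R B a b))) = ptr n R + ptr n (cov_form n B R)"
  unfolding ptr_def ptrace_add using i R
  by (simp add: ptrace_bump_expectation G.prob_space sum.distrib)
qed

text \<open>The drift is a martingale once the mean increment is subtracted; its squared increments add up.\<close>

lemma drift_square_expectation:
 fixes S B :: "nat => nat => real"
 assumes n: "0 < n" and R: "sym_on (idx n) R"
 defines "S' \<equiv> %g p p'. S p p' + (ptrace n (bump n g R B) p p' - ptrace n (cov_form n B R) p p')"
 shows "integrable (row_law n) (%g. \<Sum>p<k2. \<Sum>p'<k2. (S' g p p')^2)"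
  and "(mean n (%g. (\<Sum>p<k2. \<Sum>p'<k2. (S' g p p')^2))) <=
   (\<Sum>p<k2. \<Sum>p'<k2. (S p p')^2) + (real k2)^2 * ((sumabs B / real n)^2 * (sigma_const * (frob n R / real n)^2))"
proof -
 interpret G: prob_space "row_law n" by (rule prob_space_gauss_on)
 have am: "all_moments (row_law n) (%g. S' g p p')" for p p'
  unfolding S'_def by (intro all_moments_intros all_moments_ptrace_bump)
 have i: "integrable (row_law n) (%g. (S' g p p')^2)" for p p'
  by (intro all_moments_integrable all_moments_intros am)
 then show "integrable (row_law n) (%g. \<Sum>p<k2. \<Sum>p'<k2. (S' g p p')^2)"
  by (intro Bochner_Integration.integrable_sum)
 have one: "(mean n (%g. (S' g p p')^2)) <= (S p p')^2 + (sumabs B / real n)^2 * (sigma_const * (frob n R / real n)^2)"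
  if p: "p < k2" "p' < k2" for p p'
 proof -
  define m where "m = ptrace n (cov_form n B R) p p'"
  define x where "x = (%g. ptrace n (bump n g R B) p p')"
  have ix: "integrable (row_law n) x" "integrable (row_law n) (%g. (x g)^2)"
   unfolding x_def by (intro all_moments_integrable all_moments_intros all_moments_ptrace_bump)+
  have m: "(mean n (%g. x g)) = m"
   unfolding x_def m_def by (rule ptrace_bump_expectation[OF R p])
  have isig: "integrable (row_law n) (%g. (sigma n g R)^2)"
   by (intro all_moments_integrable all_moments_intros all_moments_sigma)
  have "(mean n (%g. (S' g p p')^2)) = (mean n (%g. (x g)^2 + (2 * (S p p' - m)) * x g + (S p p' - m)^2))"
   by (intro Bochner_Integration.integral_cong refl)
    (simp add: S'_def x_def m_def power2_eq_square algebra_simps)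
  also have "... = (mean n (%g. (x g)^2)) + (2 * (S p p' - m)) * m + (S p p' - m)^2"
   using ix m by (simp add: G.prob_space)
  also have "... <= (S p p')^2 + (mean n (%g. (x g)^2))"
   by (simp add: power2_eq_square algebra_simps)
  also have "(mean n (%g. (x g)^2)) <= (mean n (%g. (sumabs B / real n)^2 * (sigma n g R)^2))"
  proof (rule integral_mono[OF ix(2)])
   fix g
   have "\<bar>x g\<bar> <= sumabs B * sigma n g R / real n"
    unfolding x_def sumabs_def by (rule abs_ptrace_bump_le[OF p])
   then have "\<bar>x g\<bar>^2 <= (sumabs B * sigma n g R / real n)^2" by (rule power_mono) simp
   then show "(x g)^2 <= (sumabs B / real n)^2 * (sigma n g R)^2"
    by (simp add: power_mult_distrib power_divide)
  qed (use isig in simp)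
  also have "... = (sumabs B / real n)^2 * (mean n (%g. (sigma n g R)^2))" by simp
  also have "... <= (sumabs B / real n)^2 * (sigma_const * (frob n R / real n)^2)"
   by (intro mult_left_mono sigma_second_moment'[OF n]) simp
  finally show ?thesis by simp
 qed
 have "(mean n (%g. (\<Sum>p<k2. \<Sum>p'<k2. (S' g p p')^2))) =
  (\<Sum>p<k2. \<Sum>p'<k2. (mean n (%g. (S' g p p')^2)))"
  using i by (subst Bochner_Integration.integral_sum) simp_all
 also have "... <= (\<Sum>p<k2. \<Sum>p'<k2. (S p p')^2 + (sumabs B / real n)^2 * (sigma_const * (frob n R / real n)^2))"
  by (intro sum_mono one) auto
 finally show "(mean n (%g. (\<Sum>p<k2. \<Sum>p'<k2. (S' g p p')^2))) <=
   (\<Sum>p<k2. \<Sum>p'<k2. (S p p')^2) + (real k2)^2 * ((sumabs B / real n)^2 * (sigma_const * (frob n R / real n)^2))"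
  by (simp add: sum.distrib power2_eq_square[of "real k2"] ac_simps)
qed

lemma bad_row_expectation:
 fixes n :: nat and R :: "kernel" and \<theta> :: real
 assumes \<theta>: "0 < \<theta>"
 defines "bad \<equiv> %g. \<Sum>q<k1. \<Sum>q'<k1. ((rform n g q q' R - etaY (ptrace n R) q q') / \<theta>) ^ 4"
 shows "integrable (row_law n) bad"
  and "(mean n (%g. bad g)) <= (real k1)^2 * (400 * ((normA / real n)^2 * frob n R)^2 / \<theta> ^ 4)"
proof -
 have i: "integrable (row_law n) (%g. (rform n g q q' R - etaY (ptrace n R) q q') ^ 4)" for q q'
  by (intro all_moments_integrable all_moments_intros all_moments_rform)
 show "integrable (row_law n) bad"
  unfolding bad_def power_divide using i by simp
 have "(mean n (%g. bad g)) =
  (\<Sum>q<k1. \<Sum>q'<k1. (mean n (%g. (rform n g q q' R - etaY (ptrace n R) q q') ^ 4)) / \<theta> ^ 4)"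
  unfolding bad_def power_divide using i by simp
 also have "... <= (\<Sum>q<k1. \<Sum>q'<k1. 400 * ((normA / real n)^2 * frob n R)^2 / \<theta> ^ 4)"
  by (intro sum_mono divide_right_mono rform_fourth_moment) auto
 finally show "(mean n (%g. bad g)) <= (real k1)^2 * (400 * ((normA / real n)^2 * frob n R)^2 / \<theta> ^ 4)"
  by (simp add: power2_eq_square[of "real k1"] ac_simps)
qed

text \<open>The first summand measures the normalised Hilbert-Schmidt norm of the dual matrix on a logarithmic scale, whose
growth is compensated by the decreasing trace; the second measures the drift of the partial trace above $X$; the
third reserves, for each remaining row, the increment of the drift and the probability that the row deviates.
Dividing by $\ln n$ makes the initial value tend to 0, while a value below 1 still keeps the norm below a small
power of $n$, which the concentration of a row tolerates.\<close>

definition potential :: "nat => real => real => real => nat => kernel => cmat => real" where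
 "potential n b0 c0 C r Q S = (4 * ln (1 + frob n Q / real n) + b0 * ptr n Q) / ln (real n)
   + c0 * (\<Sum>p<k2. \<Sum>p'<k2. (S p p')^2) + real r * (C / (real n * sqrt (real n)))"

lemma potential_nonneg:
 assumes "1 < n" "0 <= b0" "0 <= c0" "0 <= C" "psd_on (idx n) Q"
 shows "0 <= potential n b0 c0 C r Q S"
proof -
 have "0 <= ptr n Q" unfolding ptr_eq using psd_on_tr_nonneg[OF finite_idx assms(5)] by simp
 moreover have "0 <= ln (1 + frob n Q / real n)" using frob_nonneg by (intro ln_ge_zero) simp
 ultimately show ?thesis unfolding potential_def using assms
  by (intro add_nonneg_nonneg divide_nonneg_nonneg mult_nonneg_nonneg sum_nonneg) auto
qed

lemma psd_add_bump:
 assumes "psd_on (idx n) R" "psd_on K1 B"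
 shows "psd_on (idx n) (%a b. R a b + bump n g R B a b)"
 using assms unfolding psd_on_def quad_on_linear bump_def[abs_def] quad_on_outer by simp

lemma sym_add_bump:
 assumes R: "sym_on (idx n) R" and B: "sym_on K1 B"
 shows "sym_on (idx n) (%a b. R a b + bump n g R B a b)"
 unfolding sym_on_def
proof (intro ballI)
 fix a b assume ab: "a \<in> idx n" "b \<in> idx n"
 define w where "w = (%q. app_on (idx n) R (row n g q))"
 have "bump n g R B a b = (\<Sum>q'<k1. \<Sum>q<k1. B q q' * w q a * w q' b)"
  unfolding bump_def w_def by (rule sum.swap)
 also have "... = (\<Sum>q'<k1. \<Sum>q<k1. B q' q * w q' b * w q a)"
 proof (intro sum.cong refl)
  fix q' q assume "q' \<in> K1" "q \<in> K1"
  then have "B q q' = B q' q" using sym_onD[OF B] by blast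
  then show "B q q' * w q a * w q' b = B q' q * w q' b * w q a" by simp
 qed
 also have "... = bump n g R B b a" unfolding bump_def w_def ..
 finally show "R a b + bump n g R B a b = R b a + bump n g R B b a"
  using sym_onD[OF R ab] by simp
qed

text \<open>The potential is a supermartingale along the process. It is combined with a bad event of one row: $W$ majorises
the potential after the step plus a fourth-moment majorant of the indicator of the bad event, so that $W \ge 1$
whenever duality may be lost.\<close>

lemma potential_step:
 assumes n: "1 < n" and B: "sym_on K1 B" "psd_on K1 B" and pos: "0 < \<delta>" "0 < \<theta>" "0 <= b0" "0 <= c0"
  and dualB: "!!x c. 2 * dot_on K1 x c <= quad_on K1 B x + dot_on K1 c c
    - quad_on K1 (etaY X) c - eps * dot_on K1 c c"
  and Q: "sym_on (idx n) Q" "psd_on (idx n) Q" "fenchel_on (idx n) N Q"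
  and dom: "!!v. quad_on K2 (ptrace n Q) v <= quad_on K2 X v + quad_on K2 S v"
  and b0: "4 * (sumsq B * sigma_const) <= b0 * \<delta>"
  and \<theta>: "\<theta> * (real k1)^2 <= eps / 2" and eps: "0 < eps" and c0: "(2 * normA * real k2)^2 <= eps^2 * c0"
  and C: "c0 * ((real k2)^2 * (sumabs B)^2 * sigma_const) + (real k1)^2 * (400 * normA ^ 4) / \<theta> ^ 4 <= C"
  and small: "potential n b0 c0 C (Suc r) Q S < 1"
 obtains W where "integrable (row_law n) W"
  "(mean n (%g. W g)) <= potential n b0 c0 C (Suc r) Q S"
  "!!g. 0 <= W g"
  "!!g. 1 <= W g \<or> (\<exists>Q' S'. sym_on (idx n) Q' \<and> psd_on (idx n) Q' \<and>
    fenchel_on (idx n) (next_form n (%p p'. etaX B p p' + \<delta> * of_bool (p = p')) N g) Q' \<and>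
    (\<forall>v. quad_on K2 (ptrace n Q') v <= quad_on K2 X v + quad_on K2 S' v) \<and>
    potential n b0 c0 C r Q' S' <= W g)"
proof -
 define e where "e = (%p p'. etaX B p p' + \<delta> * of_bool (p = p'))"
 have n0: "0 < n" using n by simp
 have lnn: "0 < ln (real n)" using n by simp
 have "0 <= c0 * ((real k2)^2 * (sumabs B)^2 * sigma_const)" "0 <= (real k1)^2 * (400 * normA ^ 4) / \<theta> ^ 4"
  using pos sigma_const_nonneg by auto
 then have C0: "0 <= C" using C by linarith
 obtain R where R: "sym_on (idx n) R" "psd_on (idx n) R"
  "fenchel_on (idx n) (%a b. N a b + tens e a b / real n) R"
  and Rdom: "!!v. quad_on K2 (ptrace n R) v + quad_on K2 (ptrace n (cov_form n B R)) v <= quad_on K2 (ptrace n Q) v"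
  and Rptr: "ptr n R + ptr n (cov_form n B R) + \<delta> / real n * (frob n R / real n) <= ptr n Q"
  and Rfrob: "frob n R + 2 * (\<Sum>a\<in>idx n. \<Sum>b\<in>idx n. R a b * cov_form n B R a b) <= frob n Q"
  and Rle: "frob n R <= frob n Q"
  using barrier_resolvent[OF n0 Q B pos(1)] unfolding e_def by blast
 define P where "P = cov_form n B R"
 define \<psi> where "\<psi> = frob n Q / real n"
 define \<rho> where "\<rho> = frob n R / real n"
 define s where "s = (\<Sum>p<k2. \<Sum>p'<k2. (S p p')^2)"
 have \<rho>: "0 <= \<rho>" "\<rho> <= \<psi>"
  using frob_nonneg Rle n0 by (auto simp: \<rho>_def \<psi>_def divide_right_mono)
 have s0: "0 <= s" unfolding s_def by (intro sum_nonneg) auto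
 have ptrQ: "0 <= ptr n Q" unfolding ptr_eq using psd_on_tr_nonneg[OF finite_idx Q(2)] by simp
 have pot: "(4 * ln (1 + \<psi>) + b0 * ptr n Q) / ln (real n) + c0 * s + real (Suc r) * (C / (real n * sqrt (real n))) < 1"
  using small unfolding potential_def \<psi>_def s_def .
 have parts: "0 <= ln (1 + \<psi>)" "0 <= c0 * s" "0 <= real (Suc r) * (C / (real n * sqrt (real n)))" "0 <= b0 * ptr n Q"
  using \<rho> s0 pos C0 ptrQ by (auto intro!: ln_ge_zero)
 (* a potential below 1 forces psi^4 < n, and then the bad event of one row has probability O(n^(-3/2)) *)
 have "(4 * ln (1 + \<psi>) + b0 * ptr n Q) / ln (real n) < 1"
  using pot parts by linarith
 then have "4 * ln (1 + \<psi>) < ln (real n)"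
  using lnn parts by (simp add: divide_less_eq)
 then have "ln ((1 + \<psi>) ^ 4) < ln (real n)" using \<rho> by (simp add: ln_realpow)
 then have "(1 + \<psi>) ^ 4 < real n" using \<rho> n by (subst (asm) ln_less_cancel_iff) auto
 moreover have "\<psi> ^ 4 <= (1 + \<psi>) ^ 4" using \<rho> by (intro power_mono) auto
 ultimately have "(\<psi>^2)^2 <= real n" by (simp flip: power_mult)
 then have "\<psi>^2 <= sqrt (real n)" by (rule real_le_rsqrt)
 moreover have "\<rho>^2 <= \<psi>^2" using \<rho> by (intro power_mono)
 ultimately have \<rho>2: "\<rho>^2 / (real n)^2 <= 1 / (real n * sqrt (real n))"
 proof -
  assume *: "\<psi>^2 <= sqrt (real n)" "\<rho>^2 <= \<psi>^2"
  have "\<rho>^2 / (real n)^2 <= sqrt (real n) / (real n)^2" using * by (intro divide_right_mono) auto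
  also have "... = sqrt (real n) / (real n * (sqrt (real n) * sqrt (real n)))" by (simp add: power2_eq_square)
  also have "... = 1 / (real n * sqrt (real n))" using n0 by (simp add: field_simps)
  finally show ?thesis .
 qed
 (* c0 is chosen so that a drift with c0 * s < 1 uses up only half of the slack *)
 have "c0 * s < 1"
  using pot parts lnn by (smt (verit) divide_nonneg_nonneg)
 have smallS: "normA * (\<Sum>p<k2. \<Sum>p'<k2. \<bar>S p p'\<bar>) <= eps / 2"
 proof -
  define t where "t = (\<Sum>p<k2. \<Sum>p'<k2. \<bar>S p p'\<bar>)"
  have t0: "0 <= t" unfolding t_def by (intro sum_nonneg) auto
  have "t = (\<Sum>z\<in>K2 \<times> K2. 1 * \<bar>S (fst z) (snd z)\<bar>)"
   by (simp add: t_def sum.cartesian_product case_prod_beta)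
  also have "...^2 <= (\<Sum>z\<in>K2 \<times> K2. 1^2) * (\<Sum>z\<in>K2 \<times> K2. \<bar>S (fst z) (snd z)\<bar>^2)"
   by (rule Cauchy_Schwarz_ineq_sum)
  also have "... = (real k2)^2 * s"
   by (simp add: s_def sum.cartesian_product case_prod_beta power2_eq_square)
  finally have "t^2 <= (real k2)^2 * s" .
  then have "(2 * normA)^2 * t^2 <= (2 * normA)^2 * ((real k2)^2 * s)" by (rule mult_left_mono) simp
  also have "... = (2 * normA * real k2)^2 * s" by (simp add: power_mult_distrib)
  also have "... <= (eps^2 * c0) * s" using c0 s0 by (rule mult_right_mono)
  also have "... = eps^2 * (c0 * s)" by simp
  also have "... <= eps^2 * 1" using \<open>c0 * s < 1\<close> by (intro mult_left_mono) auto
  finally have "(2 * normA * t)^2 <= eps^2" by (simp add: power_mult_distrib)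
  then have "2 * normA * t <= eps" using eps by (rule power2_le_imp_le[OF _ less_imp_le])
  then show ?thesis by (simp add: t_def)
 qed
 define Q' where "Q' = (%g a b. R a b + bump n g R B a b)"
 define S' where "S' = (%g p p'. S p p' + (ptrace n (bump n g R B) p p' - ptrace n P p p'))"
 define bad where "bad = (%g. \<Sum>q<k1. \<Sum>q'<k1. ((rform n g q q' R - etaY (ptrace n R) q q') / \<theta>) ^ 4)"
 (* W replaces the logarithm by its tangent at psi, whose expectation is linear in the norm *)
 define W where "W = (%g. (4 * (ln (1 + \<psi>) + (frob n (Q' g) / real n - \<psi>) / (1 + \<psi>)) + b0 * ptr n (Q' g)) / ln (real n)
   + c0 * (\<Sum>p<k2. \<Sum>p'<k2. (S' g p p')^2) + real r * (C / (real n * sqrt (real n))) + bad g)"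
 have bad0: "0 <= bad g" for g unfolding bad_def by (intro sum_nonneg) auto
 have W_ge: "potential n b0 c0 C r (Q' g) (S' g) + bad g <= W g" for g
 proof -
  define x where "x = frob n (Q' g) / real n"
  have x: "0 <= x" unfolding x_def using frob_nonneg by simp
  have "ln ((1 + x) / (1 + \<psi>)) <= (1 + x) / (1 + \<psi>) - 1" using x \<rho> by (intro ln_le_minus_one) auto
  also have "(1 + x) / (1 + \<psi>) - 1 = (x - \<psi>) / (1 + \<psi>)" using \<rho> by (simp add: field_simps)
  finally have "ln (1 + x) <= ln (1 + \<psi>) + (x - \<psi>) / (1 + \<psi>)" using x \<rho> by (simp add: ln_div)
  then show ?thesis unfolding potential_def W_def x_def using lnn
   by (intro add_mono divide_right_mono mult_left_mono order.refl) auto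
 qed
 have pot0: "0 <= potential n b0 c0 C r (Q' g) (S' g)" for g
  unfolding Q'_def using n pos C0 R(2) B(2) by (intro potential_nonneg psd_add_bump) auto
 have iF: "integrable (row_law n) (%g. frob n (Q' g))"
  unfolding Q'_def by (rule frob_add_bump_expectation(1)[OF n0 R(1)])
 have iT: "integrable (row_law n) (%g. ptr n (Q' g))"
  unfolding Q'_def by (rule ptr_add_bump_expectation(1)[OF R(1)])
 have iS: "integrable (row_law n) (%g. \<Sum>p<k2. \<Sum>p'<k2. (S' g p p')^2)"
  unfolding S'_def P_def by (rule drift_square_expectation(1)[OF n0 R(1)])
 have iB: "integrable (row_law n) bad"
  unfolding bad_def by (rule bad_row_expectation(1)[OF pos(2)])
 interpret G: prob_space "row_law n" by (rule prob_space_gauss_on)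
 show thesis
 proof
  show "integrable (row_law n) W"
   unfolding W_def using iF iT iS iB
   by (intro Bochner_Integration.integrable_add integrable_mult_right integrable_divide Bochner_Integration.integrable_diff)
     auto
  show "0 <= W g" for g using W_ge[of g] pot0[of g] bad0[of g] by linarith
  show "1 <= W g \<or> (\<exists>Q' S'. sym_on (idx n) Q' \<and> psd_on (idx n) Q' \<and>
    fenchel_on (idx n) (next_form n (%p p'. etaX B p p' + \<delta> * of_bool (p = p')) N g) Q' \<and>
    (\<forall>v. quad_on K2 (ptrace n Q') v <= quad_on K2 X v + quad_on K2 S' v) \<and>
    potential n b0 c0 C r Q' S' <= W g)" for g
  proof (cases "\<forall>q<k1. \<forall>q'<k1. \<bar>rform n g q q' R - etaY (ptrace n R) q q'\<bar> <= \<theta>")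
   case False
   then obtain q q' where q: "q < k1" "q' < k1" "\<theta> < \<bar>rform n g q q' R - etaY (ptrace n R) q q'\<bar>" by force
   define y where "y = (%q q'. ((rform n g q q' R - etaY (ptrace n R) q q') / \<theta>) ^ 4)"
   define z where "z = (rform n g q q' R - etaY (ptrace n R) q q') / \<theta>"
   have "1 <= \<bar>z\<bar>" using q pos by (simp add: z_def)
   then have "1 <= \<bar>z\<bar> ^ 4" by (rule one_le_power)
   then have "1 <= z ^ 4" by simp
   then have "1 <= y q q'" by (simp add: y_def z_def)
   also have "... <= (\<Sum>q'<k1. y q q')" using q by (intro member_le_sum) (auto simp: y_def)
   also have "... <= (\<Sum>q<k1. \<Sum>q'<k1. y q q')"
    using q by (intro member_le_sum[of q _ "%q. \<Sum>q'<k1. y q q'"]) (auto simp: y_def intro!: sum_nonneg)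
   also have "... = bad g" by (simp add: bad_def y_def)
   finally show ?thesis using W_ge[of g] pot0[of g] by linarith
  next
   case True
   have domR: "quad_on K2 (ptrace n R) v <= quad_on K2 X v + quad_on K2 S v" for v
   proof -
    have "0 <= quad_on K2 (ptrace n P) v"
     unfolding P_def quad_ptrace cov_form_def quad_on_sandwich[OF R(1)]
    proof (intro divide_nonneg_nonneg sum_nonneg)
     fix j
     define z where "z = app_on (idx n) R (%a. of_bool (snd a = j) * v (fst a))"
     have "quad_on (idx n) (%a b. tens (etaX B) a b / real n) z = quad_on (idx n) (tens (etaX B)) z / real n"
      using quad_on_linear(3)[of "idx n" "1 / real n" "tens (etaX B)" z] by simp
     also have "... \<ge> 0" unfolding quad_tens
      using psd_etaX[OF B(2)] by (intro divide_nonneg_nonneg sum_nonneg) (auto simp: psd_on_def)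
     finally show "0 <= quad_on (idx n) (%a b. tens (etaX B) a b / real n) z" .
    qed simp
    then show ?thesis using Rdom[of v] dom[of v] unfolding P_def by linarith
   qed
   have "fenchel_on (idx n) (next_form n e N g) (Q' g)"
    unfolding Q'_def
   proof (rule fenchel_next_form[OF R(1,3) domR dualB])
    show "\<theta> * (real k1)^2 + normA * (\<Sum>p<k2. \<Sum>p'<k2. \<bar>S p p'\<bar>) <= eps" using \<theta> smallS by linarith
   qed (use True in auto)
   moreover have "quad_on K2 (ptrace n (Q' g)) v <= quad_on K2 X v + quad_on K2 (S' g) v" for v
    using Rdom[of v] dom[of v] unfolding Q'_def S'_def P_def ptrace_add quad_on_linear by linarith
   moreover have "potential n b0 c0 C r (Q' g) (S' g) <= W g" using W_ge[of g] bad0[of g] by linarith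
   moreover have "sym_on (idx n) (Q' g)" "psd_on (idx n) (Q' g)"
    unfolding Q'_def using R B by (auto intro: sym_add_bump psd_add_bump)
   ultimately show ?thesis unfolding e_def by blast
  qed
  have "(mean n (%g. W g)) =
   (4 * (ln (1 + \<psi>) + ((mean n (%g. frob n (Q' g))) / real n - \<psi>) / (1 + \<psi>)) + b0 * (mean n (%g. ptr n (Q' g)))) / ln (real n)
   + c0 * (mean n (%g. (\<Sum>p<k2. \<Sum>p'<k2. (S' g p p')^2))) + real r * (C / (real n * sqrt (real n))) + (mean n (%g. bad g))"
   unfolding W_def using iF iT iS iB by (simp add: G.prob_space)
  also have "... <= (4 * ln (1 + \<psi>) + b0 * ptr n Q) / ln (real n)
    + (c0 * s + c0 * ((real k2)^2 * (sumabs B)^2 * sigma_const) * (\<rho>^2 / (real n)^2)) + real r * (C / (real n * sqrt (real n)))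
    + (real k1)^2 * (400 * normA ^ 4) / \<theta> ^ 4 * (\<rho>^2 / (real n)^2)"
  proof -
   have F: "(mean n (%g. frob n (Q' g))) <= frob n Q + sumsq B * (sigma_const * \<rho>^2)"
    using frob_add_bump_expectation(2)[OF n0 R(1), of B] Rfrob unfolding Q'_def \<rho>_def by linarith
   have "((mean n (%g. frob n (Q' g))) / real n - \<psi>) / (1 + \<psi>) <= ((frob n Q + sumsq B * (sigma_const * \<rho>^2)) / real n - \<psi>) / (1 + \<psi>)"
    using F \<rho> by (intro divide_right_mono diff_right_mono) auto
   also have "... = sumsq B * sigma_const / real n * (\<rho>^2 / (1 + \<psi>))"
    by (simp add: \<psi>_def add_divide_distrib)
   also have "... <= sumsq B * sigma_const / real n * \<rho>"
   proof (rule mult_left_mono)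
    have "\<rho>^2 <= \<rho> * (1 + \<psi>)" unfolding power2_eq_square using \<rho> by (intro mult_left_mono) auto
    then show "\<rho>^2 / (1 + \<psi>) <= \<rho>" using \<rho> by (simp add: divide_le_eq)
    show "0 <= sumsq B * sigma_const / real n"
     using sigma_const_nonneg by (intro divide_nonneg_nonneg mult_nonneg_nonneg) (auto simp: sumsq_def intro!: sum_nonneg)
   qed
   finally have "4 * (((mean n (%g. frob n (Q' g))) / real n - \<psi>) / (1 + \<psi>)) <= 4 * (sumsq B * sigma_const / real n * \<rho>)"
    by (rule mult_left_mono) simp
   also have "... = 4 * (sumsq B * sigma_const) * (\<rho> / real n)" by simp
   also have "... <= b0 * \<delta> * (\<rho> / real n)" using b0 \<rho> by (intro mult_right_mono) auto
   finally have 1: "4 * (((mean n (%g. frob n (Q' g))) / real n - \<psi>) / (1 + \<psi>)) <= b0 * (\<delta> / real n * \<rho>)" by simp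
   have "(mean n (%g. ptr n (Q' g))) <= ptr n Q - \<delta> / real n * \<rho>"
    using ptr_add_bump_expectation(2)[OF R(1), of B] Rptr unfolding Q'_def \<rho>_def by linarith
   then have "b0 * (mean n (%g. ptr n (Q' g))) <= b0 * (ptr n Q - \<delta> / real n * \<rho>)"
    using pos by (intro mult_left_mono) auto
   then have "4 * (ln (1 + \<psi>) + ((mean n (%g. frob n (Q' g))) / real n - \<psi>) / (1 + \<psi>)) + b0 * (mean n (%g. ptr n (Q' g)))
    <= 4 * ln (1 + \<psi>) + b0 * ptr n Q"
    using 1 by (simp add: algebra_simps)
   then have h1: "(4 * (ln (1 + \<psi>) + ((mean n (%g. frob n (Q' g))) / real n - \<psi>) / (1 + \<psi>)) + b0 * (mean n (%g. ptr n (Q' g)))) / ln (real n)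
    <= (4 * ln (1 + \<psi>) + b0 * ptr n Q) / ln (real n)"
    using lnn by (intro divide_right_mono) auto
   have "(mean n (%g. (\<Sum>p<k2. \<Sum>p'<k2. (S' g p p')^2))) <= s + (real k2)^2 * ((sumabs B / real n)^2 * (sigma_const * \<rho>^2))"
    using drift_square_expectation(2)[OF n0 R(1), of S B] unfolding S'_def P_def s_def \<rho>_def .
   then have "c0 * (mean n (%g. (\<Sum>p<k2. \<Sum>p'<k2. (S' g p p')^2))) <= c0 * (s + (real k2)^2 * ((sumabs B / real n)^2 * (sigma_const * \<rho>^2)))"
    using pos by (intro mult_left_mono) auto
   then have h2: "c0 * (mean n (%g. (\<Sum>p<k2. \<Sum>p'<k2. (S' g p p')^2))) <= c0 * s + c0 * ((real k2)^2 * (sumabs B)^2 * sigma_const) * (\<rho>^2 / (real n)^2)"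
    by (simp add: distrib_left power_divide mult_ac)
   have "frob n R = \<rho> * real n" using n0 by (simp add: \<rho>_def)
   then have "((normA / real n)^2 * frob n R)^2 = normA ^ 4 * (\<rho>^2 / (real n)^2)"
    using n0 by (simp add: power_mult_distrib power_divide field_simps eval_nat_numeral)
   then have h3: "(mean n (%g. bad g)) <= (real k1)^2 * (400 * normA ^ 4) / \<theta> ^ 4 * (\<rho>^2 / (real n)^2)"
    using bad_row_expectation(2)[OF pos(2), of n R] unfolding bad_def by (simp add: mult_ac)
   show ?thesis using add_mono[OF add_mono[OF add_mono[OF h1 h2] order.refl] h3] .
  qed
  also have "... = (4 * ln (1 + \<psi>) + b0 * ptr n Q) / ln (real n) + c0 * s + real r * (C / (real n * sqrt (real n)))
   + (c0 * ((real k2)^2 * (sumabs B)^2 * sigma_const) + (real k1)^2 * (400 * normA ^ 4) / \<theta> ^ 4) * (\<rho>^2 / (real n)^2)"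
   unfolding distrib_right by linarith
  also have "... <= (4 * ln (1 + \<psi>) + b0 * ptr n Q) / ln (real n) + c0 * s + real r * (C / (real n * sqrt (real n)))
   + C * (1 / (real n * sqrt (real n)))"
   using C C0 \<rho>2 by (intro add_mono order.refl mult_mono) auto
  also have "... = potential n b0 c0 C (Suc r) Q S"
   unfolding potential_def \<psi>_def s_def by (simp add: distrib_right add_divide_distrib)
  finally show "(mean n (%g. W g)) <= potential n b0 c0 C (Suc r) Q S" .
 qed
qed

end

text \<open>Rational vectors suffice to detect negative directions, which makes the events below countable unions.\<close>

lemma rational_negative_direction:
 assumes I: "finite I" and x: "quad_on I N x < 0"
 shows "\<exists>y\<in>Pi\<^sub>E I (%_. \<rat>). quad_on I N y < 0"
proof -
 define y where "y = (%k a. of_int \<lfloor>real (Suc k) * x a\<rfloor> / real (Suc k))"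
 have y: "(%k. y k a) \<longlonglongrightarrow> x a" for a
 proof (rule tendsto_sandwich)
  have "(%k. 1 / real (Suc k)) \<longlonglongrightarrow> 0" by (rule LIMSEQ_Suc[OF lim_1_over_n])
  then show "(%k. x a - 1 / real (Suc k)) \<longlonglongrightarrow> x a" using tendsto_diff[OF tendsto_const, of _ 0 sequentially "x a"] by simp
  show "\<forall>\<^sub>F k in sequentially. x a - 1 / real (Suc k) <= y k a"
  proof (rule always_eventually, rule allI)
   fix k
   have "real (Suc k) * x a - 1 <= of_int \<lfloor>real (Suc k) * x a\<rfloor>" by linarith
   then have "(real (Suc k) * x a - 1) / real (Suc k) <= y k a" unfolding y_def by (rule divide_right_mono) simp
   then show "x a - 1 / real (Suc k) <= y k a" by (simp add: diff_divide_distrib)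
  qed
  show "\<forall>\<^sub>F k in sequentially. y k a <= x a"
   unfolding y_def by (intro always_eventually allI) (simp add: divide_le_eq mult.commute)
 qed auto
 have "(%k. quad_on I N (y k)) \<longlonglongrightarrow> quad_on I N x"
  unfolding quad_on_alt by (intro tendsto_sum tendsto_mult tendsto_const y)
 then have "\<forall>\<^sub>F k in sequentially. quad_on I N (y k) < 0" using x by (rule order_tendstoD)
 then obtain k where k: "quad_on I N (y k) < 0" by (auto simp: eventually_sequentially)
 have "restrict (y k) I \<in> Pi\<^sub>E I (%_. \<rat>)" by (auto simp: y_def)
 moreover have "quad_on I N (restrict (y k) I) = quad_on I N (y k)" by (rule quad_on_cong) auto
 ultimately show ?thesis using k by metis
qed

lemma negative_direction_measurable:
 assumes I: "finite I" and N: "!!a b. a \<in> I ==> b \<in> I ==> (%w. N w a b) \<in> borel_measurable M"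
 shows "{w \<in> space M. \<exists>x. quad_on I (N w) x < 0} \<in> sets M"
proof -
 have "{w \<in> space M. \<exists>x. quad_on I (N w) x < 0} = (\<Union>y\<in>Pi\<^sub>E I (%_. \<rat>). {w \<in> space M. quad_on I (N w) y < 0})"
  using rational_negative_direction[OF I] by auto
 also have "... \<in> sets M"
 proof -
  have *: "{w \<in> space M. quad_on I (N w) y < 0} \<in> sets M" for y
  proof -
   have "(%w. quad_on I (N w) y) \<in> borel_measurable M"
    unfolding quad_on_alt
    by (intro borel_measurable_sum borel_measurable_times borel_measurable_const N)
   then show ?thesis by measurable
  qed
  have "countable (Pi\<^sub>E I (%_. \<rat> :: real set))" by (intro countable_PiE I countable_rat)
  then show ?thesis using * by (intro sets.countable_UN'') auto
 qed
 finally show ?thesis .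
qed

context kron_coeffs
begin

text \<open>Index $(t, i, j)$ is entry $(i, j)$ of $G_t$, with $i$ ranging over the given set of rows.\<close>

definition cube :: "nat set => nat => (nat \<times> nat \<times> nat) set" where
 "cube I n = {..<l} \<times> I \<times> {..<n}"

abbreviation "law r n \<equiv> Pi\<^sub>M (cube (lessThan r) n) (%_. gauss)"

definition row_noise :: "nat => nat => (nat \<times> nat \<times> nat => real) => nat \<times> nat => real" where
 "row_noise n i \<omega> = (\<lambda>s\<in>noise n. \<omega> (fst s, i, snd s))"

definition gram_row :: "nat => nat => (nat \<times> nat \<times> nat => real) => kernel" where
 "gram_row n i \<omega> a b = (\<Sum>q<k1. row n (row_noise n i \<omega>) q a * row n (row_noise n i \<omega>) q b)"

lemma finite_cube [simp]: "finite I ==> finite (cube I n)"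
 by (simp add: cube_def)

lemma row_noise_merge:
 assumes "I \<inter> J = {}"
 shows "i \<in> I ==> row_noise n i (merge (cube I n) (cube J n) (x, y)) = row_noise n i x"
  and "j \<in> J ==> row_noise n j (merge (cube I n) (cube J n) (x, y)) = row_noise n j y"
 using assms by (auto simp: row_noise_def merge_def cube_def noise_def intro!: restrict_ext)

lemma gram_row_merge:
 assumes "I \<inter> J = {}"
 shows "i \<in> I ==> gram_row n i (merge (cube I n) (cube J n) (x, y)) = gram_row n i x"
  and "j \<in> J ==> gram_row n j (merge (cube I n) (cube J n) (x, y)) = gram_row n j y"
 by (auto simp: gram_row_def row_noise_merge[OF assms] fun_eq_iff)

lemma row_noise_distr: "i \<in> I ==> distr (gauss_on (cube I n)) (row_law n) (row_noise n i) = row_law n"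
 unfolding row_noise_def
 by (rule distr_PiM_reindex[where M = "%_. gauss" and f = "%s. (fst s, i, snd s)"])
  (auto simp: inj_on_def cube_def noise_def prob_space_gauss)

lemma row_noise_measurable: "i \<in> I ==> row_noise n i \<in> measurable (gauss_on (cube I n)) (row_law n)"
 unfolding row_noise_def
 by (rule measurable_restrict) (auto simp: cube_def noise_def intro!: measurable_component_singleton)

lemma row_measurable:
 assumes "i \<in> I" "q < k1" "a \<in> idx n"
 shows "(%\<omega>. row n (row_noise n i \<omega>) q a) \<in> borel_measurable (gauss_on (cube I n))"
 using measurable_compose[OF row_noise_measurable all_moments_measurable[OF all_moments_row]] assms by blast

lemma gram_row_measurable:
 assumes "i \<in> I" "a \<in> idx n" "b \<in> idx n"
 shows "(%\<omega>. gram_row n i \<omega> a b) \<in> borel_measurable (gauss_on (cube I n))"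
 unfolding gram_row_def using assms by (intro borel_measurable_sum borel_measurable_times row_measurable) auto

lemma row_noise_integral:
 fixes f :: "(nat \<times> nat => real) => real"
 assumes "i \<in> I" "f \<in> borel_measurable (row_law n)"
 shows "(\<integral>\<omega>. f (row_noise n i \<omega>) \<partial>(gauss_on (cube I n))) = (mean n (%g. f g))"
  and "integrable (row_law n) f ==> integrable (gauss_on (cube I n)) (%\<omega>. f (row_noise n i \<omega>))"
proof -
 show "(\<integral>\<omega>. f (row_noise n i \<omega>) \<partial>(gauss_on (cube I n))) = (mean n (%g. f g))"
  using integral_distr[OF row_noise_measurable[OF assms(1), of n] assms(2)] row_noise_distr[OF assms(1), of n] by simp
 show "integrable (row_law n) f ==> integrable (gauss_on (cube I n)) (%\<omega>. f (row_noise n i \<omega>))"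
  using integrable_distr_eq[OF row_noise_measurable[OF assms(1), of n] assms(2)] row_noise_distr[OF assms(1), of n] by simp
qed

lemma cube_fold:
 fixes f :: "(nat \<times> nat \<times> nat => real) => real"
 assumes "I \<inter> J = {}" "finite I" "finite J" "integrable (gauss_on (cube (I \<union> J) n)) f"
 shows "integral\<^sup>L (gauss_on (cube (I \<union> J) n)) f =
  (\<integral>x. (\<integral>y. f (merge (cube I n) (cube J n) (x, y)) \<partial>(gauss_on (cube J n))) \<partial>(gauss_on (cube I n)))"
proof -
 have "cube (I \<union> J) n = cube I n \<union> cube J n" by (auto simp: cube_def)
 then show ?thesis using assms gauss_prod.product_integral_fold[of "cube I n" "cube J n" f]
  by (auto simp: cube_def)
qed

definition final_form :: "nat => cmat => nat => kernel
  => (nat \<times> nat \<times> nat => real) => kernel" where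
 "final_form n e r N \<omega> a b = N a b + real r * tens e a b / real n - (\<Sum>i<r. gram_row n i \<omega> a b)"

lemma final_form_measurable:
 assumes "a \<in> idx n" "b \<in> idx n"
 shows "(%\<omega>. final_form n e r N \<omega> a b) \<in> borel_measurable (law r n)"
 unfolding final_form_def using assms
 by (intro borel_measurable_diff borel_measurable_const borel_measurable_sum gram_row_measurable) auto

text \<open>Induction on the number of remaining rows: condition on one row; the next form is again controlled by the
potential, and the potential decreases in expectation. If the potential is at least 1 there is nothing to prove.\<close>

lemma failure_probability_le_potential:
 assumes n: "1 < n" and B: "sym_on K1 B" "psd_on K1 B" and pos: "0 < \<delta>" "0 < \<theta>" "0 <= b0" "0 <= c0"
  and dualB: "!!x c. 2 * dot_on K1 x c <= quad_on K1 B x + dot_on K1 c c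
    - quad_on K1 (etaY X) c - eps * dot_on K1 c c"
  and b0: "4 * (sumsq B * sigma_const) <= b0 * \<delta>"
  and \<theta>: "\<theta> * (real k1)^2 <= eps / 2" and eps: "0 < eps" and c0: "(2 * normA * real k2)^2 <= eps^2 * c0"
  and C: "c0 * ((real k2)^2 * (sumabs B)^2 * sigma_const) + (real k1)^2 * (400 * normA ^ 4) / \<theta> ^ 4 <= C"
  and Q: "sym_on (idx n) Q" "psd_on (idx n) Q" "fenchel_on (idx n) N Q"
  and dom: "!!v. quad_on K2 (ptrace n Q) v <= quad_on K2 X v + quad_on K2 S v"
 shows "measure (law r n) {\<omega> \<in> space (law r n).
   \<exists>x. quad_on (idx n) (final_form n (%p p'. etaX B p p' + \<delta> * of_bool (p = p')) r N \<omega>) x < 0}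
  <= potential n b0 c0 C r Q S"
 using Q dom
proof (induction r arbitrary: N Q S)
 have "0 <= c0 * ((real k2)^2 * (sumabs B)^2 * sigma_const)" "0 <= (real k1)^2 * (400 * normA ^ 4) / \<theta> ^ 4"
  using pos sigma_const_nonneg by auto
 then have C0: "0 <= C" using C by linarith
 {
  case 0
  have "0 <= quad_on (idx n) (final_form n e 0 N \<omega>) x" for \<omega> x e
  proof -
   have "final_form n e 0 N \<omega> = N" by (simp add: final_form_def fun_eq_iff)
   moreover have "2 * dot_on (idx n) x (%_. 0) <= quad_on (idx n) N x + quad_on (idx n) Q (%_. 0)"
    using 0(3) unfolding fenchel_on_def by blast
   ultimately show ?thesis by (simp add: quad_on_alt dot_on_def)
  qed
  then have "{\<omega> \<in> space (law 0 n).
   \<exists>x. quad_on (idx n) (final_form n (%p p'. etaX B p p' + \<delta> * of_bool (p = p')) 0 N \<omega>) x < 0} = {}"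
   by (auto simp: not_less)
  then show ?case using potential_nonneg[OF n pos(3,4) C0 0(2), of 0 S] by (simp only: measure_empty)
 next
  case (Suc r)
  define e where "e = (%p p'. etaX B p p' + \<delta> * of_bool (p = p'))"
  define P where "P = (%r N. measure (law r n) {\<omega> \<in> space (law r n).
   \<exists>x. quad_on (idx n) (final_form n e r N \<omega>) x < 0})"
  have IH: "P r N <= potential n b0 c0 C r Q S"
   if "sym_on (idx n) Q" "psd_on (idx n) Q" "fenchel_on (idx n) N Q"
    "!!v. quad_on K2 (ptrace n Q) v <= quad_on K2 X v + quad_on K2 S v" for N Q S
   unfolding P_def e_def by (rule Suc.IH[OF that])
  interpret M: prob_space "law (Suc r) n" by (rule prob_space_gauss_on)
  have P1: "P r N <= 1" for r N
   unfolding P_def by (rule prob_space.prob_le_1[OF prob_space_gauss_on])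
  show ?case
  proof (cases "potential n b0 c0 C (Suc r) Q S < 1")
   case False
   then show ?thesis using P1[of "Suc r" N] unfolding P_def e_def by linarith
  next
   case True
   obtain W where W: "integrable (row_law n) W"
    "(mean n (%g. W g)) <= potential n b0 c0 C (Suc r) Q S"
    "!!g. 0 <= W g"
    "!!g. 1 <= W g \<or> (\<exists>Q' S'. sym_on (idx n) Q' \<and> psd_on (idx n) Q' \<and> fenchel_on (idx n) (next_form n e N g) Q' \<and>
      (\<forall>v. quad_on K2 (ptrace n Q') v <= quad_on K2 X v + quad_on K2 S' v) \<and>
      potential n b0 c0 C r Q' S' <= W g)"
    using potential_step[OF n B pos dualB Suc.prems b0 \<theta> eps c0 C True] unfolding e_def by blast
   have PW: "P r (next_form n e N g) <= W g" for g
    using W(4)[of g]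
   proof
    assume "1 <= W g" then show ?thesis using P1[of r "next_form n e N g"] by linarith
   next
    assume "\<exists>Q' S'. sym_on (idx n) Q' \<and> psd_on (idx n) Q' \<and> fenchel_on (idx n) (next_form n e N g) Q' \<and>
      (\<forall>v. quad_on K2 (ptrace n Q') v <= quad_on K2 X v + quad_on K2 S' v) \<and>
      potential n b0 c0 C r Q' S' <= W g"
    then show ?thesis using IH by (meson order.trans)
   qed
   define F where "F = {\<omega> \<in> space (law (Suc r) n). \<exists>x. quad_on (idx n) (final_form n e (Suc r) N \<omega>) x < 0}"
   have Fsets: "F \<in> sets (law (Suc r) n)"
    unfolding F_def by (intro negative_direction_measurable final_form_measurable) auto
   have U: "{r} \<union> {..<r} = {..<Suc r}" by auto
   have cu: "cube {r} n \<union> cube {..<r} n = cube {..<Suc r} n" by (auto simp: cube_def)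
   have "P (Suc r) N = (\<integral>\<omega>. indicator F \<omega> \<partial>(law (Suc r) n))"
    unfolding P_def F_def[symmetric] using Fsets by simp
   also have "... = (\<integral>x. (\<integral>y. indicator F (merge (cube {r} n) (cube {..<r} n) (x, y)) \<partial>(law r n)) \<partial>(gauss_on (cube {r} n)))"
    using cube_fold[of "{r}" "{..<r}" n "indicator F"] Fsets unfolding U
    by (simp add: M.emeasure_finite less_top[symmetric])
   also have "... = (\<integral>x. P r (next_form n e N (row_noise n r x)) \<partial>(gauss_on (cube {r} n)))"
   proof (intro Bochner_Integration.integral_cong refl)
    fix x assume x: "x \<in> space (gauss_on (cube {r} n))"
    define F' where "F' = {\<omega> \<in> space (law r n). \<exists>z. quad_on (idx n) (final_form n e r (next_form n e N (row_noise n r x)) \<omega>) z < 0}"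
    have F's: "F' \<in> sets (law r n)"
     unfolding F'_def by (intro negative_direction_measurable final_form_measurable) auto
    have ff: "final_form n e (Suc r) N (merge (cube {r} n) (cube {..<r} n) (x, y)) =
     final_form n e r (next_form n e N (row_noise n r x)) y" for y
    proof (intro ext)
     fix a b
     have "(\<Sum>i<r. gram_row n i (merge (cube {r} n) (cube {..<r} n) (x, y)) a b) = (\<Sum>i<r. gram_row n i y a b)"
      by (intro sum.cong refl) (simp add: gram_row_merge(2))
     moreover have "gram_row n r (merge (cube {r} n) (cube {..<r} n) (x, y)) a b = gram_row n r x a b"
      by (simp add: gram_row_merge(1))
     ultimately show "final_form n e (Suc r) N (merge (cube {r} n) (cube {..<r} n) (x, y)) a b =
      final_form n e r (next_form n e N (row_noise n r x)) y a b"
      by (simp add: final_form_def next_form_def gram_row_def add_divide_distrib distrib_right)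
    qed
    have sp: "merge (cube {r} n) (cube {..<r} n) (x, y) \<in> space (law (Suc r) n)"
     if "y \<in> space (law r n)" for y
     using x that by (auto simp: space_PiM PiE_def extensional_def merge_def cube_def less_Suc_eq)
    have "(\<integral>y. indicator F (merge (cube {r} n) (cube {..<r} n) (x, y)) \<partial>(law r n)) =
     (\<integral>y. indicator F' y \<partial>(law r n))"
     using sp by (intro Bochner_Integration.integral_cong refl) (auto simp: F_def F'_def ff indicator_def)
    also have "... = P r (next_form n e N (row_noise n r x))"
     unfolding P_def F'_def[symmetric] using F's by simp
    finally show "(\<integral>y. indicator F (merge (cube {r} n) (cube {..<r} n) (x, y)) \<partial>(law r n)) =
     P r (next_form n e N (row_noise n r x))" .
   qed
   also have "... <= (\<integral>x. W (row_noise n r x) \<partial>(gauss_on (cube {r} n)))"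
    using W(1,3) PW by (intro integral_mono' row_noise_integral) auto
   also have "... = (mean n (%g. W g))"
    using W(1) by (intro row_noise_integral) auto
   also have "... <= potential n b0 c0 C (Suc r) Q S" by (rule W(2))
   finally show ?thesis unfolding P_def e_def .
  qed
 }
qed

end

section \<open>The upper bound\<close>

context kron_coeffs
begin

text \<open>The form $s - A_D \otimes I - H^T H$; it is nonnegative iff $s$ bounds the largest eigenvalue.\<close>

definition gap_form :: "cmat => real => nat => nat => (nat \<times> nat \<times> nat => real) => kernel" where
 "gap_form D s n r \<omega> a b = s * of_bool (a = b) - tens D a b - (\<Sum>i<r. gram_row n i \<omega> a b)"

text \<open>The strict inequalities of the Dyson system with a common slack \<open>eps\<close>. The first conjunct says that
$1 - \epsilon - \sum A_i X A_i^T$ dominates $Y^{-1}$, and $C$ plays the part of $X^{-1}$.\<close>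

definition feasible :: "cmat => real => real => bool" where
 "feasible D \<alpha> s \<longleftrightarrow> (\<exists>X Y C eps. 0 < eps \<and> sym_on K2 X \<and> sym_on K1 Y \<and>
   (\<forall>x c. 2 * dot_on K1 x c <= quad_on K1 Y x + dot_on K1 c c
    - quad_on K1 (etaY X) c - eps * dot_on K1 c c) \<and>
   fenchel_on K2 C X \<and>
   (\<forall>v. quad_on K2 C v + \<alpha> * quad_on K2 (etaX Y) v + quad_on K2 D v <= (s - eps) * dot_on K2 v v))"

lemma gap_form_measurable:
 assumes "a \<in> idx n" "b \<in> idx n"
 shows "(%\<omega>. gap_form D s n r \<omega> a b) \<in> borel_measurable (law r n)"
 unfolding gap_form_def using assms
 by (intro borel_measurable_diff borel_measurable_const borel_measurable_sum gram_row_measurable) auto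

lemma dot_idx: "dot_on (idx n) x y = (\<Sum>j<n. dot_on K2 (%p. x (p, j)) (%p. y (p, j)))"
 unfolding dot_on_def sum_idx by (rule sum.swap)

lemma quad_sum_matrices: "quad_on I (%a b. \<Sum>i\<in>J. X i a b) x = (\<Sum>i\<in>J. quad_on I (X i) x)"
proof (cases "finite J")
 case True
 then show ?thesis
  by induction (simp_all add: quad_on_linear, simp add: quad_on_alt)
qed (simp add: quad_on_alt)

lemma quad_gram_row:
 "quad_on (idx n) (gram_row n i \<omega>) x = (\<Sum>q<k1. (dot_on (idx n) (row n (row_noise n i \<omega>) q) x)^2)"
 unfolding gram_row_def[abs_def] by (rule quad_on_gram)

lemma quad_gap_form:
 "quad_on (idx n) (gap_form D s n r \<omega>) x = s * dot_on (idx n) x x - (\<Sum>j<n. quad_on K2 D (%p. x (p, j)))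
   - (\<Sum>i<r. \<Sum>q<k1. (dot_on (idx n) (row n (row_noise n i \<omega>) q) x)^2)"
 unfolding gap_form_def[abs_def] quad_on_linear quad_of_bool[OF finite_idx] quad_tens quad_sum_matrices quad_gram_row ..

lemma quad_final_form:
 "quad_on (idx n) (final_form n e r (tens C) \<omega>) x = (\<Sum>j<n. quad_on K2 C (%p. x (p, j)))
   + real r / real n * (\<Sum>j<n. quad_on K2 e (%p. x (p, j)))
   - (\<Sum>i<r. \<Sum>q<k1. (dot_on (idx n) (row n (row_noise n i \<omega>) q) x)^2)"
proof -
 have "final_form n e r (tens C) \<omega> = (%a b. tens C a b + (real r / real n) * tens e a b - (\<Sum>i<r. gram_row n i \<omega> a b))"
  by (simp add: final_form_def fun_eq_iff)
 then show ?thesis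
  by (simp only: quad_on_linear quad_tens quad_sum_matrices quad_gram_row)
qed

lemma ptrace_tens:
 assumes "0 < n"
 shows "ptrace n (tens X) = X"
 using assms by (simp add: ptrace_def tens_def fun_eq_iff)

lemma frob_tens: "frob n (tens X) = real n * (\<Sum>p<k2. \<Sum>p'<k2. (X p p')^2)"
proof -
 have "frob n (tens X) = (\<Sum>p<k2. \<Sum>j<n. \<Sum>p'<k2. \<Sum>j'<n. if j' = j then (X p p')^2 else 0)"
  unfolding frob_def sum_idx tens_def by (intro sum.cong refl) auto
 also have "... = (\<Sum>p<k2. \<Sum>j<n. \<Sum>p'<k2. (X p p')^2)" by (intro sum.cong refl) simp
 finally show ?thesis by (simp add: sum_distrib_left)
qed

lemma sym_tens: "sym_on K2 X ==> sym_on (idx n) (tens X)"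
proof -
 assume X: "sym_on K2 X"
 show ?thesis
  unfolding sym_on_def
 proof (intro ballI)
  fix a b assume "a \<in> idx n" "b \<in> idx n"
  then have "X (fst a) (fst b) = X (fst b) (fst a)" by (intro sym_onD[OF X]) (auto simp: idx_def)
  then show "tens X a b = tens X b a" unfolding tens_def by (cases "snd a = snd b") auto
 qed
qed

text \<open>Start the process at $C \otimes I$ with dual matrix $X \otimes I$, whose partial trace is $X$: after \<open>m
n\<close> steps the form has been raised to at most $s - A_D \otimes I$, so it bounds the gap form from below.\<close>

theorem feasible_failure_tendsto_0:
 fixes m :: "nat => nat"
 assumes feas: "feasible D \<alpha> s" and m: "(%n. real (m n) / real n) \<longlonglongrightarrow> \<alpha>"
 shows "(%n. measure (law (m n) n) {\<omega> \<in> space (law (m n) n).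
   \<exists>x. quad_on (idx n) (gap_form D s n (m n) \<omega>) x < 0}) \<longlonglongrightarrow> 0"
proof -
 have \<alpha>0: "0 <= \<alpha>" using m by (rule LIMSEQ_le_const) auto
 obtain X Y C0 eps where eps: "0 < eps" and X: "sym_on K2 X" and Y: "sym_on K1 Y"
  and f1: "!!x c. 2 * dot_on K1 x c <= quad_on K1 Y x + dot_on K1 c c
    - quad_on K1 (etaY X) c - eps * dot_on K1 c c"
  and f2: "fenchel_on K2 C0 X"
  and f3: "!!v. quad_on K2 C0 v + \<alpha> * quad_on K2 (etaX Y) v + quad_on K2 D v <= (s - eps) * dot_on K2 v v"
  using feas unfolding feasible_def by blast
 have zero: "dot_on I x (%_. 0) = 0" "dot_on I (%_. 0) x = 0" "quad_on I Z (%_. 0) = 0" for I :: "nat set" and x Z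
  by (simp_all add: dot_on_def quad_on_alt)
 have Ypsd: "psd_on K1 Y"
  unfolding psd_on_def using f1[of _ "%_. 0"] by (simp add: zero)
 have Xpsd: "psd_on K2 X"
  unfolding psd_on_def
 proof
  fix y show "0 <= quad_on K2 X y"
   using f2[unfolded fenchel_on_def, rule_format, of "%_. 0" y] by (simp add: zero)
 qed
 (* half of the slack pays for the extra delta in the shift over all rows, the other half for the deviation of m/n from its limit *)
 define \<delta> where "\<delta> = eps / (2 * (\<alpha> + 1))"
 define \<theta> where "\<theta> = eps / (2 * ((real k1)^2 + 1))"
 define b0 where "b0 = 4 * (sumsq Y * sigma_const) / \<delta>"
 define c0 where "c0 = (2 * normA * real k2)^2 / eps^2"
 define C where "C = c0 * ((real k2)^2 * (sumabs Y)^2 * sigma_const) + (real k1)^2 * (400 * normA ^ 4) / \<theta> ^ 4"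
 define e where "e = (%p p'. etaX Y p p' + \<delta> * of_bool (p = p'))"
 define c1 where "c1 = (\<Sum>p<k2. \<Sum>p'<k2. \<bar>etaX Y p p'\<bar>)"
 have \<delta>: "0 < \<delta>" using eps \<alpha>0 by (simp add: \<delta>_def)
 have k1p: "0 < (real k1)^2 + 1" by (smt (verit) zero_le_power2)
 have \<theta>: "0 < \<theta>" using eps k1p by (simp add: \<theta>_def)
 have sq0: "0 <= sumsq Y" by (auto simp: sumsq_def intro!: sum_nonneg)
 have b00: "0 <= b0" using \<delta> sigma_const_nonneg sq0 by (simp add: b0_def)
 have c00: "0 <= c0" by (simp add: c0_def)
 have c10: "0 <= c1" unfolding c1_def by (intro sum_nonneg) auto
 define V where "V = (%n. (4 * ln (1 + (\<Sum>p<k2. \<Sum>p'<k2. (X p p')^2)) + b0 * (\<Sum>p<k2. X p p)) / ln (real n)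
   + real (m n) / real n * (C / sqrt (real n)))"
 have bound: "measure (law (m n) n) {\<omega> \<in> space (law (m n) n).
   \<exists>x. quad_on (idx n) (gap_form D s n (m n) \<omega>) x < 0} <= V n"
  if n: "1 < n" and close: "\<bar>real (m n) / real n - \<alpha>\<bar> * c1 <= eps / 2" "real (m n) / real n <= \<alpha> + 1" for n
 proof -
  define r where "r = m n"
  define F where "F = {\<omega> \<in> space (law r n). \<exists>x. quad_on (idx n) (final_form n e r (tens C0) \<omega>) x < 0}"
  interpret P: prob_space "law r n" by (rule prob_space_gauss_on)
  have le: "quad_on (idx n) (final_form n e r (tens C0) \<omega>) x <= quad_on (idx n) (gap_form D s n r \<omega>) x" for \<omega> x
  proof -
   have "quad_on K2 C0 v + real r / real n * quad_on K2 e v <= s * dot_on K2 v v - quad_on K2 D v" for v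
   proof -
    define d where "d = dot_on K2 v v"
    define h where "h = quad_on K2 (etaX Y) v"
    have d: "0 <= d" unfolding d_def by (rule dot_on_nonneg)
    have qe: "quad_on K2 e v = h + \<delta> * d"
     unfolding e_def quad_on_linear d_def h_def quad_of_bool[OF finite_lessThan] ..
    have "\<bar>h\<bar> <= c1 * d" unfolding h_def d_def c1_def by (rule abs_quad_on_le) simp
    then have "\<bar>real r / real n - \<alpha>\<bar> * \<bar>h\<bar> <= \<bar>real r / real n - \<alpha>\<bar> * (c1 * d)" by (rule mult_left_mono) simp
    also have "... = \<bar>real r / real n - \<alpha>\<bar> * c1 * d" by simp
    also have "... <= eps / 2 * d" using close(1) d unfolding r_def by (rule mult_right_mono)
    finally have "(real r / real n - \<alpha>) * h <= eps / 2 * d" by (simp add: abs_mult[symmetric])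
    moreover have "real r / real n * (\<delta> * d) <= (\<alpha> + 1) * (\<delta> * d)"
     using close(2) \<delta> d unfolding r_def by (intro mult_right_mono) auto
    moreover have "(\<alpha> + 1) * (\<delta> * d) = eps / 2 * d" using \<alpha>0 by (simp add: \<delta>_def field_simps)
    ultimately show ?thesis using f3[of v]
     unfolding qe d_def[symmetric] h_def[symmetric] distrib_left left_diff_distrib by linarith
   qed
   then have "(\<Sum>j<n. quad_on K2 C0 (%p. x (p, j)) + real r / real n * quad_on K2 e (%p. x (p, j)))
    <= (\<Sum>j<n. s * dot_on K2 (%p. x (p, j)) (%p. x (p, j)) - quad_on K2 D (%p. x (p, j)))"
    by (rule sum_mono)
   then show ?thesis unfolding quad_final_form quad_gap_form dot_idx
    by (simp add: sum.distrib sum_subtractf sum_distrib_left)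
  qed
  have "measure (law r n) {\<omega> \<in> space (law r n).
   \<exists>x. quad_on (idx n) (gap_form D s n r \<omega>) x < 0} <= measure (law r n) F"
  proof (rule P.finite_measure_mono)
   show "{\<omega> \<in> space (law r n). \<exists>x. quad_on (idx n) (gap_form D s n r \<omega>) x < 0} \<subseteq> F"
   proof
    fix \<omega> assume "\<omega> \<in> {\<omega> \<in> space (law r n). \<exists>x. quad_on (idx n) (gap_form D s n r \<omega>) x < 0}"
    then obtain x where "\<omega> \<in> space (law r n)" "quad_on (idx n) (gap_form D s n r \<omega>) x < 0" by blast
    then show "\<omega> \<in> F" using le_less_trans[OF le] unfolding F_def by blast
   qed
   show "F \<in> sets (law r n)"
    unfolding F_def by (intro negative_direction_measurable final_form_measurable) auto
  qed
  also have "... <= potential n b0 c0 C r (tens X) (%_ _. 0)"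
   unfolding F_def e_def
  proof (rule failure_probability_le_potential[OF n Y Ypsd \<delta> \<theta> b00 c00 f1])
   show "4 * (sumsq Y * sigma_const) <= b0 * \<delta>" using \<delta> by (simp add: b0_def)
   have "\<theta> * (real k1)^2 <= \<theta> * ((real k1)^2 + 1)" using \<theta> by simp
   also have "... = eps / 2" using k1p by (simp add: \<theta>_def field_simps)
   finally show "\<theta> * (real k1)^2 <= eps / 2" .
   show "(2 * normA * real k2)^2 <= eps^2 * c0" using eps by (simp add: c0_def)
   show "sym_on (idx n) (tens X)" by (rule sym_tens[OF X])
   show "psd_on (idx n) (tens X)"
    using Xpsd unfolding psd_on_def quad_tens by (auto intro: sum_nonneg)
   show "fenchel_on (idx n) (tens C0) (tens X)"
    unfolding fenchel_on_def quad_tens dot_idx sum_distrib_left sum.distrib[symmetric]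
    using f2[unfolded fenchel_on_def] by (intro allI sum_mono) blast
   show "quad_on K2 (ptrace n (tens X)) v <= quad_on K2 X v + quad_on K2 (%_ _. 0) v" for v
    using n by (simp add: ptrace_tens) (simp add: quad_on_alt)
  qed (use eps C_def in auto)
  also have "... = V n"
  proof -
   have "ptr n (tens X) = (\<Sum>p<k2. X p p)" using n by (simp add: ptr_def ptrace_tens)
   then show ?thesis using n by (simp add: potential_def V_def frob_tens r_def)
  qed
  finally show ?thesis unfolding r_def .
 qed
 have V: "V \<longlonglongrightarrow> 0"
 proof -
  have 1: "(%n. K / ln (real n)) \<longlonglongrightarrow> 0" for K
   by (intro tendsto_divide_0[OF tendsto_const] filterlim_at_top_imp_at_infinity
     filterlim_compose[OF ln_at_top filterlim_real_sequentially])
  have 2: "(%n. C / sqrt (real n)) \<longlonglongrightarrow> 0"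
   by (intro tendsto_divide_0[OF tendsto_const] filterlim_at_top_imp_at_infinity
     filterlim_compose[OF sqrt_at_top filterlim_real_sequentially])
  show ?thesis unfolding V_def using tendsto_add[OF 1 tendsto_mult[OF m 2]] by simp
 qed
 have "(%n. \<bar>real (m n) / real n - \<alpha>\<bar> * c1) \<longlonglongrightarrow> \<bar>\<alpha> - \<alpha>\<bar> * c1"
  by (intro tendsto_intros m)
 then have "\<forall>\<^sub>F n in sequentially. \<bar>real (m n) / real n - \<alpha>\<bar> * c1 < eps / 2"
  using eps by (intro order_tendstoD(2)) auto
 moreover have "\<forall>\<^sub>F n in sequentially. real (m n) / real n < \<alpha> + 1"
  using m by (rule order_tendstoD) simp
 ultimately have "\<forall>\<^sub>F n in sequentially. measure (law (m n) n) {\<omega> \<in> space (law (m n) n).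
   \<exists>x. quad_on (idx n) (gap_form D s n (m n) \<omega>) x < 0} <= V n"
  using eventually_gt_at_top[of 1]
 proof eventually_elim
  case (elim n)
  show ?case by (rule bound[OF elim(3) less_imp_le[OF elim(1)] less_imp_le[OF elim(2)]])
 qed
 then show ?thesis
  by (intro tendsto_sandwich[OF _ _ tendsto_const V]) auto
qed

end

section \<open>Inverses of coercive matrices and leaving one row out\<close>

lemma dot_on_cauchy: "(dot_on I x y)^2 <= dot_on I x x * dot_on I y y"
 unfolding dot_on_def power2_eq_square[symmetric] by (rule Cauchy_Schwarz_ineq_sum)

lemma dot_on_zero_iff: "finite I ==> dot_on I x x = 0 \<longleftrightarrow> (\<forall>a\<in>I. x a = 0)"
 by (simp add: dot_on_def sum_nonneg_eq_0_iff)

lemma app_on_cong: "(!!b. b \<in> I ==> x b = y b) ==> app_on I X x = app_on I X y"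
 by (simp add: app_on_def)

context
 fixes I :: "'a set" and N :: "'a => 'a => real" and eps :: real
 assumes I: "finite I" and N: "sym_on I N" and eps: "0 < eps"
  and coercive: "!!x. eps * dot_on I x x <= quad_on I N x"
begin

lemma coercive_kernel: "(!!a. a \<in> I ==> app_on I N x a = 0) ==> \<forall>a\<in>I. x a = 0"
proof -
 assume "!!a. a \<in> I ==> app_on I N x a = 0"
 then have "quad_on I N x = 0" unfolding quad_on_def dot_on_def by simp
 then have "eps * dot_on I x x <= 0" using coercive[of x] by simp
 then have "dot_on I x x = 0" using eps dot_on_nonneg[of I x] by (simp add: mult_le_0_iff)
 then show ?thesis using dot_on_zero_iff[OF I] by blast
qed

lemma coercive_inv_app:
 "a \<in> I ==> app_on I N (app_on I (inv_on I N) y) a = y a"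
 "a \<in> I ==> app_on I (inv_on I N) (app_on I N y) a = y a"
 using app_on_inv_on[OF I coercive_kernel] by blast+

lemma coercive_inv_sym: "sym_on I (inv_on I N)"
proof (rule sym_on_of_dot[OF I])
 fix x y
 define R where "R = inv_on I N"
 have "dot_on I x (app_on I R y) = dot_on I (app_on I N (app_on I R x)) (app_on I R y)"
  by (rule dot_on_cong) (auto simp: R_def coercive_inv_app)
 also have "... = dot_on I (app_on I R x) (app_on I N (app_on I R y))"
  by (rule dot_on_app_sym[OF N, symmetric])
 also have "... = dot_on I (app_on I R x) y"
  by (rule dot_on_cong) (auto simp: R_def coercive_inv_app)
 finally show "dot_on I x (app_on I (inv_on I N) y) = dot_on I (app_on I (inv_on I N) x) y"
  by (simp add: R_def)
qed

lemma quad_coercive_inv: "quad_on I (inv_on I N) y = quad_on I N (app_on I (inv_on I N) y)"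
proof -
 have "quad_on I N (app_on I (inv_on I N) y) = dot_on I (app_on I (inv_on I N) y) y"
  unfolding quad_on_def by (rule dot_on_cong) (auto simp: coercive_inv_app)
 then show ?thesis by (simp add: quad_on_def dot_on_commute)
qed

lemma coercive_inv_bound:
 "eps^2 * dot_on I (app_on I (inv_on I N) y) (app_on I (inv_on I N) y) <= dot_on I y y"
proof -
 define u where "u = app_on I (inv_on I N) y"
 have "eps * dot_on I u u <= quad_on I (inv_on I N) y"
  unfolding quad_coercive_inv u_def by (rule coercive)
 also have "... = dot_on I y u" by (simp add: quad_on_def u_def)
 finally have le: "eps * dot_on I u u <= dot_on I y u" .
 have "0 <= dot_on I (%a. y a - eps * u a) (%a. y a - eps * u a)" by (rule dot_on_nonneg)
 then have "0 <= dot_on I y y - 2 * (eps * dot_on I y u) + eps * (eps * dot_on I u u)"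
  by (simp add: dot_on_linear dot_on_commute[of I u y])
 moreover have "eps * (eps * dot_on I u u) <= eps * dot_on I y u" using le eps by (intro mult_left_mono) auto
 ultimately have "eps * dot_on I y u <= dot_on I y y" by linarith
 then show ?thesis using \<open>eps * (eps * dot_on I u u) <= eps * dot_on I y u\<close>
  by (simp add: u_def power2_eq_square)
qed

lemma coercive_inv_psd: "psd_on I (inv_on I N)"
 unfolding psd_on_def
proof
 fix y
 have "0 <= eps * dot_on I (app_on I (inv_on I N) y) (app_on I (inv_on I N) y)"
  using eps dot_on_nonneg by (intro mult_nonneg_nonneg) auto
 then show "0 <= quad_on I (inv_on I N) y" unfolding quad_coercive_inv using coercive by (rule order.trans)
qed

lemma coercive_inv_lower:
 assumes "0 < \<kappa>" "!!x. quad_on I N x <= \<kappa> * dot_on I x x"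
 shows "dot_on I y y <= \<kappa> * quad_on I (inv_on I N) y"
proof -
 define u where "u = app_on I (inv_on I N) y"
 define z where "z = (%a. y a / \<kappa>)"
 have zz: "z = (%a. (1 / \<kappa>) * y a)" by (simp add: z_def)
 have Nu: "dot_on I z (app_on I N u) = dot_on I y y / \<kappa>"
 proof -
  have "dot_on I z (app_on I N u) = dot_on I z y"
   by (rule dot_on_cong) (auto simp: u_def coercive_inv_app)
  then show ?thesis unfolding zz dot_on_linear by simp
 qed
 have "0 <= quad_on I N (%a. u a - z a)"
  using coercive[of "%a. u a - z a"] eps dot_on_nonneg[of I "%a. u a - z a"]
  by (meson mult_nonneg_nonneg less_imp_le order.trans)
 also have "... = quad_on I N u - 2 * dot_on I z (app_on I N u) + quad_on I N z"
  unfolding quad_on_def app_on_linear dot_on_linear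
  using dot_on_app_sym[OF N, of u z] dot_on_commute[of I "app_on I N u" z] by linarith
 also have "quad_on I N z <= \<kappa> * dot_on I z z" by (rule assms(2))
 also have "\<kappa> * dot_on I z z = dot_on I y y / \<kappa>"
  unfolding zz dot_on_linear using assms(1) by simp
 finally have "dot_on I y y / \<kappa> <= quad_on I N u"
  unfolding Nu by simp
 then have "dot_on I y y / \<kappa> <= quad_on I (inv_on I N) y"
  unfolding quad_coercive_inv u_def .
 then show ?thesis using assms(1) by (simp add: field_simps)
qed

lemma coercive_inv_column:
 assumes "b \<in> I"
 shows "eps^2 * (\<Sum>a\<in>I. (inv_on I N a b)^2) <= 1"
proof -
 define u where "u = (%c. of_bool (c = b) :: real)"
 have "app_on I (inv_on I N) u a = inv_on I N a b" for a
 proof -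
  have "app_on I (inv_on I N) u a = (\<Sum>c\<in>I. if c = b then inv_on I N a b else 0)"
   unfolding app_on_def u_def by (intro sum.cong) auto
  then show ?thesis using I assms by simp
 qed
 moreover have "dot_on I u u = 1"
 proof -
  have "dot_on I u u = (\<Sum>c\<in>I. if c = b then 1 else 0)"
   unfolding dot_on_def u_def by (intro sum.cong) auto
  then show ?thesis using I assms by simp
 qed
 ultimately show ?thesis
  using coercive_inv_bound[of u] by (simp add: dot_on_def power2_eq_square)
qed

end

text \<open>Let $N' = N + h^T h$ be the form without one group of rows, with inverse $R'$. Then $h R = (1 + h R h^T)\, h R'$
and $1 + h R h^T = (1 - h R' h^T)^{-1}$; the last claim is the half of the second identity that is used, in dual
form.\<close>

lemma leave_one_out:
 fixes h :: "'q => 'a => real"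
 assumes I: "finite I" and K: "finite K" and N: "sym_on I N" and eps: "0 < eps"
  and coercive: "!!x. eps * dot_on I x x <= quad_on I N x"
 defines "N' \<equiv> %a b. N a b + (\<Sum>q\<in>K. h q a * h q b)"
 defines "R \<equiv> inv_on I N" and "R' \<equiv> inv_on I N'"
 defines "\<beta> \<equiv> %q q'. dot_on I (h q) (app_on I R (h q'))" and "\<alpha> \<equiv> %q q'. dot_on I (h q) (app_on I R' (h q'))"
 shows "sym_on I N'" "!!x. eps * dot_on I x x <= quad_on I N' x"
  and "!!y a. a \<in> I ==> app_on I R y a = app_on I R' y a + (\<Sum>q\<in>K. dot_on I (h q) (app_on I R' y) * app_on I R (h q) a)"
  and "!!q y. q \<in> K ==> dot_on I (h q) (app_on I R y) = (\<Sum>q'\<in>K. (of_bool (q = q') + \<beta> q q') * dot_on I (h q') (app_on I R' y))"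
  and "!!x c. 2 * dot_on K x c <= quad_on K (%q q'. of_bool (q = q') + \<beta> q q') x + dot_on K c c - quad_on K \<alpha> c"
proof -
 show N'sym: "sym_on I N'"
  unfolding sym_on_def N'_def
 proof (intro ballI)
  fix a b assume "a \<in> I" "b \<in> I"
  then have "N a b = N b a" by (rule sym_onD[OF N])
  then show "N a b + (\<Sum>q\<in>K. h q a * h q b) = N b a + (\<Sum>q\<in>K. h q b * h q a)" by (simp add: mult.commute)
 qed
 have quadN': "quad_on I N' x = quad_on I N x + (\<Sum>q\<in>K. (dot_on I (h q) x)^2)" for x
  unfolding N'_def quad_on_linear quad_on_gram ..
 show N'co: "eps * dot_on I x x <= quad_on I N' x" for x
  unfolding quadN' using coercive[of x] by (simp add: add_increasing2 sum_nonneg)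
 have appN': "app_on I N' z a = app_on I N z a + (\<Sum>q\<in>K. dot_on I (h q) z * h q a)" for z a
 proof -
  have "app_on I (%a b. \<Sum>q\<in>K. h q a * h q b) z a = (\<Sum>b\<in>I. \<Sum>q\<in>K. h q a * h q b * z b)"
   by (simp add: app_on_def sum_distrib_right)
  also have "... = (\<Sum>q\<in>K. \<Sum>b\<in>I. h q a * h q b * z b)" by (rule sum.swap)
  also have "... = (\<Sum>q\<in>K. dot_on I (h q) z * h q a)"
   by (intro sum.cong refl) (simp add: dot_on_def sum_distrib_left sum_distrib_right ac_simps)
  finally show ?thesis unfolding N'_def app_on_linear by simp
 qed
 show loo: "app_on I R y a = app_on I R' y a + (\<Sum>q\<in>K. dot_on I (h q) (app_on I R' y) * app_on I R (h q) a)"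
  if "a \<in> I" for y a
 proof -
  define z where "z = app_on I R' y"
  have y: "y b = app_on I N z b + (\<Sum>q\<in>K. dot_on I (h q) z * h q b)" if "b \<in> I" for b
   unfolding appN'[symmetric] z_def R'_def
   by (rule coercive_inv_app(1)[OF I N'sym eps N'co that, symmetric])
  have "app_on I R y a = app_on I R (%b. app_on I N z b + (\<Sum>q\<in>K. dot_on I (h q) z * h q b)) a"
   by (rule fun_cong[OF app_on_cong]) (rule y)
  also have "... = z a + (\<Sum>q\<in>K. dot_on I (h q) z * app_on I R (h q) a)"
   unfolding app_on_linear app_on_sum R_def coercive_inv_app(2)[OF I N eps coercive that] ..
  finally show ?thesis by (simp add: z_def)
 qed
 show hR: "dot_on I (h q) (app_on I R y) = (\<Sum>q'\<in>K. (of_bool (q = q') + \<beta> q q') * dot_on I (h q') (app_on I R' y))"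
  if "q \<in> K" for q y
 proof -
  define t where "t = (%q. dot_on I (h q) (app_on I R' y))"
  have "dot_on I (h q) (app_on I R y) = dot_on I (h q) (%a. app_on I R' y a + (\<Sum>q'\<in>K. t q' * app_on I R (h q') a))"
   unfolding t_def by (rule dot_on_cong) (auto intro: loo)
  also have "... = t q + (\<Sum>q'\<in>K. t q' * \<beta> q q')"
   unfolding dot_on_linear dot_on_sum_right \<beta>_def t_def ..
  also have "t q = (\<Sum>q'\<in>K. if q' = q then t q' else 0)" using K that by simp
  also have "... + (\<Sum>q'\<in>K. t q' * \<beta> q q') = (\<Sum>q'\<in>K. (of_bool (q = q') + \<beta> q q') * t q')"
   unfolding sum.distrib[symmetric] by (intro sum.cong refl) (auto simp: algebra_simps)
  finally show ?thesis by (simp add: t_def)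
 qed
 have \<beta>sym: "sym_on K \<beta>"
  unfolding sym_on_def \<beta>_def
  using dot_on_app_sym[OF coercive_inv_sym[OF I N eps coercive]] unfolding R_def
  by (metis dot_on_commute)
 have \<beta>psd: "0 <= quad_on K \<beta> x" for x
 proof -
  have "quad_on K \<beta> x = quad_on I R (%a. \<Sum>q\<in>K. x q * h q a)"
   unfolding quad_on_def[of I] app_on_sum dot_on_sum_left dot_on_sum_right
   by (simp add: quad_on_def dot_on_def[of K] app_on_def[of K] \<beta>_def mult.commute)
  then show ?thesis using coercive_inv_psd[OF I N eps coercive] by (simp add: R_def psd_on_def)
 qed
 define Y where "Y = (%q q'. of_bool (q = q') + \<beta> q q')"
 have Ysym: "sym_on K Y"
  using sym_onD[OF \<beta>sym] unfolding sym_on_def Y_def by (auto simp: of_bool_def)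
 have appY: "app_on K Y t q = t q + app_on K \<beta> t q" if "q \<in> K" for t q
 proof -
  have "app_on K (%q q'. of_bool (q = q')) t q = (\<Sum>q'\<in>K. if q' = q then t q else 0)"
   unfolding app_on_def by (intro sum.cong) auto
  then show ?thesis using K that unfolding Y_def app_on_linear by simp
 qed
 have quadY: "0 <= quad_on K Y x" for x
 proof -
  have "quad_on K Y x = dot_on K x x + quad_on K \<beta> x"
   unfolding Y_def quad_on_linear using K
   by (simp add: quad_on_alt dot_on_def of_bool_def if_distrib if_distribR cong: if_cong)
  then show ?thesis using \<beta>psd[of x] dot_on_nonneg[of K x] by simp
 qed
 have \<beta>eq: "\<beta> q q' = (\<Sum>q''\<in>K. Y q q'' * \<alpha> q'' q')" if "q \<in> K" for q q'
  unfolding Y_def \<alpha>_def using hR[OF that, of "h q'"] by (simp only: \<beta>_def)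
 have inv: "app_on K Y (%q. c q - app_on K \<alpha> c q) q = c q" if "q \<in> K" for c q
 proof -
  have "app_on K Y (app_on K \<alpha> c) q = app_on K (mul_on K Y \<alpha>) c q" by (simp add: app_on_mul)
  also have "... = app_on K \<beta> c q" unfolding app_on_def mul_on_def using \<beta>eq[OF that] by simp
  finally show ?thesis unfolding app_on_linear appY[OF that] by simp
 qed
 show "2 * dot_on K x c <= quad_on K (%q q'. of_bool (q = q') + \<beta> q q') x + dot_on K c c - quad_on K \<alpha> c" for x c
 proof -
  define z where "z = (%q. c q - app_on K \<alpha> c q)"
  have xz: "dot_on K x (app_on K Y z) = dot_on K x c"
   unfolding z_def by (rule dot_on_cong[OF refl inv])
  have zz: "quad_on K Y z = dot_on K z c"
   unfolding quad_on_def z_def by (rule dot_on_cong[OF refl inv])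
  have zc: "dot_on K z c = dot_on K c c - quad_on K \<alpha> c"
   unfolding z_def dot_on_linear quad_on_def by (simp add: dot_on_commute)
  have "0 <= quad_on K Y (%q. x q - z q)" by (rule quadY)
  also have "... = quad_on K Y x - 2 * dot_on K x (app_on K Y z) + quad_on K Y z"
   unfolding quad_on_def app_on_linear dot_on_linear
   using dot_on_app_sym[OF Ysym, of z x] dot_on_commute[of K "app_on K Y z" x] by linarith
  finally show ?thesis unfolding xz zz zc Y_def[symmetric] by linarith
 qed
qed

section \<open>The lower bound\<close>

context kron_coeffs
begin

definition hsq :: "nat => (nat \<times> nat => real) => real" where
 "hsq n g = (\<Sum>q<k1. dot_on (idx n) (row n g q) (row n g q))"

text \<open>The row form of this kernel is $\sum_j h_q(p, j)\,(R h_{q'})(p', j)$, which is how one group of rows enters the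
partial trace of $H^T H R$.\<close>

definition side :: "nat => nat => kernel => kernel" where
 "side p p' R a b = of_bool (fst a = p) * R b (p', snd a)"

definition form_err :: "nat => (nat \<times> nat => real) => kernel => nat => nat => real" where
 "form_err n g M q q' = rform n g q q' M - etaY (ptrace n M) q q'"

definition omit_form :: "cmat => real => nat => nat => nat => (nat \<times> nat \<times> nat => real) => kernel" where
 "omit_form D s n r i \<omega> a b = s * of_bool (a = b) - tens D a b - (\<Sum>i'\<in>{..<r} - {i}. gram_row n i' \<omega> a b)"

lemma hsq_nonneg: "0 <= hsq n g"
 unfolding hsq_def by (intro sum_nonneg dot_on_nonneg)

lemma dot_row_le_hsq: "q < k1 ==> dot_on (idx n) (row n g q) (row n g q) <= hsq n g"
 unfolding hsq_def by (rule member_le_sum) (auto intro: dot_on_nonneg)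

lemma sym_gap_form: "sym_on K2 D ==> sym_on (idx n) (gap_form D s n r \<omega>)"
proof -
 assume D: "sym_on K2 D"
 show ?thesis
  unfolding sym_on_def
 proof (intro ballI)
  fix a b assume ab: "a \<in> idx n" "b \<in> idx n"
  have "tens D a b = tens D b a" by (rule sym_onD[OF sym_tens[OF D] ab])
  moreover have "gram_row n i \<omega> a b = gram_row n i \<omega> b a" for i
   by (simp add: gram_row_def mult.commute)
  ultimately show "gap_form D s n r \<omega> a b = gap_form D s n r \<omega> b a"
   by (simp add: gap_form_def of_bool_def)
 qed
qed

lemma omit_form_eq:
 "i < r ==> omit_form D s n r i \<omega> = (%a b. gap_form D s n r \<omega> a b +
   (\<Sum>q<k1. row n (row_noise n i \<omega>) q a * row n (row_noise n i \<omega>) q b))"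
proof (intro ext)
 fix a b assume i: "i < r"
 have "(\<Sum>i'<r. gram_row n i' \<omega> a b) = gram_row n i \<omega> a b + (\<Sum>i'\<in>{..<r} - {i}. gram_row n i' \<omega> a b)"
  using i by (intro sum.remove) auto
 then show "omit_form D s n r i \<omega> a b = gap_form D s n r \<omega> a b +
   (\<Sum>q<k1. row n (row_noise n i \<omega>) q a * row n (row_noise n i \<omega>) q b)"
  by (simp add: omit_form_def gap_form_def gram_row_def[of n i])
qed

lemma app_on_column: "finite I ==> b \<in> I ==> app_on I R (%c. of_bool (c = b)) a = R a b"
proof -
 assume "finite I" "b \<in> I"
 moreover have "app_on I R (%c. of_bool (c = b)) a = (\<Sum>c\<in>I. if c = b then R a b else 0)"
  unfolding app_on_def by (intro sum.cong) auto
 ultimately show ?thesis by simp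
qed

lemma etaY_diff: "etaY X q q' - etaY X' q q' = etaY (%p p'. X p p' - X' p p') q q'"
 by (simp add: etaY_def right_diff_distrib sum_subtractf)

lemma rform_side:
 assumes R: "sym_on (idx n) R" and p: "p < k2" "p' < k2"
 shows "rform n g q q' (side p p' R) = (\<Sum>j<n. row n g q (p, j) * app_on (idx n) R (row n g q') (p', j))"
proof -
 define f where "f = (%a. \<Sum>b\<in>idx n. side p p' R a b * row n g q a * row n g q' b)"
 have "rform n g q q' (side p p' R) = (\<Sum>p1<k2. \<Sum>j<n. f (p1, j))"
  unfolding rform_def f_def[symmetric] by (rule sum_idx)
 also have "... = (\<Sum>p1<k2. if p1 = p then (\<Sum>j<n. \<Sum>b\<in>idx n. R b (p', j) * row n g q (p, j) * row n g q' b) else 0)"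
  unfolding f_def side_def by (intro sum.cong refl) (auto intro!: sum.cong sum.neutral)
 also have "... = (\<Sum>j<n. \<Sum>b\<in>idx n. R b (p', j) * row n g q (p, j) * row n g q' b)" using p by simp
 also have "... = (\<Sum>j<n. \<Sum>b\<in>idx n. row n g q (p, j) * (R (p', j) b * row n g q' b))"
 proof (intro sum.cong refl)
  fix j b assume "j \<in> {..<n}" "b \<in> idx n"
  then have "R b (p', j) = R (p', j) b" using p by (intro sym_onD[OF R]) (auto simp: idx_def)
  then show "R b (p', j) * row n g q (p, j) * row n g q' b = row n g q (p, j) * (R (p', j) b * row n g q' b)" by simp
 qed
 finally show ?thesis by (simp add: app_on_def sum_distrib_left)
qed

lemma etaY_ptrace_side:
 assumes R: "sym_on (idx n) R" and p: "p < k2" "p' < k2"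
 shows "etaY (ptrace n (side p p' R)) q q' = (\<Sum>p2<k2. cov q p q' p2 * ptrace n R p2 p')"
proof -
 have "ptrace n (side p p' R) p1 p2 = of_bool (p1 = p) * ptrace n R p2 p'" for p1 p2
  by (simp add: ptrace_def side_def)
 then have "etaY (ptrace n (side p p' R)) q q' = (\<Sum>p1<k2. if p1 = p then (\<Sum>p2<k2. cov q p q' p2 * ptrace n R p2 p') else 0)"
  unfolding etaY_def by (intro sum.cong refl) auto
 then show ?thesis using p by simp
qed

lemma frob_side_le: "p' < k2 ==> frob n (side p p' R) <= frob n R"
proof -
 assume p': "p' < k2"
 have "frob n (side p p' R) <= (\<Sum>j<n. \<Sum>b\<in>idx n. (R b (p', j))^2)"
 proof -
  define f where "f = (%a. \<Sum>b\<in>idx n. (side p p' R a b)^2)"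
  have "frob n (side p p' R) = (\<Sum>p1<k2. \<Sum>j<n. f (p1, j))"
   unfolding frob_def f_def[symmetric] by (rule sum_idx)
  also have "... = (\<Sum>p1<k2. if p1 = p then (\<Sum>j<n. \<Sum>b\<in>idx n. (R b (p', j))^2) else 0)"
   unfolding f_def side_def by (intro sum.cong refl) (auto intro!: sum.cong sum.neutral)
  also have "... <= (\<Sum>j<n. \<Sum>b\<in>idx n. (R b (p', j))^2)"
   by (auto intro!: sum_nonneg)
  finally show ?thesis .
 qed
 also have "... = (\<Sum>b\<in>idx n. \<Sum>j<n. (R b (p', j))^2)" by (rule sum.swap)
 also have "... <= frob n R"
  unfolding frob_def
 proof (rule sum_mono)
  fix b
  show "(\<Sum>j<n. (R b (p', j))^2) <= (\<Sum>c\<in>idx n. (R b c)^2)"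
   unfolding sum_idx[of "%c. (R b c)^2"]
   using p' by (intro member_le_sum[of p' "K2" "%p. \<Sum>j<n. (R b (p, j))^2"]) (auto intro: sum_nonneg)
 qed
 finally show ?thesis .
qed

text \<open>Removing one group of rows changes the partial trace of the resolvent only by $O(1/n)$, because the change has
bounded rank and the resolvent is at most $1/\epsilon$.\<close>

lemma leave_row_out:
 fixes \<omega> :: "nat \<times> nat \<times> nat => real"
 assumes n: "0 < n" and i: "i < r" and D: "sym_on K2 D" and eps: "0 < eps"
  and co: "!!x. eps * dot_on (idx n) x x <= quad_on (idx n) (gap_form D s n r \<omega>) x"
 defines "R \<equiv> inv_on (idx n) (gap_form D s n r \<omega>)" and "R' \<equiv> inv_on (idx n) (omit_form D s n r i \<omega>)"
  and "g \<equiv> row_noise n i \<omega>"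
 defines "\<beta> \<equiv> %q q'. of_bool (q = q') + dot_on (idx n) (row n g q) (app_on (idx n) R (row n g q'))"
  and "w \<equiv> 1 + hsq n g / eps"
 shows "sym_on (idx n) (omit_form D s n r i \<omega>)" "!!x. eps * dot_on (idx n) x x <= quad_on (idx n) (omit_form D s n r i \<omega>) x"
  and "sym_on (idx n) R'" "sym_on K1 \<beta>"
  and "!!q q'. q < k1 ==> q' < k1 ==> \<bar>\<beta> q q'\<bar> <= w"
  and "!!p p'. p < k2 ==> p' < k2 ==> \<bar>ptrace n R' p p' - ptrace n R p p'\<bar> <= w / (real n * eps)"
  and "!!q b. q < k1 ==> b \<in> idx n ==> app_on (idx n) R (row n g q) b = (\<Sum>q'<k1. \<beta> q q' * app_on (idx n) R' (row n g q') b)"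
  and "!!x c. 2 * dot_on K1 x c <= quad_on K1 \<beta> x + dot_on K1 c c - quad_on K1 (%q q'. rform n g q q' R') c"
proof -
 note N = sym_gap_form[OF D, of n s r \<omega>]
 have om: "omit_form D s n r i \<omega> = (%a b. gap_form D s n r \<omega> a b + (\<Sum>q<k1. row n g q a * row n g q b))"
  unfolding g_def by (rule omit_form_eq[OF i])
 note L = leave_one_out[OF finite_idx finite_lessThan[of k1] N eps co, where h = "row n g", folded om, folded R_def R'_def]
 show N': "sym_on (idx n) (omit_form D s n r i \<omega>)" by (rule L(1))
 show co': "eps * dot_on (idx n) x x <= quad_on (idx n) (omit_form D s n r i \<omega>) x" for x by (rule L(2))
 have Rsym: "sym_on (idx n) R" unfolding R_def by (rule coercive_inv_sym[OF finite_idx N eps co])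
 show R'sym: "sym_on (idx n) R'" unfolding R'_def by (rule coercive_inv_sym[OF finite_idx N' eps co'])
 have b: "eps^2 * dot_on (idx n) (app_on (idx n) R y) (app_on (idx n) R y) <= dot_on (idx n) y y" for y
  unfolding R_def by (rule coercive_inv_bound[OF finite_idx N eps co])
 have b': "eps^2 * dot_on (idx n) (app_on (idx n) R' y) (app_on (idx n) R' y) <= dot_on (idx n) y y" for y
  unfolding R'_def by (rule coercive_inv_bound[OF finite_idx N' eps co'])
 show "sym_on K1 \<beta>"
  unfolding sym_on_def
 proof (intro ballI)
  fix q q'
  show "\<beta> q q' = \<beta> q' q"
   unfolding \<beta>_def using dot_on_app_sym[OF Rsym, of "row n g q" "row n g q'"]
   by (simp add: dot_on_commute[of "idx n" "row n g q'"] of_bool_def)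
 qed
 show "\<bar>\<beta> q q'\<bar> <= w" if q: "q < k1" "q' < k1" for q q'
 proof -
  define t where "t = dot_on (idx n) (row n g q) (app_on (idx n) R (row n g q'))"
  have "(eps * t)^2 <= eps^2 * (dot_on (idx n) (row n g q) (row n g q) * dot_on (idx n) (app_on (idx n) R (row n g q')) (app_on (idx n) R (row n g q')))"
   unfolding t_def power_mult_distrib by (intro mult_left_mono dot_on_cauchy) simp
  also have "... = dot_on (idx n) (row n g q) (row n g q) * (eps^2 * dot_on (idx n) (app_on (idx n) R (row n g q')) (app_on (idx n) R (row n g q')))" by simp
  also have "... <= hsq n g * hsq n g"
   using dot_row_le_hsq[OF q(1), of n g] dot_row_le_hsq[OF q(2), of n g] b[of "row n g q'"]
   by (intro mult_mono) (auto intro!: mult_nonneg_nonneg dot_on_nonneg hsq_nonneg)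
  finally have "(eps * t)^2 <= (hsq n g)^2" by (simp add: power2_eq_square)
  then have "\<bar>eps * t\<bar> <= hsq n g" using hsq_nonneg by (metis abs_le_square_iff abs_of_nonneg)
  then have "\<bar>t\<bar> <= hsq n g / eps" using eps by (simp add: abs_mult field_simps)
  then show ?thesis unfolding \<beta>_def w_def t_def[symmetric] by (auto simp: of_bool_def)
 qed
 have diff: "R a b = R' a b + (\<Sum>q<k1. app_on (idx n) R (row n g q) a * app_on (idx n) R' (row n g q) b)"
  if ab: "a \<in> idx n" "b \<in> idx n" for a b
 proof -
  define e where "e = (%c. of_bool (c = b) :: real)"
  have e: "app_on (idx n) Z e c = Z c b" for Z c unfolding e_def by (rule app_on_column[OF finite_idx ab(2)])
  have de: "dot_on (idx n) y e = y b" for y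
  proof -
   have "dot_on (idx n) y e = (\<Sum>c\<in>idx n. if c = b then y b else 0)"
    unfolding dot_on_def e_def by (intro sum.cong) auto
   then show ?thesis using ab by simp
  qed
  have "dot_on (idx n) (row n g q) (app_on (idx n) R' e) = app_on (idx n) R' (row n g q) b" for q
   unfolding dot_on_app_sym[OF R'sym] by (rule de)
  then show ?thesis using L(3)[OF ab(1), of e] unfolding e by (simp add: mult.commute)
 qed
 show "\<bar>ptrace n R' p p' - ptrace n R p p'\<bar> <= w / (real n * eps)" if p: "p < k2" "p' < k2" for p p'
 proof -
  define M where "M = (%a b. \<Sum>q<k1. app_on (idx n) R (row n g q) a * app_on (idx n) R' (row n g q) b)"
  have "ptrace n R p p' - ptrace n R' p p' = ptrace n M p p'"
   unfolding ptrace_def diff_divide_distrib[symmetric] sum_subtractf[symmetric] M_def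
   using p by (intro arg_cong2[where f = "(/)"] sum.cong refl) (simp add: diff idx_def)
  moreover have "\<bar>ptrace n M p p'\<bar> <= (hsq n g / eps^2) / real n"
  proof (rule ptrace_gram_le[OF M_def[THEN fun_cong, THEN fun_cong] _ _ p])
   show "(\<Sum>q<k1. \<Sum>c\<in>idx n. (app_on (idx n) R (row n g q) c)^2) <= hsq n g / eps^2"
    unfolding hsq_def sum_divide_distrib using b eps
    by (intro sum_mono) (simp add: dot_on_def power2_eq_square field_simps)
   show "(\<Sum>q<k1. \<Sum>c\<in>idx n. (app_on (idx n) R' (row n g q) c)^2) <= hsq n g / eps^2"
    unfolding hsq_def sum_divide_distrib using b' eps
    by (intro sum_mono) (simp add: dot_on_def power2_eq_square field_simps)
  qed
  moreover have "(hsq n g / eps^2) / real n <= w / (real n * eps)"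
   using eps n hsq_nonneg[of n g] by (simp add: w_def field_simps power2_eq_square)
  ultimately show ?thesis by linarith
 qed
 show "app_on (idx n) R (row n g q) b = (\<Sum>q'<k1. \<beta> q q' * app_on (idx n) R' (row n g q') b)"
  if q: "q < k1" and bI: "b \<in> idx n" for q b
 proof -
  define e where "e = (%c. of_bool (c = b) :: real)"
  have de: "dot_on (idx n) y e = y b" for y
  proof -
   have "dot_on (idx n) y e = (\<Sum>c\<in>idx n. if c = b then y b else 0)"
    unfolding dot_on_def e_def by (intro sum.cong) auto
   then show ?thesis using bI by simp
  qed
  have "dot_on (idx n) (row n g q) (app_on (idx n) Z e) = app_on (idx n) Z (row n g q) b" if "sym_on (idx n) Z" for q Z
   unfolding dot_on_app_sym[OF that] by (rule de)
  then show ?thesis using L(4)[of q e] q Rsym R'sym unfolding \<beta>_def by simp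
 qed
 show "2 * dot_on K1 x c <= quad_on K1 \<beta> x + dot_on K1 c c - quad_on K1 (%q q'. rform n g q q' R') c" for x c
  using L(5)[of x c] unfolding \<beta>_def rform_dot .
qed

text \<open>An approximate solution $T, Y$ of the Dyson equation becomes a strict one after scaling $T$ down and $Y$ up by a
factor close to 1, at the price of raising the level by a multiple of \<open>\<eta>\<close>. Condition
\<open>c\<close> is the equation $(s - D - \rho \sum A_i^T Y A_i)\, T = 1$ up to an error.\<close>

lemma feasible_of_approximate:
 assumes TY: "sym_on K2 T" "sym_on K1 Y" and \<eta>: "0 < \<eta>" and \<kappa>: "0 < \<kappa>" and \<mu>: "0 < \<mu>" "\<mu> <= 1 / 2"
  and Tco: "!!v. dot_on K2 v v <= \<kappa> * quad_on K2 T v"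
  and b: "!!x c. 2 * dot_on K1 x c <= quad_on K1 Y x + dot_on K1 c c - quad_on K1 (etaY T) c + e1 * dot_on K1 c c"
  and c: "!!p p'. p < k2 ==> p' < k2 ==> \<bar>(\<Sum>p''<k2. (s * of_bool (p = p'') - D p p'' - \<rho> * etaX Y p p'') * T p'' p') - of_bool (p = p')\<bar> <= e2"
  and d: "!!v. (\<alpha> - \<rho>) * quad_on K2 (etaX Y) v <= e3 * dot_on K2 v v"
  and D: "!!v. s * dot_on K2 v v - quad_on K2 D v <= \<kappa> * dot_on K2 v v"
  and e1: "e1 <= \<mu> / 2" and e2: "(real k2)^2 * e2 * (1 + \<kappa>^2) <= 2 * \<eta>" and e3: "e3 <= \<eta>"
  and \<mu>': "2 * \<mu> * (\<kappa> + 2 * \<eta>) <= \<eta>"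
 shows "feasible D \<alpha> (s + 4 * \<eta>)"
proof -
 define Cm where "Cm = (%p p'. s * of_bool (p = p') - D p p' - \<rho> * etaX Y p p')"
 have quadC: "quad_on K2 Cm v = s * dot_on K2 v v - quad_on K2 D v - \<rho> * quad_on K2 (etaX Y) v" for v
  unfolding Cm_def quad_on_linear quad_of_bool[OF finite_lessThan] ..
 define K where "K = K2"
 have K: "finite K" by (simp add: K_def)
 have Tco': "1 / \<kappa> * dot_on K v v <= quad_on K T v" for v
  using Tco[of v] \<kappa> by (simp add: K_def field_simps)
 have Tsym: "sym_on K T" using TY(1) by (simp add: K_def)
 have f2: "2 * dot_on K x y <= quad_on K Cm x + \<eta> * dot_on K x x + quad_on K T y" for x y
 proof -
  define w where "w = app_on K (inv_on K T) x"
  have Tw: "app_on K T w p = x p" if "p \<in> K" for p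
   unfolding w_def using \<kappa> by (intro coercive_inv_app(1)[OF K Tsym _ Tco' that]) simp
  have "(1 / \<kappa>)^2 * dot_on K w w <= dot_on K x x"
   unfolding w_def using \<kappa> by (intro coercive_inv_bound[OF K Tsym _ Tco']) simp
  then have ww: "dot_on K w w <= \<kappa>^2 * dot_on K x x" using \<kappa> by (simp add: field_simps)
  define er where "er = (%p p'. mul_on K Cm T p p' - of_bool (p = p'))"
  have er: "\<bar>er p p'\<bar> <= e2" if "p \<in> K" "p' \<in> K" for p p'
   using c[of p p'] that unfolding er_def mul_on_def Cm_def K_def by simp
  have "app_on K Cm x p = w p + app_on K er w p" if "p \<in> K" for p
  proof -
   have "app_on K Cm x p = app_on K Cm (app_on K T w) p"
    by (rule fun_cong[OF app_on_cong]) (simp add: Tw)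
   also have "... = app_on K (%p p'. of_bool (p = p') + er p p') w p"
    by (simp add: app_on_mul[symmetric] er_def)
   also have "app_on K (%p p'. of_bool (p = p')) w p = (\<Sum>p'\<in>K. if p' = p then w p else 0)"
    unfolding app_on_def by (intro sum.cong) auto
   then have "app_on K (%p p'. of_bool (p = p') + er p p') w p = w p + app_on K er w p"
    using K that unfolding app_on_linear by simp
   finally show ?thesis .
  qed
  then have quadCx: "quad_on K Cm x = dot_on K x w + dot_on K x (app_on K er w)"
   unfolding quad_on_def dot_on_linear[symmetric] by (intro dot_on_cong refl)
  have xw: "dot_on K x w = quad_on K T w"
   unfolding quad_on_def dot_on_commute[of K w] by (intro dot_on_cong refl) (simp add: Tw)
  have xy: "dot_on K x y = dot_on K w (app_on K T y)"
  proof -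
   have "dot_on K x y = dot_on K (app_on K T w) y" by (intro dot_on_cong refl) (simp add: Tw)
   then show ?thesis by (simp add: dot_on_app_sym[OF Tsym])
  qed
  have "0 <= quad_on K T (%p. w p - y p)"
   using Tco'[of "%p. w p - y p"] \<kappa> dot_on_nonneg[of K "%p. w p - y p"]
   by (smt (verit) divide_nonneg_nonneg mult_nonneg_nonneg)
  also have "... = quad_on K T w - 2 * dot_on K w (app_on K T y) + quad_on K T y"
   unfolding quad_on_def app_on_linear dot_on_linear
   using dot_on_app_sym[OF Tsym, of y w] dot_on_commute[of K "app_on K T y" w] by linarith
  finally have 1: "2 * dot_on K x y <= quad_on K T w + quad_on K T y" unfolding xy by simp
  have "\<bar>dot_on K x (app_on K er w)\<bar> <= (\<Sum>p\<in>K. \<Sum>p'\<in>K. \<bar>x p * (er p p' * w p')\<bar>)"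
   unfolding dot_on_def app_on_def sum_distrib_left
   by (rule order.trans[OF sum_abs sum_mono[OF sum_abs]])
  also have "... <= (\<Sum>p\<in>K. \<Sum>p'\<in>K. e2 * ((dot_on K x x + dot_on K w w) / 2))"
  proof (intro sum_mono)
   fix p p' assume pp: "p \<in> K" "p' \<in> K"
   have sq: "(v a)^2 <= dot_on K v v" if "a \<in> K" for a v
    unfolding dot_on_def power2_eq_square[symmetric] using that K by (intro member_le_sum) auto
   have "\<bar>x p * (er p p' * w p')\<bar> = \<bar>er p p'\<bar> * (\<bar>x p\<bar> * \<bar>w p'\<bar>)" by (simp add: abs_mult)
   also have "... <= e2 * ((dot_on K x x + dot_on K w w) / 2)"
    using er[OF pp] sum_squares_bound[of "\<bar>x p\<bar>" "\<bar>w p'\<bar>"] sq[OF pp(1), of x] sq[OF pp(2), of w]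
    by (intro mult_mono) auto
   finally show "\<bar>x p * (er p p' * w p')\<bar> <= e2 * ((dot_on K x x + dot_on K w w) / 2)" .
  qed
  also have "... = (real k2)^2 * e2 * ((dot_on K x x + dot_on K w w) / 2)"
   by (simp add: K_def power2_eq_square)
  also have "... <= (real k2)^2 * e2 * ((1 + \<kappa>^2) * dot_on K x x / 2)"
  proof (cases "k2 = 0")
   case False
   then have "0 <= e2" using er[of 0 0] by (force simp: K_def)
   then show ?thesis using ww by (intro mult_left_mono) (auto simp: algebra_simps)
  qed simp
  also have "... = ((real k2)^2 * e2 * (1 + \<kappa>^2)) * dot_on K x x / 2" by simp
  also have "... <= (2 * \<eta>) * dot_on K x x / 2"
   using e2 dot_on_nonneg[of K x] by (intro divide_right_mono mult_right_mono) auto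
  finally have "\<bar>dot_on K x (app_on K er w)\<bar> <= \<eta> * dot_on K x x" by simp
  then show ?thesis using 1 quadCx xw by linarith
 qed
 define u where "u = 1 - \<mu>"
 have u: "0 < u" "1 / u <= 2" "u + \<mu> = 1" using \<mu> by (auto simp: u_def field_simps)
 define C0 where "C0 = (%p p'. (1 / u) * (Cm p p' + \<eta> * of_bool (p = p')))"
 define X' where "X' = (%p p'. u * T p p')"
 define Y' where "Y' = (%p p'. (1 / u) * Y p p')"
 have etaX': "etaX Y' = (%p p'. (1 / u) * etaX Y p p')"
  by (simp add: etaX_def Y'_def fun_eq_iff sum_distrib_left mult.left_commute sum_divide_distrib)
 have etaY': "etaY X' = (%p p'. u * etaY T p p')"
  by (simp add: etaY_def X'_def fun_eq_iff sum_distrib_left mult.left_commute)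
 have quadC0: "quad_on K C0 v = (quad_on K Cm v + \<eta> * dot_on K v v) / u" for v
  unfolding C0_def quad_on_linear quad_of_bool[OF K] by simp
 show ?thesis
  unfolding feasible_def
 proof (rule exI[of _ X'], rule exI[of _ Y'], rule exI[of _ C0], rule exI[of _ "min (\<mu> / 2) \<eta>"], intro conjI allI)
  show "0 < min (\<mu> / 2) \<eta>" using \<mu> \<eta> by simp
  show "sym_on K2 X'" unfolding sym_on_def X'_def
  proof (intro ballI)
   fix a b assume "a \<in> K2" "b \<in> K2"
   from sym_onD[OF TY(1) this] show "u * T a b = u * T b a" by simp
  qed
  show "sym_on K1 Y'" unfolding sym_on_def Y'_def
  proof (intro ballI)
   fix a b assume "a \<in> K1" "b \<in> K1"
   from sym_onD[OF TY(2) this] show "1 / u * Y a b = 1 / u * Y b a" by simp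
  qed
  have scale: "quad_on I Z (%a. (1 / u) * x a) = quad_on I Z x / (u * u)" for I :: "nat set" and Z x
   unfolding quad_on_def app_on_linear dot_on_linear by simp
  fix x c
  define cc where "cc = dot_on K1 c c"
  have cc0: "0 <= cc" unfolding cc_def by (rule dot_on_nonneg)
  have "2 * dot_on K1 x c = u * (2 * dot_on K1 (%a. (1 / u) * x a) c)"
   unfolding dot_on_linear using u by simp
  also have "... <= u * (quad_on K1 Y (%a. (1 / u) * x a) + cc - quad_on K1 (etaY T) c + e1 * cc)"
   unfolding cc_def using u by (intro mult_left_mono b) auto
  also have "... = quad_on K1 Y x / u + u * (1 + e1) * cc - u * quad_on K1 (etaY T) c"
   unfolding scale using u by (simp add: field_simps)
  also have "u * (1 + e1) * cc <= (1 - min (\<mu> / 2) \<eta>) * cc"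
  proof (rule mult_right_mono[OF _ cc0])
   have "u * e1 <= max 0 e1" using u \<mu> by (cases "0 <= e1") (auto simp: mult_left_le_one_le mult_le_0_iff u_def)
   then show "u * (1 + e1) <= 1 - min (\<mu> / 2) \<eta>" using e1 \<mu> u by (simp add: algebra_simps)
  qed
  finally show "2 * dot_on K1 x c <= quad_on K1 Y' x + dot_on K1 c c
    - quad_on K1 (etaY X') c - min (\<mu> / 2) \<eta> * dot_on K1 c c"
   unfolding etaY' Y'_def quad_on_linear cc_def by (simp add: left_diff_distrib)
 next
  have scale: "quad_on I Z (%a. (1 / u) * x a) = quad_on I Z x / (u * u)" for I :: "nat set" and Z x
   unfolding quad_on_def app_on_linear dot_on_linear by simp
  show "fenchel_on K2 C0 X'"
   unfolding fenchel_on_def K_def[symmetric]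
  proof (intro allI)
   fix x y
   have "2 * dot_on K x y = u * (2 * dot_on K (%a. (1 / u) * x a) y)"
    unfolding dot_on_linear using u by simp
   also have "... <= u * (quad_on K Cm (%a. (1 / u) * x a) + \<eta> * dot_on K (%a. (1 / u) * x a) (%a. (1 / u) * x a) + quad_on K T y)"
    using u by (intro mult_left_mono f2) auto
   also have "... = quad_on K C0 x + quad_on K X' y"
    unfolding quadC0 X'_def quad_on_linear dot_on_linear scale
    using u by (simp add: field_simps)
   finally show "2 * dot_on K x y <= quad_on K C0 x + quad_on K X' y" .
  qed
  fix v
  define d where "d = dot_on K v v"
  have d0: "0 <= d" unfolding d_def by (rule dot_on_nonneg)
  define B where "B = quad_on K Cm v + \<eta> * d + \<alpha> * quad_on K (etaX Y) v"
  have B: "B <= (s + 2 * \<eta>) * d - quad_on K D v"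
  proof -
   have "e3 * d <= \<eta> * d" using e3 d0 by (rule mult_right_mono)
   then show ?thesis using d[of v] unfolding B_def K_def quadC d_def by (simp add: algebra_simps)
  qed
  have B': "B <= (\<kappa> + 2 * \<eta>) * d" using B D[of v] unfolding K_def d_def by (simp add: algebra_simps)
  have "B / u - B = \<mu> * B * (1 / u)" using u by (simp add: field_simps u_def)
  also have "... <= \<mu> * ((\<kappa> + 2 * \<eta>) * d) * 2"
  proof (cases "0 <= B")
   case True
   have "\<mu> * B * (1 / u) <= \<mu> * B * 2" using True \<mu> u by (intro mult_left_mono) auto
   also have "... <= \<mu> * ((\<kappa> + 2 * \<eta>) * d) * 2"
    using B' \<mu> by (intro mult_right_mono mult_left_mono) auto
   finally show ?thesis .
  next
   case False
   have "\<mu> * B * (1 / u) <= 0" using False \<mu> u by (intro mult_nonpos_nonneg mult_nonneg_nonpos) auto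
   also have "0 <= \<mu> * ((\<kappa> + 2 * \<eta>) * d) * 2" using \<mu> \<kappa> \<eta> d0 by simp
   finally show ?thesis .
  qed
  also have "... = (2 * \<mu> * (\<kappa> + 2 * \<eta>)) * d" by simp
  also have "... <= \<eta> * d" using \<mu>' d0 by (rule mult_right_mono)
  finally have "B / u + quad_on K D v <= (s + 3 * \<eta>) * d" using B by (simp add: algebra_simps)
  also have "... <= (s + 4 * \<eta> - min (\<mu> / 2) \<eta>) * d" using d0 by (intro mult_right_mono) auto
  finally show "quad_on K2 C0 v + \<alpha> * quad_on K2 (etaX Y') v + quad_on K2 D v
    <= (s + 4 * \<eta> - min (\<mu> / 2) \<eta>) * dot_on K2 v v"
   unfolding etaX' quad_on_linear K_def[symmetric] quadC0 B_def d_def by (simp add: add_divide_distrib)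
 qed
qed

end

context kron_coeffs
begin

text \<open>Everything that the comparison with the leave-one-out resolvent loses at one row. The weights $\sqrt n$ and
$1/\sqrt n$ turn the products of fluctuation and weight into a sum by the arithmetic-geometric mean inequality;
both parts then have expectation of order $n^{-1/2}$.\<close>

definition row_error :: "nat => real => (nat \<times> nat => real) => kernel => real" where
 "row_error n eps g R = sqrt (real n) * ((\<Sum>q<k1. \<Sum>q'<k1. (form_err n g R q q')^2)
   + (\<Sum>p<k2. \<Sum>p'<k2. \<Sum>q<k1. \<Sum>q'<k1. (form_err n g (side p p' R) q q')^2))
   + (1 + hsq n g / eps)^2 / sqrt (real n)"

definition error_const :: "real => real" where
 "error_const eps = 1 + (real k1)^2 + (real k1)^2 * (real k2)^2 * normA / eps + (real k1)^2 * real k2 * normA / eps"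

lemma row_error_ge:
 fixes n p p' :: nat and eps :: real and g :: "nat \<times> nat => real" and R :: "kernel"
 assumes n: "0 < n" and eps: "0 < eps"
 defines "w \<equiv> 1 + hsq n g / eps" and "re \<equiv> row_error n eps g R"
 shows "0 <= re" "1 <= w" "w / (real n * eps) <= re / eps" "w * (w / (real n * eps)) <= re / eps"
  and "(\<Sum>q<k1. \<Sum>q'<k1. \<bar>form_err n g R q q'\<bar>) <= (1 + (real k1)^2) * re"
  and "p < k2 ==> p' < k2 ==> w * (\<Sum>q<k1. \<Sum>q'<k1. \<bar>form_err n g (side p p' R) q q'\<bar>) <= (1 + (real k1)^2) * re"
proof -
 have sn: "0 < sqrt (real n)" "sqrt (real n) <= real n"
  using n by (auto simp: sqrt_le_D real_sqrt_le_iff intro!: real_le_lsqrt) (simp add: power2_eq_square)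
 define F1 where "F1 = (\<Sum>q<k1. \<Sum>q'<k1. (form_err n g R q q')^2)"
 define F2 where "F2 = (%p p'. \<Sum>q<k1. \<Sum>q'<k1. (form_err n g (side p p' R) q q')^2)"
 have F0: "0 <= F1" "!!p p'. 0 <= F2 p p'" unfolding F1_def F2_def by (auto intro!: sum_nonneg)
 have re: "re = sqrt (real n) * (F1 + (\<Sum>p<k2. \<Sum>p'<k2. F2 p p')) + w^2 / sqrt (real n)"
  by (simp add: re_def row_error_def F1_def F2_def w_def)
 have F2s: "0 <= (\<Sum>p<k2. \<Sum>p'<k2. F2 p p')" using F0 by (intro sum_nonneg) auto
 have w2: "w^2 / sqrt (real n) <= re" unfolding re using F0 F2s sn by simp
 show w1: "1 <= w" using hsq_nonneg[of n g] eps by (simp add: w_def)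
 then have ww: "w <= w^2" "1 <= w^2" by (auto simp: self_le_power one_le_power)
 show re0: "0 <= re" using w2 sn by (smt (verit) divide_nonneg_pos zero_le_power2)
 have wn: "w^2 / real n <= re"
 proof -
  have "w^2 / real n <= w^2 / sqrt (real n)" using sn by (intro divide_left_mono) auto
  then show ?thesis using w2 by linarith
 qed
 have "w / real n <= w^2 / real n" using ww by (intro divide_right_mono) auto
 then have "w / real n / eps <= re / eps" using wn eps by (intro divide_right_mono) auto
 then show "w / (real n * eps) <= re / eps" by simp
 have "w^2 / real n / eps <= re / eps" using wn eps by (intro divide_right_mono) auto
 then show "w * (w / (real n * eps)) <= re / eps" by (simp add: power2_eq_square)
 have amgm: "t * \<bar>f\<bar> <= sqrt (real n) * f^2 + t^2 / sqrt (real n)" for t f :: real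
 proof -
  have Y: "sqrt (real n) / 1 * \<bar>f\<bar>^2 + 1 / sqrt (real n) * \<bar>t\<bar>^2 = sqrt (real n) * f^2 + t^2 / sqrt (real n)"
   by simp
  have half: "x / 2 <= x" if "0 <= x" for x :: real using that by simp
  have Y0: "0 <= sqrt (real n) * f^2 + t^2 / sqrt (real n)" using sn by simp
  have "t * \<bar>f\<bar> <= \<bar>t\<bar> * \<bar>f\<bar>" by (intro mult_right_mono) auto
  also have "... = \<bar>f\<bar> * \<bar>t\<bar>" by (rule mult.commute)
  also have "... <= (sqrt (real n) / 1 * \<bar>f\<bar>^2 + 1 / sqrt (real n) * \<bar>t\<bar>^2) / 2"
   by (rule weighted_am_gm) (use sn in auto)
  also have "... <= sqrt (real n) * f^2 + t^2 / sqrt (real n)" unfolding Y by (rule half[OF Y0])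
  finally show ?thesis .
 qed
 have gen: "t * (\<Sum>q<k1. \<Sum>q'<k1. \<bar>f q q'\<bar>) <= (1 + (real k1)^2) * re"
  if f: "sqrt (real n) * (\<Sum>q<k1. \<Sum>q'<k1. (f q q')^2) <= re" and t: "t^2 <= w^2" for t f
 proof -
  have "t * (\<Sum>q<k1. \<Sum>q'<k1. \<bar>f q q'\<bar>) <= (\<Sum>q<k1. \<Sum>q'<k1. sqrt (real n) * (f q q')^2 + t^2 / sqrt (real n))"
   unfolding sum_distrib_left by (intro sum_mono amgm)
  also have "... = sqrt (real n) * (\<Sum>q<k1. \<Sum>q'<k1. (f q q')^2) + (real k1)^2 * (t^2 / sqrt (real n))"
   by (simp add: sum.distrib sum_distrib_left power2_eq_square[of "real k1"])
  also have "... <= re + (real k1)^2 * re"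
  proof (intro add_mono f mult_left_mono)
   have "t^2 / sqrt (real n) <= w^2 / sqrt (real n)" using t sn by (intro divide_right_mono) auto
   then show "t^2 / sqrt (real n) <= re" using w2 by linarith
  qed simp
  finally show ?thesis by (simp add: algebra_simps)
 qed
 have snre: "sqrt (real n) * x <= re" if "x <= F1 + (\<Sum>p<k2. \<Sum>p'<k2. F2 p p')" for x
 proof -
  have "sqrt (real n) * x <= sqrt (real n) * (F1 + (\<Sum>p<k2. \<Sum>p'<k2. F2 p p'))" using that sn by (intro mult_left_mono) auto
  moreover have "0 <= w^2 / sqrt (real n)" using sn by simp
  ultimately show ?thesis unfolding re by linarith
 qed
 show "(\<Sum>q<k1. \<Sum>q'<k1. \<bar>form_err n g R q q'\<bar>) <= (1 + (real k1)^2) * re"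
  using gen[of "form_err n g R" 1] snre[of F1] F2s ww unfolding F1_def by simp
 show "w * (\<Sum>q<k1. \<Sum>q'<k1. \<bar>form_err n g (side p p' R) q q'\<bar>) <= (1 + (real k1)^2) * re" if "p < k2" "p' < k2" for p p'
 proof -
  have "F2 p p' <= (\<Sum>p'<k2. F2 p p')" using that F0 by (intro member_le_sum) auto
  also have "... <= (\<Sum>p<k2. \<Sum>p'<k2. F2 p p')"
   using that F0 by (intro member_le_sum[of p _ "%p. \<Sum>p'<k2. F2 p p'"]) (auto intro: sum_nonneg)
  finally have "sqrt (real n) * F2 p p' <= re" using F0 by (intro snre) simp
  then show ?thesis unfolding F2_def by (intro gen) auto
 qed
qed

lemma abs_etaX_le:
 assumes "p < k2" "p' < k2" "!!q q'. q < k1 ==> q' < k1 ==> \<bar>Y q q'\<bar> <= c"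
 shows "\<bar>etaX Y p p'\<bar> <= normA * ((real k1)^2 * c)"
proof -
 have "\<bar>etaX Y p p'\<bar> <= (\<Sum>q<k1. \<Sum>q'<k1. \<bar>cov q p q' p' * Y q q'\<bar>)"
  unfolding etaX_def by (rule order.trans[OF sum_abs sum_mono[OF sum_abs]])
 also have "... <= (\<Sum>q<k1. \<Sum>q'<k1. normA * c)"
  unfolding abs_mult using assms by (intro sum_mono mult_mono abs_cov_le normA_nonneg) auto
 finally show ?thesis by (simp add: power2_eq_square ac_simps)
qed

lemma quad_average:
 "quad_on I (%a b. (\<Sum>i\<in>J. X i a b) / c) x = (\<Sum>i\<in>J. quad_on I (X i) x) / c"
 using quad_on_linear(3)[of I "1 / c" "%a b. \<Sum>i\<in>J. X i a b" x] by (simp add: quad_sum_matrices)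

lemma ptrace_sym: "sym_on (idx n) R ==> sym_on K2 (ptrace n R)"
 unfolding sym_on_def[of "K2"] ptrace_def
 by (intro ballI arg_cong2[where f = "(/)"] sum.cong refl sym_onD) (auto simp: idx_def)

text \<open>Take $T$ the partial trace of the resolvent $R$ and $Y$ the average over $i$ of $1 + h_i R h_i^T$. Expanding the
identity $(s - A_D \otimes I - H^T H) R = 1$, the term $H^T H R$ is a sum over rows, in which each $h_i R$ is
rewritten by the leave-one-out identity; the row form with the remaining resolvent is then replaced by its mean,
at a cost that \<open>row_error\<close> measures.\<close>

lemma good_event_feasible:
 fixes \<omega> :: "nat \<times> nat \<times> nat => real"
 assumes n: "0 < n" and r: "0 < r" and D: "sym_on K2 D" and eps: "0 < eps"
  and co: "!!x. eps * dot_on (idx n) x x <= quad_on (idx n) (gap_form D s n r \<omega>) x"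
 defines "err \<equiv> %i. row_error n eps (row_noise n i \<omega>) (inv_on (idx n) (omit_form D s n r i \<omega>))"
  and "w \<equiv> %i. 1 + hsq n (row_noise n i \<omega>) / eps"
 assumes \<eta>: "0 < \<eta>" and \<kappa>: "0 < \<kappa>" and \<mu>: "0 < \<mu>" "\<mu> <= 1 / 2" "2 * \<mu> * (\<kappa> + 2 * \<eta>) <= \<eta>"
  and \<kappa>D: "!!v. s * dot_on K2 v v - quad_on K2 D v <= \<kappa> * dot_on K2 v v"
  and e1: "error_const eps * ((\<Sum>i<r. err i) / real r) <= \<mu> / 2"
  and e2: "(real k2)^2 * (real r / real n * (error_const eps * ((\<Sum>i<r. err i) / real r))) * (1 + \<kappa>^2) <= 2 * \<eta>"
  and e3: "\<bar>\<alpha> - real r / real n\<bar> * ((real k2)^2 * (normA * ((real k1)^2 * ((\<Sum>i<r. (w i)^2) / real r)))) <= \<eta>"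
 shows "feasible D \<alpha> (s + 4 * \<eta>)"
proof -
 define R where "R = inv_on (idx n) (gap_form D s n r \<omega>)"
 define R' where "R' = (%i. inv_on (idx n) (omit_form D s n r i \<omega>))"
 define g where "g = (%i. row_noise n i \<omega>)"
 define T where "T = ptrace n R"
 define \<beta> where "\<beta> = (%i q q'. of_bool (q = q') + dot_on (idx n) (row n (g i) q) (app_on (idx n) R (row n (g i) q')))"
 define Y where "Y = (%q q'. (\<Sum>i<r. \<beta> i q q') / real r)"
 note N = sym_gap_form[OF D, of n s r \<omega>]
 have g: "g i = row_noise n i \<omega>" for i by (simp add: g_def)
 have \<beta>: "\<beta> i q q' = of_bool (q = q') + dot_on (idx n) (row n (g i) q) (app_on (idx n) R (row n (g i) q'))" for i q q'
  by (simp add: \<beta>_def)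
 have R's: "R' i = inv_on (idx n) (omit_form D s n r i \<omega>)" for i by (simp add: R'_def)
 note loo = leave_row_out[OF n _ D eps co, folded R_def R's, folded g, folded \<beta>]
 have erri: "err i = row_error n eps (g i) (R' i)" and wi: "w i = 1 + hsq n (g i) / eps" for i
  by (simp_all add: err_def w_def g_def R'_def)
 have re1: "0 <= err i" for i unfolding erri by (rule row_error_ge(1)[OF n eps])
 have re2: "1 <= w i" for i unfolding wi by (rule row_error_ge(2)[OF n eps])
 have re3: "w i / (real n * eps) <= err i / eps" for i unfolding erri wi by (rule row_error_ge(3)[OF n eps])
 have re4: "w i * (w i / (real n * eps)) <= err i / eps" for i unfolding erri wi by (rule row_error_ge(4)[OF n eps])
 have re5: "(\<Sum>q<k1. \<Sum>q'<k1. \<bar>form_err n (g i) (R' i) q q'\<bar>) <= (1 + (real k1)^2) * err i" for i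
  unfolding erri by (rule row_error_ge(5)[OF n eps])
 have re6: "w i * (\<Sum>q<k1. \<Sum>q'<k1. \<bar>form_err n (g i) (side p p' (R' i)) q q'\<bar>) <= (1 + (real k1)^2) * err i"
  if "p < k2" "p' < k2" for i p p'
  unfolding erri wi by (rule row_error_ge(6)[OF n eps that])
 have Rsym: "sym_on (idx n) R" unfolding R_def by (rule coercive_inv_sym[OF finite_idx N eps co])
 have Tsym: "sym_on K2 T" unfolding T_def by (rule ptrace_sym[OF Rsym])
 have Ysym: "sym_on K1 Y"
  unfolding sym_on_def Y_def
 proof (intro ballI arg_cong2[where f = "(/)"] sum.cong refl)
  fix q q' i assume "q \<in> K1" "q' \<in> K1" "i \<in> {..<r}"
  then show "\<beta> i q q' = \<beta> i q' q" by (intro sym_onD[OF loo(4)]) auto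
 qed
 have Tco: "dot_on K2 v v <= \<kappa> * quad_on K2 T v" for v
 proof -
  have up: "quad_on (idx n) (gap_form D s n r \<omega>) x <= \<kappa> * dot_on (idx n) x x" for x
  proof -
   have "quad_on (idx n) (gap_form D s n r \<omega>) x <= (\<Sum>j<n. s * dot_on K2 (%p. x (p, j)) (%p. x (p, j)) - quad_on K2 D (%p. x (p, j)))"
    unfolding quad_gap_form dot_idx by (simp add: sum_subtractf sum_distrib_left sum_nonneg)
   also have "... <= (\<Sum>j<n. \<kappa> * dot_on K2 (%p. x (p, j)) (%p. x (p, j)))" by (intro sum_mono \<kappa>D)
   finally show ?thesis by (simp add: dot_idx sum_distrib_left)
  qed
  have low: "dot_on (idx n) y y <= \<kappa> * quad_on (idx n) R y" for y
   unfolding R_def by (rule coercive_inv_lower[OF finite_idx N eps co \<kappa> up])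
  have dv: "dot_on (idx n) (%a. of_bool (snd a = j) * v (fst a)) (%a. of_bool (snd a = j) * v (fst a)) = dot_on K2 v v" if "j < n" for j
  proof -
   have "dot_on (idx n) (%a. of_bool (snd a = j) * v (fst a)) (%a. of_bool (snd a = j) * v (fst a)) =
    (\<Sum>p<k2. \<Sum>i<n. if i = j then v p * v p else 0)"
    unfolding dot_on_def sum_idx by (intro sum.cong refl) auto
   then show ?thesis using that by (simp add: dot_on_def)
  qed
  have "dot_on K2 v v = (\<Sum>j<n. dot_on (idx n) (%a. of_bool (snd a = j) * v (fst a)) (%a. of_bool (snd a = j) * v (fst a))) / real n"
   using n dv by simp
  also have "... <= (\<Sum>j<n. \<kappa> * quad_on (idx n) R (%a. of_bool (snd a = j) * v (fst a))) / real n"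
   by (intro divide_right_mono sum_mono low) simp
  also have "... = \<kappa> * quad_on K2 T v"
   unfolding T_def quad_ptrace by (simp add: sum_distrib_left)
  finally show ?thesis .
 qed
 have Kc: "error_const eps = (1 + (real k1)^2) + (real k1)^2 * (real k2)^2 * normA / eps + (real k1)^2 * real k2 * normA / eps"
  by (simp add: error_const_def)
 have Kpos: "0 <= (real k1)^2 * (real k2)^2 * normA / eps" "0 <= (real k1)^2 * real k2 * normA / eps"
  using normA_nonneg eps by auto
 have b: "2 * dot_on K1 x c <= quad_on K1 Y x + dot_on K1 c c - quad_on K1 (etaY T) c
   + (error_const eps * ((\<Sum>i<r. err i) / real r)) * dot_on K1 c c" for x c
 proof -
  define d where "d = dot_on K1 c c"
  have d0: "0 <= d" unfolding d_def by (rule dot_on_nonneg)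
  have "2 * dot_on K1 x c <= quad_on K1 (\<beta> i) x + (d - quad_on K1 (etaY T) c) + error_const eps * err i * d"
   if i: "i < r" for i
  proof -
   define S where "S = (%q q'. form_err n (g i) (R' i) q q' + etaY (%p p'. ptrace n (R' i) p p' - T p p') q q')"
   have "(%q q'. rform n (g i) q q' (R' i)) = (%q q'. etaY T q q' + S q q')"
    unfolding S_def form_err_def etaY_diff[symmetric] by (intro ext) simp
   then have q: "quad_on K1 (%q q'. rform n (g i) q q' (R' i)) c = quad_on K1 (etaY T) c + quad_on K1 S c"
    by (simp add: quad_on_linear)
   have "\<bar>quad_on K1 S c\<bar> <= (\<Sum>q<k1. \<Sum>q'<k1. \<bar>S q q'\<bar>) * d"
    unfolding d_def by (rule abs_quad_on_le) simp
   also have "... <= (error_const eps * err i) * d"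
   proof (rule mult_right_mono[OF _ d0])
    have "(\<Sum>q<k1. \<Sum>q'<k1. \<bar>S q q'\<bar>) <= (\<Sum>q<k1. \<Sum>q'<k1. \<bar>form_err n (g i) (R' i) q q'\<bar> + normA * ((real k2)^2 * (w i / (real n * eps))))"
    proof (intro sum_mono)
     fix q q' assume "q \<in> K1" "q' \<in> K1"
     then have "\<bar>etaY (%p p'. ptrace n (R' i) p p' - T p p') q q'\<bar> <= normA * ((real k2)^2 * (w i / (real n * eps)))"
      unfolding wi T_def by (intro abs_etaY_le loo(6)[OF i]) auto
     then show "\<bar>S q q'\<bar> <= \<bar>form_err n (g i) (R' i) q q'\<bar> + normA * ((real k2)^2 * (w i / (real n * eps)))"
      unfolding S_def by linarith
    qed
    also have "... = (\<Sum>q<k1. \<Sum>q'<k1. \<bar>form_err n (g i) (R' i) q q'\<bar>) + (real k1)^2 * (normA * ((real k2)^2 * (w i / (real n * eps))))"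
     by (simp add: sum.distrib power2_eq_square[of "real k1"])
    also have "... <= (1 + (real k1)^2) * err i + (real k1)^2 * (normA * ((real k2)^2 * (err i / eps)))"
     using normA_nonneg by (intro add_mono re5 mult_left_mono re3) auto
    also have "... = ((1 + (real k1)^2) + (real k1)^2 * (real k2)^2 * normA / eps) * err i"
     unfolding distrib_right by simp
    also have "... <= error_const eps * err i"
     unfolding Kc using Kpos re1 by (intro mult_right_mono) auto
    finally show "(\<Sum>q<k1. \<Sum>q'<k1. \<bar>S q q'\<bar>) <= error_const eps * err i" .
   qed
   finally show ?thesis using loo(8)[OF i, of x c] unfolding q d_def by linarith
  qed
  then have "(\<Sum>i<r. 2 * dot_on K1 x c) <= (\<Sum>i<r. quad_on K1 (\<beta> i) x + (d - quad_on K1 (etaY T) c) + error_const eps * err i * d)"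
   by (intro sum_mono) auto
  then have "real r * (2 * dot_on K1 x c) <= (\<Sum>i<r. quad_on K1 (\<beta> i) x) + real r * (d - quad_on K1 (etaY T) c) + error_const eps * (\<Sum>i<r. err i) * d"
   by (simp add: sum.distrib sum_distrib_left sum_distrib_right)
  then have "(real r * (2 * dot_on K1 x c)) / real r <= ((\<Sum>i<r. quad_on K1 (\<beta> i) x) + real r * (d - quad_on K1 (etaY T) c) + error_const eps * (\<Sum>i<r. err i) * d) / real r"
   by (rule divide_right_mono) simp
  then show ?thesis using r unfolding Y_def quad_average d_def by (simp add: add_divide_distrib)
 qed
 have c: "\<bar>(\<Sum>p''<k2. (s * of_bool (p = p'') - D p p'' - real r / real n * etaX Y p p'') * T p'' p') - of_bool (p = p')\<bar>
   <= real r / real n * (error_const eps * ((\<Sum>i<r. err i) / real r))" if p: "p < k2" "p' < k2" for p p'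
 proof -
  define u where "u = (%i q j. app_on (idx n) R (row n (g i) q) (p', j))"
  have ent: "of_bool (p = p') = s * R (p, j) (p', j) - (\<Sum>p''<k2. D p p'' * R (p'', j) (p', j)) - (\<Sum>i<r. \<Sum>q<k1. row n (g i) q (p, j) * u i q j)"
   if j: "j < n" for j
  proof -
   have pj: "(p, j) \<in> idx n" "(p', j) \<in> idx n" using p j by (auto simp: idx_def)
   have "of_bool (p = p') = mul_on (idx n) (gap_form D s n r \<omega>) R (p, j) (p', j)"
    unfolding R_def using mul_on_inv_on(1)[OF finite_idx coercive_kernel[OF finite_idx N eps co] pj] by simp
   also have "... = (\<Sum>c\<in>idx n. s * (of_bool ((p, j) = c) * R c (p', j)) - tens D (p, j) c * R c (p', j) - (\<Sum>i<r. \<Sum>q<k1. row n (g i) q (p, j) * (row n (g i) q c * R c (p', j))))"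
    unfolding mul_on_def gap_form_def gram_row_def g
    by (intro sum.cong refl) (simp add: left_diff_distrib sum_distrib_right sum_distrib_left mult.assoc)
   also have "... = s * (\<Sum>c\<in>idx n. of_bool ((p, j) = c) * R c (p', j)) - (\<Sum>c\<in>idx n. tens D (p, j) c * R c (p', j))
     - (\<Sum>c\<in>idx n. \<Sum>i<r. \<Sum>q<k1. row n (g i) q (p, j) * (row n (g i) q c * R c (p', j)))"
    by (simp only: sum_subtractf sum_distrib_left)
   also have "(\<Sum>c\<in>idx n. of_bool ((p, j) = c) * R c (p', j)) = (\<Sum>c\<in>idx n. if c = (p, j) then R (p, j) (p', j) else 0)"
    by (intro sum.cong refl) auto
   also have "... = R (p, j) (p', j)" using pj by simp
   also have "(\<Sum>c\<in>idx n. tens D (p, j) c * R c (p', j)) = (\<Sum>p''<k2. \<Sum>j'<n. if j' = j then D p p'' * R (p'', j) (p', j) else 0)"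
    unfolding sum_idx tens_def by (intro sum.cong refl) auto
   also have "... = (\<Sum>p''<k2. D p p'' * R (p'', j) (p', j))" using j by simp
   also have "(\<Sum>c\<in>idx n. \<Sum>i<r. \<Sum>q<k1. row n (g i) q (p, j) * (row n (g i) q c * R c (p', j)))
    = (\<Sum>i<r. \<Sum>q<k1. row n (g i) q (p, j) * (\<Sum>c\<in>idx n. row n (g i) q c * R c (p', j)))"
   proof -
    have "(\<Sum>c\<in>idx n. \<Sum>i<r. \<Sum>q<k1. row n (g i) q (p, j) * (row n (g i) q c * R c (p', j)))
     = (\<Sum>i<r. \<Sum>c\<in>idx n. \<Sum>q<k1. row n (g i) q (p, j) * (row n (g i) q c * R c (p', j)))" by (rule sum.swap)
    also have "... = (\<Sum>i<r. \<Sum>q<k1. \<Sum>c\<in>idx n. row n (g i) q (p, j) * (row n (g i) q c * R c (p', j)))"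
     by (intro sum.cong refl sum.swap)
    finally show ?thesis by (simp only: sum_distrib_left)
   qed
   also have "... = (\<Sum>i<r. \<Sum>q<k1. row n (g i) q (p, j) * u i q j)"
   proof (intro sum.cong refl arg_cong2[where f = "(*)"])
    fix i q
    show "(\<Sum>c\<in>idx n. row n (g i) q c * R c (p', j)) = u i q j"
     unfolding u_def app_on_def
    proof (intro sum.cong refl)
     fix c assume "c \<in> idx n"
     then have "R c (p', j) = R (p', j) c" by (rule sym_onD[OF Rsym _ pj(2)])
     then show "row n (g i) q c * R c (p', j) = R (p', j) c * row n (g i) q c" by simp
    qed
   qed
   finally show ?thesis .
  qed
  have rowsum: "(\<Sum>j<n. row n (g i) q (p, j) * u i q j) = (\<Sum>q'<k1. \<beta> i q q' * rform n (g i) q q' (side p p' (R' i)))"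
   if i: "i < r" and q: "q < k1" for i q
  proof -
   have "(\<Sum>j<n. row n (g i) q (p, j) * u i q j) =
    (\<Sum>j<n. \<Sum>q'<k1. \<beta> i q q' * (row n (g i) q (p, j) * app_on (idx n) (R' i) (row n (g i) q') (p', j)))"
   proof (intro sum.cong refl)
    fix j assume "j \<in> {..<n}"
    then have "(p', j) \<in> idx n" using p by (auto simp: idx_def)
    from loo(7)[OF i q this] show "row n (g i) q (p, j) * u i q j = (\<Sum>q'<k1. \<beta> i q q' * (row n (g i) q (p, j) * app_on (idx n) (R' i) (row n (g i) q') (p', j)))"
     unfolding u_def by (simp add: sum_distrib_left mult.left_commute)
   qed
   also have "... = (\<Sum>q'<k1. \<Sum>j<n. \<beta> i q q' * (row n (g i) q (p, j) * app_on (idx n) (R' i) (row n (g i) q') (p', j)))"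
    by (rule sum.swap)
   also have "... = (\<Sum>q'<k1. \<beta> i q q' * rform n (g i) q q' (side p p' (R' i)))"
    unfolding rform_side[OF loo(3)[OF i] p] by (simp only: sum_distrib_left)
   finally show ?thesis .
  qed
  define X where "X = (%i q q'. rform n (g i) q q' (side p p' (R' i)) - (\<Sum>p2<k2. cov q p q' p2 * T p2 p'))"
  have total: "of_bool (p = p') = s * T p p' - (\<Sum>p''<k2. D p p'' * T p'' p')
    - (\<Sum>i<r. \<Sum>q<k1. \<Sum>q'<k1. \<beta> i q q' * rform n (g i) q q' (side p p' (R' i))) / real n"
  proof -
   have "real n * of_bool (p = p') = (\<Sum>j<n. of_bool (p = p'))" by simp
   also have "... = (\<Sum>j<n. s * R (p, j) (p', j) - (\<Sum>p''<k2. D p p'' * R (p'', j) (p', j)) - (\<Sum>i<r. \<Sum>q<k1. row n (g i) q (p, j) * u i q j))"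
    by (intro sum.cong refl ent) auto
   also have "... = s * (\<Sum>j<n. R (p, j) (p', j)) - (\<Sum>j<n. \<Sum>p''<k2. D p p'' * R (p'', j) (p', j)) - (\<Sum>j<n. \<Sum>i<r. \<Sum>q<k1. row n (g i) q (p, j) * u i q j)"
    by (simp add: sum_subtractf sum_distrib_left)
   also have "(\<Sum>j<n. R (p, j) (p', j)) = real n * T p p'" using n by (simp add: T_def ptrace_def)
   also have "(\<Sum>j<n. \<Sum>p''<k2. D p p'' * R (p'', j) (p', j)) = real n * (\<Sum>p''<k2. D p p'' * T p'' p')"
    unfolding T_def ptrace_def using n
    by (subst sum.swap) (simp add: sum_distrib_left sum_divide_distrib)
   also have "(\<Sum>j<n. \<Sum>i<r. \<Sum>q<k1. row n (g i) q (p, j) * u i q j) = (\<Sum>i<r. \<Sum>q<k1. \<Sum>q'<k1. \<beta> i q q' * rform n (g i) q q' (side p p' (R' i)))"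
   proof -
    have "(\<Sum>j<n. \<Sum>i<r. \<Sum>q<k1. row n (g i) q (p, j) * u i q j) = (\<Sum>i<r. \<Sum>j<n. \<Sum>q<k1. row n (g i) q (p, j) * u i q j)"
     by (rule sum.swap)
    also have "... = (\<Sum>i<r. \<Sum>q<k1. \<Sum>j<n. row n (g i) q (p, j) * u i q j)"
     by (intro sum.cong refl sum.swap)
    also have "... = (\<Sum>i<r. \<Sum>q<k1. \<Sum>q'<k1. \<beta> i q q' * rform n (g i) q q' (side p p' (R' i)))"
     by (intro sum.cong refl rowsum) auto
    finally show ?thesis .
   qed
   finally show ?thesis using n by (simp add: field_simps)
  qed
  have mid: "real r / real n * (\<Sum>p''<k2. etaX Y p p'' * T p'' p') = (\<Sum>i<r. \<Sum>q<k1. \<Sum>q'<k1. \<beta> i q q' * (\<Sum>p2<k2. cov q p q' p2 * T p2 p')) / real n"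
  proof -
   define c where "c = (%q q'. \<Sum>p2<k2. cov q p q' p2 * T p2 p')"
   have "(\<Sum>p''<k2. etaX Y p p'' * T p'' p') = (\<Sum>p''<k2. \<Sum>q<k1. \<Sum>q'<k1. Y q q' * (cov q p q' p'' * T p'' p'))"
    by (simp add: etaX_def sum_distrib_left sum_distrib_right ac_simps)
   also have "... = (\<Sum>q<k1. \<Sum>p''<k2. \<Sum>q'<k1. Y q q' * (cov q p q' p'' * T p'' p'))" by (rule sum.swap)
   also have "... = (\<Sum>q<k1. \<Sum>q'<k1. \<Sum>p''<k2. Y q q' * (cov q p q' p'' * T p'' p'))" by (intro sum.cong refl sum.swap)
   also have "... = (\<Sum>q<k1. \<Sum>q'<k1. Y q q' * c q q')" by (simp add: c_def sum_distrib_left)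
   also have "... = (\<Sum>q<k1. \<Sum>q'<k1. \<Sum>i<r. \<beta> i q q' * c q q') / real r"
    by (simp add: Y_def sum_divide_distrib sum_distrib_right)
   also have "(\<Sum>q<k1. \<Sum>q'<k1. \<Sum>i<r. \<beta> i q q' * c q q') = (\<Sum>q<k1. \<Sum>i<r. \<Sum>q'<k1. \<beta> i q q' * c q q')"
    by (intro sum.cong refl sum.swap)
   also have "... = (\<Sum>i<r. \<Sum>q<k1. \<Sum>q'<k1. \<beta> i q q' * c q q')" by (rule sum.swap)
   finally show ?thesis using r by (simp add: c_def)
  qed
  have "(\<Sum>p''<k2. (s * of_bool (p = p'') - D p p'' - real r / real n * etaX Y p p'') * T p'' p') =
   s * T p p' - (\<Sum>p''<k2. D p p'' * T p'' p') - real r / real n * (\<Sum>p''<k2. etaX Y p p'' * T p'' p')"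
  proof -
   have "(\<Sum>p''<k2. s * of_bool (p = p'') * T p'' p') = (\<Sum>p''<k2. if p'' = p then s * T p p' else 0)"
    by (intro sum.cong refl) auto
   then have "(\<Sum>p''<k2. s * of_bool (p = p'') * T p'' p') = s * T p p'" using p by simp
   then show ?thesis by (simp only: left_diff_distrib sum_subtractf) (simp add: sum_distrib_left mult.assoc)
  qed
  then have "(\<Sum>p''<k2. (s * of_bool (p = p'') - D p p'' - real r / real n * etaX Y p p'') * T p'' p') - of_bool (p = p') =
   (\<Sum>i<r. \<Sum>q<k1. \<Sum>q'<k1. \<beta> i q q' * X i q q') / real n"
   using total mid unfolding X_def right_diff_distrib sum_subtractf diff_divide_distrib by linarith
  also have "\<bar>...\<bar> <= (\<Sum>i<r. error_const eps * err i) / real n"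
  proof -
   have "\<bar>\<Sum>i<r. \<Sum>q<k1. \<Sum>q'<k1. \<beta> i q q' * X i q q'\<bar> <= (\<Sum>i<r. error_const eps * err i)"
   proof (rule order.trans[OF sum_abs sum_mono])
    fix i assume "i \<in> {..<r}"
    then have i: "i < r" by simp
    have w1: "0 <= w i" using re2[of i] by linarith
    have "\<bar>\<Sum>q<k1. \<Sum>q'<k1. \<beta> i q q' * X i q q'\<bar> <= (\<Sum>q<k1. \<Sum>q'<k1. \<bar>\<beta> i q q' * X i q q'\<bar>)"
     by (rule order.trans[OF sum_abs sum_mono[OF sum_abs]])
    also have "... <= (\<Sum>q<k1. \<Sum>q'<k1. w i * (\<bar>form_err n (g i) (side p p' (R' i)) q q'\<bar> + real k2 * (normA * (w i / (real n * eps)))))"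
     unfolding abs_mult
    proof (intro sum_mono mult_mono)
     fix q q' assume q: "q \<in> K1" "q' \<in> K1"
     show "\<bar>\<beta> i q q'\<bar> <= w i" unfolding wi using loo(5)[OF i] q by simp
     have "X i q q' = form_err n (g i) (side p p' (R' i)) q q' + (\<Sum>p2<k2. cov q p q' p2 * (ptrace n (R' i) p2 p' - T p2 p'))"
      unfolding X_def form_err_def etaY_ptrace_side[OF loo(3)[OF i] p] by (simp add: right_diff_distrib sum_subtractf)
     moreover have "\<bar>\<Sum>p2<k2. cov q p q' p2 * (ptrace n (R' i) p2 p' - T p2 p')\<bar> <= (\<Sum>p2<k2. normA * (w i / (real n * eps)))"
      unfolding T_def wi
      by (rule order.trans[OF sum_abs sum_mono], unfold abs_mult, intro mult_mono abs_cov_le loo(6)[OF i])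
       (use q p normA_nonneg in auto)
     ultimately show "\<bar>X i q q'\<bar> <= \<bar>form_err n (g i) (side p p' (R' i)) q q'\<bar> + real k2 * (normA * (w i / (real n * eps)))" by simp
    qed (use w1 in auto)
    also have "... = w i * (\<Sum>q<k1. \<Sum>q'<k1. \<bar>form_err n (g i) (side p p' (R' i)) q q'\<bar>) + (real k1)^2 * (real k2 * (normA * (w i * (w i / (real n * eps)))))"
     by (simp add: sum.distrib sum_distrib_left distrib_left power2_eq_square[of "real k1"])
    also have "... <= (1 + (real k1)^2) * err i + (real k1)^2 * (real k2 * (normA * (err i / eps)))"
     using normA_nonneg by (intro add_mono re6[OF p] mult_left_mono re4) auto
    also have "... = ((1 + (real k1)^2) + (real k1)^2 * real k2 * normA / eps) * err i"
     unfolding distrib_right by simp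
    also have "... <= error_const eps * err i"
     unfolding Kc using Kpos re1 by (intro mult_right_mono) auto
    finally show "\<bar>\<Sum>q<k1. \<Sum>q'<k1. \<beta> i q q' * X i q q'\<bar> <= error_const eps * err i" .
   qed
   then show ?thesis by (simp add: divide_right_mono)
  qed
  also have "... = real r / real n * (error_const eps * ((\<Sum>i<r. err i) / real r))"
   using r by (simp add: sum_distrib_left[symmetric])
  finally show ?thesis .
 qed
 have d: "(\<alpha> - real r / real n) * quad_on K2 (etaX Y) v <= \<eta> * dot_on K2 v v" for v
 proof -
  define W where "W = (\<Sum>i<r. (w i)^2) / real r"
  have Yle: "\<bar>Y q q'\<bar> <= W" if "q < k1" "q' < k1" for q q'
  proof -
   have "\<bar>\<Sum>i<r. \<beta> i q q'\<bar> <= (\<Sum>i<r. (w i)^2)"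
   proof (rule order.trans[OF sum_abs sum_mono])
    fix i assume "i \<in> {..<r}"
    then have "\<bar>\<beta> i q q'\<bar> <= w i" unfolding wi using loo(5) that by simp
    also have "... <= (w i)^2" using re2[of i] by (simp add: power2_eq_square)
    finally show "\<bar>\<beta> i q q'\<bar> <= (w i)^2" .
   qed
   then show ?thesis by (simp add: Y_def W_def divide_right_mono)
  qed
  have "\<bar>quad_on K2 (etaX Y) v\<bar> <= (\<Sum>p<k2. \<Sum>p'<k2. \<bar>etaX Y p p'\<bar>) * dot_on K2 v v"
   by (rule abs_quad_on_le) simp
  also have "... <= (\<Sum>p<k2. \<Sum>p'<k2. normA * ((real k1)^2 * W)) * dot_on K2 v v"
   by (intro mult_right_mono sum_mono abs_etaX_le Yle dot_on_nonneg) auto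
  also have "... = ((real k2)^2 * (normA * ((real k1)^2 * W))) * dot_on K2 v v"
   by (simp add: power2_eq_square[of "real k2"])
  finally have "\<bar>\<alpha> - real r / real n\<bar> * \<bar>quad_on K2 (etaX Y) v\<bar> <= \<bar>\<alpha> - real r / real n\<bar> * (((real k2)^2 * (normA * ((real k1)^2 * W))) * dot_on K2 v v)"
   by (rule mult_left_mono) simp
  also have "... = (\<bar>\<alpha> - real r / real n\<bar> * ((real k2)^2 * (normA * ((real k1)^2 * W)))) * dot_on K2 v v" by simp
  also have "... <= \<eta> * dot_on K2 v v" using e3 unfolding W_def by (intro mult_right_mono dot_on_nonneg)
  finally show ?thesis by (simp add: abs_mult[symmetric])
 qed
 show ?thesis
  by (rule feasible_of_approximate[OF Tsym Ysym \<eta> \<kappa> \<mu>(1,2) Tco b c d \<kappa>D e1 e2 order.refl \<mu>(3)])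
qed

end

context kron_coeffs
begin

lemma hsq_rform: "hsq n g = (\<Sum>q<k1. rform n g q q (%a b. of_bool (a = b)))"
proof -
 have "rform n g q q (%a b. of_bool (a = b)) = dot_on (idx n) (row n g q) (row n g q)" for q
 proof -
  have "rform n g q q (%a b. of_bool (a = b)) = (\<Sum>a\<in>idx n. \<Sum>b\<in>idx n. if b = a then row n g q a * row n g q a else 0)"
   unfolding rform_def by (intro sum.cong refl) auto
  then show ?thesis by (simp add: dot_on_def)
 qed
 then show ?thesis by (simp add: hsq_def)
qed

lemma all_moments_hsq: "all_moments (row_law n) (hsq n)"
 unfolding hsq_rform[abs_def] by (intro all_moments_intros all_moments_rform)

lemma hsq_second_moment:
 assumes n: "0 < n"
 shows "(mean n (%g. (hsq n g)^2)) <= sigma_const"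
proof -
 define \<rho> where "\<rho> = (%g q. rform n g q q (%a b. of_bool (a = b)))"
 have \<rho>: "(mean n (%g. (\<rho> g q)^2)) <= 42 * sandwich_norm^2" if "q < k1" for q
  unfolding \<rho>_def
 proof (rule rform_second_moment[OF that that])
  have pt: "ptrace n (%a b. of_bool (a = b)) p p' = of_bool (p = p')" for p p'
   using n by (simp add: ptrace_def)
  have "\<bar>etaY (ptrace n (%a b. of_bool (a = b))) q q\<bar> <= normA * ((real k2)^2 * 1)"
   by (intro abs_etaY_le that) (simp add: pt)
  also have "... <= sandwich_norm" using normA_nonneg by (simp add: sandwich_norm_def algebra_simps)
  finally show "\<bar>etaY (ptrace n (%a b. of_bool (a = b))) q q\<bar> <= sandwich_norm" .
  have "frob n (%a b. of_bool (a = b)) = (\<Sum>a\<in>idx n. \<Sum>b\<in>idx n. if b = a then 1 else 0)"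
   unfolding frob_def by (intro sum.cong refl) auto
  also have "... = real k2 * real n" by (simp add: idx_def)
  finally have "(normA / real n)^2 * frob n (%a b. of_bool (a = b)) = normA^2 * (real k2 / real n)"
   using n by (simp add: power_divide power2_eq_square)
  also have "... <= normA^2 * ((real k2)^2 + 1)^2"
  proof (rule mult_left_mono)
   have "real k2 / real n <= real k2 / 1" using n by (intro divide_left_mono) auto
   also have "... <= (real k2)^2 + 1" using zero_le_power2[of "real k2 - 1/2"] by (simp add: power2_eq_square algebra_simps)
   also have "... <= ((real k2)^2 + 1)^2" by (rule self_le_power) auto
   finally show "real k2 / real n <= ((real k2)^2 + 1)^2" .
  qed simp
  also have "... = sandwich_norm^2" by (simp add: sandwich_norm_def power_mult_distrib)
  finally show "(normA / real n)^2 * frob n (%a b. of_bool (a = b)) <= sandwich_norm^2" .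
 qed
 have i: "integrable (row_law n) (%g. (\<rho> g q)^2)" for q
  unfolding \<rho>_def by (intro all_moments_integrable all_moments_intros all_moments_rform)
 have "(mean n (%g. (hsq n g)^2)) <= (mean n (%g. real k1 * (\<Sum>q<k1. (\<rho> g q)^2)))"
 proof (rule integral_mono)
  show "integrable (row_law n) (%g. (hsq n g)^2)"
   by (intro all_moments_integrable all_moments_intros all_moments_hsq)
  show "integrable (row_law n) (%g. real k1 * (\<Sum>q<k1. (\<rho> g q)^2))"
   using i by (intro integrable_mult_right Bochner_Integration.integrable_sum)
  fix g
  show "(hsq n g)^2 <= real k1 * (\<Sum>q<k1. (\<rho> g q)^2)"
   using Cauchy_Schwarz_ineq_sum[of "%_. 1" "\<rho> g" "K1"] by (simp add: hsq_rform \<rho>_def)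
 qed
 also have "... = real k1 * (\<Sum>q<k1. (mean n (%g. (\<rho> g q)^2)))"
  using i by simp
 also have "... <= real k1 * (\<Sum>q<k1. 42 * sandwich_norm^2)"
  using \<rho> by (intro mult_left_mono sum_mono) auto
 finally show ?thesis by (simp add: sigma_const_def power2_eq_square ac_simps)
qed

definition weight_const :: "real => real" where
 "weight_const eps = 2 + 2 * sigma_const / eps^2"

lemma weight_expectation:
 assumes n: "0 < n"
 shows "integrable (row_law n) (%g. (1 + hsq n g / eps)^2)"
  and "(mean n (%g. (1 + hsq n g / eps)^2)) <= weight_const eps"
proof -
 interpret G: prob_space "row_law n" by (rule prob_space_gauss_on)
 have i: "integrable (row_law n) (%g. (hsq n g)^2)"
  by (intro all_moments_integrable all_moments_intros all_moments_hsq)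
 show i1: "integrable (row_law n) (%g. (1 + hsq n g / eps)^2)"
  unfolding divide_inverse by (intro all_moments_integrable all_moments_intros all_moments_hsq)
 have "(mean n (%g. (1 + hsq n g / eps)^2)) <= (mean n (%g. 2 + 2 * (hsq n g)^2 / eps^2))"
 proof (rule integral_mono[OF i1])
  show "integrable (row_law n) (%g. 2 + 2 * (hsq n g)^2 / eps^2)" using i by simp
  fix g
  have "(1 + x)^2 <= 2 + 2 * x^2" for x :: real using sum_squares_bound[of 1 x] by (simp add: power2_sum)
  from this[of "hsq n g / eps"] show "(1 + hsq n g / eps)^2 <= 2 + 2 * (hsq n g)^2 / eps^2" by (simp add: power_divide)
 qed
 also have "... = 2 + 2 * (mean n (%g. (hsq n g)^2)) / eps^2" using i by (simp add: G.prob_space)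
 also have "... <= weight_const eps"
  unfolding weight_const_def using hsq_second_moment[OF n] by (intro add_mono divide_right_mono mult_left_mono) auto
 finally show "(mean n (%g. (1 + hsq n g / eps)^2)) <= weight_const eps" .
qed

definition row_error_const :: "real => real" where
 "row_error_const eps = ((real k1)^2 + (real k2)^2 * (real k1)^2) * (20 * normA^2 * real k2 / eps^2) + weight_const eps"

lemma row_error_expectation:
 assumes n: "0 < n" and eps: "0 < eps" and R: "frob n R <= real k2 * real n / eps^2"
 shows "integrable (row_law n) (%g. row_error n eps g R)"
  and "(mean n (%g. row_error n eps g R)) <= row_error_const eps / sqrt (real n)"
proof -
 have sn: "0 < sqrt (real n)" using n by simp
 have iF: "integrable (row_law n) (%g. (form_err n g M q q')^2)" for M q q'
  unfolding form_err_def by (intro all_moments_integrable all_moments_intros all_moments_rform)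
 note iw = weight_expectation(1)[OF n, of eps]
 show "integrable (row_law n) (%g. row_error n eps g R)"
  unfolding row_error_def using iF iw by simp
 define c where "c = 20 * normA^2 * real k2 / eps^2 / real n"
 have F: "(mean n (%g. (form_err n g M q q')^2)) <= c"
  if M: "frob n M <= frob n R" and q: "q < k1" "q' < k1" for M q q'
 proof -
  have "(mean n (%g. (form_err n g M q q')^2)) <= 20 * ((normA / real n)^2 * frob n M)"
   unfolding form_err_def by (rule rform_variance[OF q])
  also have "... <= 20 * ((normA / real n)^2 * (real k2 * real n / eps^2))"
   using M R by (intro mult_left_mono) auto
  also have "... = c" using n by (simp add: c_def power_divide power2_eq_square ac_simps)
  finally show ?thesis .
 qed
 have "(mean n (%g. row_error n eps g R)) =
  sqrt (real n) * ((\<Sum>q<k1. \<Sum>q'<k1. (mean n (%g. (form_err n g R q q')^2)))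
   + (\<Sum>p<k2. \<Sum>p'<k2. \<Sum>q<k1. \<Sum>q'<k1. (mean n (%g. (form_err n g (side p p' R) q q')^2))))
  + (mean n (%g. (1 + hsq n g / eps)^2)) / sqrt (real n)"
  unfolding row_error_def using iF iw by simp
 also have "... <= sqrt (real n) * ((\<Sum>q<k1. \<Sum>q'<k1. c) + (\<Sum>p<k2. \<Sum>p'<k2. \<Sum>q<k1. \<Sum>q'<k1. c)) + weight_const eps / sqrt (real n)"
  using frob_side_le
  by (intro add_mono mult_left_mono divide_right_mono sum_mono F weight_expectation(2)[OF n]) auto
 also have "... = row_error_const eps / sqrt (real n)"
 proof -
  have "sqrt (real n) * c = (20 * normA^2 * real k2 / eps^2) / sqrt (real n)"
  proof -
   have "sqrt (real n) / real n = 1 / sqrt (real n)" using n by (simp add: field_simps)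
   then show ?thesis unfolding c_def by (metis (no_types, lifting) mult.commute times_divide_eq_left times_divide_eq_right mult_1_right)
  qed
  then show ?thesis
   by (simp add: row_error_const_def add_divide_distrib distrib_left distrib_right power2_eq_square[of "real k1"] power2_eq_square[of "real k2"] mult.left_commute[of "sqrt (real n)"])
 qed
 finally show "(mean n (%g. row_error n eps g R)) <= row_error_const eps / sqrt (real n)" .
qed

lemma frob_coercive_inv:
 assumes "sym_on (idx n) N" "0 < eps" "!!x. eps * dot_on (idx n) x x <= quad_on (idx n) N x"
 shows "frob n (inv_on (idx n) N) <= real k2 * real n / eps^2"
proof -
 have "frob n (inv_on (idx n) N) = (\<Sum>b\<in>idx n. \<Sum>a\<in>idx n. (inv_on (idx n) N a b)^2)"
  unfolding frob_def by (rule sum.swap)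
 also have "... <= (\<Sum>b\<in>idx n. 1 / eps^2)"
  using coercive_inv_column[OF finite_idx assms] assms(2) by (intro sum_mono) (simp add: field_simps)
 also have "... = real k2 * real n / eps^2" by (simp add: idx_def)
 finally show ?thesis .
qed

lemma sym_omit_form:
 assumes D: "sym_on K2 D"
 shows "sym_on (idx n) (omit_form D s n r i \<omega>)"
 unfolding sym_on_def
proof (intro ballI)
 fix a b assume ab: "a \<in> idx n" "b \<in> idx n"
 have "tens D a b = tens D b a" by (rule sym_onD[OF sym_tens[OF D] ab])
 moreover have "gram_row n i \<omega> a b = gram_row n i \<omega> b a" for i
  by (simp add: gram_row_def mult.commute)
 ultimately show "omit_form D s n r i \<omega> a b = omit_form D s n r i \<omega> b a"
  by (simp add: omit_form_def of_bool_def)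
qed

definition omit_coercive :: "cmat => real => real => nat => nat => nat => (nat \<times> nat \<times> nat => real) => bool" where
 "omit_coercive D s eps n r i \<omega> \<longleftrightarrow> (\<forall>x. eps * dot_on (idx n) x x <= quad_on (idx n) (omit_form D s n r i \<omega>) x)"

text \<open>The error of row $i$ is set to 0 unless the form without row $i$ is coercive, which is an event independent of
row $i$; this makes its expectation computable by Fubini.\<close>

definition row_total :: "cmat => real => real => real => nat => nat => nat => (nat \<times> nat \<times> nat => real) => real" where
 "row_total D s eps \<gamma> n r i \<omega> = (if omit_coercive D s eps n r i \<omega>
   then row_error n eps (row_noise n i \<omega>) (inv_on (idx n) (omit_form D s n r i \<omega>)) + \<gamma> * (1 + hsq n (row_noise n i \<omega>) / eps)^2
   else 0)"

lemma omit_form_measurable: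
 assumes "a \<in> idx n" "b \<in> idx n"
 shows "(%\<omega>. omit_form D s n r i \<omega> a b) \<in> borel_measurable (law r n)"
 unfolding omit_form_def using assms
 by (intro borel_measurable_diff borel_measurable_const borel_measurable_sum gram_row_measurable) auto

lemma omit_coercive_measurable: "{\<omega> \<in> space (law r n). omit_coercive D s eps n r i \<omega>} \<in> sets (law r n)"
proof -
 define F where "F = {\<omega> \<in> space (law r n). \<exists>x. quad_on (idx n) (%a b. omit_form D s n r i \<omega> a b - eps * of_bool (a = b)) x < 0}"
 have "F \<in> sets (law r n)"
  unfolding F_def by (intro negative_direction_measurable borel_measurable_diff borel_measurable_const omit_form_measurable) auto
 moreover have "{\<omega> \<in> space (law r n). omit_coercive D s eps n r i \<omega>} = space (law r n) - F"
  unfolding F_def omit_coercive_def quad_on_linear quad_of_bool[OF finite_idx]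
  by (auto simp: not_less) (metis linorder_not_le)
 ultimately show ?thesis by auto
qed

lemma rform_measurable:
 assumes R: "!!a b. a \<in> idx n ==> b \<in> idx n ==> (%\<omega>. R \<omega> a b) \<in> borel_measurable (gauss_on (cube I n))"
  and "i \<in> I" "q < k1" "q' < k1"
 shows "(%\<omega>. form_err n (row_noise n i \<omega>) (R \<omega>) q q') \<in> borel_measurable (gauss_on (cube I n))"
 unfolding form_err_def rform_def etaY_def ptrace_def using assms
 by (intro borel_measurable_diff borel_measurable_sum borel_measurable_times borel_measurable_divide borel_measurable_const row_measurable R)
  (auto simp: idx_def)

lemma row_total_measurable:
 assumes i: "i < r" and D: "sym_on K2 D"
 shows "row_total D s eps \<gamma> n r i \<in> borel_measurable (law r n)"
proof -
 define R where "R = (%\<omega>. inv_on (idx n) (omit_form D s n r i \<omega>))"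
 have R: "(%\<omega>. R \<omega> a b) \<in> borel_measurable (law r n)" if "a \<in> idx n" "b \<in> idx n" for a b
  unfolding R_def by (intro inv_on_borel_measurable finite_idx omit_form_measurable that)
 have h: "(%\<omega>. hsq n (row_noise n i \<omega>)) \<in> borel_measurable (law r n)"
  unfolding hsq_def dot_on_def using i
  by (intro borel_measurable_sum borel_measurable_times row_measurable) auto
 have w: "(%\<omega>. (1 + hsq n (row_noise n i \<omega>) / eps)^2) \<in> borel_measurable (law r n)"
  using h by simp
 have f: "(%\<omega>. (form_err n (row_noise n i \<omega>) (R \<omega>) q q')^2) \<in> borel_measurable (law r n)" if "q < k1" "q' < k1" for q q'
  using i that by (intro borel_measurable_power rform_measurable R) auto
 have f': "(%\<omega>. (form_err n (row_noise n i \<omega>) (side p p' (R \<omega>)) q q')^2) \<in> borel_measurable (law r n)"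
  if "q < k1" "q' < k1" "p' < k2" for p p' q q'
  using i that unfolding side_def[abs_def]
  by (intro borel_measurable_power rform_measurable borel_measurable_times borel_measurable_const R) (auto simp: idx_def)
 have "(%\<omega>. row_error n eps (row_noise n i \<omega>) (R \<omega>) + \<gamma> * (1 + hsq n (row_noise n i \<omega>) / eps)^2) \<in> borel_measurable (law r n)"
  unfolding row_error_def
  by (intro borel_measurable_add borel_measurable_times borel_measurable_const borel_measurable_sum borel_measurable_divide w f f') auto
 then show ?thesis
  unfolding row_total_def[abs_def] R_def
  by (intro measurable_If borel_measurable_const omit_coercive_measurable)
qed

lemma row_total_nonneg:
 "0 < n ==> 0 < eps ==> 0 <= \<gamma> ==> 0 <= row_total D s eps \<gamma> n r i \<omega>"
 unfolding row_total_def using row_error_ge(1) by (auto intro!: add_nonneg_nonneg)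

lemma row_total_nn_integral:
 assumes n: "0 < n" and i: "i < r" and D: "sym_on K2 D" and eps: "0 < eps" and \<gamma>: "0 <= \<gamma>"
 shows "(\<integral>\<^sup>+\<omega>. ennreal (row_total D s eps \<gamma> n r i \<omega>) \<partial>(law r n))
  <= ennreal (row_error_const eps / sqrt (real n) + \<gamma> * weight_const eps)"
proof -
 define J where "J = {..<r} - {i}"
 define K where "K = row_error_const eps / sqrt (real n) + \<gamma> * weight_const eps"
 have U: "cube J n \<union> cube {i} n = cube {..<r} n" using i by (auto simp: cube_def J_def)
 have disj: "J \<inter> {i} = {}" "cube J n \<inter> cube {i} n = {}" by (auto simp: cube_def J_def)
 have "(\<integral>\<^sup>+\<omega>. ennreal (row_total D s eps \<gamma> n r i \<omega>) \<partial>(law r n)) =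
  (\<integral>\<^sup>+x. (\<integral>\<^sup>+y. ennreal (row_total D s eps \<gamma> n r i (merge (cube J n) (cube {i} n) (x, y))) \<partial>(gauss_on (cube {i} n))) \<partial>(gauss_on (cube J n)))"
  using gauss_prod.product_nn_integral_fold[OF disj(2), of "%\<omega>. ennreal (row_total D s eps \<gamma> n r i \<omega>)"]
   row_total_measurable[OF i D, of s eps \<gamma> n] unfolding U by (simp add: J_def)
 also have "... <= (\<integral>\<^sup>+x. ennreal K \<partial>(gauss_on (cube J n)))"
 proof (rule nn_integral_mono)
  fix x
  define N where "N = omit_form D s n r i x"
  have om: "omit_form D s n r i (merge (cube J n) (cube {i} n) (x, y)) = N" for y
  proof (intro ext)
   fix a b
   have "(\<Sum>i'\<in>{..<r} - {i}. gram_row n i' (merge (cube J n) (cube {i} n) (x, y)) a b) = (\<Sum>i'\<in>{..<r} - {i}. gram_row n i' x a b)"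
    by (intro sum.cong refl) (simp add: gram_row_merge(1)[OF disj(1)] J_def[symmetric])
   then show "omit_form D s n r i (merge (cube J n) (cube {i} n) (x, y)) a b = N a b"
    by (simp add: omit_form_def N_def)
  qed
  have rn: "row_noise n i (merge (cube J n) (cube {i} n) (x, y)) = row_noise n i y" for y
   by (rule row_noise_merge(2)[OF disj(1)]) simp
  show "(\<integral>\<^sup>+y. ennreal (row_total D s eps \<gamma> n r i (merge (cube J n) (cube {i} n) (x, y))) \<partial>(gauss_on (cube {i} n))) <= ennreal K"
  proof (cases "\<forall>z. eps * dot_on (idx n) z z <= quad_on (idx n) N z")
   case False
   have "row_total D s eps \<gamma> n r i (merge (cube J n) (cube {i} n) (x, y)) = 0" for y
    unfolding row_total_def omit_coercive_def om by (rule if_not_P) (rule False)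
   then show ?thesis by simp
  next
   case True
   define f where "f = (%g. row_error n eps g (inv_on (idx n) N) + \<gamma> * (1 + hsq n g / eps)^2)"
   have fr: "frob n (inv_on (idx n) N) <= real k2 * real n / eps^2"
    using True unfolding N_def by (intro frob_coercive_inv sym_omit_form D eps) auto
   have fi: "integrable (row_law n) f"
    unfolding f_def using row_error_expectation(1)[OF n eps fr] weight_expectation(1)[OF n] by simp
   have f0: "0 <= f g" for g unfolding f_def using row_error_ge(1)[OF n eps] \<gamma> by (simp add: add_nonneg_nonneg)
   have "(\<integral>\<^sup>+y. ennreal (row_total D s eps \<gamma> n r i (merge (cube J n) (cube {i} n) (x, y))) \<partial>(gauss_on (cube {i} n))) =
    (\<integral>\<^sup>+y. ennreal (f (row_noise n i y)) \<partial>(gauss_on (cube {i} n)))"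
    using True by (simp add: row_total_def omit_coercive_def om rn f_def)
   also have "... = ennreal (\<integral>y. f (row_noise n i y) \<partial>(gauss_on (cube {i} n)))"
    using fi f0 by (intro nn_integral_eq_integral row_noise_integral(2)) auto
   also have "(\<integral>y. f (row_noise n i y) \<partial>(gauss_on (cube {i} n))) = (mean n (%g. f g))"
    using fi by (intro row_noise_integral(1)) auto
   also have "... = (mean n (%g. row_error n eps g (inv_on (idx n) N))) + \<gamma> * (mean n (%g. (1 + hsq n g / eps)^2))"
    unfolding f_def using row_error_expectation(1)[OF n eps fr] weight_expectation(1)[OF n] by simp
   also have "ennreal ... <= ennreal K"
    unfolding K_def using row_error_expectation(2)[OF n eps fr] weight_expectation(2)[OF n] \<gamma>
    by (intro ennreal_leI add_mono mult_left_mono) auto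
   finally show ?thesis .
  qed
 qed
 also have "... = ennreal K"
  by (simp add: prob_space.emeasure_space_1[OF prob_space_gauss_on])
 finally show ?thesis by (simp add: K_def)
qed

text \<open>If level \<open>s0\<close> lies above the spectrum, the gap form at a slightly larger level is coercive, and
then the errors cannot all be small, since otherwise the level \<open>s0 + \<eta>0\<close> would be feasible.
Markov's inequality bounds the probability that their average is large.\<close>

theorem infeasible_success_tendsto_0:
 fixes m :: "nat => nat"
 assumes D: "sym_on K2 D" and \<eta>0: "0 < \<eta>0" and infeas: "\<not> feasible D \<alpha> (s0 + \<eta>0)"
  and m: "(%n. real (m n) / real n) \<longlonglongrightarrow> \<alpha>" and m_top: "filterlim m at_top sequentially"
 shows "(%n. measure (law (m n) n) {\<omega> \<in> space (law (m n) n).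
   \<forall>x. 0 <= quad_on (idx n) (gap_form D s0 n (m n) \<omega>) x}) \<longlonglongrightarrow> 0"
proof -
 have \<alpha>0: "0 <= \<alpha>" using m by (rule LIMSEQ_le_const) auto
 define \<eta> where "\<eta> = \<eta>0 / 8"
 define eps where "eps = \<eta>0 / 2"
 define s where "s = s0 + eps"
 have \<eta>: "0 < \<eta>" and eps: "0 < eps" using \<eta>0 by (auto simp: \<eta>_def eps_def)
 have s4: "s + 4 * \<eta> = s0 + \<eta>0" by (simp add: s_def eps_def \<eta>_def)
 define dabs where "dabs = (\<Sum>p<k2. \<Sum>p'<k2. \<bar>D p p'\<bar>)"
 have dabs0: "0 <= dabs" unfolding dabs_def by (intro sum_nonneg) auto
 define \<kappa> where "\<kappa> = \<bar>s\<bar> + dabs + 1"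
 have \<kappa>: "0 < \<kappa>" using dabs0 by (simp add: \<kappa>_def)
 have \<kappa>D: "s * dot_on K2 v v - quad_on K2 D v <= \<kappa> * dot_on K2 v v" for v
 proof -
  define d where "d = dot_on K2 v v"
  have "0 <= d" unfolding d_def by (rule dot_on_nonneg)
  moreover have "\<bar>quad_on K2 D v\<bar> <= dabs * d" unfolding d_def dabs_def by (rule abs_quad_on_le) simp
  moreover have "s * d <= \<bar>s\<bar> * d" using \<open>0 <= d\<close> by (intro mult_right_mono) auto
  ultimately show ?thesis unfolding d_def[symmetric] \<kappa>_def distrib_right by linarith
 qed
 define \<mu> where "\<mu> = min (1 / 2) (\<eta> / (2 * (\<kappa> + 2 * \<eta>)))"
 have \<kappa>\<eta>: "0 < 2 * (\<kappa> + 2 * \<eta>)" using \<kappa> \<eta> by simp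
 have \<mu>: "0 < \<mu>" "\<mu> <= 1 / 2" unfolding \<mu>_def using \<kappa>\<eta> \<eta> by (simp_all only: min.cobounded1) simp
 have \<mu>': "2 * \<mu> * (\<kappa> + 2 * \<eta>) <= \<eta>"
 proof -
  have "\<mu> * (2 * (\<kappa> + 2 * \<eta>)) <= \<eta> / (2 * (\<kappa> + 2 * \<eta>)) * (2 * (\<kappa> + 2 * \<eta>))"
   using \<kappa>\<eta> by (intro mult_right_mono) (auto simp: \<mu>_def)
  also have "... = \<eta>" using \<kappa>\<eta> by simp
  finally show ?thesis by (simp add: algebra_simps)
 qed
 define E where "E = error_const eps"
 have E: "1 <= E" unfolding E_def error_const_def using normA_nonneg eps by simp
 define a2 where "a2 = (real k2)^2 * ((\<alpha> + 1) * E) * (1 + \<kappa>^2)"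
 define a3 where "a3 = (real k2)^2 * (normA * (real k1)^2)"
 have a0: "0 <= a2" "0 <= a3" unfolding a2_def a3_def using \<alpha>0 E normA_nonneg by auto
 define \<zeta> where "\<zeta> = min (\<mu> / (2 * E)) (\<eta> / (a2 + a3 + 1))"
 have \<zeta>: "0 < \<zeta>" using \<mu> E \<eta> a0 by (auto simp: \<zeta>_def)
 have \<zeta>1: "E * \<zeta> <= \<mu> / 2"
 proof -
  have "E * \<zeta> <= E * (\<mu> / (2 * E))" using E by (intro mult_left_mono) (auto simp: \<zeta>_def)
  then show ?thesis using E by simp
 qed
 have \<zeta>2: "(a2 + a3) * \<zeta> <= \<eta>"
 proof -
  have "(a2 + a3) * \<zeta> <= (a2 + a3 + 1) * (\<eta> / (a2 + a3 + 1))"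
   using a0 \<eta> \<zeta> by (intro mult_mono) (auto simp: \<zeta>_def)
  then show ?thesis using a0 by simp
 qed
 define V where "V = (%n. (row_error_const eps / sqrt (real n) + \<bar>\<alpha> - real (m n) / real n\<bar> * weight_const eps) / \<zeta>)"
 have bound: "measure (law (m n) n) {\<omega> \<in> space (law (m n) n).
   \<forall>x. 0 <= quad_on (idx n) (gap_form D s0 n (m n) \<omega>) x} <= V n"
  if n: "0 < n" and r: "0 < m n" and close: "real (m n) / real n <= \<alpha> + 1" for n
 proof -
  define r where "r = m n"
  define \<gamma> where "\<gamma> = \<bar>\<alpha> - real r / real n\<bar>"
  define P where "P = law r n"
  interpret P: prob_space P unfolding P_def by (rule prob_space_gauss_on)
  define G where "G = {\<omega> \<in> space P. \<forall>x. 0 <= quad_on (idx n) (gap_form D s0 n r \<omega>) x}"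
  have r0: "0 < r" using r by (simp add: r_def)
  have Gsets: "G \<in> sets P"
  proof -
   have "G = space P - {\<omega> \<in> space P. \<exists>x. quad_on (idx n) (gap_form D s0 n r \<omega>) x < 0}"
    by (auto simp: G_def not_less) (metis linorder_not_le)
   moreover have "{\<omega> \<in> space P. \<exists>x. quad_on (idx n) (gap_form D s0 n r \<omega>) x < 0} \<in> sets P"
    unfolding P_def by (intro negative_direction_measurable gap_form_measurable) auto
   ultimately show ?thesis by auto
  qed
  define Z where "Z = (%\<omega>. (\<Sum>i<r. row_total D s eps \<gamma> n r i \<omega>) / real r)"
  have Zge: "\<zeta> <= Z \<omega>" if "\<omega> \<in> G" for \<omega>
  proof (rule ccontr)
   assume "\<not> \<zeta> <= Z \<omega>"
   then have Zlt: "Z \<omega> < \<zeta>" by simp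
   have co: "eps * dot_on (idx n) x x <= quad_on (idx n) (gap_form D s n r \<omega>) x" for x
   proof -
    have "0 <= quad_on (idx n) (gap_form D s0 n r \<omega>) x" using that by (simp add: G_def)
    then show ?thesis unfolding quad_gap_form s_def by (simp add: algebra_simps)
   qed
   have oc: "omit_coercive D s eps n r i \<omega>" if "i < r" for i
    unfolding omit_coercive_def using leave_row_out(2)[OF n that D eps co] by blast
   define err where "err = (%i. row_error n eps (row_noise n i \<omega>) (inv_on (idx n) (omit_form D s n r i \<omega>)))"
   define w where "w = (%i. 1 + hsq n (row_noise n i \<omega>) / eps)"
   have errI: "row_error n eps (row_noise n i \<omega>) (inv_on (idx n) (omit_form D s n r i \<omega>)) = err i"
    and wI: "1 + hsq n (row_noise n i \<omega>) / eps = w i" for i by (simp_all only: err_def w_def)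
   have "(\<Sum>i<r. row_total D s eps \<gamma> n r i \<omega>) = (\<Sum>i<r. err i) + \<gamma> * (\<Sum>i<r. (w i)^2)"
    using oc by (simp add: row_total_def err_def w_def sum.distrib sum_distrib_left)
   then have Zsplit: "Z \<omega> = (\<Sum>i<r. err i) / real r + \<gamma> * ((\<Sum>i<r. (w i)^2) / real r)"
    by (simp add: Z_def add_divide_distrib)
   define A1 where "A1 = (\<Sum>i<r. err i) / real r"
   define A2 where "A2 = (\<Sum>i<r. (w i)^2) / real r"
   have A: "0 <= A1" "0 <= A2" unfolding A1_def A2_def err_def
    using row_error_ge(1)[OF n eps] by (auto intro!: divide_nonneg_nonneg sum_nonneg)
   have \<gamma>0: "0 <= \<gamma>" by (simp add: \<gamma>_def)
   have A1\<zeta>: "A1 <= \<zeta>" and A2\<zeta>: "\<gamma> * A2 <= \<zeta>"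
    using Zlt Zsplit A \<gamma>0 mult_nonneg_nonneg[OF \<gamma>0 A(2)] unfolding A1_def[symmetric] A2_def[symmetric] by linarith+
   have "feasible D \<alpha> (s + 4 * \<eta>)"
   proof (rule good_event_feasible[where \<alpha> = \<alpha>, OF n r0 D eps co \<eta> \<kappa> \<mu> \<mu>' \<kappa>D, unfolded errI wI, folded A1_def A2_def E_def \<gamma>_def])
    show "E * A1 <= \<mu> / 2" using mult_left_mono[OF A1\<zeta>, of E] E \<zeta>1 by linarith
    have "(real k2)^2 * (real r / real n * (E * A1)) * (1 + \<kappa>^2) <= (real k2)^2 * ((\<alpha> + 1) * (E * \<zeta>)) * (1 + \<kappa>^2)"
     using close A1\<zeta> E A \<alpha>0 unfolding r_def by (intro mult_right_mono mult_left_mono mult_mono) auto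
    also have "... = a2 * \<zeta>" by (simp add: a2_def)
    also have "... <= (a2 + a3) * \<zeta>" using a0 \<zeta> by (intro mult_right_mono) auto
    also have "... <= 2 * \<eta>" using \<zeta>2 \<eta> by linarith
    finally show "(real k2)^2 * (real r / real n * (E * A1)) * (1 + \<kappa>^2) <= 2 * \<eta>" .
    have "\<gamma> * ((real k2)^2 * (normA * ((real k1)^2 * A2))) = a3 * (\<gamma> * A2)" by (simp add: a3_def)
    also have "... <= a3 * \<zeta>" using a0 A2\<zeta> by (intro mult_left_mono) auto
    also have "... <= (a2 + a3) * \<zeta>" using a0 \<zeta> by (intro mult_right_mono) auto
    finally show "\<gamma> * ((real k2)^2 * (normA * ((real k1)^2 * A2))) <= \<eta>" using \<zeta>2 by linarith
   qed
   then show False using infeas unfolding s4 by blast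
  qed
  (* Markov: the average Z of the row errors is at least zeta on the event G *)
  have rt0: "0 <= row_total D s eps \<gamma> n r i \<omega>" for i \<omega>
   using n eps by (intro row_total_nonneg) (auto simp: \<gamma>_def)
  have Zm: "Z \<in> borel_measurable P"
   unfolding Z_def P_def by (intro borel_measurable_divide borel_measurable_sum borel_measurable_const row_total_measurable D) auto
  define K where "K = row_error_const eps / sqrt (real n) + \<gamma> * weight_const eps"
  have "ennreal \<zeta> * emeasure P G = (\<integral>\<^sup>+\<omega>. ennreal \<zeta> * indicator G \<omega> \<partial>P)"
   using Gsets by (simp add: nn_integral_cmult_indicator)
  also have "... <= (\<integral>\<^sup>+\<omega>. ennreal (Z \<omega>) \<partial>P)"
   using Zge by (intro nn_integral_mono) (auto simp: indicator_def intro: ennreal_leI)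
  also have "... = (\<integral>\<^sup>+\<omega>. (\<Sum>i<r. ennreal (row_total D s eps \<gamma> n r i \<omega>)) * ennreal (1 / real r) \<partial>P)"
   using rt0 r0 by (intro nn_integral_cong) (simp add: Z_def sum_ennreal ennreal_mult[symmetric] sum_nonneg divide_inverse)
  also have "... = (\<Sum>i<r. (\<integral>\<^sup>+\<omega>. ennreal (row_total D s eps \<gamma> n r i \<omega>) \<partial>P)) * ennreal (1 / real r)"
   using row_total_measurable[OF _ D] unfolding P_def
   by (subst nn_integral_multc, force) (subst nn_integral_sum, auto)
  also have "... <= (\<Sum>i<r. ennreal K) * ennreal (1 / real r)"
   unfolding P_def K_def by (intro mult_right_mono sum_mono row_total_nn_integral n D eps) (auto simp: \<gamma>_def)
  also have "... = ennreal K"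
  proof -
   have K0: "0 <= K" unfolding K_def row_error_const_def weight_const_def \<gamma>_def using sigma_const_nonneg by auto
   then show ?thesis using r0 by (simp add: ennreal_of_nat_eq_real_of_nat ennreal_mult[symmetric])
  qed
  finally have le: "ennreal \<zeta> * emeasure P G <= ennreal K" .
  have K0: "0 <= K" unfolding K_def row_error_const_def weight_const_def \<gamma>_def using sigma_const_nonneg by auto
  have "ennreal (\<zeta> * measure P G) <= ennreal K"
   using le \<zeta> by (simp add: P.emeasure_eq_measure ennreal_mult)
  then have "\<zeta> * measure P G <= K" using K0 by simp
  then show ?thesis using \<zeta> unfolding V_def K_def P_def G_def r_def \<gamma>_def by (simp add: field_simps)
 qed
 have V: "V \<longlonglongrightarrow> 0"
 proof -
  have 1: "(%n. row_error_const eps / sqrt (real n)) \<longlonglongrightarrow> 0"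
   by (intro tendsto_divide_0[OF tendsto_const] filterlim_at_top_imp_at_infinity
     filterlim_compose[OF sqrt_at_top filterlim_real_sequentially])
  have 2: "(%n. \<bar>\<alpha> - real (m n) / real n\<bar> * weight_const eps) \<longlonglongrightarrow> \<bar>\<alpha> - \<alpha>\<bar> * weight_const eps"
   by (intro tendsto_intros m)
  have "V \<longlonglongrightarrow> (0 + \<bar>\<alpha> - \<alpha>\<bar> * weight_const eps) / \<zeta>"
   unfolding V_def using \<zeta> by (intro tendsto_divide tendsto_add 1 2 tendsto_const) auto
  then show ?thesis by simp
 qed
 have "\<forall>\<^sub>F n in sequentially. real (m n) / real n < \<alpha> + 1"
  using m by (rule order_tendstoD) simp
 moreover have "\<forall>\<^sub>F n in sequentially. 0 < m n"
  using m_top eventually_gt_at_top[of "0::nat"] by (auto simp: filterlim_iff)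
 ultimately have "\<forall>\<^sub>F n in sequentially. measure (law (m n) n) {\<omega> \<in> space (law (m n) n).
   \<forall>x. 0 <= quad_on (idx n) (gap_form D s0 n (m n) \<omega>) x} <= V n"
  using eventually_gt_at_top[of 0]
 proof eventually_elim
  case (elim n)
  show ?case by (rule bound[OF elim(3,2) less_imp_le[OF elim(1)]])
 qed
 then show ?thesis
  by (intro tendsto_sandwich[OF _ _ tendsto_const V]) auto
qed

end

section \<open>A lattice net and the operator norm\<close>

text \<open>Integer points $k$ with $|k|^2 \le 49 d$, where $d$ is the dimension. Scaled by $1/(6 \sqrt d)$ they lie in the
ball of radius $7/6$, and rounding a point of the unit ball costs at most $1/6$.\<close>

definition lattice_points :: "'a set => ('a => int) set" where
 "lattice_points I = {k \<in> I \<rightarrow>\<^sub>E {- (49 * int (card I))..49 * int (card I)}. (\<Sum>a\<in>I. (k a)^2) <= 49 * int (card I)}"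

definition lattice_vector :: "'a set => ('a => int) => 'a => real" where
 "lattice_vector I k a = real_of_int (k a) / (6 * sqrt (real (card I)))"

lemma finite_lattice_points: "finite I ==> finite (lattice_points I)"
 unfolding lattice_points_def
 by (rule finite_subset[of _ "I \<rightarrow>\<^sub>E {- (49 * int (card I))..49 * int (card I)}"]) (auto intro: finite_PiE)

lemma sum_halves: "(\<Sum>k\<in>{- int K..int K}. (1/2::real) ^ nat \<bar>k\<bar>) = 3 - 2 * (1/2) ^ K"
proof (induction K)
 case (Suc K)
 have s: "{- int (Suc K)..int (Suc K)} = insert (int (Suc K)) (insert (- int (Suc K)) {- int K..int K})" by auto
 have n: "nat (1 + int K) = Suc K" "nat (int K + 1) = Suc K" "nat \<bar>- 1 - int K\<bar> = Suc K" "nat \<bar>1 + int K\<bar> = Suc K" by auto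
 have "(\<Sum>k\<in>{- int (Suc K)..int (Suc K)}. (1/2::real) ^ nat \<bar>k\<bar>) =
  (1/2) ^ Suc K + ((1/2) ^ Suc K + (\<Sum>k\<in>{- int K..int K}. (1/2::real) ^ nat \<bar>k\<bar>))"
  unfolding s by (subst sum.insert, simp, simp, subst sum.insert, simp, simp, simp add: n)
 then show ?case using Suc.IH by simp
qed simp

text \<open>Weight each integer point by $2^{-\sum |k_a|}$: a point of the ball has weight at least $2^{-49 d}$, since
$|k_a| \le k_a^2$, while the total weight is at most $3^d$.\<close>

lemma card_lattice_points_le:
 assumes "finite I"
 shows "real (card (lattice_points I)) <= (2 ^ 49 * 3) ^ card I"
proof -
 define K where "K = 49 * card I"
 have Keq: "49 * int (card I) = int K" by (simp add: K_def)
 let ?w = "%k. \<Prod>a\<in>I. (1/2::real) ^ nat \<bar>k a\<bar>"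
 have fin: "finite (I \<rightarrow>\<^sub>E {- int K..int K})" using assms by (intro finite_PiE) auto
 have ge: "(1/2) ^ K <= ?w k" if k: "k \<in> lattice_points I" for k
 proof -
  have "int (\<Sum>a\<in>I. nat \<bar>k a\<bar>) = (\<Sum>a\<in>I. \<bar>k a\<bar>)" by simp
  also have "... <= (\<Sum>a\<in>I. (k a)^2)"
  proof (intro sum_mono)
   fix a
   show "\<bar>k a\<bar> <= (k a)^2" by (cases "k a = 0") (use self_le_power[of "\<bar>k a\<bar>" 2] in auto)
  qed
  also have "... <= int K" using k by (simp add: lattice_points_def Keq)
  finally have "(\<Sum>a\<in>I. nat \<bar>k a\<bar>) <= K" by linarith
  then show ?thesis by (subst power_sum[symmetric]) (auto intro: power_decreasing)
 qed
 have "real (card (lattice_points I)) * (1/2) ^ K <= (\<Sum>k\<in>lattice_points I. ?w k)"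
  by (rule sum_bounded_below[OF ge])
 also have "... <= (\<Sum>k\<in>I \<rightarrow>\<^sub>E {- int K..int K}. ?w k)"
  using fin by (intro sum_mono2) (auto simp: lattice_points_def Keq intro: prod_nonneg)
 also have "... = (\<Prod>a\<in>I. \<Sum>k\<in>{- int K..int K}. (1/2::real) ^ nat \<bar>k\<bar>)"
  using assms by (subst prod_sum_PiE) auto
 also have "... <= (\<Prod>a\<in>I. 3)" unfolding sum_halves
 proof (rule prod_mono)
  fix a show "0 <= 3 - 2 * (1/2::real) ^ K \<and> 3 - 2 * (1/2::real) ^ K <= 3"
   using power_le_one[of "1/2::real" K] zero_le_power[of "1/2::real" K] by linarith
 qed
 also have "... = 3 ^ card I" by simp
 finally have "real (card (lattice_points I)) * (1/2) ^ K <= 3 ^ card I" .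
 then have "real (card (lattice_points I)) * (1/2) ^ K * 2 ^ K <= 3 ^ card I * 2 ^ K" by (rule mult_right_mono) simp
 moreover have "(1/2::real) ^ K * 2 ^ K = 1" by (simp flip: power_mult_distrib)
 ultimately have "real (card (lattice_points I)) <= 3 ^ card I * 2 ^ K" by (simp only: mult.assoc mult_1_right)
 then show ?thesis unfolding K_def power_mult power_mult_distrib by (simp add: mult.commute)
qed

lemma lattice_vector_norm:
 assumes "finite I" "k \<in> lattice_points I"
 shows "dot_on I (lattice_vector I k) (lattice_vector I k) <= 49 / 36"
proof (cases "I = {}")
 case False
 then have c: "0 < real (card I)" using assms by (simp add: card_gt_0_iff)
 have "dot_on I (lattice_vector I k) (lattice_vector I k) = real_of_int (\<Sum>a\<in>I. (k a)^2) / (36 * real (card I))"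
  using c by (simp add: dot_on_def lattice_vector_def power2_eq_square sum_divide_distrib)
 also have "... <= real_of_int (49 * int (card I)) / (36 * real (card I))"
  using assms c by (intro divide_right_mono, subst of_int_le_iff) (auto simp: lattice_points_def)
 also have "... = 49 / 36" using c by simp
 finally show ?thesis .
qed (simp add: dot_on_def)

lemma lattice_approximation:
 assumes I: "finite I" "I \<noteq> {}" and x: "dot_on I x x <= 1"
 obtains k where "k \<in> lattice_points I"
  "dot_on I (%a. x a - lattice_vector I k a) (%a. x a - lattice_vector I k a) <= 1 / 36"
proof -
 define d where "d = real (card I)"
 have d: "1 <= d" using I by (simp add: d_def Suc_le_eq card_gt_0_iff)
 define h where "h = 6 * sqrt d"
 have h: "0 < h" "h^2 = 36 * d" using d by (simp_all add: h_def power_mult_distrib)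
 define k where "k = (\<lambda>a\<in>I. \<lfloor>h * x a\<rfloor>)"
 define z where "z = lattice_vector I k"
 have z: "z a = \<lfloor>h * x a\<rfloor> / h" if "a \<in> I" for a
  using that by (simp add: z_def lattice_vector_def k_def h_def d_def)
 have err: "(x a - z a)^2 <= 1 / h^2" if "a \<in> I" for a
 proof -
  have "x a - z a = (h * x a - \<lfloor>h * x a\<rfloor>) / h" using h z[OF that] by (simp add: diff_divide_distrib)
  moreover have "\<bar>h * x a - \<lfloor>h * x a\<rfloor>\<bar> <= 1" by linarith
  ultimately show ?thesis by (simp add: power_divide divide_right_mono abs_square_le_1)
 qed
 have e: "dot_on I (%a. x a - z a) (%a. x a - z a) <= 1 / 36"
 proof -
  have "dot_on I (%a. x a - z a) (%a. x a - z a) <= (\<Sum>a\<in>I. 1 / h^2)"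
   unfolding dot_on_def by (intro sum_mono) (use err in \<open>simp add: power2_eq_square\<close>)
  also have "... = d / (36 * d)" by (simp add: d_def[symmetric] h)
  also have "... = 1 / 36" using d by simp
  finally show ?thesis .
 qed
 have "dot_on I z z <= (1 + 1/6) * dot_on I x x + (1 + 6) * dot_on I (%a. x a - z a) (%a. x a - z a)"
  unfolding dot_on_def sum_distrib_left sum.distrib[symmetric]
 proof (intro sum_mono)
  fix a
  have "0 <= (x a + 6 * (x a - z a))^2" by simp
  then show "z a * z a <= (1 + 1/6) * (x a * x a) + (1 + 6) * ((x a - z a) * (x a - z a))"
   by (simp add: power2_eq_square algebra_simps)
 qed
 also have "... <= 49 / 36" using x e by (simp add: field_simps)
 finally have zz: "dot_on I z z <= 49 / 36" .
 have "real_of_int (\<Sum>a\<in>I. (k a)^2) = h^2 * dot_on I z z"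
  using h(1) by (simp add: dot_on_def sum_distrib_left k_def z power2_eq_square)
 also have "... <= (36 * d) * (49 / 36)" unfolding h(2) using zz d by (intro mult_left_mono) auto
 finally have "real_of_int (\<Sum>a\<in>I. (k a)^2) <= real_of_int (49 * int (card I))" by (simp add: d_def)
 then have ks: "(\<Sum>a\<in>I. (k a)^2) <= 49 * int (card I)" by (simp only: of_int_le_iff)
 have "k a \<in> {- (49 * int (card I))..49 * int (card I)}" if a: "a \<in> I" for a
 proof -
  have "\<bar>k a\<bar> <= (k a)^2" by (cases "k a = 0") (use self_le_power[of "\<bar>k a\<bar>" 2] in auto)
  also have "... <= (\<Sum>a\<in>I. (k a)^2)" using I a by (intro member_le_sum) auto
  finally show ?thesis using ks by auto
 qed
 then have "k \<in> lattice_points I" using ks by (auto simp: lattice_points_def k_def)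
 with e show ?thesis using that unfolding z_def by blast
qed

text \<open>The supremum $S$ of the bilinear form over pairs of unit vectors satisfies $S \le K + (1/6 + 7/36) S$ by
rounding both vectors.\<close>

lemma net_bounds_form:
 fixes b :: "'a => 'b => real"
 assumes I: "finite I" "I \<noteq> {}" and J: "finite J" "J \<noteq> {}" and K0: "0 <= K"
  and K: "!!k k'. k \<in> lattice_points I ==> k' \<in> lattice_points J ==>
   (\<Sum>c\<in>J. lattice_vector J k' c * dot_on I (b' c) (lattice_vector I k)) <= K"
 shows "(\<Sum>c\<in>J. (dot_on I (b' c) x)^2) <= (2 * K)^2 * dot_on I x x"
proof -
 define f where "f x y = (\<Sum>c\<in>J. y c * dot_on I (b' c) x)" for x y
 have f_diff1: "f (%a. x a - u a) y = f x y - f u y" for x u y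
  by (simp add: f_def dot_on_linear right_diff_distrib sum_subtractf)
 have f_diff2: "f x (%a. y a - v a) = f x y - f x v" for x y v
  by (simp add: f_def left_diff_distrib sum_subtractf)
 have f_scale1: "f (%a. t * x a) y = t * f x y" for t x y
  by (simp add: f_def dot_on_linear sum_distrib_left ac_simps)
 have f_scale2: "f x (%a. t * y a) = t * f x y" for t x y
  by (simp add: f_def sum_distrib_left ac_simps)
 have dscale: "dot_on L (%a. t * x a) (%a. t * x a) = t^2 * dot_on L x x" for L t and x :: "'z => real"
  by (simp add: dot_on_def sum_distrib_left power2_eq_square ac_simps)
 define U where "U = {f x y | x y. dot_on I x x <= 1 \<and> dot_on J y y <= 1}"
 define S where "S = Sup U"
 have U0: "0 \<in> U" unfolding U_def
  by (rule CollectI, rule exI[of _ "%_. 0"], rule exI[of _ "%_. 0"]) (simp add: f_def dot_on_def)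
 have bdd: "bdd_above U"
 proof (rule bdd_aboveI)
  fix u assume "u \<in> U"
  then obtain x y where u: "u = f x y" and x: "dot_on I x x <= 1" and y: "dot_on J y y <= 1" unfolding U_def by blast
  have coord: "\<bar>w a\<bar> <= 1" if "finite L" "a \<in> L" "dot_on L w w <= 1" for L a and w :: "'z => real"
  proof -
   have "w a * w a <= dot_on L w w" unfolding dot_on_def using that by (intro member_le_sum) auto
   with that have "(w a)^2 <= 1" by (simp add: power2_eq_square)
   then show ?thesis by (simp add: abs_square_le_1)
  qed
  have "u <= (\<Sum>c\<in>J. \<bar>y c * dot_on I (b' c) x\<bar>)" unfolding u f_def by (rule order.trans[OF abs_ge_self sum_abs])
  also have "... <= (\<Sum>c\<in>J. 1 * (\<Sum>a\<in>I. \<bar>b' c a\<bar>))" unfolding abs_mult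
  proof (intro sum_mono mult_mono)
   fix c assume c: "c \<in> J"
   show "\<bar>y c\<bar> <= 1" by (rule coord[OF J(1) c y])
   show "\<bar>dot_on I (b' c) x\<bar> <= (\<Sum>a\<in>I. \<bar>b' c a\<bar>)" unfolding dot_on_def
   proof (rule order.trans[OF sum_abs sum_mono])
    fix a assume "a \<in> I"
    then show "\<bar>b' c a * x a\<bar> <= \<bar>b' c a\<bar>"
     unfolding abs_mult using coord[OF I(1) _ x, of a] by (intro mult_left_le) auto
   qed
  qed auto
  finally show "u <= (\<Sum>c\<in>J. 1 * (\<Sum>a\<in>I. \<bar>b' c a\<bar>))" .
 qed
 have le_S: "f x y <= S" if "dot_on I x x <= 1" "dot_on J y y <= 1" for x y
  unfolding S_def using that by (intro cSup_upper[OF _ bdd]) (auto simp: U_def)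
 have S0: "0 <= S" unfolding S_def by (rule cSup_upper[OF U0 bdd])
 (* 13/36 = 1/6 + (7/6)(1/6): the rounding errors of the two arguments *)
 have "S <= K + 13 / 36 * S"
  unfolding S_def
 proof (rule cSup_least)
  show "U \<noteq> {}" using U0 by blast
  fix u assume "u \<in> U"
  then obtain x y where u: "u = f x y" and x: "dot_on I x x <= 1" and y: "dot_on J y y <= 1" unfolding U_def by blast
  obtain k where k: "k \<in> lattice_points I"
   and ke: "dot_on I (%a. x a - lattice_vector I k a) (%a. x a - lattice_vector I k a) <= 1 / 36"
   using lattice_approximation[OF I x] by blast
  obtain k' where k': "k' \<in> lattice_points J"
   and ke': "dot_on J (%a. y a - lattice_vector J k' a) (%a. y a - lattice_vector J k' a) <= 1 / 36"
   using lattice_approximation[OF J y] by blast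
  define z where "z = lattice_vector I k"
  define z' where "z' = lattice_vector J k'"
  have 1: "f z z' <= K" unfolding f_def z_def z'_def by (rule K[OF k k'])
  have 2: "6 * f (%a. x a - z a) y <= S"
  proof -
   have "dot_on I (%a. 6 * (x a - z a)) (%a. 6 * (x a - z a)) <= 1" unfolding dscale using ke z_def by simp
   from le_S[OF this y] show ?thesis by (simp only: f_scale1)
  qed
  have 3: "36 / 7 * f z (%a. y a - z' a) <= S"
  proof -
   have a: "dot_on J (%a. 6 * (y a - z' a)) (%a. 6 * (y a - z' a)) <= 1" unfolding dscale using ke' z'_def by simp
   have "dot_on I (%a. 6/7 * z a) (%a. 6/7 * z a) <= 1"
    unfolding dscale using lattice_vector_norm[OF I(1) k] by (simp add: z_def power2_eq_square)
   from le_S[OF this a] show ?thesis by (simp only: f_scale1 f_scale2)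
  qed
  have "f x y = f z z' + f (%a. x a - z a) y + f z (%a. y a - z' a)" by (simp only: f_diff1 f_diff2)
  then show "u <= K + 13 / 36 * Sup U" using 1 2 3 unfolding u S_def[symmetric] by linarith
 qed
 then have S2: "S <= 2 * K" using K0 by linarith
 show ?thesis
 proof -
  define y where "y c = dot_on I (b' c) x" for c
  define N where "N = dot_on J y y"
  define R where "R = dot_on I x x"
  have N0: "0 <= N" and R0: "0 <= R" unfolding N_def R_def dot_on_def by (auto intro: sum_nonneg)
  have fxy: "f x y = N" by (simp add: f_def y_def N_def dot_on_def)
  have "N <= (2 * K)^2 * R"
  proof (cases "R = 0 \<or> N = 0")
   case True
   have "N = 0" if "R = 0"
   proof -
    have "x a = 0" if "a \<in> I" for a
     using \<open>R = 0\<close> that I(1) unfolding R_def dot_on_def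
     by (subst (asm) sum_nonneg_eq_0_iff) auto
    then show ?thesis by (simp add: N_def y_def dot_on_def)
   qed
   then show ?thesis using True R0 by auto
  next
   case False
   then have p: "0 < N" "0 < R" using N0 R0 by auto
   have a: "dot_on I (%a. 1 / sqrt R * x a) (%a. 1 / sqrt R * x a) <= 1"
    unfolding dscale using p by (simp add: R_def[symmetric] power_divide)
   have b: "dot_on J (%a. 1 / sqrt N * y a) (%a. 1 / sqrt N * y a) <= 1"
    unfolding dscale using p by (simp add: N_def[symmetric] power_divide)
   have "1 / sqrt N * (1 / sqrt R * N) <= 2 * K"
    using le_S[OF a b] S2 unfolding f_scale2 f_scale1 fxy by linarith
   then have "sqrt N / sqrt R <= 2 * K" using p by (simp add: real_div_sqrt field_simps)
   then have "(sqrt N / sqrt R)^2 <= (2 * K)^2" using p by (intro power_mono) auto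
   then have "N / R <= (2 * K)^2" using p by (simp add: power_divide)
   then show ?thesis using p by (simp add: field_simps)
  qed
  then show ?thesis by (simp add: N_def R_def y_def dot_on_def power2_eq_square)
 qed
qed

context kron_coeffs
begin

definition bilin :: "nat => nat => (nat \<times> nat \<times> nat => real) => (nat \<times> nat => real) => (nat \<times> nat => real) => real" where
 "bilin n r \<omega> x y = (\<Sum>c\<in>K1 \<times> {..<r}. y c * dot_on (idx n) (row n (row_noise n (snd c) \<omega>) (fst c)) x)"

definition bilin_coef :: "nat => (nat \<times> nat => real) => (nat \<times> nat => real) => nat \<times> nat \<times> nat => real" where
 "bilin_coef n x y = (%(t, i, j). (\<Sum>q<k1. \<Sum>p<k2. y (q, i) * A t q p * x (p, j)) / sqrt (real n))"

lemma sum_cube: "(\<Sum>s\<in>cube I n. f s) = (\<Sum>t<l. \<Sum>i\<in>I. \<Sum>j<n. f (t, i, j))"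
 by (simp add: cube_def sum.cartesian_product)

lemma bilin_linear: "bilin n r \<omega> x y = (\<Sum>s\<in>cube {..<r} n. bilin_coef n x y s * \<omega> s)"
proof -
 have "bilin n r \<omega> x y = (\<Sum>q<k1. \<Sum>i<r. \<Sum>p<k2. \<Sum>j<n. \<Sum>t<l. y (q, i) * A t q p * x (p, j) / sqrt (real n) * \<omega> (t, i, j))"
  unfolding bilin_def dot_on_def sum_idx sum.cartesian_product'
  by (intro sum.cong refl)
   (simp add: row_def row_noise_def noise_def sum_distrib_left sum_distrib_right sum_divide_distrib ac_simps)
 also have "... = (\<Sum>i<r. \<Sum>q<k1. \<Sum>p<k2. \<Sum>j<n. \<Sum>t<l. y (q, i) * A t q p * x (p, j) / sqrt (real n) * \<omega> (t, i, j))"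
  by (rule sum.swap)
 also have "... = (\<Sum>i<r. \<Sum>q<k1. \<Sum>j<n. \<Sum>p<k2. \<Sum>t<l. y (q, i) * A t q p * x (p, j) / sqrt (real n) * \<omega> (t, i, j))"
  by (intro sum.cong refl sum.swap)
 also have "... = (\<Sum>i<r. \<Sum>j<n. \<Sum>q<k1. \<Sum>p<k2. \<Sum>t<l. y (q, i) * A t q p * x (p, j) / sqrt (real n) * \<omega> (t, i, j))"
  by (intro sum.cong refl sum.swap)
 also have "... = (\<Sum>i<r. \<Sum>j<n. \<Sum>q<k1. \<Sum>t<l. \<Sum>p<k2. y (q, i) * A t q p * x (p, j) / sqrt (real n) * \<omega> (t, i, j))"
  by (intro sum.cong refl sum.swap)
 also have "... = (\<Sum>i<r. \<Sum>j<n. \<Sum>t<l. \<Sum>q<k1. \<Sum>p<k2. y (q, i) * A t q p * x (p, j) / sqrt (real n) * \<omega> (t, i, j))"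
  by (intro sum.cong refl sum.swap)
 also have "... = (\<Sum>i<r. \<Sum>t<l. \<Sum>j<n. \<Sum>q<k1. \<Sum>p<k2. y (q, i) * A t q p * x (p, j) / sqrt (real n) * \<omega> (t, i, j))"
  by (intro sum.cong refl sum.swap)
 also have "... = (\<Sum>t<l. \<Sum>i<r. \<Sum>j<n. \<Sum>q<k1. \<Sum>p<k2. y (q, i) * A t q p * x (p, j) / sqrt (real n) * \<omega> (t, i, j))"
  by (rule sum.swap)
 finally show ?thesis
  by (simp add: sum_cube bilin_coef_def sum_distrib_right sum_divide_distrib)
qed

lemma bilin_coef_square_sum:
 "(\<Sum>s\<in>cube {..<r} n. (bilin_coef n x y s)^2) <= normA * dot_on (idx n) x x * dot_on (K1 \<times> {..<r}) y y / real n"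
proof -
 define X where "X j = (\<Sum>p<k2. (x (p, j))^2)" for j
 define Y where "Y i = (\<Sum>q<k1. (y (q, i))^2)" for i
 define N where "N t = (\<Sum>q<k1. \<Sum>p<k2. (A t q p)^2)" for t
 have X: "0 <= X j" and Y: "0 <= Y i" for i j unfolding X_def Y_def by (auto intro: sum_nonneg)
 have one: "(bilin_coef n x y (t, i, j))^2 <= N t * (Y i * X j) / real n" for t i j
 proof -
  have e: "(\<Sum>q<k1. \<Sum>p<k2. y (q, i) * A t q p * x (p, j)) = (\<Sum>c\<in>K1 \<times> K2. A t (fst c) (snd c) * (y (fst c, i) * x (snd c, j)))"
   by (simp add: sum.cartesian_product' ac_simps)
  have "(\<Sum>q<k1. \<Sum>p<k2. y (q, i) * A t q p * x (p, j))^2 <=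
   (\<Sum>c\<in>K1 \<times> K2. (A t (fst c) (snd c))^2) * (\<Sum>c\<in>K1 \<times> K2. (y (fst c, i) * x (snd c, j))^2)"
   unfolding e by (rule Cauchy_Schwarz_ineq_sum)
  also have "(\<Sum>c\<in>K1 \<times> K2. (A t (fst c) (snd c))^2) = N t"
   by (simp add: sum.cartesian_product' N_def)
  also have "(\<Sum>c\<in>K1 \<times> K2. (y (fst c, i) * x (snd c, j))^2) = Y i * X j"
   by (simp add: sum.cartesian_product' X_def Y_def sum_product power_mult_distrib)
  finally have "(\<Sum>q<k1. \<Sum>p<k2. y (q, i) * A t q p * x (p, j))^2 <= N t * (Y i * X j)" .
  then show ?thesis by (simp add: bilin_coef_def power_divide divide_right_mono)
 qed
 have "(\<Sum>s\<in>cube {..<r} n. (bilin_coef n x y s)^2) <= (\<Sum>t<l. \<Sum>i<r. \<Sum>j<n. N t * (Y i * X j) / real n)"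
  unfolding sum_cube by (intro sum_mono one)
 also have "... = (\<Sum>t<l. N t) * ((\<Sum>i<r. Y i) * (\<Sum>j<n. X j)) / real n"
  unfolding sum_product unfolding sum_distrib_left sum_divide_distrib ..
 also have "(\<Sum>t<l. N t) = normA" by (simp add: N_def normA_def)
 also have "(\<Sum>i<r. Y i) = dot_on (K1 \<times> {..<r}) y y"
  unfolding dot_on_def Y_def sum.cartesian_product' by (subst sum.swap) (simp add: power2_eq_square)
 also have "(\<Sum>j<n. X j) = dot_on (idx n) x x"
  unfolding dot_on_def sum_idx X_def by (subst sum.swap) (simp add: power2_eq_square)
 finally show ?thesis by (simp add: ac_simps)
qed

text \<open>A smooth substitute for the positive part of (maximum over the net minus $K$): it dominates it because $t \le
e^{nt}/n$, and its expectation is explicit.\<close>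

definition net_excess :: "real => nat => nat => (nat \<times> nat \<times> nat => real) => real" where
 "net_excess K n r \<omega> = (\<Sum>(k, k')\<in>lattice_points (idx n) \<times> lattice_points (K1 \<times> {..<r}).
   exp (real n * (bilin n r \<omega> (lattice_vector (idx n) k) (lattice_vector (K1 \<times> {..<r}) k') - K))) / real n"

lemma net_excess_nonneg: "0 <= net_excess K n r \<omega>"
 unfolding net_excess_def by (intro divide_nonneg_nonneg sum_nonneg) auto

lemma operator_norm_le:
 assumes n: "0 < n" and K: "0 <= K"
 shows "(\<Sum>i<r. \<Sum>q<k1. (dot_on (idx n) (row n (row_noise n i \<omega>) q) x)^2)
  <= (2 * (K + net_excess K n r \<omega>))^2 * dot_on (idx n) x x"
proof -
 let ?J = "K1 \<times> {..<r}"
 have eq: "(\<Sum>i<r. \<Sum>q<k1. (dot_on (idx n) (row n (row_noise n i \<omega>) q) x)^2)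
  = (\<Sum>c\<in>?J. (dot_on (idx n) (row n (row_noise n (snd c) \<omega>) (fst c)) x)^2)"
  by (subst sum.swap) (simp add: sum.cartesian_product')
 show ?thesis
 proof (cases "idx n = {} \<or> ?J = {}")
  case True
  have "(\<Sum>c\<in>?J. (dot_on (idx n) (row n (row_noise n (snd c) \<omega>) (fst c)) x)^2) = 0"
  proof (rule disjE[OF True])
   assume "idx n = {}"
   then show ?thesis by (simp add: dot_on_def)
  next
   assume "?J = {}"
   then show ?thesis by (simp only: sum.empty)
  qed
  then show ?thesis unfolding eq by (simp add: dot_on_nonneg)
 next
  case False
  have "(\<Sum>c\<in>?J. lattice_vector ?J k' c * dot_on (idx n) (row n (row_noise n (snd c) \<omega>) (fst c)) (lattice_vector (idx n) k)) <= K + net_excess K n r \<omega>"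
   if "k \<in> lattice_points (idx n)" "k' \<in> lattice_points ?J" for k k'
  proof -
   let ?b = "%k k'. bilin n r \<omega> (lattice_vector (idx n) k) (lattice_vector ?J k')"
   let ?e = "exp (real n * (?b k k' - K))"
   have "real n * (?b k k' - K) <= ?e" by (smt (verit) exp_ge_add_one_self)
   then have "?b k k' - K <= ?e / real n" using n by (simp add: field_simps)
   also have "?e <= (\<Sum>(k, k')\<in>lattice_points (idx n) \<times> lattice_points ?J. exp (real n * (?b k k' - K)))"
    using that member_le_sum[of "(k, k')" "lattice_points (idx n) \<times> lattice_points ?J" "%(k, k'). exp (real n * (?b k k' - K))"]
    by (simp add: finite_lattice_points case_prod_beta)
   finally show ?thesis unfolding bilin_def[symmetric] net_excess_def by (simp add: divide_right_mono)
  qed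
  from net_bounds_form[where b' = "%c. row n (row_noise n (snd c) \<omega>) (fst c)" and I = "idx n" and J = ?J, OF _ _ _ _ _ this]
  show ?thesis unfolding eq using False K net_excess_nonneg[of K n r \<omega>] by auto
 qed
qed

lemma net_excess_expectation:
 assumes n: "0 < n"
 shows "integrable (law r n) (net_excess K n r)"
  and "(\<integral>\<omega>. net_excess K n r \<omega> \<partial>(law r n))
   <= (2 ^ 49 * 3) ^ (k2 * n + k1 * r) * exp (real n * (normA - K)) / real n"
proof -
 let ?J = "K1 \<times> {..<r}" and ?M = "law r n"
 let ?P = "lattice_points (idx n) \<times> lattice_points ?J"
 let ?b = "%k k' \<omega>. bilin n r \<omega> (lattice_vector (idx n) k) (lattice_vector ?J k')"
 let ?c = "%k k'. bilin_coef n (lattice_vector (idx n) k) (lattice_vector ?J k')"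
 have e: "exp (real n * (?b k k' \<omega> - K)) = exp (- real n * K) * exp (\<Sum>s\<in>cube {..<r} n. real n * ?c k k' s * \<omega> s)" for k k' \<omega>
  by (simp add: bilin_linear sum_distrib_left algebra_simps flip: exp_add)
 have int1: "integrable ?M (%\<omega>. exp (real n * (?b k k' \<omega> - K)))" for k k'
  unfolding e by (intro integrable_mult_right gauss_exp_linear(1)) simp
 show "integrable ?M (net_excess K n r)"
  unfolding net_excess_def[abs_def] case_prod_beta by (intro integrable_divide_zero Bochner_Integration.integrable_sum int1)
 have val: "(\<integral>\<omega>. exp (real n * (?b k k' \<omega> - K)) \<partial>?M) <= exp (real n * (normA - K))"
  if k: "k \<in> lattice_points (idx n)" and k': "k' \<in> lattice_points ?J" for k k'
 proof -
  have "(\<Sum>s\<in>cube {..<r} n. (?c k k' s)^2) <= normA * (49/36) * (49/36) / real n"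
   by (rule order.trans[OF bilin_coef_square_sum])
    (intro divide_right_mono mult_mono lattice_vector_norm k k' mult_nonneg_nonneg normA_nonneg dot_on_nonneg; simp)
  also have "... <= 2 * normA / real n"
   using normA_nonneg by (intro divide_right_mono) auto
  finally have "(real n)^2 * (\<Sum>s\<in>cube {..<r} n. (?c k k' s)^2) <= (real n)^2 * (2 * normA / real n)"
   by (rule mult_left_mono) simp
  then have "(\<Sum>s\<in>cube {..<r} n. (real n * ?c k k' s)^2) / 2 <= real n * normA"
   using n by (simp add: sum_distrib_left power_mult_distrib power2_eq_square[of "real n"])
  then have "(\<integral>\<omega>. exp (\<Sum>s\<in>cube {..<r} n. real n * ?c k k' s * \<omega> s) \<partial>?M) <= exp (real n * normA)"
   by (subst gauss_exp_linear(2)) simp_all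
  then have "exp (- real n * K) * (\<integral>\<omega>. exp (\<Sum>s\<in>cube {..<r} n. real n * ?c k k' s * \<omega> s) \<partial>?M) <= exp (- real n * K) * exp (real n * normA)"
   by (rule mult_left_mono) simp
  moreover have "exp (- real n * K) * exp (real n * normA) = exp (real n * (normA - K))"
   by (simp add: algebra_simps flip: exp_add)
  ultimately show ?thesis unfolding e integral_mult_right_zero by linarith
 qed
 have "(\<integral>\<omega>. net_excess K n r \<omega> \<partial>?M) = (\<Sum>(k, k')\<in>?P. \<integral>\<omega>. exp (real n * (?b k k' \<omega> - K)) \<partial>?M) / real n"
  unfolding net_excess_def case_prod_beta by (simp add: int1 Bochner_Integration.integral_sum)
 also have "... <= (\<Sum>(k, k')\<in>?P. exp (real n * (normA - K))) / real n"
  by (intro divide_right_mono sum_mono) (auto intro: val)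
 also have "... = (real (card (lattice_points (idx n))) * real (card (lattice_points ?J))) * exp (real n * (normA - K)) / real n"
  by (simp add: card_cartesian_product case_prod_beta)
 also have "... <= ((2 ^ 49 * 3) ^ card (idx n) * (2 ^ 49 * 3) ^ card ?J) * exp (real n * (normA - K)) / real n"
  by (intro divide_right_mono mult_right_mono mult_mono card_lattice_points_le) auto
 also have "(2 ^ 49 * 3 :: real) ^ card (idx n) * (2 ^ 49 * 3) ^ card ?J = (2 ^ 49 * 3) ^ (k2 * n + k1 * r)"
  unfolding power_add[symmetric] by (simp only: idx_def card_cartesian_product card_lessThan)
 finally show "(\<integral>\<omega>. net_excess K n r \<omega> \<partial>?M) <= (2 ^ 49 * 3) ^ (k2 * n + k1 * r) * exp (real n * (normA - K)) / real n" .
qed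

text \<open>The net has at most exponentially many points and each exponential moment grows at a fixed exponential rate; a
large constant \<open>K\<close> beats both.\<close>

theorem net_excess_tendsto_0:
 fixes m :: "nat => nat"
 assumes m: "(%n. real (m n) / real n) \<longlonglongrightarrow> \<alpha>"
 obtains K where "0 <= K" "(%n. \<integral>\<omega>. net_excess K n (m n) \<omega> \<partial>(law (m n) n)) \<longlonglongrightarrow> 0"
proof -
 have \<alpha>0: "0 <= \<alpha>" using m by (rule LIMSEQ_le_const) auto
 define b where "b = ln (2 ^ 49 * 3 :: real)"
 have b0: "0 <= b" unfolding b_def by (intro ln_ge_zero) simp
 (* b is the exponential rate of the net per dimension, and normA bounds the rate of each exponential moment *)
 define K where "K = normA + b * (real k2 + real k1 * (\<alpha> + 1))"
 have K0: "0 <= K" unfolding K_def using b0 \<alpha>0 normA_nonneg by (intro add_nonneg_nonneg mult_nonneg_nonneg) auto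
 have "eventually (%n. real (m n) / real n < \<alpha> + 1) sequentially"
  by (rule order_tendstoD(2)[OF m]) simp
 then have "eventually (%n. (\<integral>\<omega>. net_excess K n (m n) \<omega> \<partial>(law (m n) n)) <= 1 / real n) sequentially"
  using eventually_gt_at_top[of 0]
 proof eventually_elim
  case (elim n)
  have p: "(2 ^ 49 * 3 :: real) ^ N = exp (b * real N)" for N
   unfolding b_def by (subst mult.commute, subst exp_of_nat_mult) simp
  have "real (m n) <= (\<alpha> + 1) * real n" using elim by (simp add: field_simps)
  then have "real k1 * real (m n) <= real k1 * ((\<alpha> + 1) * real n)" by (intro mult_left_mono) auto
  then have "b * real (k2 * n + k1 * m n) <= b * (real k2 * real n + real k1 * ((\<alpha> + 1) * real n))"
   using b0 by (intro mult_left_mono) auto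
  also have "... = real n * (K - normA)" by (simp add: K_def algebra_simps)
  finally have le: "b * real (k2 * n + k1 * m n) + real n * (normA - K) <= 0" by (simp add: algebra_simps)
  have "(\<integral>\<omega>. net_excess K n (m n) \<omega> \<partial>(law (m n) n)) <= exp (b * real (k2 * n + k1 * m n) + real n * (normA - K)) / real n"
   using net_excess_expectation(2)[OF elim(2), of "m n" K] unfolding p exp_add by simp
  also have "... <= 1 / real n" using le by (intro divide_right_mono) auto
  finally show ?case .
 qed
 then have "(%n. \<integral>\<omega>. net_excess K n (m n) \<omega> \<partial>(law (m n) n)) \<longlonglongrightarrow> 0"
  by (intro tendsto_sandwich[OF _ _ tendsto_const lim_1_over_n]) (auto intro!: always_eventually Bochner_Integration.integral_nonneg net_excess_nonneg)
 with K0 show ?thesis by (rule that)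
qed

end

section \<open>Largest eigenvalues and quadratic forms\<close>

lemma dot_on_scale: "dot_on I (%a. t * x a) (%a. t * x a) = t^2 * dot_on I x x"
 by (simp add: dot_on_def sum_distrib_left power2_eq_square ac_simps)

lemma quad_on_scale: "quad_on I W (%a. t * x a) = t^2 * quad_on I W x"
 by (simp add: quad_on_alt sum_distrib_left power2_eq_square ac_simps)

text \<open>With \<open>\<mu>\<close> the supremum of the Rayleigh quotient, $N = \mu - W$ is positive semidefinite. If $N$
were invertible, it would be coercive and \<open>\<mu>\<close> would not be the least upper bound; so $N$ has a
kernel vector, which is a maximiser.\<close>

lemma rayleigh_max:
 assumes I: "finite I" "I \<noteq> {}" and W: "sym_on I W"
 obtains \<mu> v where "dot_on I v v = 1" "!!a. a \<in> I ==> app_on I W v a = \<mu> * v a" "quad_on I W v = \<mu>"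
  "!!x. quad_on I W x <= \<mu> * dot_on I x x"
proof -
 define U where "U = {quad_on I W x | x. dot_on I x x = 1}"
 define \<mu> where "\<mu> = Sup U"
 obtain a0 where a0: "a0 \<in> I" using I by blast
 have "dot_on I (%a. of_bool (a = a0)) (%a. of_bool (a = a0)) = 1"
  using I a0 by (simp add: dot_on_def of_bool_def if_distrib if_distribR cong: if_cong)
 then have ne: "U \<noteq> {}" unfolding U_def by blast
 have bdd: "bdd_above U"
 proof (rule bdd_aboveI)
  fix u assume "u \<in> U"
  then show "u <= (\<Sum>a\<in>I. \<Sum>b\<in>I. \<bar>W a b\<bar>)"
   unfolding U_def using abs_quad_on_le[OF I(1), of W] by auto (smt (verit) mult_cancel_left2)
 qed
 have ub: "quad_on I W x <= \<mu> * dot_on I x x" for x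
 proof (cases "dot_on I x x = 0")
  case True
  then show ?thesis using abs_quad_on_le[OF I(1), of W x] by simp
 next
  case False
  define d where "d = dot_on I x x"
  have d: "0 < d" using False dot_on_nonneg[of I x] by (simp add: d_def)
  have "dot_on I (%a. (1 / sqrt d) * x a) (%a. (1 / sqrt d) * x a) = 1"
   unfolding dot_on_scale d_def[symmetric] using d by (simp add: power_divide)
  then have "quad_on I W (%a. (1 / sqrt d) * x a) <= \<mu>"
   unfolding \<mu>_def by (intro cSup_upper[OF _ bdd]) (auto simp: U_def)
  then have "quad_on I W x / d <= \<mu>" unfolding quad_on_scale using d by (simp add: power_divide)
  then show ?thesis using d by (simp add: d_def[symmetric] field_simps)
 qed
 (* N is positive semidefinite; the claim is that it has a kernel vector *)
 define N where "N = (%a b. \<mu> * of_bool (a = b) - W a b)"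
 have quadN: "quad_on I N x = \<mu> * dot_on I x x - quad_on I W x" for x
  unfolding N_def quad_on_linear quad_of_bool[OF I(1)] ..
 have appN: "app_on I N x a = \<mu> * x a - app_on I W x a" if "a \<in> I" for x a
 proof -
  have "(\<Sum>b\<in>I. \<mu> * of_bool (a = b) * x b) = (\<Sum>b\<in>I. if b = a then \<mu> * x a else 0)" by (intro sum.cong) auto
  then show ?thesis using I that by (simp add: N_def app_on_def left_diff_distrib sum_subtractf)
 qed
 have symN: "sym_on I N"
  unfolding sym_on_def
 proof (intro ballI)
  fix a b assume "a \<in> I" "b \<in> I"
  then have "W a b = W b a" by (rule sym_onD[OF W])
  moreover have "(a = b) = (b = a)" by blast
  ultimately show "N a b = N b a" unfolding N_def by presburger
 qed
 have "\<exists>x. (\<forall>a\<in>I. app_on I N x a = 0) \<and> \<not> (\<forall>a\<in>I. x a = 0)"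
 proof (rule ccontr)
  assume "\<not> ?thesis"
  then have ker: "!!x. (!!a. a \<in> I ==> app_on I N x a = 0) ==> \<forall>a\<in>I. x a = 0" by blast
  define B where "B = inv_on I N"
  have NB: "app_on I N (app_on I B y) a = y a" if "a \<in> I" for y a
   unfolding B_def using app_on_inv_on[OF I(1) ker] that by blast
  define c where "c = (\<Sum>a\<in>I. \<Sum>b\<in>I. \<bar>B a b\<bar>) + 1"
  have c: "0 < c" unfolding c_def by (smt (verit) sum_nonneg abs_ge_zero)
  have low: "dot_on I x x <= c * quad_on I N x" for x
  proof -
   define y where "y = app_on I B x"
   have Ny: "dot_on I z (app_on I N y) = dot_on I z x" for z
    unfolding y_def by (intro dot_on_cong) (auto simp: NB)
   have yx: "dot_on I y x <= c * dot_on I x x"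
    using abs_quad_on_le[OF I(1), of B x] dot_on_nonneg[of I x]
    unfolding quad_on_def y_def[symmetric] c_def distrib_right
    by (simp add: dot_on_commute[of I y x])
   have "0 <= quad_on I N (%a. x a - (1/c) * y a)" using ub[of "%a. x a - (1/c) * y a"] by (simp add: quadN)
   also have "quad_on I N (%a. x a - (1/c) * y a) = quad_on I N x - (1/c) * dot_on I x (app_on I N y)
     - (1/c) * dot_on I y (app_on I N x) + (1/c)^2 * dot_on I y (app_on I N y)"
    by (simp only: quad_on_def app_on_linear dot_on_linear power2_eq_square)
   also have "dot_on I y (app_on I N x) = dot_on I x x"
    unfolding dot_on_app_sym[OF symN] by (subst dot_on_commute) (rule Ny)
   finally have "0 <= quad_on I N x - 2 / c * dot_on I x x + (1/c)^2 * dot_on I y x" unfolding Ny by simp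
   moreover have "(1/c)^2 * dot_on I y x <= (1/c)^2 * (c * dot_on I x x)" using yx by (rule mult_left_mono) simp
   moreover have "(1/c)^2 * (c * dot_on I x x) = dot_on I x x / c" "2 / c * dot_on I x x = 2 * (dot_on I x x / c)"
    using c by (simp_all add: power2_eq_square)
   ultimately have "dot_on I x x / c <= quad_on I N x" by linarith
   then show ?thesis using c by (simp add: field_simps)
  qed
  have "\<mu> <= \<mu> - 1 / c"
   unfolding \<mu>_def
  proof (rule cSup_least[OF ne])
   fix u assume "u \<in> U"
   then obtain x where x: "dot_on I x x = 1" and u: "u = quad_on I W x" unfolding U_def by blast
   have "1 <= c * (\<mu> - u)" using low[of x] unfolding quadN x u by simp
   then show "u <= Sup U - 1 / c" using c unfolding \<mu>_def by (simp add: field_simps)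
  qed
  then show False using c by simp
 qed
 then obtain x where ker: "\<forall>a\<in>I. app_on I N x a = 0" and nz: "\<not> (\<forall>a\<in>I. x a = 0)" by blast
 define d where "d = dot_on I x x"
 have d: "0 < d" using nz dot_on_nonneg[of I x] dot_on_zero_iff[OF I(1)] unfolding d_def by (metis less_eq_real_def)
 define v where "v = (%a. (1 / sqrt d) * x a)"
 have v: "dot_on I v v = 1" unfolding v_def dot_on_scale d_def[symmetric] using d by (simp add: power_divide)
 have eig: "app_on I W v a = \<mu> * v a" if "a \<in> I" for a
  using appN[OF that, of x] ker that unfolding v_def app_on_linear by simp
 have "quad_on I W v = dot_on I v (%a. \<mu> * v a)" unfolding quad_on_def by (intro dot_on_cong) (auto simp: eig)
 then have "quad_on I W v = \<mu>" by (simp add: dot_on_linear v)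
 with v eig ub show ?thesis by (intro that)
qed

abbreviation entries :: "real mat => nat => nat => real" where
 "entries W \<equiv> %i j. W $$ (i, j)"

lemma scalar_prod_dot_on: "dim_vec w = d ==> scalar_prod v w = dot_on {..<d} (%i. v $ i) (%i. w $ i)"
 by (simp add: scalar_prod_def dot_on_def atLeast0LessThan)

lemma mult_mat_vec_app_on:
 "W \<in> carrier_mat r c ==> v \<in> carrier_vec c ==> i < r ==> (W *\<^sub>v v) $ i = app_on {..<c} (entries W) (%j. v $ j) i"
 by (simp add: app_on_def scalar_prod_def atLeast0LessThan)

lemma mult_mat_entry:
 "X \<in> carrier_mat a b ==> Y \<in> carrier_mat b c ==> i < a ==> j < c ==> (X * Y) $$ (i, j) = (\<Sum>k<b. X $$ (i, k) * Y $$ (k, j))"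
 by (simp add: scalar_prod_def atLeast0LessThan)

lemma scalar_prod_quad_on:
 assumes "W \<in> carrier_mat d d" "v \<in> carrier_vec d"
 shows "scalar_prod v (W *\<^sub>v v) = quad_on {..<d} (entries W) (%i. v $ i)"
 using assms unfolding quad_on_def
 by (subst scalar_prod_dot_on[of _ d]) (auto intro!: dot_on_cong simp: mult_mat_vec_app_on[OF assms])

lemma transpose_eq_iff_sym_on:
 "W \<in> carrier_mat d d ==> transpose_mat W = W \<longleftrightarrow> sym_on {..<d} (entries W)"
proof
 assume W: "W \<in> carrier_mat d d" and t: "transpose_mat W = W"
 show "sym_on {..<d} (entries W)"
  unfolding sym_on_def
 proof (intro ballI)
  fix i j assume "i \<in> {..<d}" "j \<in> {..<d}"
  then have "transpose_mat W $$ (i, j) = W $$ (j, i)" using W by simp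
  then show "W $$ (i, j) = W $$ (j, i)" unfolding t .
 qed
next
 assume W: "W \<in> carrier_mat d d" and s: "sym_on {..<d} (entries W)"
 show "transpose_mat W = W"
 proof (rule eq_matI)
  fix i j assume "i < dim_row W" "j < dim_col W"
  then show "transpose_mat W $$ (i, j) = W $$ (i, j)" using W sym_onD[OF s, of j i] by simp
 qed (use W in auto)
qed

lemma lambda_max_le_iff:
 assumes W: "W \<in> carrier_mat d d" "sym_on {..<d} (entries W)" and d: "0 < d"
 shows "lambda_max W <= s \<longleftrightarrow> (\<forall>x. quad_on {..<d} (entries W) x <= s * dot_on {..<d} x x)"
proof -
 have "finite {..<d}" "{..<d} \<noteq> {}" using d by auto
 from rayleigh_max[OF this W(2)] obtain \<mu> v where v: "dot_on {..<d} v v = 1"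
  and eig: "!!a. a \<in> {..<d} ==> app_on {..<d} (entries W) v a = \<mu> * v a"
  and q: "!!x. quad_on {..<d} (entries W) x <= \<mu> * dot_on {..<d} x x" by metis
 define u where "u = vec d v"
 have "eigenvector W u \<mu>"
  unfolding eigenvector_def
 proof (intro conjI)
  show "u \<in> carrier_vec (dim_row W)" using W by (simp add: u_def)
  show "u \<noteq> 0\<^sub>v (dim_row W)"
  proof
   assume "u = 0\<^sub>v (dim_row W)"
   then have "v i = 0" if "i < d" for i using W that unfolding u_def by (metis carrier_matD(1) index_vec index_zero_vec(1))
   then show False using v by (simp add: dot_on_def)
  qed
  show "W *\<^sub>v u = \<mu> \<cdot>\<^sub>v u"
  proof (rule eq_vecI)
   fix i assume "i < dim_vec (\<mu> \<cdot>\<^sub>v u)"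
   then have i: "i < d" by (simp add: u_def)
   have "(W *\<^sub>v u) $ i = app_on {..<d} (entries W) (%j. u $ j) i"
    by (rule mult_mat_vec_app_on[OF W(1) _ i]) (simp add: u_def)
   also have "... = app_on {..<d} (entries W) v i" by (simp add: app_on_def u_def)
   finally show "(W *\<^sub>v u) $ i = (\<mu> \<cdot>\<^sub>v u) $ i" using eig[of i] i by (simp add: u_def)
  qed (use W in \<open>simp add: u_def\<close>)
 qed
 then have mem: "\<mu> \<in> spectrum W" unfolding spectrum_def eigenvalue_def by blast
 have le: "e <= \<mu>" if "e \<in> spectrum W" for e
 proof -
  from that obtain w where w: "w \<in> carrier_vec d" "w \<noteq> 0\<^sub>v d" "W *\<^sub>v w = e \<cdot>\<^sub>v w"
   using W unfolding spectrum_def eigenvalue_def eigenvector_def by auto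
  have nz: "dot_on {..<d} (%i. w $ i) (%i. w $ i) \<noteq> 0"
  proof
   assume "dot_on {..<d} (%i. w $ i) (%i. w $ i) = 0"
   then have "\<forall>i\<in>{..<d}. w $ i = 0" using dot_on_zero_iff[of "{..<d}" "%i. w $ i"] by simp
   then have "w = 0\<^sub>v d" using w(1) by (intro eq_vecI) auto
   with w(2) show False ..
  qed
  have "quad_on {..<d} (entries W) (%i. w $ i) = scalar_prod w (W *\<^sub>v w)"
   by (rule scalar_prod_quad_on[OF W(1) w(1), symmetric])
  also have "... = e * dot_on {..<d} (%i. w $ i) (%i. w $ i)"
   unfolding w(3) using w(1) by (subst scalar_prod_dot_on[of _ d]) (auto simp: dot_on_def sum_distrib_left ac_simps)
  finally have "e * dot_on {..<d} (%i. w $ i) (%i. w $ i) <= \<mu> * dot_on {..<d} (%i. w $ i) (%i. w $ i)"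
   using q by metis
  then show "e <= \<mu>" using nz dot_on_nonneg[of "{..<d}" "%i. w $ i"] by simp
 qed
 have m: "lambda_max W = \<mu>"
  unfolding lambda_max_def by (rule Max_eqI) (use mem le card_finite_spectrum[OF W(1)] in auto)
 show ?thesis
 proof
  assume "lambda_max W <= s"
  then have "\<mu> * dot_on {..<d} x x <= s * dot_on {..<d} x x" for x
   unfolding m by (rule mult_right_mono) (rule dot_on_nonneg)
  then show "\<forall>x. quad_on {..<d} (entries W) x <= s * dot_on {..<d} x x" using q order.trans by blast
 next
  assume a: "\<forall>x. quad_on {..<d} (entries W) x <= s * dot_on {..<d} x x"
  have "quad_on {..<d} (entries W) v = dot_on {..<d} v (%a. \<mu> * v a)"
   unfolding quad_on_def by (intro dot_on_cong) (auto simp: eig)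
  then show "lambda_max W <= s" using a[rule_format, of v] v unfolding m by (simp add: dot_on_linear)
 qed
qed

lemma quad_on_le_lambda_max:
 assumes "W \<in> carrier_mat d d" "sym_on {..<d} (entries W)" "0 < d"
 shows "quad_on {..<d} (entries W) x <= lambda_max W * dot_on {..<d} x x"
 using lambda_max_le_iff[OF assms, of "lambda_max W"] by simp

lemma pos_def_mats_iff:
 assumes k: "0 < k"
 shows "Z \<in> pos_def_mats k \<longleftrightarrow> Z \<in> carrier_mat k k \<and> sym_on {..<k} (entries Z) \<and>
  (\<exists>eps>0. \<forall>x. eps * dot_on {..<k} x x <= quad_on {..<k} (entries Z) x)"
proof
 assume "Z \<in> pos_def_mats k"
 then have Z: "Z \<in> carrier_mat k k" and t: "transpose_mat Z = Z"
  and p: "!!v. v \<in> carrier_vec k ==> v \<noteq> 0\<^sub>v k ==> 0 < scalar_prod v (Z *\<^sub>v v)"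
  unfolding pos_def_mats_def by auto
 have s: "sym_on {..<k} (entries Z)" using t transpose_eq_iff_sym_on[OF Z] by simp
 have s': "sym_on {..<k} (%i j. (-1) * entries Z i j)"
  unfolding sym_on_def
 proof (intro ballI)
  fix i j assume "i \<in> {..<k}" "j \<in> {..<k}"
  then show "(-1) * entries Z i j = (-1) * entries Z j i" using sym_onD[OF s, of i j] by presburger
 qed
 have "finite {..<k}" "{..<k} \<noteq> {}" using k by auto
 from rayleigh_max[OF this s'] obtain \<mu> v where v: "dot_on {..<k} v v = 1"
  and qv: "quad_on {..<k} (%i j. (-1) * entries Z i j) v = \<mu>"
  and q: "!!x. quad_on {..<k} (%i j. (-1) * entries Z i j) x <= \<mu> * dot_on {..<k} x x" by metis
 have "vec k v \<noteq> 0\<^sub>v k"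
 proof
  assume "vec k v = 0\<^sub>v k"
  then have "v i = 0" if "i < k" for i using that by (metis index_vec index_zero_vec(1))
  then show False using v by (simp add: dot_on_def)
 qed
 then have "0 < scalar_prod (vec k v) (Z *\<^sub>v vec k v)" by (intro p) auto
 also have "... = quad_on {..<k} (entries Z) (%i. vec k v $ i)" by (rule scalar_prod_quad_on[OF Z]) simp
 also have "... = quad_on {..<k} (entries Z) v" by (rule quad_on_cong) auto
 finally have "0 < - \<mu>" using qv unfolding quad_on_linear by simp
 moreover have "- \<mu> * dot_on {..<k} x x <= quad_on {..<k} (entries Z) x" for x
  using q[of x] unfolding quad_on_linear by simp
 ultimately show "Z \<in> carrier_mat k k \<and> sym_on {..<k} (entries Z) \<and>
  (\<exists>eps>0. \<forall>x. eps * dot_on {..<k} x x <= quad_on {..<k} (entries Z) x)" using Z s by blast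
next
 assume "Z \<in> carrier_mat k k \<and> sym_on {..<k} (entries Z) \<and>
  (\<exists>eps>0. \<forall>x. eps * dot_on {..<k} x x <= quad_on {..<k} (entries Z) x)"
 then obtain eps where Z: "Z \<in> carrier_mat k k" and s: "sym_on {..<k} (entries Z)" and eps: "0 < eps"
  and c: "!!x. eps * dot_on {..<k} x x <= quad_on {..<k} (entries Z) x" by blast
 have "0 < scalar_prod v (Z *\<^sub>v v)" if v: "v \<in> carrier_vec k" "v \<noteq> 0\<^sub>v k" for v
 proof -
  have "dot_on {..<k} (%i. v $ i) (%i. v $ i) \<noteq> 0"
  proof
   assume "dot_on {..<k} (%i. v $ i) (%i. v $ i) = 0"
   then have "\<forall>i\<in>{..<k}. v $ i = 0" using dot_on_zero_iff[of "{..<k}" "%i. v $ i"] by simp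
   then have "v = 0\<^sub>v k" using v(1) by (intro eq_vecI) auto
   with v(2) show False ..
  qed
  then have "0 < eps * dot_on {..<k} (%i. v $ i) (%i. v $ i)"
   using eps dot_on_nonneg[of "{..<k}" "%i. v $ i"] by (intro mult_pos_pos) auto
  also note c
  finally show ?thesis unfolding scalar_prod_quad_on[OF Z v(1)] .
 qed
 then show "Z \<in> pos_def_mats k"
  unfolding pos_def_mats_def using Z s transpose_eq_iff_sym_on[OF Z] by blast
qed

lemma mat_inv_entries:
 assumes Z: "Z \<in> carrier_mat k k"
  and B: "!!i j. i < k ==> j < k ==> mul_on {..<k} (entries Z) B i j = of_bool (i = j)"
 shows "mat_inv Z = mat k k (%(i, j). B i j)"
proof -
 define M where "M = mat k k (%(i, j). B i j)"
 have M: "M \<in> carrier_mat k k" by (simp add: M_def)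
 have ZM: "Z * M = 1\<^sub>m k"
 proof (rule eq_matI)
  fix i j assume "i < dim_row (1\<^sub>m k :: real mat)" "j < dim_col (1\<^sub>m k :: real mat)"
  then have ij: "i < k" "j < k" by auto
  have "(Z * M) $$ (i, j) = (\<Sum>c<k. Z $$ (i, c) * M $$ (c, j))" by (rule mult_mat_entry[OF Z M ij])
  also have "... = mul_on {..<k} (entries Z) B i j"
   unfolding mul_on_def by (intro sum.cong) (use ij in \<open>auto simp: M_def\<close>)
  finally show "(Z * M) $$ (i, j) = (1\<^sub>m k) $$ (i, j)" using B[OF ij] ij by simp
 qed (use Z M in auto)
 have "det Z \<noteq> 0" using det_mult[OF Z M] unfolding ZM by auto
 then have "Z \<in> Units (ring_mat TYPE(real) k b)" for b :: nat by (rule det_non_zero_imp_unit[OF Z])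
 then obtain M' where M': "mat_inverse Z = Some M'" using mat_inverse(1)[OF Z, of 0] by (cases "mat_inverse Z") auto
 from mat_inverse(2)[OF Z M'] have i: "M' * Z = 1\<^sub>m k" "M' \<in> carrier_mat k k" by auto
 have "M' = M' * (Z * M)" unfolding ZM using i by simp
 also have "... = (M' * Z) * M" by (rule assoc_mult_mat[OF i(2) Z M, symmetric])
 also have "... = M" unfolding i(1) using M by simp
 finally show ?thesis unfolding mat_inv_def M' M_def by simp
qed

text \<open>Test the pair at $y = x/c$ with $c$ larger than the norm of $Q$.\<close>

lemma fenchel_on_coercive:
 assumes I: "finite I" and f: "fenchel_on I N Q"
 obtains eps where "0 < eps" "!!x. eps * dot_on I x x <= quad_on I N x"
proof -
 define c where "c = (\<Sum>a\<in>I. \<Sum>b\<in>I. \<bar>Q a b\<bar>) + 1"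
 have c: "0 < c" unfolding c_def by (smt (verit) sum_nonneg abs_ge_zero)
 have "1 / c * dot_on I x x <= quad_on I N x" for x
 proof -
  have "2 * ((1/c) * dot_on I x x) <= quad_on I N x + (1/c)^2 * quad_on I Q x"
   using f[unfolded fenchel_on_def, rule_format, of x "%a. (1/c) * x a"] by (simp only: quad_on_scale dot_on_linear)
  moreover have "quad_on I Q x <= c * dot_on I x x"
   using abs_quad_on_le[OF I, of Q x] dot_on_nonneg[of I x] unfolding c_def distrib_right by linarith
  then have "(1/c)^2 * quad_on I Q x <= (1/c)^2 * (c * dot_on I x x)" by (rule mult_left_mono) simp
  moreover have "(1/c)^2 * (c * dot_on I x x) = (1/c) * dot_on I x x" using c by (simp add: power2_eq_square)
  ultimately show ?thesis by linarith
 qed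
 with c show ?thesis by (intro that[of "1/c"]) auto
qed

lemma fenchel_on_swap: "fenchel_on I N Q ==> fenchel_on I Q N"
 unfolding fenchel_on_def by (metis add.commute dot_on_commute)

lemma fenchel_on_inverse_le:
 assumes I: "finite I" and f: "fenchel_on I N Q" and Q: "sym_on I Q"
  and eps: "0 < eps" "!!x. eps * dot_on I x x <= quad_on I Q x"
 shows "quad_on I (inv_on I Q) x <= quad_on I N x"
proof -
 define y where "y = app_on I (inv_on I Q) x"
 have e: "quad_on I (inv_on I Q) x = quad_on I Q y"
  unfolding y_def by (rule quad_coercive_inv[OF I Q eps])
 have "quad_on I (inv_on I Q) x = dot_on I x y" by (simp add: quad_on_def y_def)
 then show ?thesis using f[unfolded fenchel_on_def, rule_format, of x y] e by linarith
qed

section \<open>The deterministic variational problem\<close>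

text \<open>The infimum of continuous functions is upper semicontinuous. A maximising sequence is compared with one function
$f_i$ at a time, which only needs the continuity of $f_i$; nonnegativity allows the passage to squares and back.\<close>

lemma maximum_of_upper_envelope:
 fixes f :: "'i => real => real"
 assumes K: "compact K" "K \<noteq> {}" and J: "J \<noteq> {}"
  and cont: "!!i. i \<in> J ==> continuous_on K (f i)"
  and nonneg: "!!i c. i \<in> J ==> c \<in> K ==> 0 <= f i c"
 obtains c where "c \<in> K" "!!c'. c' \<in> K ==> c' + (INF i\<in>J. f i c')^2 <= c + (INF i\<in>J. f i c)^2"
proof -
 define z where "z c = (INF i\<in>J. f i c)" for c
 define \<Phi> where "\<Phi> c = c + (z c)^2" for c
 have bb: "bdd_below ((%i. f i c) ` J)" if "c \<in> K" for c
  using nonneg that by (intro bdd_belowI[of _ 0]) auto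
 have z0: "0 <= z c" if "c \<in> K" for c unfolding z_def using J nonneg that by (intro cINF_greatest) auto
 have zle: "z c <= f i c" if "c \<in> K" "i \<in> J" for i c unfolding z_def using bb that by (intro cINF_lower) auto
 have \<Phi>le: "\<Phi> c <= c + (f i c)^2" if "c \<in> K" "i \<in> J" for i c
  unfolding \<Phi>_def using z0 zle that by (intro add_left_mono power_mono) auto
 obtain i0 where i0: "i0 \<in> J" using J by blast
 have "compact ((%c. c + (f i0 c)^2) ` K)"
  using K cont i0 by (intro compact_continuous_image continuous_intros) auto
 then have "bdd_above ((%c. c + (f i0 c)^2) ` K)" by (intro bounded_imp_bdd_above compact_imp_bounded)
 then obtain b where b: "c + (f i0 c)^2 <= b" if "c \<in> K" for c by (auto simp: bdd_above_def)
 have bdd: "bdd_above (\<Phi> ` K)"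
  using b \<Phi>le[OF _ i0] by (intro bdd_aboveI[of _ b]) (auto intro: order.trans)
 define S where "S = Sup (\<Phi> ` K)"
 have up: "\<Phi> c <= S" if "c \<in> K" for c unfolding S_def using bdd that by (intro cSup_upper) auto
 have "\<exists>c\<in>K. S - 1 / real (Suc n) < \<Phi> c" for n
  using less_cSup_iff[of "\<Phi> ` K" "S - 1 / real (Suc n)"] K(2) bdd unfolding S_def by auto
 then obtain u where u: "!!n. u n \<in> K" "!!n. S - 1 / real (Suc n) < \<Phi> (u n)" by metis
 obtain c r where c: "c \<in> K" and r: "strict_mono (r :: nat => nat)" and lim: "(u \<circ> r) \<longlonglongrightarrow> c"
  using K(1) u(1) unfolding compact_def by blast
 have Sle: "S <= c + (f i c)^2" if i: "i \<in> J" for i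
 proof -
  have "continuous_on K (%c. c + (f i c)^2)" using cont[OF i] by (intro continuous_intros)
  then have l2: "(%n. u (r n) + (f i (u (r n)))^2) \<longlonglongrightarrow> c + (f i c)^2"
   by (rule continuous_on_tendsto_compose[OF _ lim[unfolded comp_def] c]) (simp add: u)
  have "(%n. S - 1 / real (Suc (r n))) \<longlonglongrightarrow> S - 0"
   by (intro tendsto_diff tendsto_const filterlim_compose[OF LIMSEQ_Suc[OF lim_1_over_n] filterlim_subseq[OF r]])
  then have l1: "(%n. S - 1 / real (Suc (r n))) \<longlonglongrightarrow> S" by simp
  show ?thesis
   by (rule LIMSEQ_le[OF l1 l2]) (intro exI[of _ 0] allI impI order.trans[OF less_imp_le[OF u(2)] \<Phi>le[OF u(1) i]])
 qed
 have "S <= \<Phi> c"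
 proof (cases "S <= c")
  case True
  then show ?thesis unfolding \<Phi>_def by (smt (verit) zero_le_power2)
 next
  case False
  have "sqrt (S - c) <= f i c" if i: "i \<in> J" for i
   by (rule real_le_lsqrt) (use Sle[OF i] nonneg[OF i c] False in auto)
  then have "sqrt (S - c) <= z c" unfolding z_def using J by (intro cINF_greatest) auto
  then have "(sqrt (S - c))^2 <= (z c)^2" using False by (intro power_mono) auto
  then show ?thesis using False by (simp add: \<Phi>_def)
 qed
 then show ?thesis using that[OF c] up order.trans unfolding \<Phi>_def z_def by blast
qed

locale kron_mats =
 fixes k1 k2 l :: nat and A :: "nat => real mat" and AD :: "real mat"
 assumes k1: "0 < k1" and k2: "0 < k2"
  and A: "!!t. t < l ==> A t \<in> carrier_mat k1 k2"
  and AD: "AD \<in> carrier_mat k2 k2" and AD_sym: "sym_on {..<k2} (entries AD)"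

sublocale kron_mats \<subseteq> kron_coeffs k1 k2 l "%t q p. A t $$ (q, p)" .

context kron_mats
begin

lemma mat_sum_etaX:
 assumes B: "B \<in> carrier_mat k1 k1" and p: "p < k2" "p' < k2"
 shows "mat_sum k2 k2 (%t. transpose_mat (A t) * B * A t) l $$ (p, p') = etaX (entries B) p p'"
proof -
 have "(transpose_mat (A t) * B * A t) $$ (p, p') = (\<Sum>q<k1. \<Sum>q'<k1. A t $$ (q, p) * A t $$ (q', p') * B $$ (q, q'))" if t: "t < l" for t
 proof -
  have At: "transpose_mat (A t) \<in> carrier_mat k2 k1" using A[OF t] by simp
  have AB: "transpose_mat (A t) * B \<in> carrier_mat k2 k1" using At B by simp
  have "(transpose_mat (A t) * B) $$ (p, q') = (\<Sum>q<k1. A t $$ (q, p) * B $$ (q, q'))" if "q' < k1" for q'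
   unfolding mult_mat_entry[OF At B p(1) that] using A[OF t] p by (intro sum.cong) auto
  then have "(transpose_mat (A t) * B * A t) $$ (p, p') = (\<Sum>q'<k1. (\<Sum>q<k1. A t $$ (q, p) * B $$ (q, q')) * A t $$ (q', p'))"
   unfolding mult_mat_entry[OF AB A[OF t] p] by (intro sum.cong) auto
  also have "... = (\<Sum>q'<k1. \<Sum>q<k1. A t $$ (q, p) * A t $$ (q', p') * B $$ (q, q'))" by (intro sum.cong refl, simp only: sum_distrib_right, intro sum.cong refl, simp only: ac_simps)
  also have "... = (\<Sum>q<k1. \<Sum>q'<k1. A t $$ (q, p) * A t $$ (q', p') * B $$ (q, q'))" by (rule sum.swap)
  finally show ?thesis .
 qed
 then have "mat_sum k2 k2 (%t. transpose_mat (A t) * B * A t) l $$ (p, p') =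
  (\<Sum>t<l. \<Sum>q<k1. \<Sum>q'<k1. A t $$ (q, p) * A t $$ (q', p') * B $$ (q, q'))"
  using p by (simp add: mat_sum_def)
 also have "... = (\<Sum>q<k1. \<Sum>t<l. \<Sum>q'<k1. A t $$ (q, p) * A t $$ (q', p') * B $$ (q, q'))" by (rule sum.swap)
 also have "... = (\<Sum>q<k1. \<Sum>q'<k1. \<Sum>t<l. A t $$ (q, p) * A t $$ (q', p') * B $$ (q, q'))"
  by (intro sum.cong refl sum.swap)
 finally show ?thesis by (simp add: etaX_def cov_def sum_distrib_right)
qed

lemma mat_sum_etaY:
 assumes B: "B \<in> carrier_mat k2 k2" and q: "q < k1" "q' < k1"
 shows "mat_sum k1 k1 (%t. A t * B * transpose_mat (A t)) l $$ (q, q') = etaY (entries B) q q'"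
proof -
 have "(A t * B * transpose_mat (A t)) $$ (q, q') = (\<Sum>p<k2. \<Sum>p'<k2. A t $$ (q, p) * A t $$ (q', p') * B $$ (p, p'))" if t: "t < l" for t
 proof -
  have At: "transpose_mat (A t) \<in> carrier_mat k2 k1" using A[OF t] by simp
  have AB: "A t * B \<in> carrier_mat k1 k2" using A[OF t] B by simp
  have "(A t * B) $$ (q, p') = (\<Sum>p<k2. A t $$ (q, p) * B $$ (p, p'))" if "p' < k2" for p'
   by (rule mult_mat_entry[OF A[OF t] B q(1) that])
  then have "(A t * B * transpose_mat (A t)) $$ (q, q') = (\<Sum>p'<k2. (\<Sum>p<k2. A t $$ (q, p) * B $$ (p, p')) * A t $$ (q', p'))"
   unfolding mult_mat_entry[OF AB At q] using A[OF t] q by (intro sum.cong) auto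
  also have "... = (\<Sum>p'<k2. \<Sum>p<k2. A t $$ (q, p) * A t $$ (q', p') * B $$ (p, p'))" by (intro sum.cong refl, simp only: sum_distrib_right, intro sum.cong refl, simp only: ac_simps)
  also have "... = (\<Sum>p<k2. \<Sum>p'<k2. A t $$ (q, p) * A t $$ (q', p') * B $$ (p, p'))" by (rule sum.swap)
  finally show ?thesis .
 qed
 then have "mat_sum k1 k1 (%t. A t * B * transpose_mat (A t)) l $$ (q, q') =
  (\<Sum>t<l. \<Sum>p<k2. \<Sum>p'<k2. A t $$ (q, p) * A t $$ (q', p') * B $$ (p, p'))"
  using q by (simp add: mat_sum_def)
 also have "... = (\<Sum>p<k2. \<Sum>t<l. \<Sum>p'<k2. A t $$ (q, p) * A t $$ (q', p') * B $$ (p, p'))" by (rule sum.swap)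
 also have "... = (\<Sum>p<k2. \<Sum>p'<k2. \<Sum>t<l. A t $$ (q, p) * A t $$ (q', p') * B $$ (p, p'))"
  by (intro sum.cong refl sum.swap)
 finally show ?thesis by (simp add: etaY_def cov_def sum_distrib_right)
qed

definition x_mat :: "real => real mat => real mat => real => real mat" where
 "x_mat \<alpha> ZY ZX \<gamma> = \<gamma> \<cdot>\<^sub>m AD + (1/2) \<cdot>\<^sub>m
   (ZX + \<alpha> \<cdot>\<^sub>m mat_sum k2 k2 (%t. transpose_mat (A t) * mat_inv ZY * A t) l)"

definition y_mat :: "real mat => real mat => real mat" where
 "y_mat ZY ZX = ZY + mat_sum k1 k1 (%t. A t * mat_inv ZX * transpose_mat (A t)) l"

lemma zeta_objective_alt:
 "zeta_objective k1 k2 l \<alpha> A AD c ZY ZX \<gamma> = lambda_max (x_mat \<alpha> ZY ZX \<gamma>) + (1/2) * lambda_max (y_mat ZY ZX) - \<gamma> * c"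
 by (simp add: zeta_objective_def x_mat_def y_mat_def)

lemma sym_on_lincomb:
 assumes "sym_on I X" "sym_on I Y"
 shows "sym_on I (%a b. s * X a b + t * Y a b)"
 unfolding sym_on_def
proof (intro ballI)
 fix a b assume "a \<in> I" "b \<in> I"
 then have "X a b = X b a" "Y a b = Y b a" by (intro sym_onD[OF assms(1)] sym_onD[OF assms(2)]; simp)+
 then show "s * X a b + t * Y a b = s * X b a + t * Y b a" by presburger
qed

lemma sym_on_cong:
 assumes "sym_on I X" "!!a b. a \<in> I ==> b \<in> I ==> Y a b = X a b"
 shows "sym_on I Y"
 unfolding sym_on_def
proof (intro ballI)
 fix a b assume ab: "a \<in> I" "b \<in> I"
 have "Y a b = X a b" by (rule assms(2)[OF ab])
 also have "... = X b a" by (rule sym_onD[OF assms(1) ab])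
 also have "... = Y b a" by (rule assms(2)[OF ab(2,1), symmetric])
 finally show "Y a b = Y b a" .
qed

lemma etaX_cong: "(!!q q'. q < k1 ==> q' < k1 ==> Y q q' = Y' q q') ==> etaX Y p p' = etaX Y' p p'"
 unfolding etaX_def by (intro sum.cong) auto

lemma etaY_cong: "(!!p p'. p < k2 ==> p' < k2 ==> X p p' = X' p p') ==> etaY X q q' = etaY X' q q'"
 unfolding etaY_def by (intro sum.cong) auto

lemma x_mat:
 assumes ZX: "ZX \<in> carrier_mat k2 k2" "sym_on K2 (entries ZX)"
  and B: "mat_inv ZY = mat k1 k1 (%(i, j). B i j)" "sym_on K1 B"
 shows "x_mat \<alpha> ZY ZX \<gamma> \<in> carrier_mat k2 k2" and "sym_on K2 (entries (x_mat \<alpha> ZY ZX \<gamma>))"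
  and "quad_on K2 (entries (x_mat \<alpha> ZY ZX \<gamma>)) x
   = \<gamma> * quad_on K2 (entries AD) x + 1/2 * (quad_on K2 (entries ZX) x + \<alpha> * quad_on K2 (etaX B) x)"
proof -
 have Bc: "mat_inv ZY \<in> carrier_mat k1 k1" by (simp add: B)
 have ms: "mat_sum k2 k2 F l \<in> carrier_mat k2 k2" for F by (simp add: mat_sum_def)
 show c: "x_mat \<alpha> ZY ZX \<gamma> \<in> carrier_mat k2 k2" using ZX AD ms by (simp add: x_mat_def)
 have e: "entries (x_mat \<alpha> ZY ZX \<gamma>) p p' = \<gamma> * entries AD p p' + 1/2 * (entries ZX p p' + \<alpha> * etaX B p p')"
  if p: "p \<in> K2" "p' \<in> K2" for p p'
 proof -
  have "etaX (entries (mat_inv ZY)) p p' = etaX B p p'" by (rule etaX_cong) (simp add: B)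
  then have "mat_sum k2 k2 (%t. transpose_mat (A t) * mat_inv ZY * A t) l $$ (p, p') = etaX B p p'"
   using mat_sum_etaX[OF Bc, of p p'] p by simp
  moreover have "dim_row (mat_sum k2 k2 F l) = k2" "dim_col (mat_sum k2 k2 F l) = k2" for F by (simp_all add: mat_sum_def)
  ultimately show ?thesis using carrier_matD[OF ZX(1)] carrier_matD[OF AD] p unfolding x_mat_def by simp
 qed
 have "sym_on K2 (%p p'. \<gamma> * entries AD p p' + 1/2 * (1 * entries ZX p p' + \<alpha> * etaX B p p'))"
  by (intro sym_on_lincomb AD_sym ZX sym_etaX B)
 then show "sym_on K2 (entries (x_mat \<alpha> ZY ZX \<gamma>))"
  by (rule sym_on_cong) (simp only: e mult_1)
 have "quad_on K2 (entries (x_mat \<alpha> ZY ZX \<gamma>)) x =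
  quad_on K2 (%p p'. \<gamma> * entries AD p p' + 1/2 * (entries ZX p p' + \<alpha> * etaX B p p')) x"
  by (rule quad_on_cong) (simp_all only: e)
 then show "quad_on K2 (entries (x_mat \<alpha> ZY ZX \<gamma>)) x
   = \<gamma> * quad_on K2 (entries AD) x + 1/2 * (quad_on K2 (entries ZX) x + \<alpha> * quad_on K2 (etaX B) x)"
  by (simp only: quad_on_linear)
qed

lemma y_mat:
 assumes ZY: "ZY \<in> carrier_mat k1 k1" "sym_on K1 (entries ZY)"
  and B: "mat_inv ZX = mat k2 k2 (%(i, j). B i j)" "sym_on K2 B"
 shows "y_mat ZY ZX \<in> carrier_mat k1 k1" and "sym_on K1 (entries (y_mat ZY ZX))"
  and "quad_on K1 (entries (y_mat ZY ZX)) x = quad_on K1 (entries ZY) x + quad_on K1 (etaY B) x"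
proof -
 have Bc: "mat_inv ZX \<in> carrier_mat k2 k2" by (simp add: B)
 have ms: "mat_sum k1 k1 F l \<in> carrier_mat k1 k1" for F by (simp add: mat_sum_def)
 show c: "y_mat ZY ZX \<in> carrier_mat k1 k1" using ZY ms by (simp add: y_mat_def)
 have e: "entries (y_mat ZY ZX) q q' = entries ZY q q' + etaY B q q'"
  if q: "q \<in> K1" "q' \<in> K1" for q q'
 proof -
  have "etaY (entries (mat_inv ZX)) q q' = etaY B q q'" by (rule etaY_cong) (simp add: B)
  then have "mat_sum k1 k1 (%t. A t * mat_inv ZX * transpose_mat (A t)) l $$ (q, q') = etaY B q q'"
   using mat_sum_etaY[OF Bc, of q q'] q by simp
  moreover have "dim_row (mat_sum k1 k1 F l) = k1" "dim_col (mat_sum k1 k1 F l) = k1" for F by (simp_all add: mat_sum_def)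
  ultimately show ?thesis using carrier_matD[OF ZY(1)] q unfolding y_mat_def by simp
 qed
 have "sym_on K1 (%q q'. 1 * entries ZY q q' + 1 * etaY B q q')"
  by (intro sym_on_lincomb ZY sym_etaY B)
 then show "sym_on K1 (entries (y_mat ZY ZX))"
  by (rule sym_on_cong) (simp only: e mult_1)
 have "quad_on K1 (entries (y_mat ZY ZX)) x = quad_on K1 (%q q'. entries ZY q q' + etaY B q q') x"
  by (rule quad_on_cong) (simp_all only: e)
 then show "quad_on K1 (entries (y_mat ZY ZX)) x = quad_on K1 (entries ZY) x + quad_on K1 (etaY B) x"
  by (simp only: quad_on_linear)
qed

text \<open>The rows of $R_X$ enter the two traces separately.\<close>

lemma attainable_alt:
 "attainable k2 AD = {\<Sum>a<k2. quad_on K2 (entries AD) (\<rho> a) | \<rho>. (\<Sum>a<k2. dot_on K2 (\<rho> a) (\<rho> a)) = 1}"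
proof -
 have t1: "mat_trace (AD * transpose_mat R * R) = (\<Sum>a<k2. quad_on K2 (entries AD) (%p. R $$ (a, p)))" if R: "R \<in> carrier_mat k2 k2" for R
 proof -
  have Rt: "transpose_mat R \<in> carrier_mat k2 k2" using R by simp
  have AR: "AD * transpose_mat R \<in> carrier_mat k2 k2" using AD Rt by simp
  have "mat_trace (AD * transpose_mat R * R) = (\<Sum>p<k2. (AD * transpose_mat R * R) $$ (p, p))" using AD R by (simp add: mat_trace_def)
  also have "... = (\<Sum>p<k2. \<Sum>a<k2. (AD * transpose_mat R) $$ (p, a) * R $$ (a, p))"
   by (intro sum.cong refl mult_mat_entry[OF AR R]) auto
  also have "... = (\<Sum>p<k2. \<Sum>a<k2. (\<Sum>p'<k2. AD $$ (p, p') * R $$ (a, p')) * R $$ (a, p))"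
  proof (intro sum.cong refl)
   fix p a assume pa: "p \<in> K2" "a \<in> K2"
   have "(AD * transpose_mat R) $$ (p, a) = (\<Sum>p'<k2. AD $$ (p, p') * transpose_mat R $$ (p', a))"
    using pa by (intro mult_mat_entry[OF AD Rt]) auto
   also have "... = (\<Sum>p'<k2. AD $$ (p, p') * R $$ (a, p'))" using R pa by (intro sum.cong) auto
   finally show "(AD * transpose_mat R) $$ (p, a) * R $$ (a, p) = (\<Sum>p'<k2. AD $$ (p, p') * R $$ (a, p')) * R $$ (a, p)" by simp
  qed
  also have "... = (\<Sum>a<k2. \<Sum>p<k2. (\<Sum>p'<k2. AD $$ (p, p') * R $$ (a, p')) * R $$ (a, p))" by (rule sum.swap)
  also have "... = (\<Sum>a<k2. quad_on K2 (entries AD) (%p. R $$ (a, p)))"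
   by (simp add: quad_on_def dot_on_def app_on_def mult.commute)
  finally show ?thesis .
 qed
 have t2: "mat_trace (transpose_mat R * R) = (\<Sum>a<k2. dot_on K2 (%p. R $$ (a, p)) (%p. R $$ (a, p)))" if R: "R \<in> carrier_mat k2 k2" for R
 proof -
  have Rt: "transpose_mat R \<in> carrier_mat k2 k2" using R by simp
  have "mat_trace (transpose_mat R * R) = (\<Sum>p<k2. (transpose_mat R * R) $$ (p, p))" using R by (simp add: mat_trace_def)
  also have "... = (\<Sum>p<k2. \<Sum>a<k2. transpose_mat R $$ (p, a) * R $$ (a, p))"
   by (intro sum.cong refl mult_mat_entry[OF Rt R]) auto
  also have "... = (\<Sum>p<k2. \<Sum>a<k2. R $$ (a, p) * R $$ (a, p))"
   using R by (intro sum.cong) auto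
  also have "... = (\<Sum>a<k2. \<Sum>p<k2. R $$ (a, p) * R $$ (a, p))" by (rule sum.swap)
  finally show ?thesis by (simp add: dot_on_def)
 qed
 show ?thesis
 proof (rule subset_antisym; rule subsetI)
  fix c assume "c \<in> attainable k2 AD"
  then obtain R where R: "R \<in> carrier_mat k2 k2" "mat_trace (transpose_mat R * R) = 1" "c = mat_trace (AD * transpose_mat R * R)"
   unfolding attainable_def by blast
  then show "c \<in> {\<Sum>a<k2. quad_on K2 (entries AD) (\<rho> a) | \<rho>. (\<Sum>a<k2. dot_on K2 (\<rho> a) (\<rho> a)) = 1}"
   using t1[OF R(1)] t2[OF R(1)] by (intro CollectI exI[of _ "%a p. R $$ (a, p)"]) simp
 next
  fix c assume "c \<in> {\<Sum>a<k2. quad_on K2 (entries AD) (\<rho> a) | \<rho>. (\<Sum>a<k2. dot_on K2 (\<rho> a) (\<rho> a)) = 1}"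
  then obtain \<rho> where \<rho>: "(\<Sum>a<k2. dot_on K2 (\<rho> a) (\<rho> a)) = 1" "c = (\<Sum>a<k2. quad_on K2 (entries AD) (\<rho> a))" by blast
  define R where "R = mat k2 k2 (%(a, p). \<rho> a p)"
  have R: "R \<in> carrier_mat k2 k2" by (simp add: R_def)
  have "mat_trace (transpose_mat R * R) = (\<Sum>a<k2. dot_on K2 (\<rho> a) (\<rho> a))"
   unfolding t2[OF R] by (intro sum.cong refl dot_on_cong) (auto simp: R_def)
  moreover have "mat_trace (AD * transpose_mat R * R) = c"
   unfolding t1[OF R] \<rho>(2) by (intro sum.cong refl quad_on_cong) (auto simp: R_def)
  ultimately show "c \<in> attainable k2 AD" unfolding attainable_def using R \<rho>(1) by (intro CollectI exI[of _ R]) simp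
 qed
qed

text \<open>The end points are the extreme eigenvalues of $A_D$; two rows, multiples of extreme eigenvectors, reach
everything in between.\<close>

lemma attainable_interval:
 obtains lo hi where "lo <= hi" "attainable k2 AD = {lo..hi}"
proof -
 let ?I = "K2" and ?D = "entries AD"
 have I: "finite ?I" "?I \<noteq> {}" using k2 by auto
 from rayleigh_max[OF I AD_sym] obtain hi v where v: "dot_on ?I v v = 1" "quad_on ?I ?D v = hi"
  and hi: "!!x. quad_on ?I ?D x <= hi * dot_on ?I x x" by metis
 have neg: "sym_on ?I (%a b. (-1) * ?D a b)"
  using sym_on_lincomb[OF AD_sym AD_sym, of "-1" 0] by (simp only: mult_zero_left add_0_right)
 have "\<exists>\<mu> w. dot_on ?I w w = 1 \<and> quad_on ?I (%a b. (-1) * ?D a b) w = \<mu> \<and>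
   (\<forall>x. quad_on ?I (%a b. (-1) * ?D a b) x <= \<mu> * dot_on ?I x x)"
  by (rule rayleigh_max[OF I neg]) blast
 then obtain lo' w where w0: "dot_on ?I w w = 1" "quad_on ?I (%a b. (-1) * ?D a b) w = lo'"
  and lo0: "!!x. quad_on ?I (%a b. (-1) * ?D a b) x <= lo' * dot_on ?I x x" by blast
 define lo where "lo = - lo'"
 have w: "dot_on ?I w w = 1" "quad_on ?I ?D w = lo" using w0 unfolding quad_on_linear lo_def by simp_all
 have lo: "lo * dot_on ?I x x <= quad_on ?I ?D x" for x using lo0[of x] unfolding quad_on_linear lo_def by simp
 have le: "lo <= hi" using lo[of v] v by simp
 have "attainable k2 AD = {lo..hi}"
 proof (rule subset_antisym; rule subsetI)
  fix c assume "c \<in> attainable k2 AD"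
  then obtain \<rho> where \<rho>: "(\<Sum>a<k2. dot_on ?I (\<rho> a) (\<rho> a)) = 1" "c = (\<Sum>a<k2. quad_on ?I ?D (\<rho> a))"
   unfolding attainable_alt by blast
  have "c <= (\<Sum>a<k2. hi * dot_on ?I (\<rho> a) (\<rho> a))" unfolding \<rho>(2) by (intro sum_mono hi)
  moreover have "(\<Sum>a<k2. lo * dot_on ?I (\<rho> a) (\<rho> a)) <= c" unfolding \<rho>(2) by (intro sum_mono lo)
  ultimately show "c \<in> {lo..hi}" by (simp add: sum_distrib_left[symmetric] \<rho>(1))
 next
  fix c assume c: "c \<in> {lo..hi}"
  have zq: "quad_on ?I ?D (%_. 0) = 0" and zd: "dot_on ?I (%_. 0) (%_. 0) = 0" by (simp_all add: quad_on_alt dot_on_def)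
  show "c \<in> attainable k2 AD"
  proof (cases "lo = hi")
   case True
   define \<rho> where "\<rho> = (%a :: nat. if a = 0 then v else (%_. 0))"
   have 1: "(\<Sum>a<k2. dot_on ?I (\<rho> a) (\<rho> a)) = (\<Sum>a<k2. if a = 0 then dot_on ?I v v else 0)"
    by (intro sum.cong) (auto simp: \<rho>_def zd)
   have 2: "(\<Sum>a<k2. quad_on ?I ?D (\<rho> a)) = (\<Sum>a<k2. if a = 0 then hi else 0)"
    by (intro sum.cong) (auto simp: \<rho>_def zq v)
   have "(\<Sum>a<k2. dot_on ?I (\<rho> a) (\<rho> a)) = 1" "c = (\<Sum>a<k2. quad_on ?I ?D (\<rho> a))"
    unfolding 1 2 using k2 v c True by simp_all
   then show ?thesis unfolding attainable_alt by blast
  next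
   case False
   have "k2 \<noteq> 1"
   proof
    assume k: "k2 = 1"
    have "v 0 * v 0 = 1" "w 0 * w 0 = 1" using v(1) w(1) by (simp_all add: k dot_on_def)
    then have "hi = ?D 0 0" "lo = ?D 0 0" using v(2) w(2) by (simp_all add: k quad_on_alt mult.assoc)
    with False show False by simp
   qed
   then have sub: "{0, 1} \<subseteq> ?I" using k2 by auto
   define t where "t = (c - lo) / (hi - lo)"
   have t: "0 <= t" "t <= 1" "c = t * hi + (1 - t) * lo"
   proof -
    have "0 < hi - lo" using False le by simp
    moreover from this have "t * (hi - lo) = c - lo" by (simp add: t_def)
    ultimately show "c = t * hi + (1 - t) * lo" by (simp add: algebra_simps)
    show "0 <= t" "t <= 1" using c \<open>0 < hi - lo\<close> by (auto simp: t_def)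
   qed
   define \<rho> where "\<rho> = (%a :: nat. if a = 0 then (%p. sqrt t * v p) else if a = 1 then (%p. sqrt (1 - t) * w p) else (%_. 0))"
   have \<rho>s: "\<rho> 0 = (%p. sqrt t * v p)" "\<rho> 1 = (%p. sqrt (1 - t) * w p)" and \<rho>z: "a \<noteq> 0 ==> a \<noteq> 1 ==> \<rho> a = (%_. 0)" for a
    by (simp_all add: \<rho>_def)
   have "(\<Sum>a<k2. dot_on ?I (\<rho> a) (\<rho> a)) = (\<Sum>a\<in>{0,1}. dot_on ?I (\<rho> a) (\<rho> a))"
    using sub by (intro sum.mono_neutral_right) (auto simp: \<rho>z zd)
   also have "... = dot_on ?I (\<rho> 0) (\<rho> 0) + dot_on ?I (\<rho> 1) (\<rho> 1)" by simp
   also have "... = 1" unfolding \<rho>s dot_on_scale using t v w by simp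
   finally have 1: "(\<Sum>a<k2. dot_on ?I (\<rho> a) (\<rho> a)) = 1" .
   have "(\<Sum>a<k2. quad_on ?I ?D (\<rho> a)) = (\<Sum>a\<in>{0,1}. quad_on ?I ?D (\<rho> a))"
    using sub by (intro sum.mono_neutral_right) (auto simp: \<rho>z zq)
   also have "... = quad_on ?I ?D (\<rho> 0) + quad_on ?I ?D (\<rho> 1)" by simp
   also have "... = c" unfolding \<rho>s quad_on_scale using t v w by simp
   finally show ?thesis unfolding attainable_alt using 1 by blast
  qed
 qed
 with le show ?thesis by (rule that)
qed

lemma pos_def_mats_inverse:
 assumes k: "0 < k" and Z: "Z \<in> pos_def_mats k"
 obtains B where "mat_inv Z = mat k k (%(i, j). B i j)" "sym_on {..<k} B" "psd_on {..<k} B"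
proof -
 from Z obtain eps where c: "Z \<in> carrier_mat k k" "sym_on {..<k} (entries Z)" "0 < eps"
  "!!x. eps * dot_on {..<k} x x <= quad_on {..<k} (entries Z) x"
  unfolding pos_def_mats_iff[OF k] by blast
 note cf = finite_lessThan[of k] c(2,3,4)
 have "mat_inv Z = mat k k (%(i, j). inv_on {..<k} (entries Z) i j)"
  by (rule mat_inv_entries[OF c(1)], rule mul_on_inv_on(1)[OF finite_lessThan coercive_kernel[OF cf]]) auto
 then show ?thesis by (rule that[OF _ coercive_inv_sym[OF cf] coercive_inv_psd[OF cf]])
qed

text \<open>Testing the first matrix against the rows of $R_X$ yields at least $\gamma_D c$, because the remaining summands
are positive semidefinite. This is what makes the infimum a genuine one.\<close>

lemma zeta_objective_nonneg:
 assumes \<alpha>: "0 <= \<alpha>" and c: "c \<in> attainable k2 AD" and ZY: "ZY \<in> pos_def_mats k1" and ZX: "ZX \<in> pos_def_mats k2"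
 shows "0 <= zeta_objective k1 k2 l \<alpha> A AD c ZY ZX \<gamma>"
proof -
 obtain BY where BY: "mat_inv ZY = mat k1 k1 (%(i, j). BY i j)" "sym_on K1 BY" "psd_on K1 BY"
  using pos_def_mats_inverse[OF k1 ZY] by blast
 obtain BX where BX: "mat_inv ZX = mat k2 k2 (%(i, j). BX i j)" "sym_on K2 BX" "psd_on K2 BX"
  using pos_def_mats_inverse[OF k2 ZX] by blast
 have psd: "0 <= quad_on {..<k} (entries Z) x" if "0 < k" "Z \<in> pos_def_mats k" for k Z x
  using that pos_def_mats_iff[OF that(1), of Z] dot_on_nonneg[of "{..<k}" x] by (meson less_imp_le mult_nonneg_nonneg order.trans)
 have ZXc: "ZX \<in> carrier_mat k2 k2" "sym_on K2 (entries ZX)" and ZYc: "ZY \<in> carrier_mat k1 k1" "sym_on K1 (entries ZY)"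
  using ZX ZY pos_def_mats_iff[OF k1, of ZY] pos_def_mats_iff[OF k2, of ZX] by blast+
 note x = x_mat[OF ZXc BY(1,2)] and y = y_mat[OF ZYc BX(1,2)]
 have 1: "0 <= lambda_max (y_mat ZY ZX)"
 proof -
  define e where "e = (%q :: nat. of_bool (q = 0) :: real)"
  have "dot_on K1 e e = 1" using k1 by (simp add: e_def dot_on_def of_bool_def if_distrib if_distribR cong: if_cong)
  moreover have "0 <= quad_on K1 (entries (y_mat ZY ZX)) e"
   unfolding y using psd[OF k1 ZY] psd_etaY[OF BX(3)] by (simp add: psd_on_def)
  ultimately show ?thesis using quad_on_le_lambda_max[OF y(1,2) k1, of e] by simp
 qed
 obtain \<rho> where \<rho>: "(\<Sum>a<k2. dot_on K2 (\<rho> a) (\<rho> a)) = 1" "c = (\<Sum>a<k2. quad_on K2 (entries AD) (\<rho> a))"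
  using c unfolding attainable_alt by blast
 have "\<gamma> * c = (\<Sum>a<k2. \<gamma> * quad_on K2 (entries AD) (\<rho> a))" unfolding \<rho>(2) by (rule sum_distrib_left)
 also have "... <= (\<Sum>a<k2. lambda_max (x_mat \<alpha> ZY ZX \<gamma>) * dot_on K2 (\<rho> a) (\<rho> a))"
 proof (rule sum_mono)
  fix a
  have "0 <= \<alpha> * quad_on K2 (etaX BY) (\<rho> a)" using \<alpha> psd_etaX[OF BY(3)] by (simp add: psd_on_def)
  then have "\<gamma> * quad_on K2 (entries AD) (\<rho> a) <= quad_on K2 (entries (x_mat \<alpha> ZY ZX \<gamma>)) (\<rho> a)"
   unfolding x using psd[OF k2 ZX, of "\<rho> a"] by simp
  also have "... <= lambda_max (x_mat \<alpha> ZY ZX \<gamma>) * dot_on K2 (\<rho> a) (\<rho> a)"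
   by (rule quad_on_le_lambda_max[OF x(1,2) k2])
  finally show "\<gamma> * quad_on K2 (entries AD) (\<rho> a) <= lambda_max (x_mat \<alpha> ZY ZX \<gamma>) * dot_on K2 (\<rho> a) (\<rho> a)" .
 qed
 also have "... = lambda_max (x_mat \<alpha> ZY ZX \<gamma>)" by (simp add: sum_distrib_left[symmetric] \<rho>(1))
 finally show ?thesis unfolding zeta_objective_alt using 1 by simp
qed

lemma pos_def_identity: "0 < k ==> 1\<^sub>m k \<in> pos_def_mats k"
proof -
 assume k: "0 < k"
 have "sym_on {..<k} (entries (1\<^sub>m k))" by (auto simp: sym_on_def)
 moreover have "quad_on {..<k} (entries (1\<^sub>m k)) x = dot_on {..<k} x x" for x
 proof -
  have "quad_on {..<k} (entries (1\<^sub>m k)) x = quad_on {..<k} (%a b. of_bool (a = b)) x" by (rule quad_on_cong) auto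
  then show ?thesis by (simp add: quad_of_bool)
 qed
 ultimately show ?thesis unfolding pos_def_mats_iff[OF k] by (intro conjI exI[of _ "1::real"]) auto
qed

theorem zeta_argmax:
 assumes \<alpha>: "0 <= \<alpha>"
 obtains c where "is_arg_max (%c. c + (zeta k1 k2 l \<alpha> A AD c)^2) (%c. c \<in> attainable k2 AD) c"
proof -
 obtain lo hi where I: "lo <= hi" "attainable k2 AD = {lo..hi}" by (rule attainable_interval)
 let ?J = "pos_def_mats k1 \<times> pos_def_mats k2 \<times> (UNIV :: real set)"
 let ?f = "%i c. (case i of (ZY, ZX, \<gamma>) => zeta_objective k1 k2 l \<alpha> A AD c ZY ZX \<gamma>)"
 have z: "zeta k1 k2 l \<alpha> A AD c = (INF i\<in>?J. ?f i c)" for c by (simp add: zeta_def)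
 have "compact (attainable k2 AD)" "attainable k2 AD \<noteq> {}" "?J \<noteq> {}"
  using I pos_def_identity[OF k1] pos_def_identity[OF k2] by auto
 then obtain c where "c \<in> attainable k2 AD"
  "!!c'. c' \<in> attainable k2 AD ==> c' + (INF i\<in>?J. ?f i c')^2 <= c + (INF i\<in>?J. ?f i c)^2"
 proof (rule maximum_of_upper_envelope[where f = ?f])
  fix i :: "real mat \<times> real mat \<times> real" assume "i \<in> ?J"
  show "continuous_on (attainable k2 AD) (?f i)"
   by (cases i) (auto simp: zeta_objective_def intro!: continuous_intros)
 next
  fix i :: "real mat \<times> real mat \<times> real" and c assume "i \<in> ?J" "c \<in> attainable k2 AD"
  then show "0 <= ?f i c" using zeta_objective_nonneg[OF \<alpha>] by auto
 qed blast
 then have "is_arg_max (%c. c + (zeta k1 k2 l \<alpha> A AD c)^2) (%c. c \<in> attainable k2 AD) c"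
  unfolding is_arg_max_def z by (auto simp: not_less)
 then show ?thesis by (rule that)
qed

lemma zeta_nonneg:
 assumes "0 <= \<alpha>" "c \<in> attainable k2 AD"
 shows "0 <= zeta k1 k2 l \<alpha> A AD c"
 unfolding zeta_def
 by (rule cINF_greatest) (use zeta_objective_nonneg[OF assms] pos_def_identity[OF k1] pos_def_identity[OF k2] in auto)

lemma zeta_le:
 assumes "0 <= \<alpha>" "c \<in> attainable k2 AD" "ZY \<in> pos_def_mats k1" "ZX \<in> pos_def_mats k2"
 shows "zeta k1 k2 l \<alpha> A AD c <= zeta_objective k1 k2 l \<alpha> A AD c ZY ZX \<gamma>"
proof -
 let ?J = "pos_def_mats k1 \<times> pos_def_mats k2 \<times> (UNIV :: real set)"
 let ?f = "%i. (case i of (ZY, ZX, \<gamma>) => zeta_objective k1 k2 l \<alpha> A AD c ZY ZX \<gamma>)"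
 have "bdd_below (?f ` ?J)" by (rule bdd_belowI[of _ 0]) (use zeta_objective_nonneg[OF assms(1,2)] in auto)
 then have "(INF i\<in>?J. ?f i) <= ?f (ZY, ZX, \<gamma>)" by (rule cINF_lower) (use assms in auto)
 then show ?thesis by (simp add: zeta_def)
qed

lemma scaled_inverse_pos_def:
 assumes k: "0 < k" and X: "sym_on {..<k} X" and eps: "0 < eps" "!!x. eps * dot_on {..<k} x x <= quad_on {..<k} X x" and b: "0 < b"
 defines "Z \<equiv> mat k k (%(i, j). b * inv_on {..<k} X i j)"
 shows "Z \<in> pos_def_mats k" "mat_inv Z = mat k k (%(i, j). (1 / b) * X i j)"
  "quad_on {..<k} (entries Z) x = b * quad_on {..<k} (inv_on {..<k} X) x"
proof -
 note cf = finite_lessThan[of k] X eps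
 have Zc: "Z \<in> carrier_mat k k" by (simp add: Z_def)
 have e: "entries Z i j = b * inv_on {..<k} X i j" if "i \<in> {..<k}" "j \<in> {..<k}" for i j using that by (simp add: Z_def)
 have q: "quad_on {..<k} (entries Z) x = b * quad_on {..<k} (inv_on {..<k} X) x" for x
 proof -
  have "quad_on {..<k} (entries Z) x = quad_on {..<k} (%i j. b * inv_on {..<k} X i j) x" by (rule quad_on_cong) (simp_all only: e)
  then show ?thesis by (simp only: quad_on_linear)
 qed
 then show "quad_on {..<k} (entries Z) x = b * quad_on {..<k} (inv_on {..<k} X) x" .
 have "sym_on {..<k} (%i j. b * inv_on {..<k} X i j + 0 * inv_on {..<k} X i j)"
  by (intro sym_on_lincomb coercive_inv_sym[OF cf])
 then have s: "sym_on {..<k} (entries Z)" by (rule sym_on_cong) (simp only: e mult_zero_left add_0_right)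
 define \<kappa> where "\<kappa> = (\<Sum>a<k. \<Sum>b<k. \<bar>X a b\<bar>) + 1"
 have \<kappa>: "0 < \<kappa>" unfolding \<kappa>_def by (smt (verit) sum_nonneg abs_ge_zero)
 have "quad_on {..<k} X x <= \<kappa> * dot_on {..<k} x x" for x
  using abs_quad_on_le[OF finite_lessThan[of k], of X x] dot_on_nonneg[of "{..<k}" x] unfolding \<kappa>_def distrib_right by linarith
 then have low: "dot_on {..<k} x x <= \<kappa> * quad_on {..<k} (inv_on {..<k} X) x" for x
  by (rule coercive_inv_lower[OF cf \<kappa>])
 have "(b / \<kappa>) * dot_on {..<k} x x <= quad_on {..<k} (entries Z) x" for x
 proof -
  have "(b / \<kappa>) * dot_on {..<k} x x <= (b / \<kappa>) * (\<kappa> * quad_on {..<k} (inv_on {..<k} X) x)"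
   using b \<kappa> by (intro mult_left_mono low) auto
  then show ?thesis unfolding q using \<kappa> by simp
 qed
 then show "Z \<in> pos_def_mats k"
  unfolding pos_def_mats_iff[OF k] using Zc s b \<kappa> by (intro conjI exI[of _ "b / \<kappa>"]) auto
 show "mat_inv Z = mat k k (%(i, j). (1 / b) * X i j)"
 proof (rule mat_inv_entries[OF Zc])
  fix i j assume ij: "i < k" "j < k"
  have "mul_on {..<k} (entries Z) (%i j. (1 / b) * X i j) i j = mul_on {..<k} (inv_on {..<k} X) X i j"
   unfolding mul_on_def by (intro sum.cong refl) (use ij b in \<open>simp add: e\<close>)
  also have "... = of_bool (i = j)"
   using ij by (intro mul_on_inv_on(2)[OF finite_lessThan coercive_kernel[OF cf]]) auto
  finally show "mul_on {..<k} (entries Z) (%i j. (1 / b) * X i j) i j = of_bool (i = j)" .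
 qed
qed

text \<open>The factor $b$ balances the two summands $b (s - c)/2$ and $1/(2b)$ of the bound; both equal $\sqrt{s - c}/2$ at
the choice $b = 1/\sqrt{s - c}$.\<close>

theorem feasible_bounds_zeta:
 assumes feas: "feasible (entries AD) \<alpha> s" and \<alpha>: "0 <= \<alpha>" and c: "c \<in> attainable k2 AD"
 shows "c + (zeta k1 k2 l \<alpha> A AD c)^2 <= s"
proof -
 obtain X Y C eps where eps: "0 < eps" and X: "sym_on K2 X" and Y: "sym_on K1 Y"
  and f1: "!!x c. 2 * dot_on K1 x c <= quad_on K1 Y x + dot_on K1 c c
    - quad_on K1 (etaY X) c - eps * dot_on K1 c c"
  and f2: "fenchel_on K2 C X"
  and f3: "!!v. quad_on K2 C v + \<alpha> * quad_on K2 (etaX Y) v + quad_on K2 (entries AD) v <= (s - eps) * dot_on K2 v v"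
  using feas unfolding feasible_def by blast
 define E where "E = (%q q'. (1 - eps) * of_bool (q = q') - etaY X q q')"
 have qE: "quad_on K1 E c = (1 - eps) * dot_on K1 c c - quad_on K1 (etaY X) c" for c
  unfolding E_def quad_on_linear quad_of_bool[OF finite_lessThan] ..
 have fY: "fenchel_on K1 Y E"
  unfolding fenchel_on_def qE
 proof (intro allI)
  fix x c
  show "2 * dot_on K1 x c <= quad_on K1 Y x + ((1 - eps) * dot_on K1 c c - quad_on K1 (etaY X) c)"
   using f1[of x c] unfolding left_diff_distrib by linarith
 qed
 obtain epsX where epsX: "0 < epsX" "!!x. epsX * dot_on K2 x x <= quad_on K2 X x"
  using fenchel_on_coercive[OF finite_lessThan fenchel_on_swap[OF f2]] by blast
 obtain epsY where epsY: "0 < epsY" "!!x. epsY * dot_on K1 x x <= quad_on K1 Y x"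
  using fenchel_on_coercive[OF finite_lessThan fY] by blast
 note iX = fenchel_on_inverse_le[OF finite_lessThan f2 X epsX] and iY = fenchel_on_inverse_le[OF finite_lessThan fenchel_on_swap[OF fY] Y epsY]
 have X0: "0 <= quad_on K2 (inv_on K2 X) x" for x
  using coercive_inv_psd[OF finite_lessThan X epsX] by (simp add: psd_on_def)
 have Y0: "0 <= \<alpha> * quad_on K2 (etaX Y) x" for x
 proof -
  have "psd_on K1 Y" unfolding psd_on_def using epsY dot_on_nonneg[of "K1"] by (meson less_imp_le mult_nonneg_nonneg order.trans)
  then show ?thesis using psd_etaX \<alpha> by (simp add: psd_on_def)
 qed
 obtain \<rho> where \<rho>: "(\<Sum>a<k2. dot_on K2 (\<rho> a) (\<rho> a)) = 1" "c = (\<Sum>a<k2. quad_on K2 (entries AD) (\<rho> a))"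
  using c unfolding attainable_alt by blast
 have "c <= (\<Sum>a<k2. (s - eps) * dot_on K2 (\<rho> a) (\<rho> a))"
  unfolding \<rho>(2)
 proof (rule sum_mono)
  fix a
  show "quad_on K2 (entries AD) (\<rho> a) <= (s - eps) * dot_on K2 (\<rho> a) (\<rho> a)"
   using f3[of "\<rho> a"] iX[of "\<rho> a"] X0[of "\<rho> a"] Y0[of "\<rho> a"] by linarith
 qed
 also have "... = s - eps" by (simp add: sum_distrib_left[symmetric] \<rho>(1))
 finally have cs: "0 < s - c" using eps by simp
 (* b minimises b (s - c) / 2 + 1 / (2 b) *)
 define b where "b = 1 / sqrt (s - c)"
 have b: "0 < b" using cs by (simp add: b_def)
 define ZX where "ZX = mat k2 k2 (%(i, j). b * inv_on K2 X i j)"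
 define ZY where "ZY = mat k1 k1 (%(i, j). (1 / b) * inv_on K1 Y i j)"
 note zx = scaled_inverse_pos_def[OF k2 X epsX b, folded ZX_def]
 have b': "0 < 1 / b" using b by simp
 note zy = scaled_inverse_pos_def[OF k1 Y epsY b', folded ZY_def]
 have ZXc: "ZX \<in> carrier_mat k2 k2" "sym_on K2 (entries ZX)" and ZYc: "ZY \<in> carrier_mat k1 k1" "sym_on K1 (entries ZY)"
  using zx(1) zy(1) pos_def_mats_iff[OF k1, of ZY] pos_def_mats_iff[OF k2, of ZX] by blast+
 have sX: "sym_on K2 (%i j. 1 / b * X i j)" and sY: "sym_on K1 (%i j. 1 / (1 / b) * Y i j)"
  using sym_on_lincomb[OF X X, of "1/b" 0] sym_on_lincomb[OF Y Y, of "1/(1/b)" 0] by (simp_all only: mult_zero_left add_0_right)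
 note x = x_mat[OF ZXc zy(2) sY] and y = y_mat[OF ZYc zx(2) sX]
 have lx: "lambda_max (x_mat \<alpha> ZY ZX (b/2)) <= b / 2 * s"
  unfolding lambda_max_le_iff[OF x(1,2) k2]
 proof
  fix v
  have "quad_on K2 (etaX (%i j. 1 / (1 / b) * Y i j)) v = b * quad_on K2 (etaX Y) v"
   unfolding quad_etaX quad_on_linear by (simp add: sum_distrib_left)
  then have "quad_on K2 (entries (x_mat \<alpha> ZY ZX (b/2))) v = b / 2 * (quad_on K2 (inv_on K2 X) v
   + \<alpha> * quad_on K2 (etaX Y) v + quad_on K2 (entries AD) v)"
   unfolding x zx by (simp only: distrib_left distrib_right mult.left_commute[of \<alpha> b])
  also have "... <= b / 2 * (s * dot_on K2 v v)"
  proof (rule mult_left_mono)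
   have "0 <= eps * dot_on K2 v v" using eps dot_on_nonneg[of "K2" v] by simp
   then show "quad_on K2 (inv_on K2 X) v + \<alpha> * quad_on K2 (etaX Y) v + quad_on K2 (entries AD) v <= s * dot_on K2 v v"
    using f3[of v] iX[of v] unfolding left_diff_distrib by linarith
  qed (use b in simp)
  finally show "quad_on K2 (entries (x_mat \<alpha> ZY ZX (b/2))) v <= b / 2 * s * dot_on K2 v v" by (simp add: mult.assoc)
 qed
 have ly: "lambda_max (y_mat ZY ZX) <= 1 / b"
  unfolding lambda_max_le_iff[OF y(1,2) k1]
 proof
  fix v
  have "quad_on K1 (etaY (%i j. 1 / b * X i j)) v = 1 / b * quad_on K1 (etaY X) v"
   unfolding quad_etaY quad_on_linear by (simp add: sum_distrib_left)
  then have "quad_on K1 (entries (y_mat ZY ZX)) v = 1 / b * (quad_on K1 (inv_on K1 Y) v + quad_on K1 (etaY X) v)"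
   unfolding y zy distrib_left by simp
  also have "... <= 1 / b * dot_on K1 v v"
  proof (rule mult_left_mono)
   have "0 <= eps * dot_on K1 v v" using eps dot_on_nonneg[of "K1" v] by simp
   then show "quad_on K1 (inv_on K1 Y) v + quad_on K1 (etaY X) v <= dot_on K1 v v"
    using iY[of v] unfolding qE left_diff_distrib by linarith
  qed (use b in simp)
  finally show "quad_on K1 (entries (y_mat ZY ZX)) v <= 1 / b * dot_on K1 v v" .
 qed
 have sq: "sqrt (s - c) * sqrt (s - c) = s - c" using cs by simp
 have "zeta k1 k2 l \<alpha> A AD c <= lambda_max (x_mat \<alpha> ZY ZX (b/2)) + (1/2) * lambda_max (y_mat ZY ZX) - b / 2 * c"
  using zeta_le[OF \<alpha> c zy(1) zx(1)] unfolding zeta_objective_alt .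
 also have "... <= b / 2 * s + 1 / 2 * (1 / b) - b / 2 * c" using lx ly by linarith
 also have "... = (s - c) / sqrt (s - c) / 2 + sqrt (s - c) / 2" unfolding b_def diff_divide_distrib by simp
 also have "... = sqrt (s - c)" using cs by (simp add: real_div_sqrt)
 finally have "(zeta k1 k2 l \<alpha> A AD c)^2 <= (sqrt (s - c))^2" using zeta_nonneg[OF \<alpha> c] by (intro power_mono)
 then show ?thesis using cs by simp
qed

end

section \<open>Convergence of the largest eigenvalue\<close>

text \<open>Outside two events of vanishing probability the square roots differ by at most $e$, because $|\sqrt x - \sqrt
y|^2 \le |x - y|$; on these events the dominating variable takes over.\<close>

lemma (in prob_space) sqrt_expectation_tendsto:
 assumes meas: "!!n. n > 0 ==> X n \<in> borel_measurable M" and S: "0 <= S" and C: "0 <= C"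
  and nonneg: "eventually (%n. AE w in M. 0 <= X n w) sequentially"
  and dom: "!!n w. n > 0 ==> w \<in> space M ==> 0 <= X n w ==> sqrt (X n w) <= C + Z n w"
  and Z: "!!n. n > 0 ==> integrable M (Z n)" "!!n w. 0 <= Z n w" "(%n. expectation (Z n)) \<longlonglongrightarrow> 0"
  and up: "!!\<delta>. 0 < \<delta> ==> (%n. prob {w \<in> space M. \<not> X n w <= S + \<delta>}) \<longlonglongrightarrow> 0"
  and low: "!!\<delta>. 0 < \<delta> ==> (%n. prob {w \<in> space M. X n w <= S - \<delta>}) \<longlonglongrightarrow> 0"
 shows "(%n. expectation (%w. sqrt (X n w))) \<longlonglongrightarrow> sqrt S"
proof (rule tendstoI)
 fix e' :: real assume e': "0 < e'"
 define e where "e = e' / 2"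
 have e: "0 < e" using e' by (simp add: e_def)
 define U where "U n = {w \<in> space M. \<not> X n w <= S + e^2}" for n
 define V where "V n = {w \<in> space M. X n w <= S - e^2}" for n
 have e2: "0 < e^2" using e by simp
 have "(%n. e + (sqrt S + C) * (prob (U n) + prob (V n)) + expectation (Z n)) \<longlonglongrightarrow> e + (sqrt S + C) * (0 + 0) + 0"
  unfolding U_def V_def by (intro tendsto_intros up low Z(3) e2)
 then have lim: "(%n. e + (sqrt S + C) * (prob (U n) + prob (V n)) + expectation (Z n)) \<longlonglongrightarrow> e" by simp
 have "e < e'" using e' by (simp add: e_def)
 then have "eventually (%n. e + (sqrt S + C) * (prob (U n) + prob (V n)) + expectation (Z n) < e') sequentially"
  by (rule order_tendstoD(2)[OF lim])
 then show "eventually (%n. dist (expectation (%w. sqrt (X n w))) (sqrt S) < e') sequentially"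
  using nonneg eventually_gt_at_top[of 0]
 proof eventually_elim
  case (elim n)
  note [measurable] = meas[OF elim(3)]
  have Us: "U n \<in> events" "V n \<in> events" unfolding U_def V_def by measurable
  have int: "integrable M (%w. sqrt (X n w))"
  proof (rule Bochner_Integration.integrable_bound)
   show "integrable M (%w. C + Z n w)" using Z(1)[OF elim(3)] by simp
   show "AE w in M. norm (sqrt (X n w)) <= norm (C + Z n w)"
    using elim(2) AE_space by eventually_elim (use dom[OF elim(3)] C Z(2) in \<open>fastforce simp: abs_if\<close>)
  qed measurable
  define W where "W w = e + (sqrt S + C) * (indicator (U n) w + indicator (V n) w) + Z n w" for w
  have intW: "integrable M W" unfolding W_def using Us Z(1)[OF elim(3)]
   by (intro Bochner_Integration.integrable_add integrable_mult_right integrable_const) (auto simp: emeasure_eq_measure)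
  have EW: "expectation W = e + (sqrt S + C) * (prob (U n) + prob (V n)) + expectation (Z n)"
   unfolding W_def using Us Z(1)[OF elim(3)]
   by (subst Bochner_Integration.integral_add, simp_all add: emeasure_eq_measure prob_space)
  have pt: "AE w in M. \<bar>sqrt (X n w) - sqrt S\<bar> <= W w"
   using elim(2) AE_space
  proof eventually_elim
   case (elim w)
   note w = this
   have Z0: "0 <= Z n w" by (rule Z(2))
   have sS: "0 <= sqrt S" "0 <= sqrt (X n w)" using S w by auto
   show ?case
   proof (cases "w \<in> U n \<or> w \<in> V n")
    case True
    have "(sqrt S + C) * 1 <= (sqrt S + C) * (indicator (U n) w + indicator (V n) w)"
     using True S C by (intro mult_left_mono) (auto simp: indicator_def)
    then have "sqrt S + C + Z n w <= W w" unfolding W_def using e by simp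
    moreover have "sqrt (X n w) <= C + Z n w" using dom \<open>0 < n\<close> w by blast
    ultimately show ?thesis using sS Z0 C by linarith
   next
    case False
    then have "\<bar>X n w - S\<bar> <= e^2" using w unfolding U_def V_def by auto
    have "(sqrt (X n w) - sqrt S)^2 <= \<bar>sqrt (X n w) - sqrt S\<bar> * \<bar>sqrt (X n w) + sqrt S\<bar>"
     unfolding power2_eq_square abs_mult_self_eq[symmetric, of "sqrt (X n w) - sqrt S"]
     using sS by (intro mult_left_mono; linarith)
    also have "... = \<bar>X n w - S\<bar>"
    proof -
     have "(sqrt (X n w) - sqrt S) * (sqrt (X n w) + sqrt S) = X n w - S" using S w by (simp add: algebra_simps)
     then show ?thesis unfolding abs_mult[symmetric] by (rule arg_cong)
    qed
    also have "... <= e^2" by fact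
    finally have "\<bar>sqrt (X n w) - sqrt S\<bar> <= e" using e abs_le_square_iff[of "sqrt (X n w) - sqrt S" e] by simp
    moreover have "0 <= (sqrt S + C) * (indicator (U n) w + indicator (V n) w)" using S C by simp
    ultimately show ?thesis unfolding W_def using Z0 by linarith
   qed
  qed
  have "\<bar>expectation (%w. sqrt (X n w)) - sqrt S\<bar> = \<bar>expectation (%w. sqrt (X n w) - sqrt S)\<bar>"
   using int by (simp add: prob_space)
  also have "... <= expectation (%w. \<bar>sqrt (X n w) - sqrt S\<bar>)" by (rule integral_abs_bound)
  also have "... <= expectation W" using int intW pt by (intro integral_mono_AE) auto
  finally show ?case using elim(1) unfolding EW dist_real_def by linarith
 qed
qed

lemma sum_blocks: "(\<Sum>i<k * n. f i) = (\<Sum>p<k. \<Sum>j<n. f (p * n + j))" for f :: "nat => real"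
proof -
 have "(\<Sum>i<k * n. f i) = (\<Sum>p<k. sum f {p * n..<p * n + n})" by (rule sum.nat_group[symmetric])
 also have "... = (\<Sum>p<k. \<Sum>j<n. f (p * n + j))"
 proof (rule sum.cong[OF refl])
  fix p
  show "sum f {p * n..<p * n + n} = (\<Sum>j<n. f (p * n + j))"
   using sum.shift_bounds_nat_ivl[of f 0 "p * n" n] by (simp add: add.commute atLeast0LessThan)
 qed
 finally show ?thesis .
qed

context kron_mats
begin

definition sample_matrix :: "nat => nat => (nat => real mat) => real mat" where
 "sample_matrix r n G = kronecker AD (1\<^sub>m n) +
   transpose_mat (kron_model k1 k2 r n l A G) * kron_model k1 k2 r n l A G"

text \<open>The place of the pair \<open>(p, j)\<close> in the lexicographic order used by \<open>kronecker\<close>.\<close>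

definition position :: "nat => nat \<times> nat => nat" where
 "position n a = fst a * n + snd a"

lemma quad_on_blocks: "quad_on {..<k2 * n} W x = quad_on (idx n) (%a b. W (position n a) (position n b)) (%a. x (position n a))"
 unfolding quad_on_alt sum_idx sum_blocks position_def by simp

lemma dot_on_blocks: "dot_on {..<k2 * n} x y = dot_on (idx n) (%a. x (position n a)) (%a. y (position n a))"
 unfolding dot_on_def sum_idx sum_blocks position_def by simp

lemma position_bound:
 fixes p j k n :: nat
 assumes "p < k" "j < n"
 shows "p * n + j < k * n" "(p * n + j) div n = p" "(p * n + j) mod n = j"
proof -
 have "p * n + j < Suc p * n" using assms by simp
 also have "... <= k * n" using assms by (intro mult_le_mono1) simp
 finally show "p * n + j < k * n" .
 show "(p * n + j) div n = p" "(p * n + j) mod n = j" using assms by auto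
qed

context
 fixes r n :: nat and G :: "nat => real mat" and \<omega> :: "nat \<times> nat \<times> nat => real"
 assumes n: "0 < n" and G: "!!t. t < l ==> G t \<in> carrier_mat r n"
  and \<omega>: "!!t i j. t < l ==> i < r ==> j < n ==> \<omega> (t, i, j) = G t $$ (i, j)"
begin

lemma kron_model_carrier: "kron_model k1 k2 r n l A G \<in> carrier_mat (k1 * r) (k2 * n)"
 by (simp add: kron_model_def mat_sum_def)

lemma kron_model_entry:
 assumes q: "q < k1" and i: "i < r" and a: "a \<in> idx n"
 shows "kron_model k1 k2 r n l A G $$ (q * r + i, position n a) = row n (row_noise n i \<omega>) q a"
proof -
 obtain p j where a': "a = (p, j)" and p: "p < k2" and j: "j < n" using a by (auto simp: idx_def)
 note b1 = position_bound[OF q i] and b2 = position_bound[OF p j]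
 have "kron_model k1 k2 r n l A G $$ (q * r + i, position n a) = (1 / sqrt (real n)) * (\<Sum>t<l. kronecker (A t) (G t) $$ (q * r + i, p * n + j))"
  using b1(1) b2(1) by (simp add: kron_model_def mat_sum_def position_def a')
 also have "(\<Sum>t<l. kronecker (A t) (G t) $$ (q * r + i, p * n + j)) = (\<Sum>t<l. A t $$ (q, p) * \<omega> (t, i, j))"
 proof (intro sum.cong refl)
  fix t assume "t \<in> {..<l}"
  then have t: "t < l" by simp
  show "kronecker (A t) (G t) $$ (q * r + i, p * n + j) = A t $$ (q, p) * \<omega> (t, i, j)"
   using b1 b2 carrier_matD[OF A[OF t]] carrier_matD[OF G[OF t]] \<omega>[OF t i j] by (simp add: kronecker_def)
 qed
 finally show ?thesis using j by (simp add: row_def row_noise_def noise_def a')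
qed

lemma sample_matrix_carrier: "sample_matrix r n G \<in> carrier_mat (k2 * n) (k2 * n)"
 using kron_model_carrier AD by (simp add: sample_matrix_def kronecker_def)

lemma sample_matrix_entry:
 assumes a: "a \<in> idx n" and b: "b \<in> idx n"
 shows "sample_matrix r n G $$ (position n a, position n b) = tens (entries AD) a b + (\<Sum>i<r. gram_row n i \<omega> a b)"
proof -
 let ?H = "kron_model k1 k2 r n l A G"
 obtain p j p' j' where a': "a = (p, j)" and p: "p < k2" and j: "j < n" and b': "b = (p', j')" and p': "p' < k2" and j': "j' < n"
  using a b by (auto simp: idx_def)
 note ba = position_bound[OF p j] and bb = position_bound[OF p' j']
 have pa: "position n a < k2 * n" "position n b < k2 * n" using ba bb by (simp_all add: position_def a' b')
 have Ht: "transpose_mat ?H \<in> carrier_mat (k2 * n) (k1 * r)" using kron_model_carrier by simp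
 have K: "kronecker AD (1\<^sub>m n) $$ (position n a, position n b) = tens (entries AD) a b"
  using ba bb j j' carrier_matD[OF AD] by (simp add: kronecker_def position_def a' b' tens_def)
 have "(transpose_mat ?H * ?H) $$ (position n a, position n b) = (\<Sum>c<k1 * r. transpose_mat ?H $$ (position n a, c) * ?H $$ (c, position n b))"
  by (rule mult_mat_entry[OF Ht kron_model_carrier pa])
 also have "... = (\<Sum>c<k1 * r. ?H $$ (c, position n a) * ?H $$ (c, position n b))"
  using carrier_matD[OF kron_model_carrier] pa by (intro sum.cong) auto
 also have "... = (\<Sum>q<k1. \<Sum>i<r. row n (row_noise n i \<omega>) q a * row n (row_noise n i \<omega>) q b)"
  unfolding sum_blocks by (intro sum.cong refl) (simp add: kron_model_entry a b)
 also have "... = (\<Sum>i<r. gram_row n i \<omega> a b)" unfolding gram_row_def by (rule sum.swap)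
 finally have "(transpose_mat ?H * ?H) $$ (position n a, position n b) = (\<Sum>i<r. gram_row n i \<omega> a b)" .
 then show ?thesis
  using K pa carrier_matD[OF kron_model_carrier] by (simp add: sample_matrix_def)
qed

lemma sample_matrix_sym: "sym_on {..<k2 * n} (entries (sample_matrix r n G))"
 unfolding sym_on_def
proof (intro ballI)
 fix c d assume "c \<in> {..<k2 * n}" "d \<in> {..<k2 * n}"
 define a where "a = (c div n, c mod n)"
 define b where "b = (d div n, d mod n)"
 have ab: "a \<in> idx n" "b \<in> idx n" using \<open>c \<in> _\<close> \<open>d \<in> _\<close> n by (auto simp: a_def b_def idx_def less_mult_imp_div_less)
 have cd: "c = position n a" "d = position n b" by (simp_all add: position_def a_def b_def)
 have g: "gram_row n i \<omega> a b = gram_row n i \<omega> b a" for i by (simp add: gram_row_def mult.commute)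
 have "tens (entries AD) a b = tens (entries AD) b a" by (rule sym_onD[OF sym_tens[OF AD_sym] ab])
 then show "sample_matrix r n G $$ (c, d) = sample_matrix r n G $$ (d, c)"
  unfolding cd sample_matrix_entry[OF ab] sample_matrix_entry[OF ab(2,1)] using g by presburger
qed

lemma lambda_max_sample_le_iff:
 "lambda_max (sample_matrix r n G) <= s \<longleftrightarrow> (\<forall>x. 0 <= quad_on (idx n) (gap_form (entries AD) s n r \<omega>) x)"
proof -
 have d: "0 < k2 * n" using k2 n by simp
 have q: "quad_on (idx n) (gap_form (entries AD) s n r \<omega>) (%a. x (position n a)) =
  s * dot_on {..<k2 * n} x x - quad_on {..<k2 * n} (entries (sample_matrix r n G)) x" for x
 proof -
  have "quad_on {..<k2 * n} (entries (sample_matrix r n G)) x =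
   quad_on (idx n) (%a b. tens (entries AD) a b + (\<Sum>i<r. gram_row n i \<omega> a b)) (%a. x (position n a))"
   unfolding quad_on_blocks by (rule quad_on_cong) (simp_all add: sample_matrix_entry)
  then show ?thesis
   unfolding gap_form_def[abs_def] dot_on_blocks quad_on_linear quad_of_bool[OF finite_idx] by simp
 qed
 have surj: "\<exists>x. \<forall>a\<in>idx n. y a = x (position n a)" for y :: "nat \<times> nat => real"
  by (rule exI[of _ "%c. y (c div n, c mod n)"]) (auto simp: idx_def position_def position_bound[of _ k2])
 show ?thesis
  unfolding lambda_max_le_iff[OF sample_matrix_carrier sample_matrix_sym d]
 proof
  assume a: "\<forall>x. quad_on {..<k2 * n} (entries (sample_matrix r n G)) x <= s * dot_on {..<k2 * n} x x"
  show "\<forall>x. 0 <= quad_on (idx n) (gap_form (entries AD) s n r \<omega>) x"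
  proof
   fix y :: "nat \<times> nat => real"
   obtain x where x: "\<forall>b\<in>idx n. y b = x (position n b)" using surj[of y] by blast
   have "quad_on (idx n) (gap_form (entries AD) s n r \<omega>) y = quad_on (idx n) (gap_form (entries AD) s n r \<omega>) (%a. x (position n a))"
    by (rule quad_on_cong) (use x in auto)
   then show "0 <= quad_on (idx n) (gap_form (entries AD) s n r \<omega>) y" unfolding q using a by simp
  qed
 next
  assume a: "\<forall>x. 0 <= quad_on (idx n) (gap_form (entries AD) s n r \<omega>) x"
  show "\<forall>x. quad_on {..<k2 * n} (entries (sample_matrix r n G)) x <= s * dot_on {..<k2 * n} x x"
  proof
   fix x
   show "quad_on {..<k2 * n} (entries (sample_matrix r n G)) x <= s * dot_on {..<k2 * n} x x"
    using a[rule_format, of "%a. x (position n a)"] unfolding q by linarith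
  qed
 qed
qed

lemma lambda_max_sample_le:
 assumes K: "0 <= K"
 shows "lambda_max (sample_matrix r n G) <= (\<Sum>p<k2. \<Sum>p'<k2. \<bar>entries AD p p'\<bar>) + (2 * (K + net_excess K n r \<omega>))^2"
 unfolding lambda_max_sample_le_iff
proof
 fix x
 define d where "d = (\<Sum>p<k2. \<Sum>p'<k2. \<bar>entries AD p p'\<bar>)"
 have "(\<Sum>j<n. quad_on K2 (entries AD) (%p. x (p, j))) <= (\<Sum>j<n. d * dot_on K2 (%p. x (p, j)) (%p. x (p, j)))"
  unfolding d_def by (intro sum_mono order.trans[OF abs_ge_self abs_quad_on_le]) simp
 also have "... = d * dot_on (idx n) x x" by (simp add: dot_idx sum_distrib_left)
 finally show "0 <= quad_on (idx n) (gap_form (entries AD) ((\<Sum>p<k2. \<Sum>p'<k2. \<bar>entries AD p p'\<bar>) + (2 * (K + net_excess K n r \<omega>))^2) n r \<omega>) x"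
  unfolding quad_gap_form d_def[symmetric] distrib_right using operator_norm_le[OF n K, where r = r and \<omega> = \<omega> and x = x] by linarith
qed

end

lemma fenchel_scalar: "0 < \<tau> ==> 2 * dot_on I x y <= dot_on I x x / \<tau> + \<tau> * dot_on I y y"
proof -
 assume \<tau>: "0 < \<tau>"
 have "0 <= dot_on I (%a. x a - \<tau> * y a) (%a. x a - \<tau> * y a)" by (rule dot_on_nonneg)
 also have "... = dot_on I x x - 2 * \<tau> * dot_on I x y + \<tau>^2 * dot_on I y y"
  by (simp only: dot_on_linear dot_on_commute[of I y x]) (simp add: power2_eq_square algebra_simps)
 finally have "0 <= (dot_on I x x - 2 * \<tau> * dot_on I x y + \<tau>^2 * dot_on I y y) / \<tau>" using \<tau> by simp
 also have "... = dot_on I x x / \<tau> - 2 * dot_on I x y + \<tau> * dot_on I y y"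
  using \<tau> by (simp add: add_divide_distrib diff_divide_distrib power2_eq_square)
 finally show ?thesis by linarith
qed

text \<open>A small multiple of the identity for $X$ makes the first inequality hold with $Y = 2$; the second then holds at
a high level.\<close>

lemma feasible_exists:
 assumes \<alpha>: "0 <= \<alpha>"
 shows "\<exists>s. feasible D \<alpha> s"
proof -
 let ?i = "%a b :: nat. of_bool (a = b) :: real"
 define \<kappa> where "\<kappa> = (\<Sum>a<k1. \<Sum>b<k1. \<bar>etaY ?i a b\<bar>)"
 define \<beta> where "\<beta> = (\<Sum>a<k2. \<Sum>b<k2. \<bar>etaX (%a b. 2 * ?i a b) a b\<bar>)"
 define d where "d = (\<Sum>a<k2. \<Sum>b<k2. \<bar>D a b\<bar>)"
 have \<kappa>: "0 <= \<kappa>" unfolding \<kappa>_def by (intro sum_nonneg) auto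
 define \<tau> where "\<tau> = 1 / (4 * (\<kappa> + 1))"
 have \<tau>: "0 < \<tau>" "\<tau> * \<kappa> <= 1 / 4" using \<kappa> by (simp_all add: \<tau>_def field_simps)
 have sym: "sym_on I (%a b. t * ?i a b)" for I t by (auto simp: sym_on_def)
 have qi: "quad_on {..<k} (%a b. t * ?i a b) x = t * dot_on {..<k} x x" for k t x
  unfolding quad_on_linear quad_of_bool[OF finite_lessThan] ..
 have "feasible D \<alpha> (1 / \<tau> + \<alpha> * \<beta> + d + 1 / 4)"
  unfolding feasible_def
 proof (intro exI conjI allI)
  show "0 < (1 / 4 :: real)" by simp
  show "sym_on K2 (%a b. \<tau> * ?i a b)" "sym_on K1 (%a b. 2 * ?i a b)" by (rule sym)+
  show "fenchel_on K2 (%a b. (1 / \<tau>) * ?i a b) (%a b. \<tau> * ?i a b)"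
   unfolding fenchel_on_def qi by (simp add: fenchel_scalar[OF \<tau>(1)])
 next
  fix x c
  have "quad_on K1 (etaY (%a b. \<tau> * ?i a b)) c = \<tau> * quad_on K1 (etaY ?i) c"
   unfolding quad_etaY quad_on_linear by (rule sum_distrib_left[symmetric])
  also have "... <= \<tau> * (\<kappa> * dot_on K1 c c)"
   unfolding \<kappa>_def using \<tau> by (intro mult_left_mono order.trans[OF abs_ge_self abs_quad_on_le]) auto
  also have "... <= 1 / 4 * dot_on K1 c c"
   unfolding mult.assoc[symmetric] by (intro mult_right_mono \<tau> dot_on_nonneg)
  finally have "quad_on K1 (etaY (%a b. \<tau> * ?i a b)) c <= 1 / 4 * dot_on K1 c c" .
  then show "2 * dot_on K1 x c <= quad_on K1 (%a b. 2 * ?i a b) x + dot_on K1 c c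
    - quad_on K1 (etaY (%a b. \<tau> * ?i a b)) c - 1 / 4 * dot_on K1 c c"
   unfolding qi using fenchel_scalar[of "1/2" "K1" x c] by simp
 next
  fix v
  have "\<alpha> * quad_on K2 (etaX (%a b. 2 * ?i a b)) v <= \<alpha> * (\<beta> * dot_on K2 v v)"
   unfolding \<beta>_def using \<alpha> by (intro mult_left_mono order.trans[OF abs_ge_self abs_quad_on_le]) auto
  moreover have "quad_on K2 D v <= d * dot_on K2 v v"
   unfolding d_def by (intro order.trans[OF abs_ge_self abs_quad_on_le]) auto
  ultimately show "quad_on K2 (%a b. (1 / \<tau>) * ?i a b) v + \<alpha> * quad_on K2 (etaX (%a b. 2 * ?i a b)) v
   + quad_on K2 D v <= (1 / \<tau> + \<alpha> * \<beta> + d + 1 / 4 - 1 / 4) * dot_on K2 v v"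
   unfolding qi by (simp add: distrib_right)
 qed
 then show ?thesis by blast
qed

end

text \<open>The array of all entries has the product law. For an empty index set the law is the unique probability measure
on a one-point space, which is treated separately.\<close>

lemma gaussian_array_distr:
 fixes G :: "nat => 'w => real mat"
 assumes M: "prob_space M" and G: "indep_gaussian_matrices M l r n G"
 defines "S \<equiv> {..<l} \<times> {..<r} \<times> {..<n}"
 defines "\<Omega> \<equiv> %w. \<lambda>(t, i, j)\<in>S. G t w $$ (i, j)"
 shows "\<Omega> \<in> measurable M (gauss_on S)" "distr M (gauss_on S) \<Omega> = gauss_on S"
proof -
 interpret prob_space M by (rule M)
 define X where "X = (%(t, i, j) w. G t w $$ (i, j))"
 have \<Omega>: "\<Omega> = (%w. \<lambda>s\<in>S. X s w)" by (auto simp: \<Omega>_def X_def fun_eq_iff)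
 have dist: "distributed M lborel (X s) std_normal_density" if "s \<in> S" for s
  using G that unfolding indep_gaussian_matrices_def S_def X_def by auto
 have Xm: "X s \<in> borel_measurable M" if "s \<in> S" for s
  using distributed_measurable[OF dist[OF that]] by simp
 have XD: "distr M borel (X s) = gauss" if "s \<in> S" for s
 proof -
  have "distr M borel (X s) = distr M lborel (X s)" by (rule distr_cong) auto
  also have "... = gauss" unfolding gauss_def by (rule distributed_distr_eq_density[OF dist[OF that]])
  finally show ?thesis .
 qed
 show m: "\<Omega> \<in> measurable M (gauss_on S)"
  unfolding \<Omega> by (intro measurable_restrict) (use Xm in \<open>simp add: measurable_cong_sets[OF refl sets_gauss]\<close>)
 show "distr M (gauss_on S) \<Omega> = gauss_on S"
 proof (cases "S = {}")
  case True
  interpret g: prob_space "gauss_on S" by (rule prob_space_gauss_on)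
  interpret d: prob_space "distr M (gauss_on S) \<Omega>" by (rule prob_space_distr[OF m])
  show ?thesis
  proof (rule measure_eqI)
   fix B assume "B \<in> sets (distr M (gauss_on S) \<Omega>)"
   then have "B \<in> {{}, {%k. undefined}}" by (simp add: True sets_PiM_empty)
   then have "B = {} \<or> B = space (gauss_on S)" by (auto simp: True space_PiM)
   then show "emeasure (distr M (gauss_on S) \<Omega>) B = emeasure (gauss_on S) B"
    using g.emeasure_space_1 d.emeasure_space_1 by auto
  qed simp
 next
  case False
  have iv: "indep_vars (%_. borel) X S"
   using G unfolding indep_gaussian_matrices_def S_def X_def by blast
  have "distr M (\<Pi>\<^sub>M s\<in>S. borel) (%w. \<lambda>s\<in>S. X s w) = (\<Pi>\<^sub>M s\<in>S. distr M borel (X s))"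
   using iv indep_vars_iff_distr_eq_PiM'[OF False, where M' = "%_. borel" and X = X] Xm by blast
  moreover have "(\<Pi>\<^sub>M s\<in>S. distr M borel (X s)) = gauss_on S" by (intro PiM_cong refl XD)
  moreover have "distr M (\<Pi>\<^sub>M s\<in>S. borel) (%w. \<lambda>s\<in>S. X s w) = distr M (gauss_on S) \<Omega>"
   unfolding \<Omega> by (intro distr_cong refl sets_PiM_cong) (simp_all add: sets_gauss)
  ultimately show ?thesis by simp
 qed
qed

theorem theorem6:
  fixes k1 k2 l :: nat
    and m :: "nat \<Rightarrow> nat"
    and \<alpha> :: real
    and A :: "nat \<Rightarrow> real mat"
    and AD :: "real mat"
    and M :: "'w measure"
    and G :: "nat \<Rightarrow> nat \<Rightarrow> 'w \<Rightarrow> real mat"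
  defines "\<Lambda> \<equiv> \<lambda>n w. lambda_max (kronecker AD (1\<^sub>m n) +
      transpose_mat (kron_model k1 k2 (m n) n l A (\<lambda>t. G n t w)) *
      kron_model k1 k2 (m n) n l A (\<lambda>t. G n t w))"
    and "\<Phi> \<equiv> \<lambda>c. c + (zeta k1 k2 l \<alpha> A AD c)\<^sup>2"
  assumes "k1 > 0" and "k2 > 0"
    and "\<And>t. t < l \<Longrightarrow> A t \<in> carrier_mat k1 k2"
    and "AD \<in> carrier_mat k2 k2" and "transpose_mat AD = AD"
    and "filterlim m at_top sequentially"
    and "(\<lambda>n. real (m n) / real n) \<longlonglongrightarrow> \<alpha>"
    and "prob_space M"
    and "\<And>n. indep_gaussian_matrices M l (m n) n (G n)"
    and "eventually (\<lambda>n. AE w in M. \<Lambda> n w \<ge> 0) sequentially"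
  shows "\<exists>c. is_arg_max \<Phi> (\<lambda>c. c \<in> attainable k2 AD) c \<and>
    (\<Phi> c \<ge> 0 \<longrightarrow>
      (\<exists>L. (\<lambda>n. prob_space.expectation M (\<lambda>w. sqrt (\<Lambda> n w))) \<longlonglongrightarrow> L \<and> L \<ge> sqrt (\<Phi> c)))"
proof -
 have AD_sym: "sym_on {..<k2} (entries AD)" using assms(6,7) transpose_eq_iff_sym_on by blast
 interpret kron_mats k1 k2 l A AD by unfold_locales (use assms AD_sym in auto)
 interpret prob_space M by (rule assms)
 note m_top = assms(8) and m_lim = assms(9)
 define S where "S n = {..<l} \<times> {..<m n} \<times> {..<n}" for n
 have S_cube: "S n = cube {..<m n} n" for n by (simp add: S_def cube_def)
 define \<Omega> where "\<Omega> n w = (\<lambda>(t, i, j)\<in>S n. G n t w $$ (i, j))" for n w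
 have \<Omega>m: "\<Omega> n \<in> measurable M (gauss_on (S n))" and \<Omega>d: "distr M (gauss_on (S n)) (\<Omega> n) = gauss_on (S n)" for n
  unfolding \<Omega>_def[abs_def] S_def by (rule gaussian_array_distr[OF assms(10) assms(11)])+
 have \<Lambda>: "\<Lambda> n w = lambda_max (sample_matrix (m n) n (%t. G n t w))" for n w by (simp add: \<Lambda>_def sample_matrix_def)
 have Gc: "G n t w \<in> carrier_mat (m n) n" if "t < l" "w \<in> space M" for n t w
  using assms(11)[of n] that unfolding indep_gaussian_matrices_def by blast
 have \<Omega>G: "\<Omega> n w (t, i, j) = G n t w $$ (i, j)" if "t < l" "i < m n" "j < n" for n w t i j
  using that by (simp add: \<Omega>_def S_def)
 have \<alpha>: "0 <= \<alpha>" using m_lim by (rule LIMSEQ_le_const) auto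
 have le_iff: "\<Lambda> n w <= s \<longleftrightarrow> (\<forall>x. 0 <= quad_on (idx n) (gap_form (entries AD) s n (m n) (\<Omega> n w)) x)"
  if "0 < n" "w \<in> space M" for n w s
  unfolding \<Lambda> by (rule lambda_max_sample_le_iff[OF that(1) Gc[OF _ that(2)] \<Omega>G])
 define F where "F s n = {\<omega> \<in> space (gauss_on (S n)). \<exists>x. quad_on (idx n) (gap_form (entries AD) s n (m n) \<omega>) x < 0}" for s n
 define E where "E s n = {\<omega> \<in> space (gauss_on (S n)). \<forall>x. 0 <= quad_on (idx n) (gap_form (entries AD) s n (m n) \<omega>) x}" for s n
 have Fs: "F s n \<in> sets (gauss_on (S n))" for s n
  unfolding F_def S_cube by (intro negative_direction_measurable gap_form_measurable) auto
 have EF: "E s n = space (gauss_on (S n)) - F s n" for s n unfolding E_def F_def by (auto simp: not_less) (metis linorder_not_le)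
 have Es: "E s n \<in> sets (gauss_on (S n))" for s n unfolding EF using Fs by auto
 have \<Omega>s: "\<Omega> n w \<in> space (gauss_on (S n))" if "w \<in> space M" for n w using measurable_space[OF \<Omega>m that] .
 have le_E: "{w \<in> space M. \<Lambda> n w <= s} = \<Omega> n -` E s n \<inter> space M" if "0 < n" for n s
  using le_iff[OF that] \<Omega>s by (auto simp: E_def)
 have gt_F: "{w \<in> space M. \<not> \<Lambda> n w <= s} = \<Omega> n -` F s n \<inter> space M" if "0 < n" for n s
  using le_E[OF that, of s] \<Omega>s unfolding EF by blast
 have prob_\<Omega>: "prob (\<Omega> n -` B \<inter> space M) = measure (gauss_on (S n)) B" if "B \<in> sets (gauss_on (S n))" for B n
  using measure_distr[OF \<Omega>m that] unfolding \<Omega>d by simp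
 have \<Lambda>m: "\<Lambda> n \<in> borel_measurable M" if "0 < n" for n
  unfolding borel_measurable_iff_le
 proof
  fix s show "{w \<in> space M. \<Lambda> n w <= s} \<in> sets M"
   unfolding le_E[OF that] by (rule measurable_sets[OF \<Omega>m Es])
 qed
 have up: "(%n. prob {w \<in> space M. \<not> \<Lambda> n w <= s}) \<longlonglongrightarrow> 0" if "feasible (entries AD) \<alpha> s" for s
 proof (rule Lim_transform_eventually)
  show "(%n. measure (gauss_on (S n)) (F s n)) \<longlonglongrightarrow> 0"
   unfolding F_def S_cube by (rule feasible_failure_tendsto_0[OF that m_lim])
  show "eventually (%n. measure (gauss_on (S n)) (F s n) = prob {w \<in> space M. \<not> \<Lambda> n w <= s}) sequentially"
   using eventually_gt_at_top[of 0] by eventually_elim (simp only: gt_F prob_\<Omega>[OF Fs])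
 qed
 have low: "(%n. prob {w \<in> space M. \<Lambda> n w <= s}) \<longlonglongrightarrow> 0" if "0 < \<eta>" "\<not> feasible (entries AD) \<alpha> (s + \<eta>)" for s \<eta>
 proof (rule Lim_transform_eventually)
  show "(%n. measure (gauss_on (S n)) (E s n)) \<longlonglongrightarrow> 0"
   unfolding E_def S_cube by (rule infeasible_success_tendsto_0[OF AD_sym that m_lim m_top])
  show "eventually (%n. measure (gauss_on (S n)) (E s n) = prob {w \<in> space M. \<Lambda> n w <= s}) sequentially"
   using eventually_gt_at_top[of 0] by eventually_elim (simp only: le_E prob_\<Omega>[OF Es])
 qed
 (* the limit of the largest eigenvalue is the infimum of Q *)
 define Q where "Q = {s. feasible (entries AD) \<alpha> s}"
 define s0 where "s0 = Inf Q"
 obtain c where c: "is_arg_max \<Phi> (%c. c \<in> attainable k2 AD) c"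
  unfolding \<Phi>_def by (rule zeta_argmax[OF \<alpha>])
 have Qne: "Q \<noteq> {}" using feasible_exists[OF \<alpha>] by (auto simp: Q_def)
 have ca: "c \<in> attainable k2 AD" using c by (simp add: is_arg_max_def)
 have Qge: "\<Phi> c <= s" if "s \<in> Q" for s
  using feasible_bounds_zeta[OF _ \<alpha> ca, of s] that by (simp add: Q_def \<Phi>_def)
 then have Qbdd: "bdd_below Q" by (rule bdd_belowI)
 have \<Phi>s0: "\<Phi> c <= s0" unfolding s0_def by (rule cInf_greatest[OF Qne Qge])
 have up': "(%n. prob {w \<in> space M. \<not> \<Lambda> n w <= s0 + \<delta>}) \<longlonglongrightarrow> 0" if \<delta>: "0 < \<delta>" for \<delta>
 proof -
  obtain s where s: "s \<in> Q" "s < s0 + \<delta>" using cInf_lessD[OF Qne, of "s0 + \<delta>"] \<delta> unfolding s0_def by auto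
  have l: "(%n. prob {w \<in> space M. \<not> \<Lambda> n w <= s}) \<longlonglongrightarrow> 0" using up s by (simp add: Q_def)
  show ?thesis
  proof (rule tendsto_sandwich[OF _ _ tendsto_const l])
   show "eventually (%n. prob {w \<in> space M. \<not> \<Lambda> n w <= s0 + \<delta>} <= prob {w \<in> space M. \<not> \<Lambda> n w <= s}) sequentially"
    using eventually_gt_at_top[of 0]
   proof eventually_elim
    case (elim n)
    have "{w \<in> space M. \<not> \<Lambda> n w <= s} \<in> events" unfolding gt_F[OF elim] by (rule measurable_sets[OF \<Omega>m Fs])
    then show ?case using s by (intro finite_measure_mono) auto
   qed
  qed simp
 qed
 have low': "(%n. prob {w \<in> space M. \<Lambda> n w <= s0 - \<delta>}) \<longlonglongrightarrow> 0" if \<delta>: "0 < \<delta>" for \<delta>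
 proof (rule low[of "\<delta> / 2"])
  show "\<not> feasible (entries AD) \<alpha> (s0 - \<delta> + \<delta> / 2)"
  proof
   assume "feasible (entries AD) \<alpha> (s0 - \<delta> + \<delta> / 2)"
   then have "s0 <= s0 - \<delta> + \<delta> / 2" unfolding s0_def by (intro cInf_lower[OF _ Qbdd]) (simp add: Q_def)
   then show False using \<delta> by simp
  qed
 qed (use \<delta> in simp)
 obtain K where K: "0 <= K" and Zlim: "(%n. \<integral>\<omega>. net_excess K n (m n) \<omega> \<partial>(law (m n) n)) \<longlonglongrightarrow> 0"
  using net_excess_tendsto_0[OF m_lim] by blast
 define a where "a = (\<Sum>p<k2. \<Sum>p'<k2. \<bar>entries AD p p'\<bar>)"
 have a: "0 <= a" unfolding a_def by (intro sum_nonneg) auto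
 define Z where "Z n w = 2 * net_excess K n (m n) (\<Omega> n w)" for n w
 have s0: "0 <= s0"
 proof (rule ccontr)
  assume "\<not> 0 <= s0"
  then have "0 < - s0 / 2" by simp
  from order_tendstoD(2)[OF up'[OF this], of 1] have "eventually (%n. prob {w \<in> space M. \<not> \<Lambda> n w <= s0 + - s0 / 2} < 1) sequentially" by simp
  then have "eventually (%n. False) sequentially"
   using assms(12) eventually_gt_at_top[of 0]
  proof eventually_elim
   case (elim n)
   have "AE w in M. \<not> \<Lambda> n w <= s0 + - s0 / 2" using elim(2) by eventually_elim (use \<open>\<not> 0 <= s0\<close> in linarith)
   moreover have "{w \<in> space M. \<not> \<Lambda> n w <= s0 + - s0 / 2} \<in> events" unfolding gt_F[OF elim(3)] by (rule measurable_sets[OF \<Omega>m Fs])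
   ultimately have "prob {w \<in> space M. \<not> \<Lambda> n w <= s0 + - s0 / 2} = 1" by (simp add: prob_Collect_eq_1)
   with elim(1) show False by simp
  qed
  then show False by simp
 qed
 have Zint: "integrable M (Z n)" if "0 < n" for n
 proof -
  have "integrable (distr M (gauss_on (S n)) (\<Omega> n)) (net_excess K n (m n))"
   unfolding \<Omega>d unfolding S_cube by (rule net_excess_expectation(1)[OF that])
  then show ?thesis unfolding Z_def by (intro integrable_mult_right integrable_distr[OF \<Omega>m])
 qed
 have ZE: "expectation (Z n) = 2 * (\<integral>\<omega>. net_excess K n (m n) \<omega> \<partial>(gauss_on (S n)))" if "0 < n" for n
 proof -
  have "net_excess K n (m n) \<in> borel_measurable (gauss_on (S n))"
   unfolding S_cube using net_excess_expectation(1)[OF that] by (rule borel_measurable_integrable)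
  then have "(\<integral>\<omega>. net_excess K n (m n) \<omega> \<partial>(distr M (gauss_on (S n)) (\<Omega> n))) = expectation (%w. net_excess K n (m n) (\<Omega> n w))"
   by (rule integral_distr[OF \<Omega>m])
  then show ?thesis unfolding \<Omega>d Z_def by simp
 qed
 have "(%n. expectation (%w. sqrt (\<Lambda> n w))) \<longlonglongrightarrow> sqrt s0"
 proof (rule sqrt_expectation_tendsto[where C = "sqrt a + 2 * K" and Z = Z])
  show "0 <= sqrt a + 2 * K" using a K by simp
  show "0 <= Z n w" for n w unfolding Z_def by (simp add: net_excess_nonneg)
  show "(%n. expectation (Z n)) \<longlonglongrightarrow> 0"
  proof (rule Lim_transform_eventually)
   show "(%n. 2 * (\<integral>\<omega>. net_excess K n (m n) \<omega> \<partial>(gauss_on (S n)))) \<longlonglongrightarrow> 0"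
    using tendsto_mult_right_zero[OF Zlim, of 2] by (simp add: S_cube)
   show "eventually (%n. 2 * (\<integral>\<omega>. net_excess K n (m n) \<omega> \<partial>(gauss_on (S n))) = expectation (Z n)) sequentially"
    using eventually_gt_at_top[of 0] by eventually_elim (simp only: ZE)
  qed
  fix n w assume n: "0 < n" and w: "w \<in> space M" and nn: "0 <= \<Lambda> n w"
  define z where "z = 2 * (K + net_excess K n (m n) (\<Omega> n w))"
  have z: "0 <= z" using K net_excess_nonneg by (simp add: z_def)
  have "\<Lambda> n w <= a + z^2"
   unfolding \<Lambda> a_def z_def by (rule lambda_max_sample_le[OF n Gc[OF _ w] \<Omega>G K])
  then have "sqrt (\<Lambda> n w) <= sqrt (a + z^2)" by simp
  also have "... <= sqrt a + sqrt (z^2)" using a by (intro sqrt_add_le_add_sqrt) auto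
  also have "... = sqrt a + 2 * K + Z n w" using z by (simp add: z_def Z_def)
  finally show "sqrt (\<Lambda> n w) <= sqrt a + 2 * K + Z n w" .
 qed (use \<Lambda>m s0 assms(12) Zint up' low' in auto)
 then show ?thesis using c \<Phi>s0 by (intro exI[of _ c] conjI impI exI[of _ "sqrt s0"]) auto
qed

end
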